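(* Let $\kappa\in\mathbb{R}$ with $-\bigl(2(N^2-N+2)\bigr)^{-1}<\kappa<\bigl(2(N^2-N+2)\bigr)^{-1}$. Suppose $H$ is a Hermitian $n_\tau\times n_\tau$ matrix such that $\upsilon H=H\upsilon$ and $(L_1(x_0)^{\ast})^{-1}HL_1(x_0)^{-1}$ commutes with $\sigma$. Then $$\int_{\mathbb{T}^N}\bigl\{(x_i\mathcal{D}_if(x))^{\ast}L(x)^{\ast}HL(x)g(x)-f(x)^{\ast}L(x)^{\ast}HL(x)\,x_i\mathcal{D}_ig(x)\bigr\}\,\mathrm{d}m(x)=0$$ for all $f,g\in C^{(1)}(\mathbb{T}^N;V_\tau)$ and $1\le i\le N$.
   Context: **Representation.** $N\ge 3$. $\mathcal{S}_N$ acts on $\mathbb{C}^N$ by $(xw)_i=x_{w(i)}$. $\tau$ is a partition of $N$, $\tau\ne(N),(1,\dots,1)$, and also denotes the corresponding irreducible representation of $\mathcal{S}_N$ on $V_\tau$, $n_\tau=\dim V_\tau$. $V_\tau$ has basis $\mathcal{Y}(\tau)$, the set of reverse standard Young tableaux of shape $\tau$ (fillings of the diagram by $1,\dots,N$ with entries decreasing along rows and columns); $c(i,T)$ is the column index minus the row index of the entry $i$ in $T$; the representation satisfies $\sum_{j>i}\tau((i,j))T=c(i,T)T$ for all $i$, and the inner product $\langle T,T'\rangle_0=\delta_{T,T'}\prod_{i<j,\;c(i,T)\le c(j,T)-2}\bigl(1-(c(i,T)-c(j,T))^{-2}\bigr)$ is $\mathcal{S}_N$-invariant. Matrices and components of vectors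 are with respect to the orthonormal basis $\langle T,T\rangle_0^{-1/2}T$, ordered so that the $T$ with $c(N-1,T)=-1$ come first (let $m_\tau$ be their number). Then each $\tau(w)$ is a real orthogonal matrix and $\sigma:=\tau((N-1,N))=\mathrm{diag}(-I_{m_\tau},I_{n_\tau-m_\tau})$. Put $\gamma=\frac1N\sum_{i=1}^N c(i,T)$ (independent of $T$), and $\rho(a,b):=\mathrm{diag}(aI_{m_\tau},bI_{n_\tau-m_\tau})$. $w_0$ is the $N$-cycle with $w_0(i)=i+1$ ($i<N$), $w_0(N)=1$, and $\upsilon=\tau(w_0)$. $A^\ast$ is the Hermitian adjoint. **Torus and $L$.** $\mathbb{T}^N=\{x\in\mathbb{C}^N:|x_j|=1\}$, $m$ is normalized Haar measure, $\mathbb{T}^N_{\rm reg}=\{x\in\mathbb{T}^N:x_i\ne x_j,\ i\ne j\}$. With $x_j=e^{\mathrm{i}\theta_j}$, $x_j\partial_j$ acts on functions on $\mathbb{T}^N$ as $-\mathrm{i}\,\partial/\partial\theta_j$. $\omega=e^{2\pi\mathrm{i}/N}$, $x_0=(1,\omega,\dots,\omega^{N-1})$, and $\mathcal{C}_0=\{(e^{\mathrm{i}\theta_j})_j:\theta_1<\theta_2<\dots<\theta_N<\theta_1+2\pi\}$ is the component of $\mathbb{T}^N_{\rm reg}$ containing $x_0$. $L$ is the unique ($n_\tau\times n_\tau$ matrix-valued) solution on $\mathcal{C}_0$ of $$\partial_iL(x)=\kappa L(x)\Bigl\{\sum_{j\ne i}\frac{1}{x_i-x_j}\tau((i,j))-\frac{\gamma}{x_i}I\Bigr\},\quad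 1\le i\le N,\qquad L(x_0)=I$$ (single valued since it is homogeneous of degree $0$). For $x\in\mathbb{T}^N_{\rm reg}$ let $w_x$ be the unique element of $\mathcal{S}_N$ with $w_x(1)=1$ and $xw_x^{-1}\in\mathcal{C}_0$; $L$ is extended to $\mathbb{T}^N_{\rm reg}$ by $L(x)=L(xw_x^{-1})\tau(w_x)$. **$L_1$.** Write $x(u,z)=(x_1,\dots,x_{N-2},u-z,u+z)$ and $x^{(0)}=(1,\omega,\dots,\omega^{N-3},\omega^{-3/2},\omega^{-3/2})$. $L_1$ is the solution of the same differential system of the form $$L_1(x(u,z))=\Bigl((u^2-z^2)\prod_{j=1}^{N-2}x_j\Bigr)^{-\gamma\kappa}\rho(z^{-\kappa},z^{\kappa})\sum_{n=0}^\infty\alpha_n(x(u,0))z^n,$$ for $|z|<\min_{1\le j\le N-2}|x_j-u|$, $|z|<|u|$, $\operatorname{Im}(z/u)>0$ (fixed continuous branches of the powers), where the $\alpha_n$ are matrix functions analytic in $(x_1,\dots,x_{N-2},u)$ on a simply connected open subset of $\{(x_1,\dots,x_{N-2},u)\in(\mathbb{C}\setminus\{0\})^{N-1}$ with pairwise distinct entries$\}$ containing $(1,\omega,\dots,\omega^{N-3},t\omega^{-3/2})$ for $\cos\frac{\pi}{N}\le t\le1$, with $\sigma\alpha_n\sigma=(-1)^n\alpha_n$ and $\alpha_0(x^{(0)})=I$. The point $x_0$ (with $u=\frac12(\omega^{-1}+\omega^{-2})$, $z=\frac12(\omega^{-1}-\omega^{-2})$) lies in the domain of convergence. **Operators.**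 For $f\in C^{(1)}(\mathbb{T}^N;V_\tau)$, $x_i\mathcal{D}_if(x)=x_i\partial_if(x)+\kappa\sum_{j\ne i}\frac{x_i}{x_i-x_j}\tau((i,j))\bigl(f(x)-f(x(i,j))\bigr)$ (extended by continuity to $x_i=x_j$).
   Formalization: In the description of L_1 the condition |z|<|u| is dropped: for N=3,4 the point x_0 violates it (N=3: |u|=1/2, |z|=√3/2), so L_1(x_0) would be undefined; the expansion is required for |z|<min|x_j-u|, Im(z/u)>0, where it also holds, with the same L_1(x_0) when N≥5. *)

theory Defs
  imports "HOL-Analysis.Analysis"
begin

section \<open>Reverse standard Young tableaux\<close>

definition is_partition :: "nat \<Rightarrow> nat list \<Rightarrow> bool" where
  "is_partition N p \<longleftrightarrow> sorted_wrt (\<ge>) p \<and> (\<forall>k\<in>set p. k > 0) \<and> sum_list p = N"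

text \<open>Boxes are pairs (row, column), counted from 0.\<close>

definition diagram :: "nat list \<Rightarrow> (nat \<times> nat) set" where
  "diagram p = {(r, c). r < length p \<and> c < p ! r}"

text \<open>A tableau maps boxes to entries and is \<open>undefined\<close> outside the diagram, so that distinct
  elements of the set below are distinct fillings.\<close>

definition rsyt :: "nat \<Rightarrow> nat list \<Rightarrow> (nat \<times> nat \<Rightarrow> nat) set" where
  "rsyt N p = {T \<in> extensional (diagram p).
     bij_betw T (diagram p) {1..N} \<and>
     (\<forall>r c c'. (r, c) \<in> diagram p \<and> (r, c') \<in> diagram p \<and> c < c' \<longrightarrow> T (r, c) > T (r, c')) \<and>
     (\<forall>r r' c. (r, c) \<in> diagram p \<and> (r', c) \<in> diagram p \<and> r < r' \<longrightarrow> T (r, c) > T (r', c))}"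

definition content :: "nat list \<Rightarrow> nat \<Rightarrow> (nat \<times> nat \<Rightarrow> nat) \<Rightarrow> int" where
  "content p i T = (case the_inv_into (diagram p) T i of (r, c) \<Rightarrow> int c - int r)"

definition norm0_sq :: "nat \<Rightarrow> nat list \<Rightarrow> (nat \<times> nat \<Rightarrow> nat) \<Rightarrow> real" where
  "norm0_sq N p T =
     (\<Prod>(i, j) \<in> {(i, j). i \<in> {1..N} \<and> j \<in> {1..N} \<and> i < j \<and> content p i T \<le> content p j T - 2}.
        1 - 1 / (real_of_int (content p i T - content p j T))\<^sup>2)"

text \<open>The average content, written as a sum over boxes to make its independence of the tableau
  evident; see \<open>gamma_eq\<close>.\<close>

definition gamma :: "nat \<Rightarrow> nat list \<Rightarrow> real" where
  "gamma N p = (\<Sum>(r, c)\<in>diagram p. real c - real r) / real N"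

lemma gamma_eq:
  assumes "T \<in> rsyt N p"
  shows "gamma N p = (\<Sum>i = 1..N. real_of_int (content p i T)) / real N"
proof -
  from assms have bij: "bij_betw T (diagram p) {1..N}" by (simp add: rsyt_def)
  have "(\<Sum>i = 1..N. real_of_int (content p i T)) =
      (\<Sum>b\<in>diagram p. real_of_int (content p (T b) T))"
    using sum.reindex_bij_betw[OF bij, of "\<lambda>i. real_of_int (content p i T)"] by simp
  also have "\<dots> = (\<Sum>(r, c)\<in>diagram p. real c - real r)"
  proof (rule sum.cong)
    fix b assume "b \<in> diagram p"
    then have "the_inv_into (diagram p) T (T b) = b"
      using bij by (auto simp: bij_betw_def intro: the_inv_into_f_f)
    then show "real_of_int (content p (T b) T) = (case b of (r, c) \<Rightarrow> real c - real r)"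
      by (auto simp: content_def split: prod.splits)
  qed simp
  finally show ?thesis by (simp add: gamma_def)
qed

section \<open>Matrices\<close>

definition adj :: "complex^'t^'t \<Rightarrow> complex^'t^'t" where
  "adj A = (\<chi> a b. cnj (A $ b $ a))"

definition mscale :: "complex \<Rightarrow> complex^'t^'t \<Rightarrow> complex^'t^'t" where
  "mscale c A = (\<chi> a b. c * A $ a $ b)"

definition herm :: "complex^'t \<Rightarrow> complex^'t \<Rightarrow> complex" where
  "herm v w = (\<Sum>a\<in>UNIV. cnj (v $ a) * w $ a)"

section \<open>The representation\<close>

text \<open>The finite type \<open>'t\<close> indexes the tableaux through a bijection \<open>Y\<close>; it plays the role of
  \<open>{1..dim V}\<close>. No order on \<open>'t\<close> is fixed: where the order that puts the tableaux with
  \<open>content p (N - 1) T = -1\<close> first is used, that is in block matrices, \<open>rho\<close> below refers to the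
  condition on the content itself.

  \<open>R w\<close> is the matrix of \<open>w\<close> in the basis of tableaux: column \<open>b\<close> holds the coordinates of
  \<open>w\<close> applied to \<open>Y b\<close>. Permutations of \<open>{1..N}\<close> are functions on \<open>nat\<close> fixing all other numbers.
  The eigenvalue condition pins down the equivalence class of the representation.\<close>

definition inner0 ::
  "nat \<Rightarrow> nat list \<Rightarrow> ('t::finite \<Rightarrow> nat \<times> nat \<Rightarrow> nat) \<Rightarrow> real^'t \<Rightarrow> real^'t \<Rightarrow> real" where
  "inner0 N p Y u v = (\<Sum>a\<in>UNIV. u $ a * v $ a * norm0_sq N p (Y a))"

definition young_rep ::
  "nat \<Rightarrow> nat list \<Rightarrow> ('t::finite \<Rightarrow> nat \<times> nat \<Rightarrow> nat) \<Rightarrow> ((nat \<Rightarrow> nat) \<Rightarrow> real^'t^'t) \<Rightarrow> bool" where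
  "young_rep N p Y R \<longleftrightarrow>
     bij_betw Y UNIV (rsyt N p) \<and>
     R id = mat 1 \<and>
     (\<forall>v w. v permutes {1..N} \<and> w permutes {1..N} \<longrightarrow> R (v \<circ> w) = R v ** R w) \<and>
     (\<forall>S :: (complex^'t) set. vec.subspace S \<and>
        (\<forall>w v. w permutes {1..N} \<and> v \<in> S \<longrightarrow> (\<chi> a b. complex_of_real (R w $ a $ b)) *v v \<in> S)
        \<longrightarrow> S = {0} \<or> S = UNIV) \<and>
     (\<forall>i\<in>{1..N}. \<forall>b. (\<Sum>j\<in>{i<..N}. R (Transposition.transpose i j)) *v axis b 1
        = real_of_int (content p i (Y b)) *s axis b 1) \<and>
     (\<forall>w u v. w permutes {1..N} \<longrightarrow> inner0 N p Y (R w *v u) (R w *v v) = inner0 N p Y u v)"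

text \<open>Change to the orthonormal basis \<open>T / sqrt (norm0_sq N p T)\<close>.\<close>

definition orthonormal_matrix ::
  "nat \<Rightarrow> nat list \<Rightarrow> ('t::finite \<Rightarrow> nat \<times> nat \<Rightarrow> nat) \<Rightarrow> ((nat \<Rightarrow> nat) \<Rightarrow> real^'t^'t)
     \<Rightarrow> (nat \<Rightarrow> nat) \<Rightarrow> complex^'t^'t" where
  "orthonormal_matrix N p Y R w =
     (\<chi> a b. complex_of_real
        (sqrt (norm0_sq N p (Y a)) * R w $ a $ b / sqrt (norm0_sq N p (Y b))))"

definition rho ::
  "nat \<Rightarrow> nat list \<Rightarrow> ('t::finite \<Rightarrow> nat \<times> nat \<Rightarrow> nat) \<Rightarrow> complex \<Rightarrow> complex \<Rightarrow> complex^'t^'t" where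
  "rho N p Y a b =
     (\<chi> s t. if s \<noteq> t then 0 else if content p (N - 1) (Y s) = -1 then a else b)"

definition w0 :: "nat \<Rightarrow> nat \<Rightarrow> nat" where
  "w0 N i = (if 1 \<le> i \<and> i < N then i + 1 else if i = N then 1 else i)"

section \<open>The torus\<close>

text \<open>Points of the \<open>N\<close>-dimensional complex space are functions on \<open>nat\<close> that are \<open>undefined\<close>
  outside \<open>{1..N}\<close>. A permutation \<open>w\<close> acts on the right by \<open>x \<mapsto> x \<circ> w\<close>.\<close>

definition torus :: "nat \<Rightarrow> (nat \<Rightarrow> complex) set" where
  "torus N = {1..N} \<rightarrow>\<^sub>E sphere 0 1"

definition torus_reg :: "nat \<Rightarrow> (nat \<Rightarrow> complex) set" where
  "torus_reg N = {x \<in> torus N. inj_on x {1..N}}"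

definition circle_measure :: "complex measure" where
  "circle_measure =
     distr (uniform_measure lborel {0..<2 * pi}) (restrict_space borel (sphere 0 1)) cis"

text \<open>Normalized Haar measure. It is completed because the matrix function \<open>L\<close> has arbitrary values
  on the null set where two coordinates coincide.\<close>

definition haar_torus :: "nat \<Rightarrow> (nat \<Rightarrow> complex) measure" where
  "haar_torus N = completion (Pi\<^sub>M {1..N} (\<lambda>_. circle_measure))"

definition omega :: "nat \<Rightarrow> complex" where
  "omega N = cis (2 * pi / real N)"

definition x0 :: "nat \<Rightarrow> nat \<Rightarrow> complex" where
  "x0 N = (\<lambda>i\<in>{1..N}. omega N ^ (i - 1))"

definition C0 :: "nat \<Rightarrow> (nat \<Rightarrow> complex) set" where
  "C0 N = {(\<lambda>i\<in>{1..N}. cis (\<theta> i)) | \<theta> :: nat \<Rightarrow> real.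
     (\<forall>i\<in>{1..<N}. \<theta> i < \<theta> (i + 1)) \<and> \<theta> N < \<theta> 1 + 2 * pi}"

section \<open>The differential system\<close>

text \<open>The system is \<open>\<partial>\<^sub>i L(x) = L(x) ** system_coeff N \<kappa> \<gamma> \<tau> i x\<close>.\<close>

definition system_coeff ::
  "nat \<Rightarrow> real \<Rightarrow> real \<Rightarrow> ((nat \<Rightarrow> nat) \<Rightarrow> complex^'t^'t) \<Rightarrow> nat \<Rightarrow> (nat \<Rightarrow> complex)
     \<Rightarrow> complex^'t^'t" where
  "system_coeff N \<kappa> \<gamma> \<tau> i x =
     mscale (of_real \<kappa>)
       ((\<Sum>j\<in>{1..N} - {i}. mscale (1 / (x i - x j)) (\<tau> (Transposition.transpose i j)))
        - mscale (of_real \<gamma> / x i) (mat 1))"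

text \<open>On the torus \<open>x\<^sub>i \<partial>\<^sub>i\<close> is \<open>-\<i> \<partial>/\<partial>\<theta>\<^sub>i\<close>, so the derivative of \<open>L\<close> along the angle \<open>\<theta>\<^sub>i\<close> is
  \<open>\<i> * x\<^sub>i * \<partial>\<^sub>i L\<close>. The last clause is \<open>L(x) = L(x w\<^sub>x\<^sup>-\<^sup>1) \<tau>(w\<^sub>x)\<close>; the permutation \<open>w\<close> in it is
  unique.\<close>

definition is_L ::
  "nat \<Rightarrow> real \<Rightarrow> real \<Rightarrow> ((nat \<Rightarrow> nat) \<Rightarrow> complex^'t^'t) \<Rightarrow> ((nat \<Rightarrow> complex) \<Rightarrow> complex^'t^'t)
     \<Rightarrow> bool" where
  "is_L N \<kappa> \<gamma> \<tau> L \<longleftrightarrow>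
     L (x0 N) = mat 1 \<and>
     (\<forall>x\<in>C0 N. \<forall>i\<in>{1..N}.
        ((\<lambda>t::real. L (x(i := x i * cis t))) has_vector_derivative
           mscale (\<i> * x i) (L x ** system_coeff N \<kappa> \<gamma> \<tau> i x)) (at 0)) \<and>
     (\<forall>x\<in>torus_reg N. \<forall>w. w permutes {1..N} \<and> w 1 = 1 \<and> x \<circ> inv w \<in> C0 N
        \<longrightarrow> L x = L (x \<circ> inv w) ** \<tau> w)"

section \<open>The solution near the collision of the last two coordinates\<close>

text \<open>A point \<open>(x\<^sub>1, \<dots>, x\<^sub>N\<^sub>-\<^sub>2, u)\<close> is a function \<open>y\<close> on \<open>{1..N-1}\<close> with \<open>y (N - 1) = u\<close>.\<close>

definition split_point :: "nat \<Rightarrow> (nat \<Rightarrow> complex) \<Rightarrow> complex \<Rightarrow> nat \<Rightarrow> complex" where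
  "split_point N y z =
     (\<lambda>i\<in>{1..N}. if i = N - 1 then y (N - 1) - z else if i = N then y (N - 1) + z else y i)"

text \<open>\<open>(1, \<omega>, \<dots>, \<omega>\<^sup>N\<^sup>-\<^sup>3, t \<omega>\<^sup>-\<^sup>3\<^sup>/\<^sup>2)\<close>\<close>

definition base_point :: "nat \<Rightarrow> real \<Rightarrow> nat \<Rightarrow> complex" where
  "base_point N t =
     (\<lambda>i\<in>{1..N - 1}. if i = N - 1 then of_real t * cis (- 3 * pi / real N) else omega N ^ (i - 1))"

text \<open>Analytic functions of several complex variables: continuous and holomorphic in each variable.\<close>

definition analytic_several ::
  "nat \<Rightarrow> (nat \<Rightarrow> complex) set \<Rightarrow> ((nat \<Rightarrow> complex) \<Rightarrow> complex^'t^'t) \<Rightarrow> bool" where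
  "analytic_several n D F \<longleftrightarrow>
     continuous_on D F \<and>
     (\<forall>y\<in>D. \<forall>i\<in>{1..n}. \<forall>a b. (\<lambda>s. F (y(i := s)) $ a $ b) field_differentiable (at (y i)))"

text \<open>The parameters \<open>(y, z)\<close> for which the expansion of \<open>L\<^sub>1\<close> converges. The condition
  \<open>norm z < norm u\<close> is not imposed: it fails at \<open>x0 N\<close> for \<open>N = 3, 4\<close>, and it is not needed, since
  \<open>Im (z / u) > 0\<close> already implies that \<open>u\<^sup>2 - z\<^sup>2\<close> is nonzero and has a continuous logarithm.\<close>

definition expansion_domain ::
  "nat \<Rightarrow> (nat \<Rightarrow> complex) set \<Rightarrow> ((nat \<Rightarrow> complex) \<times> complex) set" where
  "expansion_domain N D =
     {(y, z). y \<in> D \<and> (\<forall>j\<in>{1..N - 2}. norm z < norm (y j - y (N - 1))) \<and> Im (z / y (N - 1)) > 0}"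

text \<open>\<open>lp\<close> and \<open>lz\<close> are continuous logarithms that fix the branches of the powers of
  \<open>(u\<^sup>2 - z\<^sup>2) \<Prod> x\<^sub>j\<close> and of \<open>z\<close>.\<close>

definition is_L1 ::
  "nat \<Rightarrow> real \<Rightarrow> nat list \<Rightarrow> ('t::finite \<Rightarrow> nat \<times> nat \<Rightarrow> nat) \<Rightarrow> ((nat \<Rightarrow> nat) \<Rightarrow> complex^'t^'t)
     \<Rightarrow> ((nat \<Rightarrow> complex) \<Rightarrow> complex^'t^'t) \<Rightarrow> bool" where
  "is_L1 N \<kappa> p Y \<tau> L1 \<longleftrightarrow>
     (\<exists>D \<alpha> lp lz.
        openin (product_topology (\<lambda>_. euclidean) {1..N - 1}) D \<and>
        simply_connected D \<and>
        (\<forall>y\<in>D. inj_on y {1..N - 1} \<and> (\<forall>i\<in>{1..N - 1}. y i \<noteq> 0)) \<and>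
        (\<forall>t\<in>{cos (pi / real N)..1}. base_point N t \<in> D) \<and>
        (\<forall>n::nat. analytic_several (N - 1) D (\<alpha> n)) \<and>
        (\<forall>n. \<forall>y\<in>D. \<tau> (Transposition.transpose (N - 1) N) ** \<alpha> n y **
               \<tau> (Transposition.transpose (N - 1) N) = mscale ((-1) ^ n) (\<alpha> n y)) \<and>
        \<alpha> 0 (base_point N 1) = mat 1 \<and>
        continuous_on (expansion_domain N D) lp \<and>
        continuous_on (expansion_domain N D) lz \<and>
        (\<forall>(y, z)\<in>expansion_domain N D.
           exp (lp (y, z)) = ((y (N - 1))\<^sup>2 - z\<^sup>2) * (\<Prod>j = 1..N - 2. y j) \<and>
           exp (lz (y, z)) = z \<and>
           summable (\<lambda>n. mscale (z ^ n) (\<alpha> n y)) \<and>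
           L1 (split_point N y z) =
             mscale (exp (- of_real (gamma N p * \<kappa>) * lp (y, z)))
               (rho N p Y (exp (- of_real \<kappa> * lz (y, z))) (exp (of_real \<kappa> * lz (y, z)))
                ** (\<Sum>n. mscale (z ^ n) (\<alpha> n y)))) \<and>
        (\<forall>(y, z)\<in>expansion_domain N D. let x = split_point N y z in
           \<forall>i\<in>{1..N}. \<forall>a b.
             ((\<lambda>s. L1 (x(i := s)) $ a $ b) has_field_derivative
                (L1 x ** system_coeff N \<kappa> (gamma N p) \<tau> i x) $ a $ b) (at (x i))))"

section \<open>Dunkl operators\<close>

text \<open>\<open>x\<^sub>i \<partial>\<^sub>i = -\<i> \<partial>/\<partial>\<theta>\<^sub>i\<close>\<close>

definition euler_deriv ::
  "nat \<Rightarrow> ((nat \<Rightarrow> complex) \<Rightarrow> complex^'t) \<Rightarrow> (nat \<Rightarrow> complex) \<Rightarrow> complex^'t" where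
  "euler_deriv i f x =
     (- \<i>) *s vector_derivative (\<lambda>t::real. f (x(i := x i * cis t))) (at 0)"

definition C1_torus :: "nat \<Rightarrow> ((nat \<Rightarrow> complex) \<Rightarrow> complex^'t) \<Rightarrow> bool" where
  "C1_torus N f \<longleftrightarrow>
     continuous_on (torus N) f \<and>
     (\<forall>i\<in>{1..N}.
        (\<forall>x\<in>torus N. (\<lambda>t::real. f (x(i := x i * cis t))) differentiable (at 0)) \<and>
        continuous_on (torus N) (euler_deriv i f))"

definition dunkl_formula ::
  "nat \<Rightarrow> real \<Rightarrow> ((nat \<Rightarrow> nat) \<Rightarrow> complex^'t^'t) \<Rightarrow> nat \<Rightarrow> ((nat \<Rightarrow> complex) \<Rightarrow> complex^'t)
     \<Rightarrow> (nat \<Rightarrow> complex) \<Rightarrow> complex^'t" where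
  "dunkl_formula N \<kappa> \<tau> i f x =
     euler_deriv i f x +
     of_real \<kappa> *s (\<Sum>j\<in>{1..N} - {i}. (x i / (x i - x j)) *s
       (\<tau> (Transposition.transpose i j) *v (f x - f (x \<circ> Transposition.transpose i j))))"

text \<open>\<open>x\<^sub>i D\<^sub>i\<close>, extended by continuity.\<close>

definition dunkl ::
  "nat \<Rightarrow> real \<Rightarrow> ((nat \<Rightarrow> nat) \<Rightarrow> complex^'t^'t) \<Rightarrow> nat \<Rightarrow> ((nat \<Rightarrow> complex) \<Rightarrow> complex^'t)
     \<Rightarrow> (nat \<Rightarrow> complex) \<Rightarrow> complex^'t" where
  "dunkl N \<kappa> \<tau> i f x =
     (if \<forall>j\<in>{1..N} - {i}. x i \<noteq> x j then dunkl_formula N \<kappa> \<tau> i f x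
      else Lim (at x within torus_reg N) (dunkl_formula N \<kappa> \<tau> i f))"

end

theory Submission
 imports Defs "HOL-Probability.Probability"
begin

text \<open>Put \<open>K = L\<^sup>* H L\<close>. On every component of the regular torus, \<open>K\<close> solves a linear equation whose
 coefficients are commutators with the reflections \<open>\<tau>((i, j))\<close> and, multiplied by
 \<open>cot((th\<^sub>i - th\<^sub>j) / 2)\<close>, anticommutators with them (\<open>quadratic_partial\<close>). Since \<open>H\<close> commutes with \<open>\<upsilon>\<close>
 and the sum of all reflections is a scalar, \<open>K(x w) = \<tau>(w)\<^sup>* K(x) \<tau>(w)\<close> for all permutations \<open>w\<close>
 (\<open>K_equivariant\<close>). For \<open>\<Phi>(x) = \<langle>f(x), K(x) g(x)\<rangle>\<close> the equation says that the integrand of the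
 theorem is \<open>\<i> \<partial>\<Phi>/\<partial>th\<^sub>i + \<Sum>\<^sub>j S\<^sub>j\<close>, where \<open>S\<^sub>j\<close> changes sign under the exchange of \<open>x\<^sub>i\<close> and \<open>x\<^sub>j\<close>. Formally,
 all these terms integrate to zero; what has to be controlled are the walls \<open>x\<^sub>i = x\<^sub>j\<close>.

 Two estimates do this. First, the commutators are skew for the Frobenius inner product, so only the
 cotangents make \<open>K\<close> grow, and \<open>K\<close> is at most of order \<open>\<delta> powr (-\<bar>\<kappa>\<bar> N (N - 1))\<close> at points whose
 coordinates have distances at least \<open>\<delta>\<close> (\<open>K_bound\<close>); the condition on \<open>\<kappa>\<close> makes the exponent less
 than one half. Second, the defect \<open>K - \<tau>((i, j)) K \<tau>((i, j))\<close> vanishes on the wall \<open>x\<^sub>i = x\<^sub>j\<close>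
 (\<open>reflection_defect\<close>). This is where the hypothesis on \<open>\<sigma>\<close> enters: near one point of one wall, \<open>K\<close>
 is a form in \<open>L\<^sub>1\<close>, and \<open>L\<^sub>1\<close> is asymptotically a multiple of \<open>\<rho>(z powr -\<kappa>, z powr \<kappa>)\<close>, which
 commutes with \<open>\<sigma>\<close> (\<open>base_wall_zero\<close>). Moving parallel to the wall, the singular coefficient drops out
 of the equation for the defect, which thus vanishes on the whole wall (\<open>wall_step\<close>), and by
 equivariance on all walls. The same asymptotics show that \<open>L\<^sub>1(x\<^sub>0)\<close> is invertible (\<open>L1_kernel\<close>),
 without which the hypothesis on \<open>\<sigma>\<close> would speak of an arbitrary matrix.

 For the integration, \<open>\<Phi>\<close> is multiplied by a smooth cutoff that vanishes on the walls
 (\<open>torus_integral_by_parts\<close>). The derivative of the cutoff contributes \<open>cot((th\<^sub>i - th\<^sub>j) / 2) \<Phi>\<close>, which is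
 not integrable in general. But the cotangent is odd under the exchange of \<open>x\<^sub>i\<close> and \<open>x\<^sub>j\<close>, so \<open>\<Phi>\<close> may be
 replaced by half its difference with the exchanged function, and by the second estimate the product
 has an integrable majorant. Dominated convergence removes the cutoff.\<close>

section \<open>Complex matrices with the Frobenius norm\<close>

lemma norm_matrix_sq:
 fixes A :: "complex^'t^'t"
 shows "(norm A)\<^sup>2 = (\<Sum>i\<in>UNIV. \<Sum>j\<in>UNIV. (cmod (A $ i $ j))\<^sup>2)"
 by (simp add: norm_vec_def L2_set_def sum_nonneg)

lemma norm_matrix_mult_le:
 fixes A B :: "complex^'t^'t"
 shows "norm (A ** B) <= norm A * norm B"
proof -
 have entry: "(cmod ((A ** B) $ i $ j))\<^sup>2 \<le>
   (\<Sum>k\<in>UNIV. (cmod (A $ i $ k))\<^sup>2) * (\<Sum>k\<in>UNIV. (cmod (B $ k $ j))\<^sup>2)" for i j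
 proof -
  have "cmod ((A ** B) $ i $ j) <= (\<Sum>k\<in>UNIV. cmod (A $ i $ k) * cmod (B $ k $ j))"
   unfolding matrix_matrix_mult_def
   by (simp add: norm_mult flip: norm_mult) (rule norm_sum)
  also have "\<dots> <= L2_set (\<lambda>k. cmod (A $ i $ k)) UNIV * L2_set (\<lambda>k. cmod (B $ k $ j)) UNIV"
   using L2_set_mult_ineq[of "\<lambda>k. cmod (A $ i $ k)" "\<lambda>k. cmod (B $ k $ j)" UNIV] by simp
  finally have "(cmod ((A ** B) $ i $ j))\<^sup>2 \<le>
    (L2_set (\<lambda>k. cmod (A $ i $ k)) UNIV * L2_set (\<lambda>k. cmod (B $ k $ j)) UNIV)\<^sup>2"
   by (intro power_mono) auto
  then show ?thesis by (simp add: L2_set_def power_mult_distrib sum_nonneg)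
 qed
 have "(norm (A ** B))\<^sup>2 <= (\<Sum>i\<in>UNIV. \<Sum>j\<in>UNIV.
   (\<Sum>k\<in>UNIV. (cmod (A $ i $ k))\<^sup>2) * (\<Sum>k\<in>UNIV. (cmod (B $ k $ j))\<^sup>2))"
  unfolding norm_matrix_sq by (intro sum_mono entry)
 also have "\<dots> = (\<Sum>i\<in>UNIV. \<Sum>k\<in>UNIV. (cmod (A $ i $ k))\<^sup>2) *
   (\<Sum>j\<in>UNIV. \<Sum>k\<in>UNIV. (cmod (B $ k $ j))\<^sup>2)"
  by (simp add: sum_product)
 also have "(\<Sum>j\<in>UNIV. \<Sum>k\<in>UNIV. (cmod (B $ k $ j))\<^sup>2) = (norm B)\<^sup>2"
  unfolding norm_matrix_sq by (rule sum.swap)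
 finally have "(norm (A ** B))\<^sup>2 <= (norm A * norm B)\<^sup>2"
  by (simp add: norm_matrix_sq power_mult_distrib)
 then show ?thesis by (rule power2_le_imp_le) simp
qed

lemma bounded_bilinear_matrix_mult:
 "bounded_bilinear ((**) :: complex^'t^'t => complex^'t^'t => complex^'t^'t)"
proof
 show "\<exists>K. \<forall>(a :: complex^'t^'t) (b :: complex^'t^'t). norm (a ** b) <= norm a * norm b * K"
  using norm_matrix_mult_le by (intro exI[of _ 1]) auto
qed (simp_all add: matrix_matrix_mult_def vec_eq_iff algebra_simps sum.distrib scaleR_sum_right)

interpretation mm: bounded_bilinear
 "(**) :: complex^'t^'t => complex^'t^'t => complex^'t^'t"
 by (rule bounded_bilinear_matrix_mult)

lemma norm_matrix_mult3_le:
 fixes A B C :: "complex^'t^'t"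
 shows "norm (A ** B ** C) <= norm A * norm B * norm C"
 using norm_matrix_mult_le[of "A ** B" C] norm_matrix_mult_le[of A B]
 by (meson mult_right_mono norm_ge_zero order_trans)

lemma mscale_eq: "mscale c A = mat c ** A"
 by (simp add: mscale_def matrix_matrix_mult_def mat_def vec_eq_iff if_distrib[where f = "\<lambda>x. x * _"]
   cong: if_cong)

lemma mscale_simps:
 "mscale c (A + B) = mscale c A + mscale c B"
 "mscale c (A - B) = mscale c A - mscale c B"
 "mscale c (- A) = - mscale c A"
 "mscale (c + e) A = mscale c A + mscale e A"
 "mscale (c - e) A = mscale c A - mscale e A"
 "mscale (- c) A = - mscale c A"
 "mscale c 0 = 0" "mscale 0 A = 0" "mscale 1 A = A"
 "mscale c (r *\<^sub>R A) = r *\<^sub>R mscale c A"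
 "mscale c (mscale e A) = mscale (c * e) A"
 "mscale c A ** B = mscale c (A ** B)"
 "A ** mscale c B = mscale c (A ** B)"
 by (simp_all add: mscale_def vec_eq_iff algebra_simps matrix_matrix_mult_def sum_distrib_left)

lemma mscale_of_real: "mscale (complex_of_real r) A = r *\<^sub>R A"
 by (simp add: mscale_def vec_eq_iff scaleR_conv_of_real[where 'a = complex])

lemma mscale_sum: "mscale c (\<Sum>i\<in>I. f i) = (\<Sum>i\<in>I. mscale c (f i))"
 by (simp add: mscale_eq mm.sum_right)

lemma norm_mscale: "norm (mscale c (A :: complex^'t^'t)) = cmod c * norm A"
proof -
 have "(norm (mscale c A))\<^sup>2 = (cmod c * norm A)\<^sup>2"
  unfolding power_mult_distrib norm_matrix_sq
  by (simp add: mscale_def norm_mult power_mult_distrib sum_distrib_left)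
 then show ?thesis by (simp add: power2_eq_iff_nonneg)
qed

lemma adj_simps:
 "adj (A + B) = adj A + adj B" "adj (A - B) = adj A - adj B" "adj (- A) = - adj A"
 "adj 0 = 0" "adj (mat 1) = mat 1" "adj (r *\<^sub>R A) = r *\<^sub>R adj A"
 "adj (adj A) = A" "adj (mscale c A) = mscale (cnj c) (adj A)"
 "adj (A ** B) = adj B ** adj A"
 by (simp_all add: adj_def mscale_def mat_def vec_eq_iff matrix_matrix_mult_def mult.commute)

lemma adj_sum: "adj (\<Sum>i\<in>I. f i) = (\<Sum>i\<in>I. adj (f i))"
 by (induction I rule: infinite_finite_induct) (simp_all add: adj_simps)

lemma norm_adj: "norm (adj A :: complex^'t^'t) = norm A"
proof -
 have "(norm (adj A))\<^sup>2 = (norm A)\<^sup>2"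
  unfolding norm_matrix_sq by (subst sum.swap) (simp add: adj_def)
 then show ?thesis by (simp add: power2_eq_iff_nonneg)
qed

lemma bounded_linear_adj: "bounded_linear (adj :: complex^'t^'t => complex^'t^'t)"
 by (rule bounded_linear_intro[where K = 1]) (simp_all add: adj_simps norm_adj)

lemma inner_matrix_eq: "inner A B = Re (trace (adj A ** B))"
 for A B :: "complex^'t^'t"
proof -
 have "trace (adj A ** B) = (\<Sum>i\<in>UNIV. \<Sum>k\<in>UNIV. cnj (A $ k $ i) * B $ k $ i)"
  by (simp add: trace_def adj_def matrix_matrix_mult_def)
 also have "\<dots> = (\<Sum>k\<in>UNIV. \<Sum>i\<in>UNIV. cnj (A $ k $ i) * B $ k $ i)" by (rule sum.swap)
 finally show ?thesis
  by (simp add: inner_vec_def inner_complex_def Re_sum)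
qed

lemma cnj_trace: "cnj (trace A) = trace (adj A)"
 by (simp add: trace_def adj_def)

lemma trace_mscale: "trace (mscale c A) = c * trace A"
 by (simp add: trace_def mscale_def sum_distrib_left)

lemma norm_unitary_left: "norm (U ** A) = norm A" if "adj U ** U = mat 1"
 for A U :: "complex^'t^'t"
proof -
 have "adj (U ** A) ** (U ** A) = adj A ** (adj U ** U) ** A"
  by (simp add: adj_simps matrix_mul_assoc)
 then have "inner (U ** A) (U ** A) = inner A A"
  by (simp add: that inner_matrix_eq matrix_mul_rid)
 then show ?thesis by (simp add: norm_eq_sqrt_inner)
qed

lemma norm_unitary_right: "norm (A ** U) = norm A" if "U ** adj U = mat 1"
 for A U :: "complex^'t^'t"
proof -
 have "norm (adj U ** adj A) = norm (adj A)"
  by (rule norm_unitary_left) (simp add: adj_simps that)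
 then show ?thesis by (metis adj_simps(9) norm_adj)
qed

text \<open>The commutator part of the differential equation is skew for the Frobenius inner product, as
 the trace of a product of two Hermitian matrices is real.\<close>

lemma inner_commutator:
 fixes K t :: "complex^'t^'t"
 assumes "adj t = t"
 shows "inner K (mscale (of_real c * \<i>) (K ** t - t ** K)) = 0"
proof -
 have real1: "cnj (trace (adj K ** (K ** t))) = trace (adj K ** (K ** t))"
 proof -
  have "cnj (trace (adj K ** (K ** t))) = trace (t ** (adj K ** K))"
   by (simp add: cnj_trace adj_simps assms matrix_mul_assoc)
  also have "\<dots> = trace (adj K ** K ** t)" by (rule trace_mul_sym)
  finally show ?thesis by (simp add: matrix_mul_assoc)
 qed
 have real2: "cnj (trace (adj K ** (t ** K))) = trace (adj K ** (t ** K))"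
  by (simp add: cnj_trace adj_simps assms matrix_mul_assoc)
 have "adj K ** mscale (of_real c * \<i>) (K ** t - t ** K) =
   mscale (of_real c * \<i>) (adj K ** (K ** t)) - mscale (of_real c * \<i>) (adj K ** (t ** K))"
  by (simp add: mscale_simps mm.diff_right)
 then have "trace (adj K ** mscale (of_real c * \<i>) (K ** t - t ** K)) =
   of_real c * \<i> * (trace (adj K ** (K ** t)) - trace (adj K ** (t ** K)))"
  by (simp only: trace_sub trace_mscale right_diff_distrib)
 moreover have "Im (trace (adj K ** (K ** t)) - trace (adj K ** (t ** K))) = 0"
  using real1 real2 by (metis Im_complex_of_real Reals_cnj_iff complex_is_Real_iff minus_complex.sel(2) diff_self)
 ultimately show ?thesis by (simp add: inner_matrix_eq)
qed

section \<open>One-variable estimates\<close>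

text \<open>Gronwall's inequality for the squared norm, which unlike the norm is differentiable.\<close>

lemma gronwall:
 fixes X X' :: "real => 'a::real_inner"
 assumes der: "\<And>t. t \<in> {0..1} ==> (X has_vector_derivative X' t) (at t within {0..1})"
  and bound: "\<And>t. t \<in> {0..1} ==> norm (X' t) <= C * norm (X t) + e"
  and "C >= 0" "e >= 0" "s \<in> {0..1}"
 shows "(norm (X s))\<^sup>2 <= exp (2 * C + 1) * ((norm (X 0))\<^sup>2 + e\<^sup>2)"
proof -
 define u where "u = (\<lambda>t. exp (- (2 * C + 1) * t) * inner (X t) (X t) - e\<^sup>2 * t)"
 define u' where "u' = (\<lambda>t. exp (- (2 * C + 1) * t) * (2 * inner (X t) (X' t)) 
   - (2 * C + 1) * exp (- (2 * C + 1) * t) * inner (X t) (X t) - e\<^sup>2)"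
 have u: "(u has_real_derivative u' t) (at t within {0..1})" if "t \<in> {0..1}" for t
 proof -
  have "((\<lambda>t. inner (X t) (X t)) has_vector_derivative (inner (X t) (X' t) + inner (X' t) (X t)))
    (at t within {0..1})"
   by (rule bounded_bilinear.has_vector_derivative[OF bounded_bilinear_inner der[OF that] der[OF that]])
  then have "((\<lambda>t. inner (X t) (X t)) has_real_derivative (2 * inner (X t) (X' t)))
    (at t within {0..1})"
   by (simp add: has_real_derivative_iff_has_vector_derivative inner_commute)
  then show ?thesis unfolding u_def u'_def
   by (auto intro!: derivative_eq_intros simp: algebra_simps)
 qed
 have u'_le: "u' t <= 0" if "t \<in> {0..1}" for t
 proof -
  have "inner (X t) (X' t) <= norm (X t) * (C * norm (X t) + e)"
   using bound[OF that] norm_cauchy_schwarz[of "X t" "X' t"]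
   by (meson mult_left_mono norm_ge_zero order_trans)
  moreover have "2 * (norm (X t) * e) <= (norm (X t))\<^sup>2 + e\<^sup>2"
   using sum_squares_bound[of "norm (X t)" e] by simp
  ultimately have le: "2 * inner (X t) (X' t) <= (2 * C + 1) * inner (X t) (X t) + e\<^sup>2"
   by (simp add: power2_norm_eq_inner algebra_simps power2_eq_square flip: power2_norm_eq_inner)
  have "exp (- (2 * C + 1) * t) * (2 * inner (X t) (X' t) - (2 * C + 1) * inner (X t) (X t))
    <= exp (- (2 * C + 1) * t) * e\<^sup>2"
   using le by (intro mult_left_mono) auto
  also have "\<dots> <= 1 * e\<^sup>2"
   using that \<open>C >= 0\<close> by (intro mult_right_mono) (auto intro!: mult_nonpos_nonneg)
  finally show ?thesis unfolding u'_def by (simp add: algebra_simps)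
 qed
 have "u s <= u 0"
 proof (rule DERIV_nonpos_imp_decreasing_open[where f = u])
  show "0 <= s" using assms by simp
  show "\<exists>y. DERIV u x :> y \<and> y <= 0" if "0 < x" "x < s" for x
   using u[of x] u'_le[of x] that assms(5) at_within_Icc_at[of 0 x 1] by auto
  show "continuous_on {0..s} u"
   by (rule continuous_on_subset[of "{0..1}"])
    (use assms(5) in \<open>auto intro!: DERIV_continuous_on u\<close>)
 qed
 then have "exp (- (2 * C + 1) * s) * (norm (X s))\<^sup>2 <= (norm (X 0))\<^sup>2 + e\<^sup>2 * s"
  by (simp add: u_def power2_norm_eq_inner)
 also have "\<dots> <= (norm (X 0))\<^sup>2 + e\<^sup>2"
  using assms(5) mult_left_mono[of s 1 "e\<^sup>2"] by auto
 finally have le_final: "exp (- (2 * C + 1) * s) * (norm (X s))\<^sup>2 <= (norm (X 0))\<^sup>2 + e\<^sup>2" .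
 have one: "exp ((2 * C + 1) * s) * exp (- (2 * C + 1) * s) = 1"
  by (simp flip: exp_add add: algebra_simps)
 from mult_left_mono[OF le_final, of "exp ((2 * C + 1) * s)"]
 have "(norm (X s))\<^sup>2 <= exp ((2 * C + 1) * s) * ((norm (X 0))\<^sup>2 + e\<^sup>2)"
  by (simp only: mult.assoc[symmetric] one mult_1_left exp_ge_zero)
 also have "\<dots> <= exp (2 * C + 1) * ((norm (X 0))\<^sup>2 + e\<^sup>2)"
  using assms(3,5) mult_left_mono[of s 1 "2 * C + 1"] by (intro mult_right_mono) auto
 finally show ?thesis .
qed

lemma norm_increment_le:
 fixes X X' :: "real => 'a::real_normed_vector"
 assumes "\<And>t. t \<in> {0..1} ==> (X has_vector_derivative X' t) (at t within {0..1})"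
  and "\<And>t. t \<in> {0..1} ==> norm (X' t) <= B"
 shows "norm (X 1 - X 0) <= B"
proof -
 have "norm (X 1 - X 0) <= B * norm (1 - 0 :: real)"
 proof (rule differentiable_bound[of "{0..1}" X "\<lambda>t s. s *\<^sub>R X' t"])
  show "onorm (\<lambda>s. s *\<^sub>R X' t) <= B" if "t \<in> {0..1}" for t
   using assms(2)[OF that] by (simp add: onorm_scaleR_left onorm_id)
 qed (use assms(1) in \<open>auto simp: has_vector_derivative_def\<close>)
 then show ?thesis by simp
qed

section \<open>From partial derivatives to derivatives along lines\<close>

definition coord_box :: "nat set => (nat => real) => real => (nat => real) set" where
 "coord_box S th \<delta> = {et. (\<forall>i\<in>S. \<bar>et i - th i\<bar> < \<delta>) \<and> (\<forall>i. i \<notin> S \<longrightarrow> et i = th i)}"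

definition shift :: "nat set => (nat => real) => (nat => real) => real => nat => real" where
 "shift S th d t = (\<lambda>i. if i \<in> S then th i + t * d i else th i)"

lemma coord_box_fun_upd:
 assumes "et \<in> coord_box S th \<delta>" "j \<in> S" "\<bar>r - th j\<bar> < \<delta>"
 shows "et(j := r) \<in> coord_box S th \<delta>"
 using assms by (auto simp: coord_box_def)

text \<open>A linear bound on the partial derivatives in terms of the function gives joint continuity: the
 coordinates are moved one after the other, and Gronwall's inequality controls each move.\<close>

lemma partials_imp_lipschitz:
 fixes F :: "(nat => real) => 'a::real_inner"
 assumes fin: "finite S" and "\<delta> > 0" and "M >= 0"
  and der: "\<And>et i. et \<in> coord_box S th \<delta> ==> i \<in> S ==>
   ((\<lambda>r. F (et(i := r))) has_vector_derivative G i et) (at (et i))"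
  and bound: "\<And>et i. et \<in> coord_box S th \<delta> ==> i \<in> S ==> norm (G i et) <= M * norm (F et)"
 obtains C where "C >= 0" and
  "\<And>et. et \<in> coord_box S th \<delta> ==> norm (F et - F th) <= C * (\<Sum>i\<in>S. \<bar>et i - th i\<bar>)"
proof -
 define A where "A = sqrt (exp (2 * (M * \<delta>) + 1))"
 have "1 <= exp (2 * (M * \<delta>) + 1)" using assms(2,3) by simp
 then have A1: "A >= 1" unfolding A_def by simp
 have move: "norm (F (et(j := r))) <= A * norm (F (et(j := th j)))"
   "norm (F (et(j := r)) - F (et(j := th j))) <= M * A * norm (F (et(j := th j))) * \<bar>r - th j\<bar>"
  if et: "et \<in> coord_box S th \<delta>" and j: "j \<in> S" and r: "\<bar>r - th j\<bar> < \<delta>" for et j r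
 proof -
  define p where "p = (\<lambda>s. et(j := th j + s * (r - th j)))"
  have pbox: "p s \<in> coord_box S th \<delta>" if "s \<in> {0..1}" for s
  proof -
   have "\<bar>s * (r - th j)\<bar> <= 1 * \<bar>r - th j\<bar>"
    unfolding abs_mult using that by (intro mult_right_mono) auto
   then show ?thesis unfolding p_def using r by (intro coord_box_fun_upd et j) simp
  qed
  have pd: "((\<lambda>s. F (p s)) has_vector_derivative (r - th j) *\<^sub>R G j (p s)) (at s within {0..1})"
   if s: "s \<in> {0..1}" for s
  proof -
   have 1: "((\<lambda>x. F ((p s)(j := x))) has_vector_derivative G j (p s))
     (at (th j + s * (r - th j)))"
    using der[OF pbox[OF s] j] by (simp add: p_def)
   have 2: "((\<lambda>s. th j + s * (r - th j)) has_vector_derivative (r - th j)) (at s)"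
    by (auto intro!: derivative_eq_intros)
   have "(((\<lambda>x. F ((p s)(j := x))) \<circ> (\<lambda>s. th j + s * (r - th j)))
     has_vector_derivative (r - th j) *\<^sub>R G j (p s)) (at s)"
    using vector_diff_chain_at[OF 2 1] .
   then show ?thesis by (simp add: o_def p_def has_vector_derivative_at_within)
  qed
  have pb: "norm ((r - th j) *\<^sub>R G j (p s)) <= \<bar>r - th j\<bar> * M * norm (F (p s))" if "s \<in> {0..1}" for s
   using mult_left_mono[OF bound[OF pbox[OF that] j], of "\<bar>r - th j\<bar>"] by (simp add: mult.assoc)
  have growth: "norm (F (p s)) <= A * norm (F (p 0))" if s: "s \<in> {0..1}" for s
  proof -
   have "(norm (F (p s)))\<^sup>2 <= exp (2 * (M * \<delta>) + 1) * ((norm (F (p 0)))\<^sup>2 + 0\<^sup>2)"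
   proof (rule gronwall[OF pd])
    show "norm ((r - th j) *\<^sub>R G j (p t)) <= M * \<delta> * norm (F (p t)) + 0" if "t \<in> {0..1}" for t
    proof -
     have "\<bar>r - th j\<bar> * (M * norm (F (p t))) <= \<delta> * (M * norm (F (p t)))"
      using r \<open>M >= 0\<close> by (intro mult_right_mono) auto
     then show ?thesis using pb[OF that] by (simp add: mult_ac)
    qed
   qed (use assms s in auto)
   then have "(norm (F (p s)))\<^sup>2 <= (A * norm (F (p 0)))\<^sup>2"
    by (simp add: A_def power_mult_distrib)
   then show ?thesis by (rule power2_le_imp_le) (use A1 in auto)
  qed
  show "norm (F (et(j := r))) <= A * norm (F (et(j := th j)))"
   using growth[of 1] by (simp add: p_def)
  have "norm (F (p 1) - F (p 0)) <= M * A * norm (F (p 0)) * \<bar>r - th j\<bar>"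
  proof (rule norm_increment_le[OF pd])
   show "norm ((r - th j) *\<^sub>R G j (p s)) <= M * A * norm (F (p 0)) * \<bar>r - th j\<bar>" if "s \<in> {0..1}" for s
   proof -
    have "\<bar>r - th j\<bar> * M * norm (F (p s)) <= \<bar>r - th j\<bar> * M * (A * norm (F (p 0)))"
     using \<open>M >= 0\<close> by (intro mult_left_mono growth that) auto
    then show ?thesis using pb[OF that] by (simp add: mult_ac)
   qed
  qed auto
  then show "norm (F (et(j := r)) - F (et(j := th j))) <= M * A * norm (F (et(j := th j))) * \<bar>r - th j\<bar>"
   by (simp add: p_def)
 qed
 have main: "S' \<subseteq> S ==> \<forall>et\<in>coord_box S th \<delta>. (\<forall>i. i \<notin> S' \<longrightarrow> et i = th i) \<longrightarrow>
   norm (F et) <= A ^ card S' * norm (F th) \<and>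
   norm (F et - F th) <= (\<Sum>i\<in>S'. \<bar>et i - th i\<bar>) * (M * A ^ card S' * norm (F th))"
  if "finite S'" for S'
  using that
 proof (induction S')
  case empty
  show ?case
  proof (intro ballI impI)
   fix et assume "\<forall>i. i \<notin> {} \<longrightarrow> et i = th i"
   then have "et = th" by auto
   then show "norm (F et) <= A ^ card ({}::nat set) * norm (F th) \<and>
    norm (F et - F th) <= (\<Sum>i\<in>{}. \<bar>et i - th i\<bar>) * (M * A ^ card ({}::nat set) * norm (F th))" by simp
  qed
 next
  case (insert j S')
  show ?case
  proof (intro ballI impI)
   fix et assume et: "et \<in> coord_box S th \<delta>" and off: "\<forall>i. i \<notin> insert j S' \<longrightarrow> et i = th i"
   have j: "j \<in> S" using insert by auto
   define et' where "et' = et(j := th j)"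
   have et': "et' \<in> coord_box S th \<delta>" unfolding et'_def by (rule coord_box_fun_upd[OF et j]) (use assms in auto)
   have off': "\<forall>i. i \<notin> S' \<longrightarrow> et' i = th i" using off by (auto simp: et'_def)
   have IH: "norm (F et') <= A ^ card S' * norm (F th)"
     "norm (F et' - F th) <= (\<Sum>i\<in>S'. \<bar>et' i - th i\<bar>) * (M * A ^ card S' * norm (F th))"
    using insert.IH insert.prems et' off' by auto
   have sum_eq: "(\<Sum>i\<in>S'. \<bar>et' i - th i\<bar>) = (\<Sum>i\<in>S'. \<bar>et i - th i\<bar>)"
    using insert.hyps by (intro sum.cong) (auto simp: et'_def)
   have etj: "\<bar>et j - th j\<bar> < \<delta>" using et j by (auto simp: coord_box_def)
   have card: "card (insert j S') = Suc (card S')" using insert.hyps by simp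
   have m1: "norm (F et) <= A * norm (F et')" and
    m2: "norm (F et - F et') <= M * A * norm (F et') * \<bar>et j - th j\<bar>"
    using move[OF et j etj] by (simp_all add: et'_def)
   have "norm (F et) <= A * (A ^ card S' * norm (F th))"
    using m1 IH(1) A1 by (meson mult_left_mono order_trans zero_le_one)
   moreover have "norm (F et - F th) \<le>
     (\<Sum>i\<in>insert j S'. \<bar>et i - th i\<bar>) * (M * A ^ card (insert j S') * norm (F th))"
   proof -
    have "M * A * norm (F et') * \<bar>et j - th j\<bar> <= M * A * (A ^ card S' * norm (F th)) * \<bar>et j - th j\<bar>"
     using IH(1) A1 \<open>M >= 0\<close> by (intro mult_left_mono mult_right_mono) auto
    then have 1: "norm (F et - F et') <= \<bar>et j - th j\<bar> * (M * A ^ card (insert j S') * norm (F th))"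
     using m2 by (simp add: card mult_ac)
    have "A ^ card S' <= A ^ card (insert j S')" unfolding card using A1 by (intro power_increasing) auto
    then have "(\<Sum>i\<in>S'. \<bar>et i - th i\<bar>) * (M * A ^ card S' * norm (F th)) \<le>
      (\<Sum>i\<in>S'. \<bar>et i - th i\<bar>) * (M * A ^ card (insert j S') * norm (F th))"
     using \<open>M >= 0\<close> by (intro mult_left_mono mult_right_mono sum_nonneg) auto
    with IH(2) sum_eq have 2: "norm (F et' - F th) \<le>
      (\<Sum>i\<in>S'. \<bar>et i - th i\<bar>) * (M * A ^ card (insert j S') * norm (F th))" by simp
    have "norm (F et - F th) <= norm (F et - F et') + norm (F et' - F th)"
     using norm_triangle_ineq[of "F et - F et'" "F et' - F th"] by simp
    then show ?thesis using 1 2 insert.hyps by (simp add: distrib_right)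
   qed
   ultimately show "norm (F et) <= A ^ card (insert j S') * norm (F th) \<and> norm (F et - F th) \<le>
     (\<Sum>i\<in>insert j S'. \<bar>et i - th i\<bar>) * (M * A ^ card (insert j S') * norm (F th))"
    by (simp add: card mult_ac)
  qed
 qed
 show ?thesis
 proof (rule that)
  show "0 <= M * A ^ card S * norm (F th)" using A1 \<open>M >= 0\<close> by simp
  show "norm (F et - F th) <= (M * A ^ card S * norm (F th)) * (\<Sum>i\<in>S. \<bar>et i - th i\<bar>)"
   if "et \<in> coord_box S th \<delta>" for et
   using main[OF fin order_refl] that by (auto simp: coord_box_def mult_ac)
 qed
qed

text \<open>Joint continuity upgrades partial derivatives to derivatives in all directions: the increment is a sum of
 increments in single coordinates, whose slopes are close to those at the base point.\<close>

lemma partials_imp_line_derivative: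
 fixes F :: "(nat => real) => 'a::real_inner"
 assumes "finite S" and "\<delta> > 0"
  and der: "\<And>et i. et \<in> coord_box S th \<delta> ==> i \<in> S ==>
   ((\<lambda>r. F (et(i := r))) has_vector_derivative G i et) (at (et i))"
  and cont: "\<And>i \<epsilon>. i \<in> S ==> \<epsilon> > 0 ==>
   \<exists>\<delta>'>0. \<forall>et\<in>coord_box S th \<delta>'. norm (G i et - G i th) <= \<epsilon>"
 shows "((\<lambda>t. F (shift S th d t)) has_vector_derivative (\<Sum>i\<in>S. d i *\<^sub>R G i th)) (at 0)"
proof -
 have "S' \<subseteq> S ==>
   ((\<lambda>t. F (shift S' th d t)) has_vector_derivative (\<Sum>i\<in>S'. d i *\<^sub>R G i th)) (at 0)"
  if "finite S'" for S'
  using that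
 proof (induction S')
  case empty
  show ?case by (simp add: shift_def)
 next
  case (insert j S')
  then have j: "j \<in> S" and S': "S' \<subseteq> S" by auto
  define D where "D = (\<lambda>t. F (shift (insert j S') th d t) - F (shift S' th d t))"
  have "(D has_vector_derivative d j *\<^sub>R G j th) (at 0)"
   unfolding has_vector_derivative_def
  proof -
   show "(D has_derivative (\<lambda>x. x *\<^sub>R d j *\<^sub>R G j th)) (at 0)"
    unfolding has_derivative_at_alt
   proof (intro conjI allI impI bounded_linear_scaleR_left)
    fix e :: real assume "e > 0"
    define e' where "e' = e / (\<bar>d j\<bar> + 1)"
    have e': "e' > 0" "\<bar>d j\<bar> * e' <= e" using \<open>e > 0\<close> by (auto simp: e'_def field_simps)
    obtain \<delta>' where \<delta>': "\<delta>' > 0" "\<And>et. et \<in> coord_box S th \<delta>' ==> norm (G j et - G j th) <= e'"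
     using cont[OF j e'(1)] by auto
    define m where "m = Max (insert 1 ((\<lambda>i. \<bar>d i\<bar>) ` S)) "
    have m: "m >= 1" "\<And>i. i \<in> S ==> \<bar>d i\<bar> <= m" using assms(1) by (auto simp: m_def)
    define \<delta>'' where "\<delta>'' = min \<delta> \<delta>' / m"
    have "norm (D t - D 0 - (t - 0) *\<^sub>R d j *\<^sub>R G j th) <= e * norm (t - 0)" if t: "\<bar>t\<bar> < \<delta>''" for t
    proof -
     have tm: "\<bar>t\<bar> * m < min \<delta> \<delta>'" using t m(1) by (simp add: \<delta>''_def field_simps)
     define q where "q = (\<lambda>s. (shift S' th d t)(j := th j + s * (t * d j)))"
     have tdi: "\<bar>t * d i\<bar> < min \<delta> \<delta>'" if "i \<in> S" for i
      using mult_left_mono[OF m(2)[OF that], of "\<bar>t\<bar>"] tm by (simp add: abs_mult)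
     have q: "q s \<in> coord_box S th (min \<delta> \<delta>')" if "s \<in> {0..1}" for s
     proof -
      have "\<bar>s * (t * d j)\<bar> <= 1 * \<bar>t * d j\<bar>"
       unfolding abs_mult[of s] using that by (intro mult_right_mono) auto
      then have "\<bar>s * (t * d j)\<bar> < min \<delta> \<delta>'" using tdi[OF j] by linarith
      then show ?thesis using tdi S' \<delta>'(1) assms(2) j
       by (auto simp: q_def coord_box_def shift_def)
     qed
     have q1: "q s \<in> coord_box S th \<delta>" and q2: "q s \<in> coord_box S th \<delta>'" if "s \<in> {0..1}" for s
      using q[OF that] by (auto simp: coord_box_def)
     define X where "X = (\<lambda>s. F (q s) - s *\<^sub>R (t * d j) *\<^sub>R G j th)"
     have "norm (X 1 - X 0) <= \<bar>t * d j\<bar> * e'"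
     proof (rule norm_increment_le)
      fix s :: real assume s: "s \<in> {0..1}"
      have 1: "((\<lambda>x. F ((q s)(j := x))) has_vector_derivative G j (q s))
        (at (th j + s * (t * d j)))"
       using der[OF q1[OF s] j] by (simp add: q_def)
      have 2: "((\<lambda>s. th j + s * (t * d j)) has_vector_derivative (t * d j)) (at s)"
       by (auto intro!: derivative_eq_intros)
      have "(((\<lambda>x. F ((q s)(j := x))) \<circ> (\<lambda>s. th j + s * (t * d j)))
        has_vector_derivative (t * d j) *\<^sub>R G j (q s)) (at s)"
       using vector_diff_chain_at[OF 2 1] .
      then have 3: "((\<lambda>s. F (q s)) has_vector_derivative (t * d j) *\<^sub>R G j (q s)) (at s)"
       by (simp add: o_def q_def)
      have 4: "((\<lambda>s. s *\<^sub>R (t * d j) *\<^sub>R G j th) has_vector_derivative (t * d j) *\<^sub>R G j th) (at s)"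
       by (auto intro!: derivative_eq_intros)
      have "(X has_vector_derivative ((t * d j) *\<^sub>R G j (q s) - (t * d j) *\<^sub>R G j th)) (at s)"
       unfolding X_def by (rule has_vector_derivative_diff[OF 3 4])
      then show "(X has_vector_derivative ((t * d j) *\<^sub>R (G j (q s) - G j th))) (at s within {0..1})"
       by (simp add: scaleR_diff_right has_vector_derivative_at_within)
      show "norm ((t * d j) *\<^sub>R (G j (q s) - G j th)) <= \<bar>t * d j\<bar> * e'"
       using mult_left_mono[OF \<delta>'(2)[OF q2[OF s]], of "\<bar>t * d j\<bar>"] by simp
     qed
     also have "X 1 - X 0 = D t - D 0 - (t - 0) *\<^sub>R d j *\<^sub>R G j th"
     proof -
      have "q 1 = shift (insert j S') th d t" "q 0 = shift S' th d t"
       using insert.hyps by (auto simp: q_def shift_def)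
      moreover have "shift A th d 0 = th" for A by (auto simp: shift_def)
      then have "D 0 = 0" by (simp add: D_def)
      ultimately show ?thesis by (simp add: X_def D_def)
     qed
     also have "\<bar>t * d j\<bar> * e' <= e * norm (t - 0)"
      using mult_left_mono[OF e'(2), of "\<bar>t\<bar>"] by (simp add: abs_mult mult_ac)
     finally show ?thesis .
    qed
    moreover have "\<delta>'' > 0" using \<delta>'(1) assms(2) m(1) by (simp add: \<delta>''_def)
    ultimately show "\<exists>a>0. \<forall>t. norm (t - 0) < a \<longrightarrow>
      norm (D t - D 0 - (t - 0) *\<^sub>R d j *\<^sub>R G j th) <= e * norm (t - 0)"
     by auto
   qed
  qed
  from has_vector_derivative_add[OF this insert.IH[OF S']] show ?case
   using insert.hyps by (simp add: D_def)
 qed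
 from this[OF assms(1)] show ?thesis by simp
qed

section \<open>The differential equation of the quadratic form\<close>

definition pairs :: "nat => (nat \<times> nat) set" where
 "pairs N = {(i, j). i \<in> {1..N} \<and> j \<in> {1..N} \<and> i ~= j}"

lemma finite_pairs [simp, intro]: "finite (pairs N)"
 by (rule finite_subset[of _ "{1..N} \<times> {1..N}"]) (auto simp: pairs_def)

definition unit_vec :: "nat => nat => real" where
 "unit_vec i = (\<lambda>k. if k = i then 1 else 0)"

text \<open>The commutator carries the part of the coefficient that does not depend on the angles, the
 anticommutator the cotangent that is singular where two coordinates meet.\<close>

definition brk :: "real => real => complex^'t^'t => complex^'t^'t => complex^'t^'t" where
 "brk c e t X = mscale (of_real c * \<i>) (X ** t - t ** X) + e *\<^sub>R (X ** t + t ** X)"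

definition pt :: "nat => (nat => real) => nat => complex" where
 "pt N th = (\<lambda>i\<in>{1..N}. cis (th i))"

definition regular :: "nat => (nat => real) => bool" where
 "regular N th \<longleftrightarrow> (\<forall>(i, j)\<in>pairs N. sin ((th i - th j) / 2) ~= 0)"

lemma regularD: "regular N th ==> (i, j) \<in> pairs N ==> sin ((th i - th j) / 2) ~= 0"
 by (auto simp: regular_def)

lemma brk_linear:
 "brk c e t (X + Y) = brk c e t X + brk c e t Y"
 "brk c e t (X - Y) = brk c e t X - brk c e t Y"
 "brk c e t (r *\<^sub>R X) = r *\<^sub>R brk c e t X"
 "brk (c + c') (e + e') t X = brk c e t X + brk c' e' t X"
 "brk (c - c') (e - e') t X = brk c e t X - brk c' e' t X"
 "brk (r * c) (r * e) t X = r *\<^sub>R brk c e t X"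
proof -
 have 1: "mscale (of_real (r * c) * \<i>) A = r *\<^sub>R mscale (of_real c * \<i>) A" for A :: "complex^'t^'t"
  unfolding mscale_of_real[symmetric] mscale_simps(11) by (simp add: mult.assoc)
 show "brk c e t (X + Y) = brk c e t X + brk c e t Y"
  "brk c e t (X - Y) = brk c e t X - brk c e t Y"
  by (simp_all add: brk_def mscale_simps(1,2) mm.add_left mm.add_right mm.diff_left mm.diff_right
   scaleR_add_right scaleR_diff_right)
 show "brk c e t (r *\<^sub>R X) = r *\<^sub>R brk c e t X"
  by (simp add: brk_def mscale_simps(2,10) mm.scaleR_left mm.scaleR_right
   scaleR_add_right scaleR_diff_right mult.commute)
 show "brk (c + c') (e + e') t X = brk c e t X + brk c' e' t X"
  by (simp add: brk_def mscale_simps(4) distrib_right scaleR_add_left)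
 show "brk (c - c') (e - e') t X = brk c e t X - brk c' e' t X"
  by (simp add: brk_def mscale_simps(5) left_diff_distrib scaleR_diff_left)
 show "brk (r * c) (r * e) t X = r *\<^sub>R brk c e t X"
  unfolding brk_def 1 by (simp add: scaleR_add_right)
qed

lemma norm_brk_le:
 fixes t X :: "complex^'t^'t"
 assumes "adj t ** t = mat 1" "t ** adj t = mat 1"
 shows "norm (brk c e t X) <= 2 * (\<bar>c\<bar> + \<bar>e\<bar>) * norm X"
proof -
 have Xt: "norm (X ** t) = norm X" "norm (t ** X) = norm X"
  using assms by (simp_all add: norm_unitary_left norm_unitary_right)
 have "norm (brk c e t X) <= \<bar>c\<bar> * norm (X ** t - t ** X) + \<bar>e\<bar> * norm (X ** t + t ** X)"
  unfolding brk_def by (rule norm_triangle_le) (simp add: norm_mscale norm_mult)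
 also have "\<dots> <= \<bar>c\<bar> * (norm X + norm X) + \<bar>e\<bar> * (norm X + norm X)"
  by (intro add_mono mult_left_mono norm_triangle_le_diff norm_triangle_le) (simp_all add: Xt)
 finally show ?thesis by (simp add: algebra_simps)
qed

lemma brk_conj:
 fixes t X U :: "complex^'t^'t"
 assumes "adj U ** U = mat 1"
 shows "U ** brk c e t X ** adj U = brk c e (U ** t ** adj U) (U ** X ** adj U)"
proof -
 have m: "U ** A ** adj U ** (U ** B ** adj U) = U ** (A ** B) ** adj U" for A B
  by (metis assms matrix_mul_assoc matrix_mul_rid)
 show ?thesis unfolding brk_def m
  by (simp add: mscale_simps mm.add_left mm.add_right mm.diff_left mm.diff_right
   mm.scaleR_left mm.scaleR_right)
qed

lemma cot_plus_pi: "cot (x + pi) = cot (x :: real)" "cot (x - pi) = cot x"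
 by (simp_all add: cot_def)

lemma cis_quotient:
 assumes "sin ((a - b) / 2) ~= 0"
 shows "\<i> * cis a / (cis a - cis b) = of_real (cot ((a - b) / 2) / 2) + \<i> / 2"
proof -
 define h m where "h = (a - b) / 2" and "m = (a + b) / 2"
 have "cis a = cis m * cis h" "cis b = cis m * cis (- h)"
  by (simp_all add: cis_mult h_def m_def field_simps)
 moreover have diff: "cis h - cis (- h) = 2 * \<i> * of_real (sin h)"
  by (simp add: complex_eq_iff)
 ultimately have "cis a - cis b = cis m * (2 * \<i> * of_real (sin h))"
  by (simp flip: diff add: algebra_simps)
 then have "\<i> * cis a / (cis a - cis b) = cis h / (2 * of_real (sin h))"
  using \<open>cis a = cis m * cis h\<close> by simp
 also have "\<dots> = of_real (cot h / 2) + \<i> / 2"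
  using assms by (simp add: h_def[symmetric] cot_def complex_eq_iff Re_divide Im_divide power2_eq_square)
 finally show ?thesis by (simp add: h_def)
qed

lemma cis_neq:
 assumes "sin ((a - b) / 2) ~= 0"
 shows "cis a ~= cis b"
proof
 assume "cis a = cis b"
 then have "cis (a - b) = 1" by (simp flip: cis_divide)
 moreover define h where "h = (a - b) / 2"
 then have "a - b = 2 * h" by simp
 ultimately have "cos (2 * h) = 1" by (metis cis.sel(1) one_complex.sel(1))
 then show False using assms cos_double_sin[of h] by (simp add: h_def)
qed

text \<open>\<open>gen d th\<close> is the generator of the equation satisfied by \<open>L\<^sup>* H L\<close> along the line through
 \<open>th\<close> with direction \<open>d\<close>. The sum over ordered pairs counts every reflection twice; this keeps the
 action of permutations a mere reindexing.\<close>

locale torus_rep =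
 fixes N :: nat and \<kappa> :: real and \<tau> :: "(nat => nat) => complex^'t^'t"
 assumes N3: "N >= 3"
  and \<tau>_id: "\<tau> id = mat 1"
  and \<tau>_comp: "v permutes {1..N} ==> w permutes {1..N} ==> \<tau> (v \<circ> w) = \<tau> v ** \<tau> w"
  and \<tau>_unitary: "w permutes {1..N} ==> adj (\<tau> w) ** \<tau> w = mat 1"
  and \<tau>_central: "\<exists>c. (\<Sum>(i, j)\<in>pairs N. \<tau> (Transposition.transpose i j)) = mat c"
begin

abbreviation refl :: "nat => nat => complex^'t^'t" where
 "refl i j \<equiv> \<tau> (Transposition.transpose i j)"

definition gen :: "(nat => real) => (nat => real) => complex^'t^'t => complex^'t^'t" where
 "gen d th X = (\<Sum>(i, j)\<in>pairs N.
   brk (\<kappa> * (d i + d j) / 4) (\<kappa> * (d i - d j) / 4 * cot ((th i - th j) / 2)) (refl i j) X)"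

definition gen_bound :: "(nat => real) => (nat => real) => real" where
 "gen_bound d th = (\<Sum>(i, j)\<in>pairs N.
   \<bar>\<kappa>\<bar> / 2 * (\<bar>d i + d j\<bar> + \<bar>d i - d j\<bar> * \<bar>cot ((th i - th j) / 2)\<bar>))"

lemma \<tau>_unitary': "w permutes {1..N} ==> \<tau> w ** adj (\<tau> w) = mat 1"
 using \<tau>_unitary matrix_left_right_inverse by blast

lemma \<tau>_inv: "w permutes {1..N} ==> \<tau> (inv w) = adj (\<tau> w)"
proof -
 assume w: "w permutes {1..N}"
 have "\<tau> w ** \<tau> (inv w) = mat 1"
  using \<tau>_comp[OF w permutes_inv[OF w]] by (simp add: permutes_inv_o[OF w] \<tau>_id)
 then have "adj (\<tau> w) = adj (\<tau> w) ** \<tau> w ** \<tau> (inv w)"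
  by (simp flip: matrix_mul_assoc)
 then show ?thesis using \<tau>_unitary[OF w] by simp
qed

lemma norm_\<tau>_conj: "w permutes {1..N} ==> norm (adj (\<tau> w) ** X ** \<tau> w) = norm X"
 by (simp add: norm_unitary_left norm_unitary_right \<tau>_unitary \<tau>_unitary' adj_simps)

lemma transpose_permutes: "(i, j) \<in> pairs N ==> Transposition.transpose i j permutes {1..N}"
 by (auto simp: pairs_def intro!: permutes_swap_id)

lemma refl_hermitian: "(i, j) \<in> pairs N ==> adj (refl i j) = refl i j"
 using \<tau>_inv[OF transpose_permutes, of i j] by simp

lemma refl_refl: "(i, j) \<in> pairs N ==> refl i j ** refl i j = mat 1"
 using \<tau>_unitary[OF transpose_permutes, of i j] refl_hermitian[of i j] by simp

lemma refl_unitary: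
 "(i, j) \<in> pairs N ==> adj (refl i j) ** refl i j = mat 1"
 "(i, j) \<in> pairs N ==> refl i j ** adj (refl i j) = mat 1"
 by (simp_all add: refl_hermitian refl_refl)

lemma refl_conj:
 assumes w: "w permutes {1..N}" and ij: "(i, j) \<in> pairs N"
 shows "\<tau> w ** refl i j ** adj (\<tau> w) = refl (w i) (w j)"
proof -
 have "w \<circ> Transposition.transpose i j \<circ> inv w = Transposition.transpose (w i) (w j)"
 proof
  fix k
  have "k = w (inv w k)" using permutes_inverses(1)[OF w] by simp
  then show "(w \<circ> Transposition.transpose i j \<circ> inv w) k = Transposition.transpose (w i) (w j) k"
   using inj_eq[OF permutes_inj[OF w]] permutes_inverses[OF w]
   by (auto simp: Transposition.transpose_def)
 qed
 then have "refl (w i) (w j) = \<tau> (w \<circ> Transposition.transpose i j) ** \<tau> (inv w)"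
  using \<tau>_comp[OF permutes_compose[OF transpose_permutes[OF ij] w] permutes_inv[OF w]] by simp
 then show ?thesis using \<tau>_comp[OF w transpose_permutes[OF ij]] \<tau>_inv[OF w] by simp
qed

lemma gen_linear:
 "gen d th (X + Y) = gen d th X + gen d th Y"
 "gen d th (X - Y) = gen d th X - gen d th Y"
 "gen d th (r *\<^sub>R X) = r *\<^sub>R gen d th X"
 by (simp_all add: gen_def brk_linear sum.distrib sum_subtractf scaleR_sum_right split_def)

lemma norm_gen_le: "norm (gen d th X) <= gen_bound d th * norm X"
proof -
 have "norm (gen d th X) <= (\<Sum>(i, j)\<in>pairs N. 2 * (\<bar>\<kappa> * (d i + d j) / 4\<bar>
   + \<bar>\<kappa> * (d i - d j) / 4 * cot ((th i - th j) / 2)\<bar>) * norm X)"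
  unfolding gen_def
  by (rule sum_norm_le, unfold split_paired_all prod.case) (rule norm_brk_le; erule refl_unitary)
 also have "\<dots> = gen_bound d th * norm X"
  unfolding gen_bound_def sum_distrib_right
 proof (intro sum.cong refl, clarify)
  fix a b
  show "2 * (\<bar>\<kappa> * (d a + d b) / 4\<bar> + \<bar>\<kappa> * (d a - d b) / 4 * cot ((th a - th b) / 2)\<bar>) * norm X =
   \<bar>\<kappa>\<bar> / 2 * (\<bar>d a + d b\<bar> + \<bar>d a - d b\<bar> * \<bar>cot ((th a - th b) / 2)\<bar>) * norm X"
   by (simp only: abs_mult abs_divide) (simp add: algebra_simps)
 qed
 finally show ?thesis .
qed

lemma norm_gen_diff_le:
 "norm (gen d th X - gen d th' X) <= (\<Sum>(i, j)\<in>pairs N.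
   \<bar>\<kappa>\<bar> / 2 * (\<bar>d i - d j\<bar> * \<bar>cot ((th i - th j) / 2) - cot ((th' i - th' j) / 2)\<bar>)) * norm X"
proof -
 have diff: "gen d th X - gen d th' X = (\<Sum>(i, j)\<in>pairs N. brk 0
   (\<kappa> * (d i - d j) / 4 * (cot ((th i - th j) / 2) - cot ((th' i - th' j) / 2))) (refl i j) X)"
  unfolding gen_def sum_subtractf[symmetric]
  by (intro sum.cong) (auto simp: right_diff_distrib brk_linear(5)[symmetric])
 have "norm (gen d th X - gen d th' X) <= (\<Sum>(i, j)\<in>pairs N. 2 * (\<bar>0\<bar> + \<bar>\<kappa> * (d i - d j) / 4 *
   (cot ((th i - th j) / 2) - cot ((th' i - th' j) / 2))\<bar>) * norm X)"
  unfolding diff by (rule sum_norm_le, unfold split_paired_all prod.case)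
   (rule norm_brk_le; erule refl_unitary)
 also have "\<dots> = (\<Sum>(i, j)\<in>pairs N.
   \<bar>\<kappa>\<bar> / 2 * (\<bar>d i - d j\<bar> * \<bar>cot ((th i - th j) / 2) - cot ((th' i - th' j) / 2)\<bar>)) * norm X"
  unfolding sum_distrib_right
 proof (intro sum.cong refl, clarify)
  fix a b
  define y where "y = cot ((th a - th b) / 2) - cot ((th' a - th' b) / 2)"
  show "2 * (\<bar>0\<bar> + \<bar>\<kappa> * (d a - d b) / 4 * (cot ((th a - th b) / 2) - cot ((th' a - th' b) / 2))\<bar>) * norm X =
   \<bar>\<kappa>\<bar> / 2 * (\<bar>d a - d b\<bar> * \<bar>cot ((th a - th b) / 2) - cot ((th' a - th' b) / 2)\<bar>) * norm X"
   unfolding y_def[symmetric] by (simp only: abs_mult abs_divide) simp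
 qed
 finally show ?thesis .
qed

text \<open>Conjugation by a permutation only relabels the reflections. The angles may jump by a full turn, as they
 do when the coordinates are rotated cyclically: the cotangent of the half angle has period \<open>2 \<pi>\<close>.\<close>

lemma gen_conj:
 assumes w: "w permutes {1..N}"
  and d: "\<And>i. i \<in> {1..N} ==> d' (w i) = d i"
  and th: "\<And>i. i \<in> {1..N} ==> th' (w i) = th i \<or> th' (w i) = th i - 2 * pi"
 shows "\<tau> w ** gen d th X ** adj (\<tau> w) = gen d' th' (\<tau> w ** X ** adj (\<tau> w))"
proof -
 have bij: "bij_betw (\<lambda>(i, j). (w i, w j)) (pairs N) (pairs N)"
  by (rule bij_betwI[where g = "\<lambda>(i, j). (inv w i, inv w j)"])
   (use w permutes_inv[OF w] in \<open>auto simp: pairs_def permutes_inverses permutes_in_image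
    permutes_inv_eq inj_eq[OF permutes_inj] simp del: atLeastAtMost_iff\<close>)
 have cot: "cot ((th' (w i) - th' (w j)) / 2) = cot ((th i - th j) / 2)" if "(i, j) \<in> pairs N" for i j
 proof -
  define x where "x = (th i - th j) / 2"
  have "th' (w i) - th' (w j) \<in> {2 * x, 2 * (x + pi), 2 * (x - pi)}"
   using th[of i] th[of j] that by (auto simp: pairs_def x_def)
  then have "(th' (w i) - th' (w j)) / 2 \<in> {x, x + pi, x - pi}" by auto
  then have "cot ((th' (w i) - th' (w j)) / 2) = cot x"
   using cot_plus_pi[of x] by (metis empty_iff insert_iff)
  then show ?thesis by (simp add: x_def)
 qed
 have "gen d' th' (\<tau> w ** X ** adj (\<tau> w)) = (\<Sum>(i, j)\<in>pairs N.
   brk (\<kappa> * (d' (w i) + d' (w j)) / 4) (\<kappa> * (d' (w i) - d' (w j)) / 4 * cot ((th' (w i) - th' (w j)) / 2))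
    (refl (w i) (w j)) (\<tau> w ** X ** adj (\<tau> w)))"
  unfolding gen_def by (subst sum.reindex_bij_betw[OF bij, symmetric]) (simp add: split_def)
 also have "\<dots> = (\<Sum>(i, j)\<in>pairs N. \<tau> w **
   brk (\<kappa> * (d i + d j) / 4) (\<kappa> * (d i - d j) / 4 * cot ((th i - th j) / 2)) (refl i j) X ** adj (\<tau> w))"
 proof (intro sum.cong refl, clarify)
  fix i j assume ij: "(i, j) \<in> pairs N"
  then have "d' (w i) = d i" "d' (w j) = d j" using d by (auto simp: pairs_def)
  then show "brk (\<kappa> * (d' (w i) + d' (w j)) / 4)
    (\<kappa> * (d' (w i) - d' (w j)) / 4 * cot ((th' (w i) - th' (w j)) / 2))
    (refl (w i) (w j)) (\<tau> w ** X ** adj (\<tau> w)) =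
   \<tau> w ** brk (\<kappa> * (d i + d j) / 4) (\<kappa> * (d i - d j) / 4 * cot ((th i - th j) / 2)) (refl i j) X ** adj (\<tau> w)"
   by (simp add: brk_conj[OF \<tau>_unitary[OF w]] refl_conj[OF w ij] cot[OF ij])
 qed
 also have "\<dots> = \<tau> w ** gen d th X ** adj (\<tau> w)"
  by (simp add: gen_def mm.sum_left mm.sum_right split_def)
 finally show ?thesis by simp
qed

lemma gen_unit:
 assumes i: "i \<in> {1..N}"
 shows "gen (unit_vec i) th X = (\<Sum>j\<in>{1..N} - {i}.
   brk (\<kappa> / 2) (\<kappa> / 2 * cot ((th i - th j) / 2)) (refl i j) X)"
proof -
 define T where "T = (\<lambda>(a, b). brk (\<kappa> * (unit_vec i a + unit_vec i b) / 4)
   (\<kappa> * (unit_vec i a - unit_vec i b) / 4 * cot ((th a - th b) / 2)) (refl a b) X)"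
 define I where "I = {1..N} - {i}"
 have "gen (unit_vec i) th X = sum T (pairs N)" by (simp add: gen_def T_def)
 also have "\<dots> = sum T ((\<lambda>j. (i, j)) ` I \<union> (\<lambda>j. (j, i)) ` I)"
 proof (rule sum.mono_neutral_right)
  show "(\<lambda>j. (i, j)) ` I \<union> (\<lambda>j. (j, i)) ` I \<subseteq> pairs N"
   using i by (auto simp: pairs_def I_def)
  show "\<forall>p\<in>pairs N - ((\<lambda>j. (i, j)) ` I \<union> (\<lambda>j. (j, i)) ` I). T p = 0"
  proof
   fix p assume p: "p \<in> pairs N - ((\<lambda>j. (i, j)) ` I \<union> (\<lambda>j. (j, i)) ` I)"
   then have "fst p ~= i" "snd p ~= i" by (auto simp: pairs_def I_def)
   then show "T p = 0" by (simp add: T_def split_def unit_vec_def brk_def mscale_simps(8))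
  qed
 qed simp
 also have "\<dots> = sum T ((\<lambda>j. (i, j)) ` I) + sum T ((\<lambda>j. (j, i)) ` I)"
  by (rule sum.union_disjoint) (auto simp: I_def)
 also have "\<dots> = (\<Sum>j\<in>I. T (i, j)) + (\<Sum>j\<in>I. T (j, i))"
  by (simp add: sum.reindex inj_on_def)
 also have "\<dots> = (\<Sum>j\<in>I. T (i, j) + T (j, i))" by (simp add: sum.distrib)
 also have "\<dots> = (\<Sum>j\<in>I. brk (\<kappa> / 2) (\<kappa> / 2 * cot ((th i - th j) / 2)) (refl i j) X)"
 proof (rule sum.cong)
  fix j assume j: "j \<in> I"
  have "cot ((th j - th i) / 2) = - cot ((th i - th j) / 2)"
   using cot_minus[of "(th i - th j) / 2"] by (simp add: minus_divide_left)
  then show "T (i, j) + T (j, i) = brk (\<kappa> / 2) (\<kappa> / 2 * cot ((th i - th j) / 2)) (refl i j) X"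
   using j by (simp add: T_def unit_vec_def I_def transpose_commute brk_linear(4)[symmetric])
 qed simp
 finally show ?thesis by (simp add: I_def)
qed

lemma gen_direction_linear:
 "gen (\<lambda>k. d k + d' k) th X = gen d th X + gen d' th X"
 "gen (\<lambda>k. r * d k) th X = r *\<^sub>R gen d th X"
 "gen (\<lambda>k. 0) th X = 0"
proof -
 show "gen (\<lambda>k. d k + d' k) th X = gen d th X + gen d' th X"
  unfolding gen_def sum.distrib[symmetric]
  by (intro sum.cong) (auto simp: algebra_simps add_divide_distrib diff_divide_distrib simp flip: brk_linear(4))
 show "gen (\<lambda>k. r * d k) th X = r *\<^sub>R gen d th X"
  unfolding gen_def scaleR_sum_right
  by (intro sum.cong) (auto simp: algebra_simps add_divide_distrib diff_divide_distrib simp flip: brk_linear(6))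
 show "gen (\<lambda>k. 0) th X = 0" by (simp add: gen_def brk_def mscale_simps)
qed

lemma gen_cong: 
 assumes "\<And>i. i \<in> {1..N} ==> d i = d' i" "\<And>i. i \<in> {1..N} ==> th i = th' i"
 shows "gen d th X = gen d' th' X"
 unfolding gen_def using assms by (intro sum.cong) (auto simp: pairs_def)

lemma gen_sum_unit:
 assumes "finite S"
 shows "gen (\<lambda>k. if k \<in> S then d k else 0) th X = (\<Sum>i\<in>S. d i *\<^sub>R gen (unit_vec i) th X)"
 using assms
proof (induction S)
 case empty
 then show ?case by (simp add: gen_direction_linear)
next
 case (insert j S)
 have "(\<lambda>k. if k \<in> insert j S then d k else 0) =
   (\<lambda>k. d j * unit_vec j k + (if k \<in> S then d k else 0))"
  using insert.hyps by (auto simp: unit_vec_def)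
 then show ?case
  using insert by (simp add: gen_direction_linear)
qed

text \<open>The scalar part \<open>\<gamma>\<close> of the system cancels in \<open>L\<^sup>* H L\<close>.\<close>

lemma quadratic_partial:
 assumes i: "i \<in> {1..N}" and reg: "regular N th"
  and L: "(L has_vector_derivative mscale (\<i> * pt N th i) (L r ** system_coeff N \<kappa> \<gamma> \<tau> i (pt N th))) (at r)"
 shows "((\<lambda>r. adj (L r) ** H ** L r) has_vector_derivative
  gen (unit_vec i) th (adj (L r) ** H ** L r)) (at r)"
proof -
 define I where "I = {1..N} - {i}"
 define c where "c = (\<lambda>j. \<kappa> / 2 * cot ((th i - th j) / 2))"
 define z where "z = (\<lambda>j. of_real (c j) + of_real (\<kappa> / 2) * \<i>)"
 define g where "g = \<i> * of_real (\<kappa> * \<gamma>)"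
 define Q where "Q = (\<Sum>j\<in>I. mscale (z j) (refl i j)) - mscale g (mat 1)"
 have ij: "(i, j) \<in> pairs N" if "j \<in> I" for j using that i by (auto simp: I_def pairs_def)
 have Q: "mscale (\<i> * pt N th i) (system_coeff N \<kappa> \<gamma> \<tau> i (pt N th)) = Q"
 proof -
  have "\<i> * cis (th i) * of_real \<kappa> * (1 / (cis (th i) - cis (th j))) =
    z j" if "j \<in> I" for j
  proof -
   have "\<i> * cis (th i) * of_real \<kappa> * (1 / (cis (th i) - cis (th j))) =
     of_real \<kappa> * (\<i> * cis (th i) / (cis (th i) - cis (th j)))" by simp
   also have "\<dots> = of_real \<kappa> * (of_real (cot ((th i - th j) / 2) / 2) + \<i> / 2)"
    by (simp only: cis_quotient[OF regularD[OF reg ij[OF that]]])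
   finally show ?thesis by (simp add: c_def z_def algebra_simps)
  qed
  then have "(\<Sum>j\<in>I. mscale (\<i> * cis (th i) * of_real \<kappa> * (1 / (cis (th i) - cis (th j)))) (refl i j)) =
    (\<Sum>j\<in>I. mscale (z j) (refl i j))"
   by (intro sum.cong) auto
  moreover have "pt N th i = cis (th i)" "\<And>j. j \<in> I ==> pt N th j = cis (th j)"
   using i by (auto simp: pt_def I_def)
  moreover have "\<i> * cis (th i) * (of_real \<kappa> * (of_real \<gamma> / cis (th i))) = g"
   by (simp add: g_def)
  ultimately show ?thesis
   unfolding system_coeff_def Q_def I_def[symmetric]
   by (simp add: mscale_simps mscale_sum mult.assoc[symmetric])
 qed
 have der: "(L has_vector_derivative L r ** Q) (at r)"
  using L by (simp add: mscale_simps flip: Q)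
 have dadj: "((\<lambda>r. adj (L r)) has_vector_derivative adj (L r ** Q)) (at r)"
  using bounded_linear.has_vector_derivative[OF bounded_linear_adj der] .
 have "((\<lambda>r. adj (L r) ** H) has_vector_derivative adj (L r ** Q) ** H) (at r)"
  using mm.has_vector_derivative[OF dadj has_vector_derivative_const[of H]] by simp
 from mm.has_vector_derivative[OF this der]
 have D: "((\<lambda>r. adj (L r) ** H ** L r) has_vector_derivative
   adj (L r) ** H ** (L r ** Q) + adj (L r ** Q) ** H ** L r) (at r)" .
 define K where "K = adj (L r) ** H ** L r"
 have "adj (L r) ** H ** (L r ** Q) + adj (L r ** Q) ** H ** L r = K ** Q + adj Q ** K"
  by (simp add: K_def matrix_mul_assoc adj_simps)
 also have "\<dots> = (\<Sum>j\<in>I. brk (\<kappa> / 2) (c j) (refl i j) K)"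
 proof -
  have "K ** mscale (z j) (refl i j) +
    mscale (cnj (z j)) (refl i j) ** K =
    brk (\<kappa> / 2) (c j) (refl i j) K" for j
   unfolding brk_def mscale_of_real[symmetric]
   by (simp add: z_def mscale_simps mm.add_right mm.add_left mm.diff_left mm.diff_right algebra_simps)
  then have "(\<Sum>j\<in>I. brk (\<kappa> / 2) (c j) (refl i j) K) =
    (\<Sum>j\<in>I. K ** mscale (z j) (refl i j) +
    mscale (cnj (z j)) (refl i j) ** K)" by simp
  moreover have "cnj g = - g" by (simp add: g_def)
  then have "adj Q = (\<Sum>j\<in>I. mscale (cnj (z j)) (refl i j))
    + mscale g (mat 1)"
   unfolding Q_def adj_simps adj_sum
   by (simp add: refl_hermitian[OF ij] mscale_simps)
  ultimately show ?thesis unfolding \<open>adj Q = _\<close>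
   by (simp add: Q_def mm.diff_right mm.add_left mm.sum_left mm.sum_right sum.distrib mscale_simps)
 qed
 finally show ?thesis using D gen_unit[OF i] by (simp add: K_def c_def I_def)
qed

end

section \<open>Solutions along lines\<close>

definition chamber :: "nat => (nat => real) set" where
 "chamber N = {th. (\<forall>i\<in>{1..<N}. th i < th (i + 1)) \<and> th N < th 1 + 2 * pi}"

lemma C0_eq: "C0 N = pt N ` chamber N"
 by (auto simp: C0_def pt_def chamber_def)

lemma chamber_less:
 assumes "th \<in> chamber N" "1 <= i" "i < j" "j <= N"
 shows "th i < th j" "th j < th i + 2 * pi"
proof -
 have mono: "i < j ==> 1 <= i ==> j <= N ==> th i < th j" for i j
 proof (induction j)
  case (Suc j)
  have "th j < th (j + 1)" if "1 <= j" using assms(1) Suc.prems that by (auto simp: chamber_def)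
  then show ?case using Suc by (cases "i = j") (auto simp: less_Suc_eq)
 qed simp
 then show "th i < th j" using assms by blast
 have "th 1 <= th i" using mono[of 1 i] assms by (cases "i = 1") auto
 moreover have "th j <= th N" using mono[of j N] assms by (cases "j = N") auto
 ultimately show "th j < th i + 2 * pi" using assms(1) by (auto simp: chamber_def)
qed

lemma chamber_diff:
 assumes "th \<in> chamber N" "(i, j) \<in> pairs N"
 shows "i < j ==> th i - th j \<in> {- 2 * pi<..<0}" "j < i ==> th i - th j \<in> {0<..<2 * pi}"
 using chamber_less[OF assms(1), of i j] chamber_less[OF assms(1), of j i] assms(2)
 by (auto simp: pairs_def)

lemma chamber_regular: "th \<in> chamber N ==> regular N th"
 unfolding regular_def
proof clarify
 fix i j assume th: "th \<in> chamber N" and ij: "(i, j) \<in> pairs N" and 0: "sin ((th i - th j) / 2) = 0"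
 show False
 proof (cases "i < j")
  case True
  have "0 < - ((th i - th j) / 2)" "- ((th i - th j) / 2) < pi"
   using chamber_diff(1)[OF th ij True] by (simp_all add: field_simps)
  then have "sin (- ((th i - th j) / 2)) > 0" by (rule sin_gt_zero)
  then show False using 0 unfolding sin_minus by simp
 next
  case False
  then have "j < i" using ij by (auto simp: pairs_def)
  have "sin ((th i - th j) / 2) > 0"
   using chamber_diff(2)[OF th ij \<open>j < i\<close>] by (intro sin_gt_zero) auto
  then show False using 0 by simp
 qed
qed

lemma chamber_box:
 assumes "th \<in> chamber N" "N >= 1"
 shows "\<exists>\<delta>>0. \<forall>et. (\<forall>i\<in>{1..N}. \<bar>et i - th i\<bar> < \<delta>) \<longrightarrow> et \<in> chamber N"
proof -
 define G where "G = insert (th 1 + 2 * pi - th N) ((\<lambda>i. th (i + 1) - th i) ` {1..<N})"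
 define \<delta> where "\<delta> = Min G / 2"
 have G: "finite G" "G ~= {}" "\<And>g. g \<in> G ==> g > 0"
  using assms(1) by (auto simp: G_def chamber_def)
 have Min: "Min G > 0" using G by (simp add: Min_gr_iff)
 then have "\<delta> > 0" by (simp add: \<delta>_def)
 moreover have "et \<in> chamber N" if et: "\<forall>i\<in>{1..N}. \<bar>et i - th i\<bar> < \<delta>" for et
  unfolding chamber_def
 proof (intro CollectI conjI ballI)
  fix i assume i: "i \<in> {1..<N}"
  then have "th (i + 1) - th i >= 2 * \<delta>"
   using Min_le[OF G(1), of "th (i + 1) - th i"] by (auto simp: \<delta>_def G_def)
  then show "et i < et (i + 1)"
   using et[rule_format, of i] et[rule_format, of "i + 1"] i by auto
 next
  have "th 1 + 2 * pi - th N >= 2 * \<delta>"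
   using Min_le[OF G(1), of "th 1 + 2 * pi - th N"] by (auto simp: \<delta>_def G_def)
  then show "et N < et 1 + 2 * pi"
   using et[rule_format, of 1] et[rule_format, of N] assms(2) by auto
 qed
 ultimately show ?thesis by blast
qed

lemma chamber_convex:
 assumes "th \<in> chamber N" "th' \<in> chamber N" "t \<in> {0..1}"
 shows "(\<lambda>i. th i + t * (th' i - th i)) \<in> chamber N"
proof -
 have conv: "a + t * (a' - a) < b + t * (b' - b)" if "a < b" "a' < b'" for a b a' b' :: real
 proof -
  have "(1 - t) * a + t * a' < (1 - t) * b + t * b'"
  proof (cases "t = 0")
   case False
   then have "t * a' < t * b'" using that assms(3) by simp
   moreover have "(1 - t) * a <= (1 - t) * b" using that assms(3) by (intro mult_left_mono) auto
   ultimately show ?thesis by linarith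
  qed (use that in simp)
  then show ?thesis by (simp add: algebra_simps)
 qed
 have "th N + t * (th' N - th N) < th 1 + 2 * pi + t * (th' 1 + 2 * pi - (th 1 + 2 * pi))"
  using assms by (intro conv) (auto simp: chamber_def)
 then show ?thesis using assms by (auto simp: chamber_def intro!: conv)
qed

definition rot_angles :: "nat => (nat => real) => nat => real" where
 "rot_angles N th = (\<lambda>i. if i = N then th 1 + 2 * pi else th (i + 1))"

lemma rot_angles_chamber:
 assumes "th \<in> chamber N" "N >= 2"
 shows "rot_angles N th \<in> chamber N"
 using assms chamber_less[OF assms(1), of 1 2] by (auto simp: chamber_def rot_angles_def numeral_2_eq_2)

lemma w0_permutes: "N >= 1 ==> w0 N permutes {1..N}"
proof (rule bij_imp_permutes)
 assume "N >= 1"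
 then show "bij_betw (w0 N) {1..N} {1..N}"
  by (intro bij_betwI[where g = "\<lambda>i. if i = 1 then N else i - 1"]) (auto simp: w0_def)
qed (auto simp: w0_def)

lemma pt_rot_angles: "N >= 1 ==> pt N (rot_angles N th) = pt N th \<circ> w0 N"
 by (auto simp: fun_eq_iff pt_def rot_angles_def w0_def restrict_def cis_mult[symmetric])

definition regular_angles :: "nat => nat => real" where
 "regular_angles N = (\<lambda>i. 2 * pi * real (i - 1) / real N)"

lemma x0_eq: "x0 N = pt N (regular_angles N)"
proof -
 have "omega N ^ (i - 1) = cis (regular_angles N i)" for i
  using Complex.DeMoivre[of "2 * pi / real N" "i - 1"] by (simp add: omega_def regular_angles_def mult_ac)
 then show ?thesis by (simp add: x0_def pt_def restrict_def)
qed

lemma regular_angles_chamber: "N >= 1 ==> regular_angles N \<in> chamber N"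
 by (auto simp: regular_angles_def chamber_def of_nat_diff field_simps)

context torus_rep
begin

lemma gen_continuous:
 assumes reg: "regular N th" and "\<epsilon> > 0"
 shows "\<exists>\<delta>>0. \<forall>et. (\<forall>i\<in>{1..N}. \<bar>et i - th i\<bar> < \<delta>) \<longrightarrow>
  (\<forall>X. norm (gen d et X - gen d th X) <= \<epsilon> * norm X)"
proof -
 define M where "M = 1 + (\<Sum>(i, j)\<in>pairs N. \<bar>\<kappa>\<bar> / 2 * \<bar>d i - d j\<bar>)"
 have M: "M > 0" unfolding M_def by (intro add_pos_nonneg sum_nonneg) auto
 have "\<forall>p\<in>pairs N. \<forall>\<^sub>F \<delta> in at_right 0. \<forall>et :: nat => real. (\<forall>i\<in>{1..N}. \<bar>et i - th i\<bar> < \<delta>) \<longrightarrow>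
   \<bar>cot ((et (fst p) - et (snd p)) / 2) - cot ((th (fst p) - th (snd p)) / 2)\<bar> < \<epsilon> / M"
 proof
  fix p assume p: "p \<in> pairs N"
  obtain i j where ij: "p = (i, j)" "i \<in> {1..N}" "j \<in> {1..N}" using p by (auto simp: pairs_def)
  have "isCont cot ((th i - th j) / 2)"
   using regularD[OF reg] p ij by (intro isCont_cot) auto
  then obtain s where s: "s > 0" "\<And>y. \<bar>y - (th i - th j) / 2\<bar> < s ==>
    \<bar>cot y - cot ((th i - th j) / 2)\<bar> < \<epsilon> / M"
   using \<open>\<epsilon> > 0\<close> M unfolding continuous_at_eps_delta dist_real_def by (meson divide_pos_pos)
  have "\<bar>cot ((et i - et j) / 2) - cot ((th i - th j) / 2)\<bar> < \<epsilon> / M"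
   if "\<delta> < s" and et: "\<forall>i\<in>{1..N}. \<bar>et i - th i\<bar> < \<delta>" for \<delta> and et :: "nat => real"
  proof (rule s(2))
   have "\<bar>et i - th i\<bar> < s" "\<bar>et j - th j\<bar> < s" using that ij by fastforce+
   moreover have "(et i - et j) / 2 - (th i - th j) / 2 = ((et i - th i) - (et j - th j)) / 2"
    by (simp add: field_simps)
   moreover have "\<bar>(a - b) / 2\<bar> < s" if "\<bar>a\<bar> < s" "\<bar>b\<bar> < s" for a b
    using that abs_triangle_ineq4[of a b] by (simp add: abs_divide)
   ultimately show "\<bar>(et i - et j) / 2 - (th i - th j) / 2\<bar> < s" by presburger
  qed
  then show "\<forall>\<^sub>F \<delta> in at_right 0. \<forall>et :: nat => real. (\<forall>i\<in>{1..N}. \<bar>et i - th i\<bar> < \<delta>) \<longrightarrow>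
   \<bar>cot ((et (fst p) - et (snd p)) / 2) - cot ((th (fst p) - th (snd p)) / 2)\<bar> < \<epsilon> / M"
   unfolding eventually_at_right_field using s(1) ij(1) by (intro exI[of _ s]) auto
 qed
 then have "\<forall>\<^sub>F \<delta> in at_right 0. \<forall>p\<in>pairs N. \<forall>et :: nat => real. (\<forall>i\<in>{1..N}. \<bar>et i - th i\<bar> < \<delta>) \<longrightarrow>
   \<bar>cot ((et (fst p) - et (snd p)) / 2) - cot ((th (fst p) - th (snd p)) / 2)\<bar> < \<epsilon> / M"
  by (simp add: eventually_ball_finite_distrib)
 then obtain b where b: "b > 0" "\<And>\<delta> p et. 0 < \<delta> ==> \<delta> < b ==> p \<in> pairs N ==>
   (\<forall>i\<in>{1..N}. \<bar>et i - th i\<bar> < \<delta>) ==>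
   \<bar>cot ((et (fst p) - et (snd p)) / 2) - cot ((th (fst p) - th (snd p)) / 2)\<bar> < \<epsilon> / M"
  unfolding eventually_at_right_field by blast
 have "norm (gen d et X - gen d th X) <= \<epsilon> * norm X" if et: "\<forall>i\<in>{1..N}. \<bar>et i - th i\<bar> < b / 2" for et X
 proof -
  have "norm (gen d et X - gen d th X) <= (\<Sum>(i, j)\<in>pairs N. \<bar>\<kappa>\<bar> / 2 *
    (\<bar>d i - d j\<bar> * \<bar>cot ((et i - et j) / 2) - cot ((th i - th j) / 2)\<bar>)) * norm X"
   by (rule norm_gen_diff_le)
  also have "\<dots> <= (\<Sum>(i, j)\<in>pairs N. \<bar>\<kappa>\<bar> / 2 * \<bar>d i - d j\<bar> * (\<epsilon> / M)) * norm X"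
  proof (intro mult_right_mono sum_mono, clarify)
   fix i j assume "(i, j) \<in> pairs N"
   from b(2)[OF _ _ this et] have "\<bar>cot ((et i - et j) / 2) - cot ((th i - th j) / 2)\<bar> <= \<epsilon> / M"
    using b(1) by simp
   then show "\<bar>\<kappa>\<bar> / 2 * (\<bar>d i - d j\<bar> * \<bar>cot ((et i - et j) / 2) - cot ((th i - th j) / 2)\<bar>) \<le>
     \<bar>\<kappa>\<bar> / 2 * \<bar>d i - d j\<bar> * (\<epsilon> / M)"
    unfolding mult.assoc by (intro mult_left_mono) auto
  qed auto
  also have "(\<Sum>(i, j)\<in>pairs N. \<bar>\<kappa>\<bar> / 2 * \<bar>d i - d j\<bar> * (\<epsilon> / M)) = (M - 1) * (\<epsilon> / M)"
  proof -
   have "M - 1 = (\<Sum>(i, j)\<in>pairs N. \<bar>\<kappa>\<bar> / 2 * \<bar>d i - d j\<bar>)" by (simp add: M_def)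
   then show ?thesis by (simp only: sum_distrib_right split_def)
  qed
  also have "(M - 1) * (\<epsilon> / M) <= M * (\<epsilon> / M)" using M \<open>\<epsilon> > 0\<close> by (intro mult_right_mono) auto
  also have "M * (\<epsilon> / M) = \<epsilon>" using M by simp
  finally show ?thesis by (simp add: mult_right_mono)
 qed
 then show ?thesis using b(1) by (intro exI[of _ "b / 2"]) auto
qed

text \<open>The equation is required in a whole box, since partial derivatives at a single point say nothing
 about other directions.\<close>

definition solves_at :: "nat set => (nat => real) => ((nat => real) => complex^'t^'t) => bool" where
 "solves_at S th F \<longleftrightarrow> (\<exists>\<delta>>0. \<forall>et\<in>coord_box S th \<delta>. \<forall>i\<in>S.
   ((\<lambda>r. F (et(i := r))) has_vector_derivative gen (unit_vec i) et (F et)) (at (et i)))"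

lemma coord_box_mono: "\<delta> <= \<delta>' ==> coord_box S th \<delta> \<subseteq> coord_box S th \<delta>'"
 by (fastforce simp: coord_box_def)

lemma solves_at_bounds:
 assumes S: "S \<subseteq> {1..N}" and reg: "regular N th" and sol: "solves_at S th F"
 shows "\<exists>\<delta> C. \<delta> > 0 \<and> C >= 0 \<and>
  (\<forall>et\<in>coord_box S th \<delta>. (\<forall>i\<in>S.
    ((\<lambda>r. F (et(i := r))) has_vector_derivative gen (unit_vec i) et (F et)) (at (et i))) \<and>
    norm (F et - F th) <= C * (\<Sum>i\<in>S. \<bar>et i - th i\<bar>))"
proof -
 have fin: "finite S" using S finite_subset by blast
 obtain \<delta>1 where \<delta>1: "\<delta>1 > 0" "\<And>et i. et \<in> coord_box S th \<delta>1 ==> i \<in> S ==>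
   ((\<lambda>r. F (et(i := r))) has_vector_derivative gen (unit_vec i) et (F et)) (at (et i))"
  using sol unfolding solves_at_def by blast
 have "\<forall>i\<in>S. \<exists>\<delta>>0. \<forall>et. (\<forall>i\<in>{1..N}. \<bar>et i - th i\<bar> < \<delta>) \<longrightarrow>
   (\<forall>X. norm (gen (unit_vec i) et X - gen (unit_vec i) th X) <= 1 * norm X)"
  using gen_continuous[OF reg, of 1] by auto
 then obtain D where D: "\<And>i. i \<in> S ==> D i > 0" "\<And>i et X. i \<in> S ==> (\<forall>k\<in>{1..N}. \<bar>et k - th k\<bar> < D i) ==>
   norm (gen (unit_vec i) et X - gen (unit_vec i) th X) <= 1 * norm X"
  by metis
 define \<delta> where "\<delta> = Min (insert \<delta>1 (D ` S))"
 have \<delta>: "\<delta> > 0" "\<delta> <= \<delta>1" "\<And>i. i \<in> S ==> \<delta> <= D i"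
  using fin \<delta>1 D(1) by (auto simp: \<delta>_def)
 define M where "M = (\<Sum>i\<in>S. gen_bound (unit_vec i) th) + 1"
 have gb: "gen_bound (unit_vec i) th >= 0" for i
  unfolding gen_bound_def by (auto intro!: sum_nonneg)
 have der: "((\<lambda>r. F (et(i := r))) has_vector_derivative gen (unit_vec i) et (F et)) (at (et i))"
  if "et \<in> coord_box S th \<delta>" "i \<in> S" for et i
  using \<delta>1(2) that coord_box_mono[OF \<delta>(2)] by blast
 have bound: "norm (gen (unit_vec i) et (F et)) <= M * norm (F et)" if "et \<in> coord_box S th \<delta>" "i \<in> S" for et i
 proof -
  have "\<forall>k\<in>{1..N}. \<bar>et k - th k\<bar> < D i"
  proof
   fix k assume "k \<in> {1..N}"
   show "\<bar>et k - th k\<bar> < D i"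
    using that \<delta>(3)[OF that(2)] D(1)[OF that(2)] by (cases "k \<in> S") (force simp: coord_box_def)+
  qed
  then have "norm (gen (unit_vec i) et (F et) - gen (unit_vec i) th (F et)) <= norm (F et)"
   using D(2)[OF that(2)] by simp
  moreover have "norm (gen (unit_vec i) th (F et)) <= gen_bound (unit_vec i) th * norm (F et)"
   by (rule norm_gen_le)
  moreover have "gen_bound (unit_vec i) th * norm (F et) <= (M - 1) * norm (F et)"
   using gb fin that(2) by (intro mult_right_mono) (auto simp: M_def intro: member_le_sum)
  moreover have "norm (gen (unit_vec i) et (F et)) \<le>
    norm (gen (unit_vec i) et (F et) - gen (unit_vec i) th (F et)) + norm (gen (unit_vec i) th (F et))"
   by (metis diff_add_cancel norm_triangle_ineq)
  ultimately show ?thesis by (simp add: algebra_simps)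
 qed
 have "M >= 0" unfolding M_def using gb by (intro add_nonneg_nonneg sum_nonneg) auto
 from partials_imp_lipschitz[OF fin \<delta>(1) this der bound]
 obtain C where "C >= 0" "\<And>et. et \<in> coord_box S th \<delta> ==> norm (F et - F th) <= C * (\<Sum>i\<in>S. \<bar>et i - th i\<bar>)"
  by metis
 then show ?thesis using \<delta>(1) der by blast
qed

lemma solves_at_line_derivative:
 assumes S: "S \<subseteq> {1..N}" and reg: "regular N th" and sol: "solves_at S th F"
 shows "((\<lambda>t. F (shift S th d t)) has_vector_derivative
  gen (\<lambda>k. if k \<in> S then d k else 0) th (F th)) (at 0)"
proof -
 have fin: "finite S" using S finite_subset by blast
 obtain \<delta> C where \<delta>: "\<delta> > 0" "C >= 0"
  "\<And>et i. et \<in> coord_box S th \<delta> ==> i \<in> S ==>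
    ((\<lambda>r. F (et(i := r))) has_vector_derivative gen (unit_vec i) et (F et)) (at (et i))"
  "\<And>et. et \<in> coord_box S th \<delta> ==> norm (F et - F th) <= C * (\<Sum>i\<in>S. \<bar>et i - th i\<bar>)"
  using solves_at_bounds[OF assms] by blast
 have "((\<lambda>t. F (shift S th d t)) has_vector_derivative
   (\<Sum>i\<in>S. d i *\<^sub>R gen (unit_vec i) th (F th))) (at 0)"
 proof (rule partials_imp_line_derivative[OF fin \<delta>(1) \<delta>(3)])
  fix i and \<epsilon> :: real assume i: "i \<in> S" and \<epsilon>: "\<epsilon> > 0"
  define e1 where "e1 = \<epsilon> / (2 * (norm (F th) + 1))"
  define B where "B = gen_bound (unit_vec i) th"
  have B: "B >= 0" unfolding B_def gen_bound_def by (auto intro!: sum_nonneg)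
  have e1: "e1 > 0" "e1 * (norm (F th) + 1) <= \<epsilon> / 2"
   using \<epsilon> by (auto simp: e1_def divide_simps add_nonneg_pos intro!: divide_pos_pos)
  obtain \<delta>2 where \<delta>2: "\<delta>2 > 0" "\<And>et X. (\<forall>k\<in>{1..N}. \<bar>et k - th k\<bar> < \<delta>2) ==>
    norm (gen (unit_vec i) et X - gen (unit_vec i) th X) <= e1 * norm X"
   using gen_continuous[OF reg e1(1), of "unit_vec i"] by blast
  define e2 where "e2 = min 1 (\<epsilon> / (2 * (B + 1)))"
  have e2: "e2 > 0" "e2 <= 1" "B * e2 <= \<epsilon> / 2"
  proof -
   show "e2 > 0" "e2 <= 1" using B \<epsilon> by (auto simp: e2_def)
   have "B * e2 <= (B + 1) * (\<epsilon> / (2 * (B + 1)))"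
    using B \<epsilon> \<open>e2 > 0\<close> by (intro mult_mono) (auto simp: e2_def)
   also have "(B + 1) * (\<epsilon> / (2 * (B + 1))) = \<epsilon> / 2"
    using B nonzero_mult_div_cancel_left[of "B + 1" "\<epsilon> / 2"] by (simp add: mult_ac)
   finally show "B * e2 <= \<epsilon> / 2" .
  qed
  define c1 where "c1 = real (card S) + 1"
  have c1: "c1 > 0" by (simp add: c1_def)
  define \<delta>3 where "\<delta>3 = min (min \<delta> \<delta>2) (e2 / ((C + 1) * c1))"
  have \<delta>3: "\<delta>3 > 0" using \<delta> \<delta>2 e2 c1 by (auto simp: \<delta>3_def)
  show "\<exists>\<delta>'>0. \<forall>et\<in>coord_box S th \<delta>'. norm (gen (unit_vec i) et (F et) - gen (unit_vec i) th (F th)) <= \<epsilon>"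
  proof (intro exI[of _ \<delta>3] conjI ballI \<delta>3)
   fix et assume et: "et \<in> coord_box S th \<delta>3"
   have "\<delta>3 <= \<delta>" by (simp add: \<delta>3_def)
   then have "et \<in> coord_box S th \<delta>" using et coord_box_mono by blast
   from \<delta>(4)[OF this] have "norm (F et - F th) <= C * (\<Sum>i\<in>S. \<bar>et i - th i\<bar>)" .
   also have "\<dots> <= (C + 1) * (\<Sum>i\<in>S. \<delta>3)"
    using et \<delta>(2) by (intro mult_mono sum_mono) (auto simp: coord_box_def intro: less_imp_le sum_nonneg)
   also have "\<dots> = (C + 1) * (real (card S) * \<delta>3)" by simp
   also have "\<dots> <= (C + 1) * (c1 * (e2 / ((C + 1) * c1)))"
    using \<delta>(2) \<delta>3 by (intro mult_left_mono mult_mono) (auto simp: \<delta>3_def c1_def)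
   also have "\<dots> = e2" using \<delta>(2) c1 by simp
   finally have F: "norm (F et - F th) <= e2" .
   then have F1: "norm (F et) <= norm (F th) + 1"
    using norm_triangle_ineq2[of "F et" "F th"] e2(2) by linarith
   have "\<bar>et k - th k\<bar> < \<delta>2" for k
    using et \<delta>2(1) by (cases "k \<in> S") (auto simp: coord_box_def \<delta>3_def)
   then have "norm (gen (unit_vec i) et (F et) - gen (unit_vec i) th (F et)) <= e1 * norm (F et)"
    using \<delta>2(2) by blast
   also have "\<dots> <= e1 * (norm (F th) + 1)" using F1 e1(1) by (intro mult_left_mono) auto
   also have "\<dots> <= \<epsilon> / 2" by (rule e1(2))
   finally have 1: "norm (gen (unit_vec i) et (F et) - gen (unit_vec i) th (F et)) <= \<epsilon> / 2" .
   have "norm (gen (unit_vec i) th (F et) - gen (unit_vec i) th (F th)) <= B * norm (F et - F th)"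
    unfolding gen_linear(2)[symmetric] B_def by (rule norm_gen_le)
   also have "\<dots> <= B * e2" using F B by (intro mult_left_mono)
   finally have "norm (gen (unit_vec i) th (F et) - gen (unit_vec i) th (F th)) <= \<epsilon> / 2"
    using e2(3) by simp
   with 1 norm_triangle_ineq[of "gen (unit_vec i) et (F et) - gen (unit_vec i) th (F et)"
     "gen (unit_vec i) th (F et) - gen (unit_vec i) th (F th)"]
   show "norm (gen (unit_vec i) et (F et) - gen (unit_vec i) th (F th)) <= \<epsilon>" by simp
  qed
 qed
 then show ?thesis by (simp add: gen_sum_unit[OF fin])
qed

lemma solves_at_line:
 assumes S: "S \<subseteq> {1..N}" and d: "\<And>k. k \<notin> S ==> d k = 0"
  and reg: "regular N (\<lambda>i. th i + t * d i)" and sol: "solves_at S (\<lambda>i. th i + t * d i) F"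
 shows "((\<lambda>t. F (\<lambda>i. th i + t * d i)) has_vector_derivative
  gen d (\<lambda>i. th i + t * d i) (F (\<lambda>i. th i + t * d i))) (at t within A)"
proof -
 have shift: "shift S (\<lambda>i. th i + t * d i) d s = (\<lambda>i. th i + (t + s) * d i)" for s
  using d by (auto simp: shift_def algebra_simps)
 have d': "(\<lambda>k. if k \<in> S then d k else 0) = d" using d by auto
 have "((\<lambda>s. F (\<lambda>i. th i + (t + s) * d i)) has_vector_derivative
  gen d (\<lambda>i. th i + t * d i) (F (\<lambda>i. th i + t * d i))) (at (t - t))"
  using solves_at_line_derivative[OF S reg sol, of d] unfolding shift d' by simp
 then have "(((\<lambda>s. F (\<lambda>i. th i + (t + s) * d i)) \<circ> (\<lambda>u. u - t)) has_vector_derivative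
  1 *\<^sub>R gen d (\<lambda>i. th i + t * d i) (F (\<lambda>i. th i + t * d i))) (at t)"
  by (intro vector_diff_chain_at) (auto intro!: derivative_eq_intros)
 then show ?thesis by (simp add: o_def has_vector_derivative_at_within)
qed

text \<open>A bound on the whole segment, as needed for Gronwall's inequality.\<close>

lemma gen_bound_line_bounded:
 assumes "\<And>t. t \<in> {0..1} ==> regular N (\<lambda>i. th i + t * d i)"
 obtains B where "B >= 0" "\<And>t. t \<in> {0..1} ==> gen_bound d (\<lambda>i. th i + t * d i) <= B"
proof -
 have "continuous_on {0..1} (\<lambda>t. gen_bound d (\<lambda>i. th i + t * d i))"
  unfolding gen_bound_def split_def
  by (intro continuous_intros ballI; (rule regularD[OF assms])?; simp)
 then have "compact ((\<lambda>t. gen_bound d (\<lambda>i. th i + t * d i)) ` {0..1})"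
  by (rule compact_continuous_image) simp
 then have "bounded ((\<lambda>t. gen_bound d (\<lambda>i. th i + t * d i)) ` {0..1})" by (rule compact_imp_bounded)
 then obtain B where B: "\<And>t. t \<in> {0..1} ==> \<bar>gen_bound d (\<lambda>i. th i + t * d i)\<bar> <= B"
  unfolding bounded_iff by fastforce
 show ?thesis
 proof (rule that[of B])
  show "B >= 0" using B[of 0] by auto
  show "gen_bound d (\<lambda>i. th i + t * d i) <= B" if "t \<in> {0..1}" for t using B[OF that] by simp
 qed
qed

lemma line_unique:
 assumes reg: "\<And>t. t \<in> {0..1} ==> regular N (\<lambda>i. th i + t * d i)"
  and X: "\<And>t. t \<in> {0..1} ==> (X has_vector_derivative gen d (\<lambda>i. th i + t * d i) (X t)) (at t within {0..1})"
  and Y: "\<And>t. t \<in> {0..1} ==> (Y has_vector_derivative gen d (\<lambda>i. th i + t * d i) (Y t)) (at t within {0..1})"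
  and "X 0 = Y 0" "t \<in> {0..1}"
 shows "X t = Y t"
proof -
 obtain B where B: "B >= 0" "\<And>t. t \<in> {0..1} ==> gen_bound d (\<lambda>i. th i + t * d i) <= B"
  using gen_bound_line_bounded[OF reg] by blast
 have "(norm (X t - Y t))\<^sup>2 <= exp (2 * B + 1) * ((norm (X 0 - Y 0))\<^sup>2 + 0\<^sup>2)"
 proof (rule gronwall[where X = "\<lambda>t. X t - Y t" and X' = "\<lambda>t. gen d (\<lambda>i. th i + t * d i) (X t - Y t)"])
  fix t :: real assume t: "t \<in> {0..1}"
  show "((\<lambda>t. X t - Y t) has_vector_derivative gen d (\<lambda>i. th i + t * d i) (X t - Y t)) (at t within {0..1})"
   unfolding gen_linear(2) by (rule has_vector_derivative_diff[OF X[OF t] Y[OF t]])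
  show "norm (gen d (\<lambda>i. th i + t * d i) (X t - Y t)) <= B * norm (X t - Y t) + 0"
   using norm_gen_le[of d "\<lambda>i. th i + t * d i" "X t - Y t"] mult_right_mono[OF B(2)[OF t], of "norm (X t - Y t)"]
   by simp
 qed (use B assms in auto)
 then show ?thesis using assms by simp
qed

end

section \<open>Sorting the coordinates\<close>

lemma ex_sorting:
 fixes y :: "nat => real"
 assumes inj: "inj_on y {1..N}"
 shows "\<exists>w. w permutes {1..N} \<and> (\<forall>i\<in>{1..<N}. y (w i) < y (w (i + 1)))"
proof -
 define xs where "xs = sorted_list_of_set (y ` {1..N})"
 have xs: "sorted xs" "distinct xs" "set xs = y ` {1..N}" "length xs = N"
  using inj by (simp_all add: xs_def card_image)
 define w where "w = (\<lambda>i. if i \<in> {1..N} then inv_into {1..N} y (xs ! (i - 1)) else i)"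
 have nth: "xs ! (i - 1) \<in> y ` {1..N}" if "i \<in> {1..N}" for i
 proof -
  have "xs ! (i - 1) \<in> set xs" using that xs(4) by (intro nth_mem) auto
  then show ?thesis using xs(3) by simp
 qed
 have yw: "y (w i) = xs ! (i - 1)" if "i \<in> {1..N}" for i
  using f_inv_into_f[OF nth[OF that]] that by (simp add: w_def)
 have "bij_betw w {1..N} {1..N}"
 proof -
  have "inj_on w {1..N}"
  proof (rule inj_onI)
   fix i j assume ij: "i \<in> {1..N}" "j \<in> {1..N}" "w i = w j"
   then have "xs ! (i - 1) = xs ! (j - 1)" using yw by metis
   moreover have "i - 1 < length xs" "j - 1 < length xs" using ij xs(4) by auto
   ultimately have "i - 1 = j - 1" using nth_eq_iff_index_eq[OF xs(2)] by blast
   then show "i = j" using ij by auto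
  qed
  moreover have "w ` {1..N} \<subseteq> {1..N}"
   using inv_into_into[OF nth] by (auto simp: w_def)
  ultimately show ?thesis by (simp add: bij_betw_def endo_inj_surj)
 qed
 then have "w permutes {1..N}" by (rule bij_imp_permutes) (auto simp: w_def)
 moreover have "y (w i) < y (w (i + 1))" if "i \<in> {1..<N}" for i
 proof -
  have "xs ! (i - 1) < xs ! i"
   using sorted_wrt_nth_less[of "(<)" xs "i - 1" i] that xs strict_sorted_iff by auto
  then show ?thesis using yw[of i] yw[of "i + 1"] that by simp
 qed
 ultimately show ?thesis by blast
qed

lemma pt_comp_permutes:
 assumes "w permutes {1..N}"
 shows "pt N th \<circ> w = pt N (th \<circ> w)"
proof
 fix i
 show "(pt N th \<circ> w) i = pt N (th \<circ> w) i"
  using permutes_in_image[OF assms, of i] by (simp add: pt_def)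
qed

lemma pt_torus: "pt N th \<in> torus N"
 by (auto simp: pt_def torus_def)

lemma torus_comp: "x \<in> torus N ==> w permutes {1..N} ==> x \<circ> w \<in> torus N"
 by (auto simp: torus_def PiE_iff extensional_def permutes_in_image permutes_not_in
   simp del: atLeastAtMost_iff)

lemma torus_reg_comp:
 assumes "x \<in> torus_reg N" "w permutes {1..N}"
 shows "x \<circ> w \<in> torus_reg N"
 using assms torus_comp[of x N w]
 by (auto simp: torus_reg_def permutes_image intro!: comp_inj_on permutes_inj_on)

lemma torus_eq_pt: "x \<in> torus N ==> (\<And>i. i \<in> {1..N} ==> x i = cis (th i)) ==> x = pt N th"
 by (auto simp: torus_def pt_def fun_eq_iff PiE_iff extensional_def)

lemma chamber_torus_reg:
 assumes "th \<in> chamber N"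
 shows "pt N th \<in> torus_reg N"
 unfolding torus_reg_def
proof (intro CollectI conjI pt_torus inj_onI)
 fix i j assume ij: "i \<in> {1..N}" "j \<in> {1..N}" "pt N th i = pt N th j"
 show "i = j"
 proof (rule ccontr)
  assume "i ~= j"
  then have "(i, j) \<in> pairs N" using ij by (auto simp: pairs_def)
  then show False using cis_neq[OF regularD[OF chamber_regular[OF assms]]] ij by (auto simp: pt_def)
 qed
qed

lemma torus_reg_sorted:
 assumes x: "x \<in> torus_reg N" and "N >= 1"
 obtains w th where "w permutes {1..N}" "th \<in> chamber N" "x \<circ> w = pt N th"
proof -
 have xi: "x i = cis (Arg2pi (x i))" if "i \<in> {1..N}" for i
 proof -
  have "cmod (x i) = 1" using x that by (auto simp: torus_reg_def torus_def)
  then show ?thesis using Arg2pi_eq[of "x i"] by (simp add: cis_conv_exp)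
 qed
 have x_pt: "x = pt N (\<lambda>i. Arg2pi (x i))"
  by (rule torus_eq_pt) (use x in \<open>simp add: torus_reg_def\<close>, rule xi)
 have "inj_on (\<lambda>i. Arg2pi (x i)) {1..N}"
 proof (rule inj_onI)
  fix i j assume ij: "i \<in> {1..N}" "j \<in> {1..N}" "Arg2pi (x i) = Arg2pi (x j)"
  have "x i = x j" using xi[OF ij(1)] xi[OF ij(2)] unfolding ij(3) by (rule trans[OF _ sym])
  moreover have "inj_on x {1..N}" using x by (simp add: torus_reg_def)
  ultimately show "i = j" using ij(1,2) by (simp only: inj_on_eq_iff)
 qed
 from ex_sorting[OF this] obtain w where
  w: "w permutes {1..N}" "\<forall>i\<in>{1..<N}. Arg2pi (x (w i)) < Arg2pi (x (w (i + 1)))" by blast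
 show ?thesis
 proof (rule that[OF w(1)])
  show "x \<circ> w = pt N ((\<lambda>i. Arg2pi (x i)) \<circ> w)"
   using x_pt pt_comp_permutes[OF w(1)] by metis
  have "Arg2pi (x (w N)) < Arg2pi (x (w 1)) + 2 * pi"
   using Arg2pi_lt_2pi[of "x (w N)"] Arg2pi_ge_0[of "x (w 1)"] by linarith
  then show "(\<lambda>i. Arg2pi (x i)) \<circ> w \<in> chamber N" using w(2) by (simp add: chamber_def)
 qed
qed

lemma chord_eq: "cmod (cis a - cis b) = 2 * \<bar>sin ((a - b) / 2)\<bar>"
proof -
 define h m where "h = (a - b) / 2" and "m = (a + b) / 2"
 have "cis a = cis m * cis h" "cis b = cis m * cis (- h)"
  by (simp_all add: cis_mult h_def m_def field_simps)
 moreover have diff: "cis h - cis (- h) = 2 * \<i> * of_real (sin h)"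
  by (simp add: complex_eq_iff)
 ultimately have "cis a - cis b = cis m * (2 * \<i> * of_real (sin h))"
  by (simp flip: diff add: algebra_simps)
 then show ?thesis by (simp add: norm_mult h_def)
qed

section \<open>The quadratic form on the torus\<close>

text \<open>The form \<open>K = L\<^sup>* H L\<close>, through the properties used from here on.\<close>

locale torus_form = torus_rep N \<kappa> \<tau> for N :: nat and \<kappa> :: real and \<tau> :: "(nat => nat) => complex^'t^'t" +
 fixes K :: "(nat => complex) => complex^'t^'t"
 assumes K_partial: "th \<in> chamber N ==> i \<in> {1..N} ==>
   ((\<lambda>r. K (pt N (th(i := r)))) has_vector_derivative gen (unit_vec i) th (K (pt N th))) (at (th i))"
  and K_w0: "\<tau> (w0 N) ** K (x0 N) ** adj (\<tau> (w0 N)) = K (x0 N)"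
  and K_extend: "x \<in> torus_reg N ==> w permutes {1..N} ==> w 1 = 1 ==> x \<circ> inv w \<in> C0 N ==>
   K x = adj (\<tau> w) ** K (x \<circ> inv w) ** \<tau> w"
begin

lemma K_solves: 
 assumes "th \<in> chamber N"
 shows "solves_at {1..N} th (\<lambda>th. K (pt N th))"
proof -
 obtain \<delta> where "\<delta> > 0" "\<And>et. (\<forall>i\<in>{1..N}. \<bar>et i - th i\<bar> < \<delta>) ==> et \<in> chamber N"
  using chamber_box[OF assms] N3 by auto
 then show ?thesis unfolding solves_at_def
  by (intro exI[of _ \<delta>]) (auto simp: coord_box_def intro!: K_partial)
qed

lemma pt_outside: "(\<And>i. i \<in> {1..N} ==> th i = th' i) ==> pt N th = pt N th'"
 by (auto simp: pt_def restrict_def fun_eq_iff)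

lemma K_line:
 assumes "(\<lambda>i. th i + t * d i) \<in> chamber N"
 shows "((\<lambda>t. K (pt N (\<lambda>i. th i + t * d i))) has_vector_derivative
  gen d (\<lambda>i. th i + t * d i) (K (pt N (\<lambda>i. th i + t * d i)))) (at t within A)"
proof -
 define d' where "d' = (\<lambda>k. if k \<in> {1..N} then d k else 0)"
 have pt': "pt N (\<lambda>i. th i + t * d' i) = pt N (\<lambda>i. th i + t * d i)" for t
  by (rule pt_outside) (simp add: d'_def)
 have ch: "(\<lambda>i. th i + t * d' i) \<in> chamber N"
  using assms N3 by (auto simp: chamber_def d'_def)
 have "((\<lambda>t. K (pt N (\<lambda>i. th i + t * d' i))) has_vector_derivative
  gen d' (\<lambda>i. th i + t * d' i) (K (pt N (\<lambda>i. th i + t * d' i)))) (at t within A)"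
  by (rule solves_at_line[OF order_refl _ chamber_regular[OF ch] K_solves[OF ch]])
   (auto simp: d'_def)
 moreover have "gen d' (\<lambda>i. th i + t * d' i) X = gen d (\<lambda>i. th i + t * d i) X" for X
  by (rule gen_cong) (auto simp: d'_def)
 ultimately show ?thesis by (simp only: pt')
qed

text \<open>A common rotation of all coordinates does not change \<open>K\<close>, because the sum of all
 reflections is central.\<close>

lemma gen_rotation: "gen (\<lambda>_. c) th X = 0"
proof -
 obtain s where s: "(\<Sum>(i, j)\<in>pairs N. refl i j) = mat s" using \<tau>_central by blast
 have "gen (\<lambda>_. c) th X = (\<Sum>(i, j)\<in>pairs N.
   mscale (of_real (\<kappa> * (c + c) / 4) * \<i>) (X ** refl i j - refl i j ** X))"
  by (simp add: gen_def brk_def)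
 also have "\<dots> = mscale (of_real (\<kappa> * (c + c) / 4) * \<i>)
   (X ** (\<Sum>(i, j)\<in>pairs N. refl i j) - (\<Sum>(i, j)\<in>pairs N. refl i j) ** X)"
  by (simp add: mscale_sum mm.sum_left mm.sum_right split_def flip: sum_subtractf)
 also have "X ** mat s = mat s ** X"
  using mscale_simps(13)[of X s "mat 1"] by (simp add: mscale_eq)
 then have "X ** (\<Sum>(i, j)\<in>pairs N. refl i j) - (\<Sum>(i, j)\<in>pairs N. refl i j) ** X = 0"
  by (simp add: s)
 finally show ?thesis by (simp add: mscale_simps)
qed

lemma K_rotation:
 assumes "th \<in> chamber N"
 shows "K (pt N (\<lambda>i. th i + c)) = K (pt N th)"
proof -
 have ch: "(\<lambda>i. th i + t * c) \<in> chamber N" for t using assms by (auto simp: chamber_def)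
 have "K (pt N (\<lambda>i. th i + 1 * c)) = K (pt N th)"
 proof (rule line_unique[of th "\<lambda>_. c" "\<lambda>t. K (pt N (\<lambda>i. th i + t * c))" "\<lambda>_. K (pt N th)" 1])
  show "((\<lambda>_. K (pt N th)) has_vector_derivative gen (\<lambda>_. c) (\<lambda>i. th i + t * c) (K (pt N th)))
    (at t within {0..1})" for t by (simp add: gen_rotation)
 qed (use ch in \<open>auto intro: chamber_regular K_line\<close>)
 then show ?thesis by simp
qed

text \<open>Both sides solve the same equation on the chamber and agree at the regular polygon \<open>x\<^sub>0\<close>.\<close>

lemma K_w0_chamber:
 assumes th: "th \<in> chamber N"
 shows "\<tau> (w0 N) ** K (pt N th \<circ> w0 N) ** adj (\<tau> (w0 N)) = K (pt N th)"
proof -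
 define a where "a = regular_angles N"
 define d where "d = (\<lambda>i. th i - a i)"
 define p where "p = (\<lambda>t i. a i + t * d i)"
 define a' d' where "a' = rot_angles N a" and "d' = (\<lambda>i. if i = N then d 1 else d (i + 1))"
 have N: "N >= 1" "N >= 2" using N3 by auto
 have w: "w0 N permutes {1..N}" by (rule w0_permutes[OF N(1)])
 have p: "p t \<in> chamber N" if "t \<in> {0..1}" for t
  unfolding p_def d_def a_def using chamber_convex[OF regular_angles_chamber[OF N(1)] th that] .
 have rot: "rot_angles N (p t) = (\<lambda>i. a' i + t * d' i)" for t
  by (auto simp: rot_angles_def p_def a'_def d'_def)
 have p': "(\<lambda>i. a' i + t * d' i) \<in> chamber N" if "t \<in> {0..1}" for t
  using rot_angles_chamber[OF p[OF that] N(2)] by (simp add: rot)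
 define Y where "Y = (\<lambda>t. \<tau> (w0 N) ** K (pt N (\<lambda>i. a' i + t * d' i)) ** adj (\<tau> (w0 N)))"
 have "Y 1 = K (pt N (p 1))"
 proof (rule line_unique[of a d Y "\<lambda>t. K (pt N (p t))" 1])
  fix t :: real assume t: "t \<in> {0..1}"
  show "regular N (\<lambda>i. a i + t * d i)" using chamber_regular[OF p[OF t]] by (simp add: p_def)
  show "((\<lambda>t. K (pt N (p t))) has_vector_derivative gen d (\<lambda>i. a i + t * d i) (K (pt N (p t))))
    (at t within {0..1})"
   using K_line[of a t d] p[OF t] by (simp add: p_def)
  have "(Y has_vector_derivative (\<tau> (w0 N) **
    gen d' (\<lambda>i. a' i + t * d' i) (K (pt N (\<lambda>i. a' i + t * d' i))) ** adj (\<tau> (w0 N))))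
    (at t within {0..1})"
   unfolding Y_def
   using bounded_linear.has_vector_derivative[OF bounded_linear_compose[OF
     mm.bounded_linear_left[of "adj (\<tau> (w0 N))"] mm.bounded_linear_right[of "\<tau> (w0 N)"]]
     K_line[OF p'[OF t]]] .
  also have "\<tau> (w0 N) ** gen d' (\<lambda>i. a' i + t * d' i) (K (pt N (\<lambda>i. a' i + t * d' i))) ** adj (\<tau> (w0 N))
    = gen d (\<lambda>i. a i + t * d i) (Y t)"
   unfolding Y_def
  proof (rule gen_conj[OF w])
   show "d (w0 N i) = d' i" if "i \<in> {1..N}" for i using that by (auto simp: w0_def d'_def)
   show "a (w0 N i) + t * d (w0 N i) = a' i + t * d' i \<or>
     a (w0 N i) + t * d (w0 N i) = a' i + t * d' i - 2 * pi" if "i \<in> {1..N}" for i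
    using that by (auto simp: w0_def d'_def a'_def rot_angles_def)
  qed
  finally show "(Y has_vector_derivative gen d (\<lambda>i. a i + t * d i) (Y t)) (at t within {0..1})" .
 next
  have "pt N a' = pt N (\<lambda>i. a i + 2 * pi / real N)"
   unfolding a'_def a_def rot_angles_def regular_angles_def
   using N by (intro pt_outside) (auto simp: of_nat_diff field_simps)
  then have "K (pt N a') = K (x0 N)"
   using K_rotation[OF regular_angles_chamber[OF N(1)]] by (simp add: x0_eq a_def)
  then show "Y 0 = K (pt N (p 0))"
   using K_w0 by (simp add: Y_def p_def x0_eq a_def)
 qed simp
 moreover have p1: "p 1 = th" by (simp add: p_def d_def)
 moreover have "pt N (\<lambda>i. a' i + 1 * d' i) = pt N th \<circ> w0 N"
  using pt_rot_angles[OF N(1), of th] rot[of 1] by (simp only: p1)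
 ultimately show ?thesis by (simp add: Y_def)
qed

lemma conj_cancel:
 assumes "w permutes {1..N}" "\<tau> w ** A ** adj (\<tau> w) = B"
 shows "A = adj (\<tau> w) ** B ** \<tau> w"
proof -
 have "adj (\<tau> w) ** B ** \<tau> w = (adj (\<tau> w) ** \<tau> w) ** A ** (adj (\<tau> w) ** \<tau> w)"
  unfolding assms(2)[symmetric] by (simp only: matrix_mul_assoc)
 then show ?thesis by (simp add: \<tau>_unitary[OF assms(1)])
qed

text \<open>A power of the cycle reduces the claim to permutations that fix 1, for which it is the definition
 of the extension.\<close>

lemma K_equivariant_chamber:
 assumes th: "th \<in> chamber N" and w: "w permutes {1..N}"
 shows "K (pt N th \<circ> w) = adj (\<tau> w) ** K (pt N th) ** \<tau> w"
proof -
 have N: "N >= 1" "N >= 2" using N3 by auto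
 have w0: "w0 N permutes {1..N}" by (rule w0_permutes[OF N(1)])
 have pow: "\<exists>th'\<in>chamber N. pt N th \<circ> (w0 N ^^ m) = pt N th' \<and> (w0 N ^^ m) permutes {1..N} \<and>
   K (pt N th') = adj (\<tau> (w0 N ^^ m)) ** K (pt N th) ** \<tau> (w0 N ^^ m)" for m
 proof (induction m)
  case 0
  show ?case using th by (auto simp: \<tau>_id adj_simps permutes_id simp flip: id_def intro!: bexI[of _ th])
 next
  case (Suc m)
  then obtain th' where th': "th' \<in> chamber N" "pt N th \<circ> (w0 N ^^ m) = pt N th'" "(w0 N ^^ m) permutes {1..N}"
   "K (pt N th') = adj (\<tau> (w0 N ^^ m)) ** K (pt N th) ** \<tau> (w0 N ^^ m)" by blast
  have swap: "w0 N ^^ Suc m = (w0 N ^^ m) \<circ> w0 N" by (simp add: funpow_swap1 fun_eq_iff)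
  have eq: "pt N (rot_angles N th') = pt N th' \<circ> w0 N" by (rule pt_rot_angles[OF N(1)])
  have "K (pt N th' \<circ> w0 N) = adj (\<tau> (w0 N)) ** K (pt N th') ** \<tau> (w0 N)"
   by (rule conj_cancel[OF w0 K_w0_chamber[OF th'(1)]])
  also have "\<dots> = adj (\<tau> (w0 N ^^ Suc m)) ** K (pt N th) ** \<tau> (w0 N ^^ Suc m)"
   unfolding swap th'(4) \<tau>_comp[OF th'(3) w0] by (simp add: adj_simps matrix_mul_assoc)
  finally show ?case
   using rot_angles_chamber[OF th'(1) N(2)] eq th'(2) permutes_compose[OF w0 th'(3)]
   by (intro bexI[of _ "rot_angles N th'"]) (auto simp only: swap o_assoc)
 qed
 define m where "m = w 1 - 1"
 have w1: "w 1 \<in> {1..N}" using permutes_in_image[OF w, of 1] N by auto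
 have reach: "k < N ==> (w0 N ^^ k) 1 = k + 1" for k
  by (induction k) (auto simp: w0_def)
 have wm1: "(w0 N ^^ m) 1 = w 1" using reach[of m] w1 by (auto simp: m_def)
 obtain th' where th': "th' \<in> chamber N" "pt N th \<circ> (w0 N ^^ m) = pt N th'" "(w0 N ^^ m) permutes {1..N}"
   "K (pt N th') = adj (\<tau> (w0 N ^^ m)) ** K (pt N th) ** \<tau> (w0 N ^^ m)" using pow by blast
 define v where "v = inv (w0 N ^^ m) \<circ> w"
 have v: "v permutes {1..N}" unfolding v_def by (rule permutes_compose[OF w permutes_inv[OF th'(3)]])
 have wv: "w = (w0 N ^^ m) \<circ> v" by (simp add: v_def o_assoc permutes_inv_o(1)[OF th'(3)])
 have v1: "v 1 = 1"
  using permutes_inverses(2)[OF th'(3), of 1] by (simp only: v_def o_apply wm1)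
 have undo: "pt N th' \<circ> v \<circ> inv v = pt N th'"
  by (simp add: o_assoc[symmetric] permutes_inv_o(1)[OF v])
 have "K (pt N th' \<circ> v) = adj (\<tau> v) ** K (pt N th' \<circ> v \<circ> inv v) ** \<tau> v"
  using th'(1) by (intro K_extend torus_reg_comp chamber_torus_reg v v1) (auto simp: undo C0_eq)
 then have "K (pt N th' \<circ> v) = adj (\<tau> v) ** K (pt N th') ** \<tau> v" by (simp only: undo)
 moreover have "pt N th \<circ> w = pt N th' \<circ> v" by (simp add: wv o_assoc th'(2))
 ultimately show ?thesis
  unfolding wv \<tau>_comp[OF th'(3) v] by (simp add: th'(4) adj_simps matrix_mul_assoc)
qed

lemma K_equivariant:
 assumes x: "x \<in> torus_reg N" and v: "v permutes {1..N}"
 shows "K (x \<circ> v) = adj (\<tau> v) ** K x ** \<tau> v"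
proof -
 obtain w th where w: "w permutes {1..N}" "th \<in> chamber N" "x \<circ> w = pt N th"
  using torus_reg_sorted[OF x] N3 by auto
 have x_eq: "x = pt N th \<circ> inv w"
  unfolding w(3)[symmetric] by (simp add: o_assoc[symmetric] permutes_inv_o(1)[OF w(1)])
 have "K (x \<circ> v) = K (pt N th \<circ> (inv w \<circ> v))" by (simp add: x_eq o_assoc)
 also have "\<dots> = adj (\<tau> (inv w \<circ> v)) ** K (pt N th) ** \<tau> (inv w \<circ> v)"
  by (rule K_equivariant_chamber[OF w(2) permutes_compose[OF v permutes_inv[OF w(1)]]])
 also have "\<dots> = adj (\<tau> v) ** (adj (\<tau> (inv w)) ** K (pt N th) ** \<tau> (inv w)) ** \<tau> v"
  by (simp add: \<tau>_comp[OF permutes_inv[OF w(1)] v] adj_simps matrix_mul_assoc)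
 also have "adj (\<tau> (inv w)) ** K (pt N th) ** \<tau> (inv w) = K x"
  unfolding x_eq by (rule K_equivariant_chamber[OF w(2) permutes_inv[OF w(1)], symmetric])
 finally show ?thesis .
qed

lemma norm_K_comp: "x \<in> torus_reg N ==> v permutes {1..N} ==> norm (K (x \<circ> v)) = norm (K x)"
 by (simp add: K_equivariant norm_\<tau>_conj)

end

section \<open>Growth of the form towards the walls\<close>

lemma cot_le_inverse:
 fixes x :: real
 assumes "0 < x" "x < pi"
 shows "cot x <= 1 / x"
proof -
 have "sin 0 - 0 * cos 0 <= sin x - x * cos x"
 proof (rule DERIV_nonneg_imp_nondecreasing[of 0 x "\<lambda>x. sin x - x * cos x"])
  show "\<exists>y. DERIV (\<lambda>x. sin x - x * cos x) t :> y \<and> y >= 0" if "0 <= t" "t <= x" for t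
   using that assms by (intro exI[of _ "t * sin t"] conjI) (auto intro!: derivative_eq_intros mult_nonneg_nonneg sin_ge_zero)
 qed (use assms in simp)
 then show ?thesis using assms sin_gt_zero[of x] by (simp add: cot_def field_simps)
qed

lemma abs_cot_le:
 fixes \<phi> :: real
 assumes "0 < \<phi>" "\<phi> < 2 * pi"
 shows "\<bar>cot (\<phi> / 2)\<bar> <= 2 / \<phi> + 2 / (2 * pi - \<phi>)"
proof -
 have 1: "cot (\<phi> / 2) <= 2 / \<phi>" using cot_le_inverse[of "\<phi> / 2"] assms by simp
 have "cot (pi - \<phi> / 2) <= 1 / (pi - \<phi> / 2)" using assms by (intro cot_le_inverse) auto
 moreover have "cot (pi - \<phi> / 2) = - cot (\<phi> / 2)" by (simp add: cot_def)
 moreover have "1 / (pi - \<phi> / 2) = 2 / (2 * pi - \<phi>)" using assms by (simp add: field_simps)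
 ultimately have 2: "- cot (\<phi> / 2) <= 2 / (2 * pi - \<phi>)" by simp
 have "0 <= 2 / \<phi>" "0 <= 2 / (2 * pi - \<phi>)" using assms by auto
 then show ?thesis using 1 2 by linarith
qed

text \<open>An antiderivative of an upper bound for the coefficient of one reflection along a line. The
 bound \<open>2 / \<phi> + 2 / (2 \<pi> - \<phi>)\<close> has the monotone antiderivative \<open>2 ln (\<phi> / (2 \<pi> - \<phi>))\<close>, so the
 total variation along the line is visible from the end points.\<close>

lemma pair_comparison_pos:
 fixes \<phi>0 \<phi>1 :: real
 assumes "\<phi>0 \<in> {0<..<2 * pi}" "\<phi>1 \<in> {0<..<2 * pi}"
 shows "\<exists>E E'. (\<forall>t\<in>{0..1}. (E has_real_derivative E' t) (at t) \<and>
   \<bar>\<phi>1 - \<phi>0\<bar> * \<bar>cot ((\<phi>0 + t * (\<phi>1 - \<phi>0)) / 2)\<bar> <= E' t) \<and>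
  E 1 - E 0 <= 2 * ln (pi / \<bar>sin (\<phi>0 / 2)\<bar>) + 2 * ln (pi / \<bar>sin (\<phi>1 / 2)\<bar>)"
proof -
 define g where "g = (\<lambda>\<phi>. 2 * ln \<phi> - 2 * ln (2 * pi - \<phi>) :: real)"
 define p where "p = (\<lambda>t. \<phi>0 + t * (\<phi>1 - \<phi>0))"
 define E where "E = (\<lambda>t. sgn (\<phi>1 - \<phi>0) * g (p t))"
 define E' where "E' = (\<lambda>t. \<bar>\<phi>1 - \<phi>0\<bar> * (2 / p t + 2 / (2 * pi - p t)))"
 have p: "0 < p t \<and> p t < 2 * pi" if t: "t \<in> {0..1}" for t
 proof -
  have "p t \<in> closed_segment \<phi>0 \<phi>1"
   unfolding in_segment using t by (intro exI[of _ t]) (auto simp: p_def algebra_simps)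
  moreover have "closed_segment \<phi>0 \<phi>1 \<subseteq> {0<..<2 * pi}"
   by (rule closed_segment_subset) (use assms in auto)
  ultimately show ?thesis by auto
 qed
 have gE: "\<bar>g \<phi>\<bar> <= 2 * ln (pi / \<bar>sin (\<phi> / 2)\<bar>)" if \<phi>: "\<phi> \<in> {0<..<2 * pi}" for \<phi>
 proof -
  have s: "sin (\<phi> / 2) > 0" using \<phi> by (intro sin_gt_zero) auto
  have s1: "2 * sin (\<phi> / 2) <= \<phi>" using sin_x_le_x[of "\<phi> / 2"] \<phi> by simp
  have "sin (pi - \<phi> / 2) <= pi - \<phi> / 2" using \<phi> by (intro sin_x_le_x) auto
  then have s2: "2 * sin (\<phi> / 2) <= 2 * pi - \<phi>" by simp
  have "ln \<phi> <= ln (2 * pi)" "ln (2 * pi - \<phi>) <= ln (2 * pi)" using \<phi> by auto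
  moreover have "ln (2 * sin (\<phi> / 2)) <= ln \<phi>" "ln (2 * sin (\<phi> / 2)) <= ln (2 * pi - \<phi>)"
   using s s1 s2 by (auto simp del: ln_le_cancel_iff intro!: ln_mono)
  moreover have "ln (pi / \<bar>sin (\<phi> / 2)\<bar>) = ln (2 * pi) - ln (2 * sin (\<phi> / 2))"
   using s by (simp add: ln_div ln_mult)
  ultimately show ?thesis unfolding g_def by linarith
 qed
 have ring: "s * (2 * (D / a) - 2 * (- D / b)) = D * s * (2 / a + 2 / b)" for s D a b :: real
  by (simp add: algebra_simps)
 have "(E has_real_derivative E' t) (at t)" if "t \<in> {0..1}" for t
 proof -
  have "(E has_real_derivative sgn (\<phi>1 - \<phi>0) * (2 * ((\<phi>1 - \<phi>0) / p t)
    - 2 * (- (\<phi>1 - \<phi>0) / (2 * pi - p t)))) (at t)"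
   unfolding E_def g_def p_def using p[OF that] unfolding p_def
   by (auto intro!: derivative_eq_intros simp: field_simps)
  moreover have "sgn (\<phi>1 - \<phi>0) * (2 * ((\<phi>1 - \<phi>0) / p t) - 2 * (- (\<phi>1 - \<phi>0) / (2 * pi - p t))) = E' t"
   unfolding E'_def abs_sgn by (rule ring)
  ultimately show ?thesis by simp
 qed
 moreover have "\<bar>\<phi>1 - \<phi>0\<bar> * \<bar>cot ((\<phi>0 + t * (\<phi>1 - \<phi>0)) / 2)\<bar> <= E' t" if "t \<in> {0..1}" for t
  unfolding E'_def p_def[symmetric] using p[OF that] abs_cot_le[of "p t"]
  by (intro mult_left_mono) (auto simp: p_def)
 moreover have "E 1 - E 0 <= 2 * ln (pi / \<bar>sin (\<phi>0 / 2)\<bar>) + 2 * ln (pi / \<bar>sin (\<phi>1 / 2)\<bar>)"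
 proof -
  have "E 1 - E 0 <= \<bar>g \<phi>1\<bar> + \<bar>g \<phi>0\<bar>" unfolding E_def p_def sgn_if by simp arith
  then show ?thesis using gE[OF assms(1)] gE[OF assms(2)] by linarith
 qed
 ultimately show ?thesis by blast
qed

lemma pair_comparison:
 fixes \<phi>0 \<phi>1 :: real
 assumes "\<phi>0 \<in> {0<..<2 * pi} \<and> \<phi>1 \<in> {0<..<2 * pi} \<or> \<phi>0 \<in> {- 2 * pi<..<0} \<and> \<phi>1 \<in> {- 2 * pi<..<0}"
 shows "\<exists>E E'. (\<forall>t\<in>{0..1}. (E has_real_derivative E' t) (at t) \<and>
   \<bar>\<phi>1 - \<phi>0\<bar> * \<bar>cot ((\<phi>0 + t * (\<phi>1 - \<phi>0)) / 2)\<bar> <= E' t) \<and>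
  E 1 - E 0 <= 2 * ln (pi / \<bar>sin (\<phi>0 / 2)\<bar>) + 2 * ln (pi / \<bar>sin (\<phi>1 / 2)\<bar>)"
 using assms
proof (elim disjE conjE)
 assume "\<phi>0 \<in> {- 2 * pi<..<0}" "\<phi>1 \<in> {- 2 * pi<..<0}"
 then have "- \<phi>0 \<in> {0<..<2 * pi}" "- \<phi>1 \<in> {0<..<2 * pi}" by auto
 from pair_comparison_pos[OF this] obtain E E' where E: "\<And>t. t \<in> {0..1} ==> (E has_real_derivative E' t) (at t)"
   "\<And>t. t \<in> {0..1} ==> \<bar>- \<phi>1 - - \<phi>0\<bar> * \<bar>cot ((- \<phi>0 + t * (- \<phi>1 - - \<phi>0)) / 2)\<bar> <= E' t"
   "E 1 - E 0 <= 2 * ln (pi / \<bar>sin (- \<phi>0 / 2)\<bar>) + 2 * ln (pi / \<bar>sin (- \<phi>1 / 2)\<bar>)"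
  by blast
 have "\<bar>\<phi>1 - \<phi>0\<bar> * \<bar>cot ((\<phi>0 + t * (\<phi>1 - \<phi>0)) / 2)\<bar> <= E' t" if t: "t \<in> {0..1}" for t
 proof -
  have "(- \<phi>0 + t * (- \<phi>1 - - \<phi>0)) / 2 = - ((\<phi>0 + t * (\<phi>1 - \<phi>0)) / 2)" by (simp add: field_simps)
  then have "\<bar>cot ((- \<phi>0 + t * (- \<phi>1 - - \<phi>0)) / 2)\<bar> = \<bar>cot ((\<phi>0 + t * (\<phi>1 - \<phi>0)) / 2)\<bar>"
   by (simp only: cot_minus abs_minus_cancel)
  moreover have "\<bar>- \<phi>1 - - \<phi>0\<bar> = \<bar>\<phi>1 - \<phi>0\<bar>" by simp
  ultimately show ?thesis using E(2)[OF t] by (simp only:)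
 qed
 moreover have "E 1 - E 0 <= 2 * ln (pi / \<bar>sin (\<phi>0 / 2)\<bar>) + 2 * ln (pi / \<bar>sin (\<phi>1 / 2)\<bar>)"
  using E(3) by simp
 ultimately show ?thesis using E(1) by blast
qed (rule pair_comparison_pos)

lemma card_pairs: "card (pairs N) = N * (N - 1)"
proof -
 have "pairs N = Sigma {1..N} (\<lambda>i. {1..N} - {i})" by (auto simp: pairs_def)
 then have "card (pairs N) = (\<Sum>i\<in>{1..N}. card ({1..N} - {i}))" by (simp add: card_SigmaI)
 also have "\<dots> = (\<Sum>i\<in>{1..N}. N - 1)" by (intro sum.cong) auto
 finally show ?thesis by simp
qed

context torus_rep
begin

text \<open>Only the anticommutators contribute, as the commutators are skew.\<close>

lemma inner_gen_le:
 "2 * inner X (gen d th X) \<le>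
  (\<Sum>(i, j)\<in>pairs N. \<bar>\<kappa>\<bar> * (\<bar>d i - d j\<bar> * \<bar>cot ((th i - th j) / 2)\<bar>)) * inner X X"
proof -
 have "2 * inner X (gen d th X) = (\<Sum>(i, j)\<in>pairs N. 2 * inner X
   (brk (\<kappa> * (d i + d j) / 4) (\<kappa> * (d i - d j) / 4 * cot ((th i - th j) / 2)) (refl i j) X))"
  by (simp add: gen_def inner_sum_right split_def sum_distrib_left)
 also have "\<dots> <= (\<Sum>(i, j)\<in>pairs N.
   \<bar>\<kappa>\<bar> * (\<bar>d i - d j\<bar> * \<bar>cot ((th i - th j) / 2)\<bar>) * inner X X)"
 proof (intro sum_mono, clarify)
  fix i j assume ij: "(i, j) \<in> pairs N"
  define t where "t = refl i j"
  define e where "e = \<kappa> * (d i - d j) / 4 * cot ((th i - th j) / 2)"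
  have "inner X (brk c e t X) = e * inner X (X ** t + t ** X)" for c
   by (simp add: brk_def inner_add_right inner_commutator[OF refl_hermitian[OF ij]] t_def)
  also have "\<dots> <= \<bar>e\<bar> * (norm X * norm (X ** t + t ** X))"
   using Cauchy_Schwarz_ineq2[of X "X ** t + t ** X"] abs_mult[of e]
   by (metis abs_ge_self abs_ge_zero mult_left_mono order_trans)
  also have "\<dots> <= \<bar>e\<bar> * (norm X * (norm X + norm X))"
   using norm_triangle_ineq[of "X ** t" "t ** X"] refl_unitary[OF ij]
   by (intro mult_left_mono) (auto simp: t_def norm_unitary_left norm_unitary_right)
  also have "\<bar>e\<bar> = \<bar>\<kappa>\<bar> * \<bar>d i - d j\<bar> / 4 * \<bar>cot ((th i - th j) / 2)\<bar>"
   by (simp add: e_def abs_mult)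
  finally have "inner X (brk c e t X) \<le>
    \<bar>\<kappa>\<bar> * \<bar>d i - d j\<bar> / 4 * \<bar>cot ((th i - th j) / 2)\<bar> * (norm X * (norm X + norm X))" for c .
  moreover have "inner X X = norm X * norm X" by (simp add: power2_norm_eq_inner flip: power2_eq_square)
  ultimately show "2 * inner X (brk (\<kappa> * (d i + d j) / 4) (\<kappa> * (d i - d j) / 4 * cot ((th i - th j) / 2))
    (refl i j) X) <= \<bar>\<kappa>\<bar> * (\<bar>d i - d j\<bar> * \<bar>cot ((th i - th j) / 2)\<bar>) * inner X X"
   unfolding e_def t_def by (simp add: mult_ac)
 qed
 finally show ?thesis by (simp add: sum_distrib_right split_def)
qed

end

context torus_form
begin

text \<open>The logarithmic derivative of the squared norm along the segment is at most the sum of the cotangents,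
 whose integrals are bounded in terms of the end points.\<close>

lemma K_growth:
 assumes th0: "th0 \<in> chamber N" and th1: "th1 \<in> chamber N"
 shows "(norm (K (pt N th1)))\<^sup>2 <= (norm (K (pt N th0)))\<^sup>2 * exp (\<bar>\<kappa>\<bar> * (\<Sum>(i, j)\<in>pairs N.
  2 * ln (pi / \<bar>sin ((th0 i - th0 j) / 2)\<bar>) + 2 * ln (pi / \<bar>sin ((th1 i - th1 j) / 2)\<bar>)))"
proof -
 define d where "d = (\<lambda>i. th1 i - th0 i)"
 define p where "p = (\<lambda>t i. th0 i + t * d i)"
 define \<phi>0 \<phi>1 where "\<phi>0 = (\<lambda>q. th0 (fst q) - th0 (snd q))" and "\<phi>1 = (\<lambda>q. th1 (fst q) - th1 (snd q))"
 define X where "X = (\<lambda>t. K (pt N (p t)))"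
 have p: "p t \<in> chamber N" if "t \<in> {0..1}" for t
  unfolding p_def d_def by (rule chamber_convex[OF assms that])
 have X: "(X has_vector_derivative gen d (p t) (X t)) (at t)" if "t \<in> {0..1}" for t
  unfolding X_def p_def using K_line p[OF that] by (auto simp: p_def)
 have "\<exists>E E'. (\<forall>t\<in>{0..1}. (E has_real_derivative E' t) (at t) \<and>
   \<bar>\<phi>1 q - \<phi>0 q\<bar> * \<bar>cot ((\<phi>0 q + t * (\<phi>1 q - \<phi>0 q)) / 2)\<bar> <= E' t) \<and>
   E 1 - E 0 <= 2 * ln (pi / \<bar>sin (\<phi>0 q / 2)\<bar>) + 2 * ln (pi / \<bar>sin (\<phi>1 q / 2)\<bar>)" if q: "q \<in> pairs N" for q
 proof (rule pair_comparison)
  obtain i j where ij: "q = (i, j)" "(i, j) \<in> pairs N" using q by (cases q) auto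
  then have "i < j \<or> j < i" by (auto simp: pairs_def)
  then show "\<phi>0 q \<in> {0<..<2 * pi} \<and> \<phi>1 q \<in> {0<..<2 * pi} \<or>
    \<phi>0 q \<in> {- 2 * pi<..<0} \<and> \<phi>1 q \<in> {- 2 * pi<..<0}"
   using chamber_diff[OF th0 ij(2)] chamber_diff[OF th1 ij(2)] by (simp add: \<phi>0_def \<phi>1_def ij(1)) blast
 qed
 then obtain E E' where E: "\<And>q t. q \<in> pairs N ==> t \<in> {0..1} ==> (E q has_real_derivative E' q t) (at t)"
  "\<And>q t. q \<in> pairs N ==> t \<in> {0..1} ==>
    \<bar>\<phi>1 q - \<phi>0 q\<bar> * \<bar>cot ((\<phi>0 q + t * (\<phi>1 q - \<phi>0 q)) / 2)\<bar> <= E' q t"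
  "\<And>q. q \<in> pairs N ==> E q 1 - E q 0 <= 2 * ln (pi / \<bar>sin (\<phi>0 q / 2)\<bar>) + 2 * ln (pi / \<bar>sin (\<phi>1 q / 2)\<bar>)"
  by metis
 define F where "F = (\<lambda>t. \<bar>\<kappa>\<bar> * (\<Sum>q\<in>pairs N. E q t))"
 define F' where "F' = (\<lambda>t. \<bar>\<kappa>\<bar> * (\<Sum>q\<in>pairs N. E' q t))"
 define u where "u = (\<lambda>t. exp (- F t) * inner (X t) (X t))"
 have "u 1 <= u 0"
 proof (rule DERIV_nonpos_imp_nonincreasing[of 0 1 u])
  fix t :: real assume "0 <= t" "t <= 1"
  then have t: "t \<in> {0..1}" by simp
  have F: "(F has_real_derivative F' t) (at t)"
   unfolding F_def F'_def by (intro DERIV_cmult DERIV_sum E(1) t)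
  have "((\<lambda>t. inner (X t) (X t)) has_vector_derivative
    (inner (X t) (gen d (p t) (X t)) + inner (gen d (p t) (X t)) (X t))) (at t)"
   by (rule bounded_bilinear.has_vector_derivative[OF bounded_bilinear_inner X[OF t] X[OF t]])
  then have I: "((\<lambda>t. inner (X t) (X t)) has_real_derivative 2 * inner (X t) (gen d (p t) (X t))) (at t)"
   by (simp add: has_real_derivative_iff_has_vector_derivative inner_commute)
  have "(u has_real_derivative exp (- F t) * (2 * inner (X t) (gen d (p t) (X t)))
    + (exp (- F t) * - F' t) * inner (X t) (X t)) (at t)"
   unfolding u_def by (auto intro!: derivative_eq_intros F I)
  moreover have "2 * inner (X t) (gen d (p t) (X t)) <= F' t * inner (X t) (X t)"
  proof -
   have "(\<Sum>(i, j)\<in>pairs N. \<bar>\<kappa>\<bar> * (\<bar>d i - d j\<bar> * \<bar>cot ((p t i - p t j) / 2)\<bar>)) <= F' t"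
    unfolding F'_def sum_distrib_left
   proof (intro sum_mono, clarify)
    fix i j assume ij: "(i, j) \<in> pairs N"
    have "d i - d j = \<phi>1 (i, j) - \<phi>0 (i, j)" "p t i - p t j = \<phi>0 (i, j) + t * (\<phi>1 (i, j) - \<phi>0 (i, j))"
     by (simp_all add: d_def p_def \<phi>0_def \<phi>1_def algebra_simps)
    then show "\<bar>\<kappa>\<bar> * (\<bar>d i - d j\<bar> * \<bar>cot ((p t i - p t j) / 2)\<bar>) <= \<bar>\<kappa>\<bar> * E' (i, j) t"
     using E(2)[OF ij t] by (simp only:) (rule mult_left_mono, simp_all)
   qed
   then show ?thesis
    using inner_gen_le[of "X t" d "p t"] mult_right_mono[of _ _ "inner (X t) (X t)"]
    by (meson inner_ge_zero order_trans)
  qed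
  then have "exp (- F t) * (2 * inner (X t) (gen d (p t) (X t)) - F' t * inner (X t) (X t)) <= 0"
   by (intro mult_nonneg_nonpos) auto
  then have "exp (- F t) * (2 * inner (X t) (gen d (p t) (X t)))
    + (exp (- F t) * - F' t) * inner (X t) (X t) <= 0" by (simp add: algebra_simps)
  ultimately show "\<exists>y. (u has_real_derivative y) (at t) \<and> y <= 0" by blast
 qed simp
 then have "exp (F 1) * (exp (- F 1) * inner (X 1) (X 1)) <= exp (F 1) * (exp (- F 0) * inner (X 0) (X 0))"
  unfolding u_def by (intro mult_left_mono) auto
 then have "inner (X 1) (X 1) <= inner (X 0) (X 0) * exp (F 1 - F 0)"
  by (simp add: mult.assoc[symmetric] exp_diff exp_minus field_simps)
 also have "\<dots> <= inner (X 0) (X 0) * exp (\<bar>\<kappa>\<bar> * (\<Sum>q\<in>pairs N.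
   2 * ln (pi / \<bar>sin (\<phi>0 q / 2)\<bar>) + 2 * ln (pi / \<bar>sin (\<phi>1 q / 2)\<bar>)))"
  unfolding F_def right_diff_distrib[symmetric] sum_subtractf[symmetric]
  by (intro mult_left_mono exp_mono sum_mono E(3)) (auto simp: inner_ge_zero)
 finally show ?thesis
  by (simp add: X_def p_def d_def \<phi>0_def \<phi>1_def split_def power2_norm_eq_inner)
qed

text \<open>Summing over all pairs, the exponent at a point whose coordinates have mutual distance at least
 \<open>\<delta>\<close> is \<open>\<bar>\<kappa>\<bar> N (N - 1)\<close>; the hypothesis on \<open>\<kappa>\<close> makes it less than one half.\<close>

abbreviation expo :: real where
 "expo \<equiv> \<bar>\<kappa>\<bar> * real (N * (N - 1))"

lemma K_bound:
 "\<exists>C>0. \<forall>x\<in>torus_reg N. \<forall>\<delta>>0. (\<forall>(i, j)\<in>pairs N. \<delta> <= cmod (x i - x j)) \<longrightarrow>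
   norm (K x) <= C * \<delta> powr (- expo)"
proof -
 define a where "a = regular_angles N"
 have a: "a \<in> chamber N" unfolding a_def using N3 by (intro regular_angles_chamber) auto
 define S0 where "S0 = (\<Sum>(i, j)\<in>pairs N. 2 * ln (pi / \<bar>sin ((a i - a j) / 2)\<bar>))"
 define C where "C = norm (K (pt N a)) * exp (\<bar>\<kappa>\<bar> * S0 / 2) * (2 * pi) powr expo + 1"
 have chamber_case: "norm (K (pt N th)) <= C * \<delta> powr (- expo)"
  if th: "th \<in> chamber N" and \<delta>: "\<delta> > 0" "\<forall>(i, j)\<in>pairs N. \<delta> <= cmod (pt N th i - pt N th j)" for th \<delta>
 proof -
  have "ln (pi / \<bar>sin ((th i - th j) / 2)\<bar>) <= ln (2 * pi / \<delta>)" if ij: "(i, j) \<in> pairs N" for i j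
  proof (rule ln_mono)
   have "\<delta> <= 2 * \<bar>sin ((th i - th j) / 2)\<bar>"
   proof -
    have "\<delta> <= cmod (pt N th i - pt N th j)" using \<delta>(2) ij by blast
    then show ?thesis using ij chord_eq[of "th i" "th j"] by (simp add: pairs_def pt_def)
   qed
   then show "pi / \<bar>sin ((th i - th j) / 2)\<bar> <= 2 * pi / \<delta>"
    using \<delta>(1) by (simp add: frac_le field_simps)
   show "0 < pi / \<bar>sin ((th i - th j) / 2)\<bar>"
    using \<open>\<delta> <= _\<close> \<delta>(1) by simp
  qed
  then have "(\<Sum>(i, j)\<in>pairs N. 2 * ln (pi / \<bar>sin ((th i - th j) / 2)\<bar>)) \<le>
    (\<Sum>(i, j)\<in>pairs N. 2 * ln (2 * pi / \<delta>))"
   by (intro sum_mono) auto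
  also have "\<dots> = 2 * (real (N * (N - 1)) * ln (2 * pi / \<delta>))" by (simp add: card_pairs split_def)
  finally have S1: "S0 + (\<Sum>(i, j)\<in>pairs N. 2 * ln (pi / \<bar>sin ((th i - th j) / 2)\<bar>)) \<le>
    S0 + 2 * (real (N * (N - 1)) * ln (2 * pi / \<delta>))" by simp
  have "(norm (K (pt N th)))\<^sup>2 <= (norm (K (pt N a)))\<^sup>2 *
    exp (\<bar>\<kappa>\<bar> * (S0 + (\<Sum>(i, j)\<in>pairs N. 2 * ln (pi / \<bar>sin ((th i - th j) / 2)\<bar>))))"
   using K_growth[OF a th] by (simp add: S0_def sum.distrib split_def)
  also have "\<dots> <= (norm (K (pt N a)))\<^sup>2 * exp (\<bar>\<kappa>\<bar> * (S0 + 2 * (real (N * (N - 1)) * ln (2 * pi / \<delta>))))"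
   by (intro mult_left_mono exp_mono S1) auto
  also have "\<bar>\<kappa>\<bar> * (S0 + 2 * (real (N * (N - 1)) * ln (2 * pi / \<delta>))) =
    2 * (\<bar>\<kappa>\<bar> * S0 / 2 + expo * ln (2 * pi / \<delta>))" by (simp add: algebra_simps)
  also have "exp \<dots> = (exp (\<bar>\<kappa>\<bar> * S0 / 2) * (2 * pi / \<delta>) powr expo)\<^sup>2"
   unfolding exp_double exp_add using \<delta>(1) by (simp add: powr_def)
  finally have "(norm (K (pt N th)))\<^sup>2 \<le>
    (norm (K (pt N a)) * (exp (\<bar>\<kappa>\<bar> * S0 / 2) * (2 * pi / \<delta>) powr expo))\<^sup>2"
   by (simp add: power_mult_distrib)
  then have "norm (K (pt N th)) <= norm (K (pt N a)) * (exp (\<bar>\<kappa>\<bar> * S0 / 2) * (2 * pi / \<delta>) powr expo)"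
   by (rule power2_le_imp_le) auto
  also have "(2 * pi / \<delta>) powr expo = (2 * pi) powr expo * \<delta> powr (- expo)"
   using \<delta>(1) by (simp add: powr_divide powr_minus_divide)
  finally have "norm (K (pt N th)) <= (C - 1) * \<delta> powr (- expo)" by (simp add: C_def mult.assoc)
  also have "\<dots> <= C * \<delta> powr (- expo)" by (intro mult_right_mono) auto
  finally show ?thesis .
 qed
 show ?thesis
 proof (intro exI[of _ C] conjI ballI allI impI)
  show "C > 0" unfolding C_def by (intro add_nonneg_pos mult_nonneg_nonneg) auto
  fix x \<delta> assume x: "x \<in> torus_reg N" and \<delta>: "\<delta> > 0" "\<forall>(i, j)\<in>pairs N. \<delta> <= cmod (x i - x j)"
  obtain w th where w: "w permutes {1..N}" "th \<in> chamber N" "x \<circ> w = pt N th"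
   using torus_reg_sorted[OF x] N3 by auto
  have "\<forall>(i, j)\<in>pairs N. \<delta> <= cmod (pt N th i - pt N th j)"
  proof clarify
   fix i j assume "(i, j) \<in> pairs N"
   then have "(w i, w j) \<in> pairs N"
    using permutes_in_image[OF w(1)] inj_eq[OF permutes_inj[OF w(1)]] by (simp add: pairs_def del: atLeastAtMost_iff)
   then show "\<delta> <= cmod (pt N th i - pt N th j)" using \<delta>(2) by (auto simp flip: w(3))
  qed
  from chamber_case[OF w(2) \<delta>(1) this] show "norm (K x) <= C * \<delta> powr (- expo)"
   using norm_K_comp[OF x w(1)] by (simp add: w(3))
 qed
qed

end

section \<open>Vanishing of the anticommuting part on the walls\<close>

lemma sin_ge_half:
 fixes x :: real
 assumes "0 <= x" "x <= pi / 2"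
 shows "x / 2 <= sin x"
proof (cases "x = 0")
 case False
 have s: "sin (x / 2) > 0" using assms False by (intro sin_gt_zero) auto
 have "cot (x / 2) <= 1 / (x / 2)" using assms False by (intro cot_le_inverse) auto
 then have "x * cos (x / 2) <= 2 * sin (x / 2)" using s assms False by (simp add: cot_def field_simps)
 moreover have "cos (x / 2) >= 0" using assms by (intro cos_ge_zero) auto
 ultimately have "x * cos (x / 2) * cos (x / 2) <= 2 * sin (x / 2) * cos (x / 2)"
  by (intro mult_right_mono)
 also have "2 * sin (x / 2) * cos (x / 2) = sin x" using sin_double[of "x / 2"] by simp
 finally have "x * (cos (x / 2))\<^sup>2 <= sin x" by (simp add: power2_eq_square mult.assoc)
 moreover have "(cos (x / 2))\<^sup>2 = (1 + cos x) / 2"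
  using cos_double_cos[of "x / 2"] by simp
 moreover have "x * (1 / 2) <= x * ((1 + cos x) / 2)"
  using assms by (intro mult_left_mono) (auto intro!: cos_ge_zero)
 ultimately show ?thesis by simp
qed simp

lemma sin_half_ge:
 assumes "m <= \<phi>" "\<phi> <= 2 * pi - m" "0 <= m" "m <= pi"
 shows "sin (m / 2) <= sin (\<phi> / 2)"
proof (cases "\<phi> <= pi")
 case True
 then show ?thesis using assms by (intro sin_monotone_2pi_le) auto
next
 case False
 then have "sin (m / 2) <= sin (pi - \<phi> / 2)" using assms by (intro sin_monotone_2pi_le) auto
 then show ?thesis by simp
qed

lemma abs_cot_le_inverse_sin:
 fixes x :: real
 assumes "m > 0" "\<bar>sin x\<bar> >= m"
 shows "\<bar>cot x\<bar> <= 1 / m"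
proof -
 have "\<bar>cot x\<bar> = \<bar>cos x\<bar> / \<bar>sin x\<bar>" by (simp add: cot_def abs_divide)
 also have "\<dots> <= 1 / m" using assms by (intro frac_le) auto
 finally show ?thesis .
qed

lemma abs_cot_diff_le:
 fixes x y :: real
 assumes "m > 0" "\<bar>sin x\<bar> >= m" "\<bar>sin y\<bar> >= m"
 shows "\<bar>cot x - cot y\<bar> <= \<bar>x - y\<bar> / (m * m)"
proof -
 have "sin x ~= 0" "sin y ~= 0" using assms by auto
 then have "cot x - cot y = sin (y - x) / (sin x * sin y)"
  by (simp add: cot_def sin_diff field_simps)
 then have "\<bar>cot x - cot y\<bar> = \<bar>sin (y - x)\<bar> / (\<bar>sin x\<bar> * \<bar>sin y\<bar>)" by (simp add: abs_mult)
 also have "\<dots> <= \<bar>y - x\<bar> / (m * m)"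
  using assms abs_sin_x_le_abs_x[of "y - x"] by (intro frac_le mult_mono) auto
 finally show ?thesis by (simp add: abs_minus_commute)
qed

text \<open>Angles near the wall on which the last two coordinates meet: they lie symmetrically around \<open>c\<close>.\<close>

definition wpt :: "nat => (nat => real) => real => real => nat => real" where
 "wpt N q c s = (\<lambda>i. if i = N - 1 then c - s else if i = N then c + s else q i)"

definition wgap :: "nat => (nat => real) => real => real => bool" where
 "wgap N q c et \<longleftrightarrow> (\<forall>i\<in>{1..<N - 2}. q i + et <= q (i + 1)) \<and> q (N - 2) + et <= c \<and> c + et <= q 1 + 2 * pi"

abbreviation last_pairs :: "nat => (nat \<times> nat) set" where
 "last_pairs N \<equiv> {(N - 1, N), (N, N - 1)}"

lemma wgap_pairs:
 assumes "N >= 3" "wgap N q c et" "0 < et" "0 <= s" "s <= et / 2"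
  and ij: "1 <= i" "i < j" "j <= N" "i ~= N - 1"
 shows "wpt N q c s j - wpt N q c s i \<in> {et / 2..2 * pi - et / 2}"
proof -
 have mono: "i < j ==> 1 <= i ==> j <= N - 2 ==> q i + et <= q j" for i j
 proof (induction j)
  case (Suc j)
  have "q j + et <= q (j + 1)" if "1 <= j" using assms(2) Suc.prems that by (auto simp: wgap_def)
  then show ?case using Suc assms(3) by (cases "i = j") (auto simp: less_Suc_eq)
 qed simp
 have i: "i <= N - 2" using ij by auto
 have q1: "q 1 <= q i" using mono[of 1 i] assms(3) ij i by (cases "i = 1") auto
 have qN: "q k <= q (N - 2)" if "1 <= k" "k <= N - 2" for k
  using mono[of k "N - 2"] assms(3) that by (cases "k = N - 2") auto
 have ends: "q (N - 2) + et <= c" "c + et <= q 1 + 2 * pi" using assms(2) by (auto simp: wgap_def)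
 have wi: "wpt N q c s i = q i" using i ij assms(1) by (auto simp: wpt_def)
 show ?thesis
 proof (cases "j <= N - 2")
  case True
  then have wj: "wpt N q c s j = q j" using assms(1) by (auto simp: wpt_def)
  have "q i + et <= q j" using mono ij True by auto
  moreover have "q j <= q (N - 2)" using qN True ij by auto
  ultimately show ?thesis unfolding wi wj using ends q1 assms(3) by auto
 next
  case False
  then have "j = N - 1 \<or> j = N" using ij by auto
  then have "wpt N q c s j = c - s \<or> wpt N q c s j = c + s" by (auto simp: wpt_def)
  moreover have "q i <= q (N - 2)" using qN i ij by auto
  ultimately show ?thesis unfolding wi using ends q1 assms(3,4,5) by auto
 qed
qed

lemma wgap_sin:
 assumes "N >= 3" "wgap N q c et" "0 < et" "et <= 1" "0 <= s" "s <= et / 2"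
  and p: "(i, j) \<in> pairs N" "(i, j) \<notin> last_pairs N"
 shows "sin (et / 4) <= \<bar>sin ((wpt N q c s i - wpt N q c s j) / 2)\<bar>"
proof -
 have main: "sin (et / 4) <= \<bar>sin ((wpt N q c s j - wpt N q c s i) / 2)\<bar>"
  if "1 <= i" "i < j" "j <= N" "i ~= N - 1" for i j
  using sin_half_ge[of "et / 2" "wpt N q c s j - wpt N q c s i"] wgap_pairs[OF assms(1-3,5,6) that]
   assms(3,4) pi_gt3 by auto
 have sym: "\<bar>sin ((a - b) / 2)\<bar> = \<bar>sin ((b - a) / 2)\<bar>" for a b :: real
  using sin_minus[of "(a - b) / 2"] by (simp add: minus_divide_left)
 show ?thesis
 proof (cases "i < j")
  case True
  then show ?thesis using main[of i j] p by (subst sym) (auto simp: pairs_def)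
 next
  case False
  then show ?thesis using main[of j i] p by (auto simp: pairs_def)
 qed
qed

lemma wgap_chamber:
 assumes "N >= 3" "wgap N q c et" "0 < et" "0 < s" "s <= et / 2"
 shows "wpt N q c s \<in> chamber N"
 unfolding chamber_def
proof (intro CollectI conjI ballI)
 fix i assume i: "i \<in> {1..<N}"
 show "wpt N q c s i < wpt N q c s (i + 1)"
 proof (cases "i = N - 1")
  case True
  then show ?thesis using assms by (auto simp: wpt_def)
 next
  case False
  then show ?thesis using wgap_pairs[OF assms(1-3) _ assms(5), of i "i + 1"] i assms by auto
 qed
next
 show "wpt N q c s N < wpt N q c s 1 + 2 * pi"
 proof -
  have "(1::nat) ~= N - 1" using assms(1) by auto
  then have "wpt N q c s N - wpt N q c s 1 \<in> {et / 2..2 * pi - et / 2}"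
   using assms by (intro wgap_pairs) auto
  then show ?thesis using assms(3) by auto
 qed
qed

lemma wgap_convex:
 assumes "wgap N q c et" "wgap N q' c' et" "t \<in> {0..1}"
 shows "wgap N (\<lambda>i. q i + t * (q' i - q i)) (c + t * (c' - c)) et"
proof -
 have conv: "a + t * (a' - a) + et <= b + t * (b' - b)" if "a + et <= b" "a' + et <= b'" for a b a' b' :: real
 proof -
  have "(1 - t) * (a + et) + t * (a' + et) <= (1 - t) * b + t * b'"
   using that assms(3) by (intro add_mono mult_left_mono) auto
  then show ?thesis by (simp add: algebra_simps)
 qed
 have "c + t * (c' - c) + et <= (q 1 + 2 * pi) + t * ((q' 1 + 2 * pi) - (q 1 + 2 * pi))"
  using assms by (intro conv) (auto simp: wgap_def)
 then show ?thesis using assms by (auto simp: wgap_def intro!: conv)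
qed

definition wall :: "nat => (nat => real) => real => bool" where
 "wall N q c \<longleftrightarrow> (\<forall>i\<in>{1..<N - 2}. q i < q (i + 1)) \<and> q (N - 2) < c \<and> c < q 1 + 2 * pi"

lemma wall_wgap:
 assumes "wall N q c"
 shows "\<exists>et>0. et <= 1 \<and> (\<forall>et'\<le>et. wgap N q c et')"
proof -
 define G where "G = insert 1 (insert (c - q (N - 2)) (insert (q 1 + 2 * pi - c) ((\<lambda>i. q (i + 1) - q i) ` {1..<N - 2})))"
 have G: "finite G" "G ~= {}" "\<And>g. g \<in> G ==> g > 0" using assms by (auto simp: G_def wall_def)
 show ?thesis
 proof (intro exI[of _ "Min G"] conjI allI impI)
  show "Min G > 0" using G by (simp add: Min_gr_iff)
  show "Min G <= 1" using Min_le[OF G(1), of 1] by (simp add: G_def)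
  fix et' assume "et' <= Min G"
  then have "et' <= g" if "g \<in> G" for g using Min_le[OF G(1) that] by simp
  from this[of "c - q (N - 2)"] this[of "q 1 + 2 * pi - c"] this[of "q (_ + 1) - q _"]
  show "wgap N q c et'" by (auto simp: wgap_def G_def algebra_simps)
 qed
qed

context torus_form
begin

abbreviation sw :: "nat => nat" where
 "sw \<equiv> Transposition.transpose (N - 1) N"

text \<open>The part of \<open>X\<close> that anticommutes with the last reflection, up to a factor 2.\<close>

definition anti :: "complex^'t^'t => complex^'t^'t" where
 "anti X = X - refl (N - 1) N ** X ** refl (N - 1) N"

lemma last_pair: "(N - 1, N) \<in> pairs N"
 using N3 by (auto simp: pairs_def)

lemma sw_permutes: "sw permutes {1..N}"
 by (rule transpose_permutes[OF last_pair])

lemma conj_refl: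
 "refl (N - 1) N ** gen d th X ** refl (N - 1) N = gen (d \<circ> sw) (th \<circ> sw) (refl (N - 1) N ** X ** refl (N - 1) N)"
 using gen_conj[OF sw_permutes, of "d \<circ> sw" d "th \<circ> sw" th X] refl_hermitian[OF last_pair]
 by (simp del: One_nat_def)

lemma norm_conj_refl: "norm (refl (N - 1) N ** X ** refl (N - 1) N) = norm X"
 using norm_\<tau>_conj[OF sw_permutes, of X] by (simp add: refl_hermitian[OF last_pair] del: One_nat_def)

lemma norm_anti_le: "norm (anti X) <= 2 * norm X"
 unfolding anti_def using norm_triangle_ineq4[of X "refl (N - 1) N ** X ** refl (N - 1) N"]
 by (simp add: norm_conj_refl del: One_nat_def)

lemma bounded_linear_anti: "bounded_linear anti"
 unfolding anti_def
 by (intro bounded_linear_sub bounded_linear_ident bounded_linear_compose[OF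
  mm.bounded_linear_left mm.bounded_linear_right])

lemma anti_derivative:
 assumes "(X has_vector_derivative gen d th (X t)) (at t within A)"
 shows "((\<lambda>t. anti (X t)) has_vector_derivative
  gen d th (X t) - gen (d \<circ> sw) (th \<circ> sw) (refl (N - 1) N ** X t ** refl (N - 1) N)) (at t within A)"
 using bounded_linear.has_vector_derivative[OF bounded_linear_anti assms]
 by (simp add: anti_def conj_refl del: One_nat_def)

definition wall_zero :: "(nat => real) => real => bool" where
 "wall_zero q c \<longleftrightarrow> ((\<lambda>s. anti (K (pt N (wpt N q c s)))) \<longlongrightarrow> 0) (at_right 0)"

text \<open>Moving parallel to the wall keeps the last two coordinates at distance \<open>2 s\<close>, so the singular
 coefficient of the last reflection drops out of the equation for the anticommuting part. What
 remains is a linear equation with bounded coefficients and an inhomogeneity of order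
 \<open>s \<cdot> s powr (- expo)\<close>.\<close>

lemma wall_step_bound:
 assumes w0: "wgap N q0 c0 et" and w1: "wgap N q1 c1 et" and et: "0 < et" "et <= 1"
 shows "\<exists>B D. B >= 0 \<and> D >= 0 \<and> (\<forall>s. 0 < s \<and> s <= et / 2 \<and> s <= 2 * sin (et / 4) \<longrightarrow>
  (norm (anti (K (pt N (wpt N q1 c1 s)))))\<^sup>2 <= exp (2 * B + 1) *
   ((norm (anti (K (pt N (wpt N q0 c0 s)))))\<^sup>2 + (D * s powr (1 - expo))\<^sup>2))"
proof -
 define m where "m = sin (et / 4)"
 have m: "m > 0" unfolding m_def using et pi_gt3 by (intro sin_gt_zero) auto
 define d where "d = (\<lambda>i. if i = N - 1 \<or> i = N then c1 - c0 else q1 i - q0 i)"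
 have d_sw: "d \<circ> sw = d" by (auto simp: d_def fun_eq_iff Transposition.transpose_def)
 obtain C where C: "C > 0" "\<And>x \<delta>. x \<in> torus_reg N ==> \<delta> > 0 ==>
   (\<forall>(i, j)\<in>pairs N. \<delta> <= cmod (x i - x j)) ==> norm (K x) <= C * \<delta> powr (- expo)"
  using K_bound by blast
 define B where "B = (\<Sum>(i, j)\<in>pairs N. \<bar>\<kappa>\<bar> / 2 * (\<bar>d i + d j\<bar> + \<bar>d i - d j\<bar> * (1 / m)))"
 define S where "S = (\<Sum>(i, j)\<in>pairs N. \<bar>\<kappa>\<bar> / 2 * (\<bar>d i - d j\<bar> * (2 / (m * m))))"
 define D where "D = S * C"
 have B0: "B >= 0" unfolding B_def using m by (intro sum_nonneg) auto
 have S0: "S >= 0" unfolding S_def using m by (intro sum_nonneg) auto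
 then have D0: "D >= 0" unfolding D_def using C(1) by (intro mult_nonneg_nonneg) auto
 have main: "(norm (anti (K (pt N (wpt N q1 c1 s)))))\<^sup>2 <= exp (2 * B + 1) *
   ((norm (anti (K (pt N (wpt N q0 c0 s)))))\<^sup>2 + (D * s powr (1 - expo))\<^sup>2)"
  if s: "0 < s" "s <= et / 2" "s <= 2 * m" for s
 proof -
  define p where "p = (\<lambda>t i. wpt N q0 c0 s i + t * d i)"
  have p_eq: "p t = wpt N (\<lambda>i. q0 i + t * (q1 i - q0 i)) (c0 + t * (c1 - c0)) s" for t
   by (auto simp: p_def wpt_def d_def fun_eq_iff)
  define X where "X = (\<lambda>t. K (pt N (p t)))"
  define Y where "Y = (\<lambda>t. refl (N - 1) N ** X t ** refl (N - 1) N)"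
  have gap: "wgap N (\<lambda>i. q0 i + t * (q1 i - q0 i)) (c0 + t * (c1 - c0)) et" if "t \<in> {0..1}" for t
   by (rule wgap_convex[OF w0 w1 that])
  have ch: "p t \<in> chamber N" if "t \<in> {0..1}" for t
   unfolding p_eq by (rule wgap_chamber[OF N3 gap[OF that] et(1) s(1,2)])
  have sinm: "m <= \<bar>sin ((p t i - p t j) / 2)\<bar>"
   if "t \<in> {0..1}" "(i, j) \<in> pairs N" "(i, j) \<notin> last_pairs N" for t i j
   unfolding m_def p_eq using s by (intro wgap_sin[OF N3 gap[OF that(1)] et _ s(2) that(2,3)]) auto
  have Xder: "(X has_vector_derivative gen d (p t) (X t)) (at t within {0..1})" if "t \<in> {0..1}" for t
   unfolding X_def using K_line[of "wpt N q0 c0 s" t d] ch[OF that] by (simp add: p_def)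
  have sw_p: "\<bar>p t i - p t (sw i)\<bar> <= 2 * s" for t i
   using s(1) N3 by (auto simp: p_eq wpt_def Transposition.transpose_def)
  have normX: "norm (X t) <= C * s powr (- expo)" if t: "t \<in> {0..1}" for t
   unfolding X_def
  proof (rule C(2)[OF chamber_torus_reg[OF ch[OF t]] s(1)], clarify)
   fix i j assume ij: "(i, j) \<in> pairs N"
   have "pt N (p t) i - pt N (p t) j = cis (p t i) - cis (p t j)"
    using ij by (simp add: pairs_def pt_def)
   then have chord: "cmod (pt N (p t) i - pt N (p t) j) = 2 * \<bar>sin ((p t i - p t j) / 2)\<bar>"
    by (simp add: chord_eq)
   show "s <= cmod (pt N (p t) i - pt N (p t) j)"
   proof (cases "(i, j) \<in> last_pairs N")
    case True
    then have "\<bar>sin ((p t i - p t j) / 2)\<bar> = \<bar>sin s\<bar>"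
     using N3 by (auto simp: p_eq wpt_def)
    moreover have "s / 2 <= sin s" using s et pi_gt3 by (intro sin_ge_half) auto
    ultimately show ?thesis unfolding chord by linarith
   next
    case False
    then show ?thesis unfolding chord using sinm[OF t ij False] s(3) by linarith
   qed
  qed
  have "(norm (anti (X 1)))\<^sup>2 <= exp (2 * B + 1) *
    ((norm (anti (X 0)))\<^sup>2 + (D * s powr (1 - expo))\<^sup>2)"
  proof (rule gronwall[where X = "\<lambda>t. anti (X t)"
     and X' = "\<lambda>t. gen d (p t) (X t) - gen d (p t \<circ> sw) (Y t)"])
   fix t :: real assume t: "t \<in> {0..1}"
   show "((\<lambda>t. anti (X t)) has_vector_derivative gen d (p t) (X t) - gen d (p t \<circ> sw) (Y t))
     (at t within {0..1})"
    using anti_derivative[OF Xder[OF t]] by (simp add: d_sw Y_def del: One_nat_def)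
   have split: "gen d (p t) (X t) - gen d (p t \<circ> sw) (Y t) =
     gen d (p t) (anti (X t)) + (gen d (p t) (Y t) - gen d (p t \<circ> sw) (Y t))"
    by (simp add: anti_def Y_def gen_linear del: One_nat_def)
   have "norm (gen d (p t) (anti (X t))) <= gen_bound d (p t) * norm (anti (X t))"
    by (rule norm_gen_le)
   also have "\<dots> <= B * norm (anti (X t))"
   proof (intro mult_right_mono)
    show "gen_bound d (p t) <= B"
     unfolding gen_bound_def B_def
    proof (intro sum_mono, clarify)
     fix i j assume ij: "(i, j) \<in> pairs N"
     have "\<bar>d i - d j\<bar> * \<bar>cot ((p t i - p t j) / 2)\<bar> <= \<bar>d i - d j\<bar> * (1 / m)"
     proof (cases "(i, j) \<in> last_pairs N")
      case True
      then have "d i = d j" by (auto simp: d_def)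
      then show ?thesis by simp
     next
      case False
      then show ?thesis by (intro mult_left_mono abs_cot_le_inverse_sin m sinm[OF t ij]) auto
     qed
     then show "\<bar>\<kappa>\<bar> / 2 * (\<bar>d i + d j\<bar> + \<bar>d i - d j\<bar> * \<bar>cot ((p t i - p t j) / 2)\<bar>) \<le>
       \<bar>\<kappa>\<bar> / 2 * (\<bar>d i + d j\<bar> + \<bar>d i - d j\<bar> * (1 / m))"
      by (intro mult_left_mono) auto
    qed
   qed simp
   finally have 1: "norm (gen d (p t) (anti (X t))) <= B * norm (anti (X t))" .
   have "norm (gen d (p t) (Y t) - gen d (p t \<circ> sw) (Y t)) <= (\<Sum>(i, j)\<in>pairs N. \<bar>\<kappa>\<bar> / 2 *
     (\<bar>d i - d j\<bar> * \<bar>cot ((p t i - p t j) / 2) - cot (((p t \<circ> sw) i - (p t \<circ> sw) j) / 2)\<bar>)) * norm (Y t)"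
    by (rule norm_gen_diff_le)
   also have "\<dots> <= (\<Sum>(i, j)\<in>pairs N. \<bar>\<kappa>\<bar> / 2 * (\<bar>d i - d j\<bar> * (2 / (m * m)) * s)) * norm (Y t)"
   proof (intro mult_right_mono sum_mono, clarify)
    fix i j assume ij: "(i, j) \<in> pairs N"
    have "\<bar>d i - d j\<bar> * \<bar>cot ((p t i - p t j) / 2) - cot (((p t \<circ> sw) i - (p t \<circ> sw) j) / 2)\<bar>
      <= \<bar>d i - d j\<bar> * (2 / (m * m)) * s"
    proof (cases "(i, j) \<in> last_pairs N")
     case True
     then have "d i = d j" by (auto simp: d_def)
     then show ?thesis by simp
    next
     case False
     have ij': "(sw i, sw j) \<in> pairs N"
      using ij permutes_in_image[OF sw_permutes] inj_eq[OF permutes_inj[OF sw_permutes]]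
      by (simp add: pairs_def del: atLeastAtMost_iff)
     have "sw (sw i) = i" "sw (sw j) = j" by simp_all
     then have not_last: "(sw i, sw j) \<notin> last_pairs N"
      using False N3 by (auto simp: Transposition.transpose_def split: if_splits)
     have "\<bar>(p t i - p t j) / 2 - (p t (sw i) - p t (sw j)) / 2\<bar> <= 2 * s"
      using sw_p[of t i] sw_p[of t j] by (simp add: abs_le_iff field_simps)
     then have "\<bar>(p t i - p t j) / 2 - (p t (sw i) - p t (sw j)) / 2\<bar> / (m * m) <= 2 / (m * m) * s"
      using m by (simp add: divide_right_mono)
     then have "\<bar>cot ((p t i - p t j) / 2) - cot ((p t (sw i) - p t (sw j)) / 2)\<bar> <= 2 / (m * m) * s"
      using abs_cot_diff_le[OF m sinm[OF t ij False] sinm[OF t ij' not_last]] by linarith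
     then show ?thesis unfolding mult.assoc o_apply by (intro mult_left_mono) auto
    qed
    then show "\<bar>\<kappa>\<bar> / 2 * (\<bar>d i - d j\<bar> * \<bar>cot ((p t i - p t j) / 2) - cot (((p t \<circ> sw) i - (p t \<circ> sw) j) / 2)\<bar>)
      <= \<bar>\<kappa>\<bar> / 2 * (\<bar>d i - d j\<bar> * (2 / (m * m)) * s)"
     by (intro mult_left_mono) auto
   qed auto
   also have "\<dots> = S * s * norm (X t)"
    by (simp del: One_nat_def add: S_def Y_def norm_conj_refl sum_distrib_right split_def mult.assoc)
   also have "\<dots> <= S * s * (C * s powr (- expo))"
    using s(1) S0 by (intro mult_left_mono normX t) auto
   also have "\<dots> = D * s powr (1 - expo)"
    using s(1) by (simp add: D_def powr_diff powr_minus divide_inverse)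
   finally have 2: "norm (gen d (p t) (Y t) - gen d (p t \<circ> sw) (Y t)) <= D * s powr (1 - expo)" .
   show "norm (gen d (p t) (X t) - gen d (p t \<circ> sw) (Y t)) <= B * norm (anti (X t)) + D * s powr (1 - expo)"
    unfolding split using 1 2 norm_triangle_ineq by (meson add_mono order_trans)
  qed (use B0 D0 in auto)
  moreover have "p 0 = wpt N q0 c0 s" "p 1 = wpt N q1 c1 s" by (auto simp: p_def wpt_def d_def)
  ultimately show ?thesis by (simp add: X_def)
 qed
 show ?thesis
  using B0 D0 main unfolding m_def by blast
qed

text \<open>The points of the wall form a convex set, so the previous bound compares any two of them; both of its
 terms tend to zero at the wall.\<close>

lemma wall_step:
 assumes small: "expo < 1" and w0: "wall N q0 c0" and w1: "wall N q1 c1" and z: "wall_zero q0 c0"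
 shows "wall_zero q1 c1"
proof -
 obtain et0 where et0: "et0 > 0" "et0 <= 1" "\<forall>et'\<le>et0. wgap N q0 c0 et'" using wall_wgap[OF w0] by blast
 obtain et1 where et1: "et1 > 0" "et1 <= 1" "\<forall>et'\<le>et1. wgap N q1 c1 et'" using wall_wgap[OF w1] by blast
 define et where "et = min et0 et1"
 have et: "et > 0" "et <= 1" "wgap N q0 c0 et" "wgap N q1 c1 et"
  using et0 et1 by (auto simp: et_def)
 obtain B D where BD: "\<And>s. 0 < s ==> s <= et / 2 ==> s <= 2 * sin (et / 4) ==>
  (norm (anti (K (pt N (wpt N q1 c1 s)))))\<^sup>2 <= exp (2 * B + 1) *
   ((norm (anti (K (pt N (wpt N q0 c0 s)))))\<^sup>2 + (D * s powr (1 - expo))\<^sup>2)"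
  using wall_step_bound[OF et(3,4,1,2)] by blast
 define b where "b = (\<lambda>s. exp (2 * B + 1) *
   ((norm (anti (K (pt N (wpt N q0 c0 s)))))\<^sup>2 + (D * s powr (1 - expo))\<^sup>2))"
 have s4: "sin (et / 4) > 0" using et pi_gt3 by (intro sin_gt_zero) auto
 have "((\<lambda>s. s powr (1 - expo)) \<longlongrightarrow> 0) (at_right 0)"
 proof -
  have "((\<lambda>s. s powr (1 - expo)) \<longlongrightarrow> 0 powr (1 - expo)) (at_right 0)"
   using small by (intro tendsto_powr2 tendsto_const tendsto_ident_at) 
    (auto simp: eventually_at_right_field intro!: exI[of _ 1])
  then show ?thesis by simp
 qed
 then have "(b \<longlongrightarrow> exp (2 * B + 1) * ((norm (0 :: complex^'t^'t))\<^sup>2 + (D * 0)\<^sup>2)) (at_right 0)"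
  unfolding b_def using z unfolding wall_zero_def by (intro tendsto_intros)
 then have b: "((\<lambda>s. sqrt (b s)) \<longlongrightarrow> 0) (at_right 0)"
  using tendsto_real_sqrt by fastforce
 have "\<forall>\<^sub>F s in at_right 0. norm (anti (K (pt N (wpt N q1 c1 s)))) <= sqrt (b s)"
  unfolding eventually_at_right_field
 proof (intro exI[of _ "min (et / 2) (2 * sin (et / 4))"] conjI allI impI)
  show "0 < min (et / 2) (2 * sin (et / 4))" using et s4 by simp
  fix s :: real assume "0 < s" "s < min (et / 2) (2 * sin (et / 4))"
  then show "norm (anti (K (pt N (wpt N q1 c1 s)))) <= sqrt (b s)"
   using BD[of s] by (intro real_le_rsqrt) (simp add: b_def)
 qed
 then show ?thesis unfolding wall_zero_def
  by (rule Lim_null_comparison[OF _ b])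
qed

text \<open>Closing the distance of the last two coordinates symmetrically, the singular coefficient
 multiplies \<open>K \<sigma> + \<sigma> K\<close>, which commutes with the last reflection; so the derivative of the
 anticommuting part is no more singular than \<open>K\<close> itself, and it can be integrated from the
 wall.\<close>

lemma near_wall_bound:
 assumes small: "expo < 1 / 2"
 shows "\<exists>M>0. \<forall>q c h r. wall_zero q c \<and> wpt N q c h \<in> chamber N \<and> 0 < h \<and> h <= pi / 2 \<and> 0 < r \<and> r <= 2 \<and>
  2 * sin h <= r / 2 \<and>
  (\<forall>(i, j)\<in>pairs N - last_pairs N. r <= cmod (pt N (wpt N q c h) i - pt N (wpt N q c h) j)) \<longrightarrow>
  norm (anti (K (pt N (wpt N q c h)))) <= M / r * h powr (1 - expo)"
proof -
 obtain C where C: "C > 0" "\<And>x \<delta>. x \<in> torus_reg N ==> \<delta> > 0 ==>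
   (\<forall>(i, j)\<in>pairs N. \<delta> <= cmod (x i - x j)) ==> norm (K x) <= C * \<delta> powr (- expo)"
  using K_bound by blast
 define M0 where "M0 = real (card (pairs N)) * (12 * \<bar>\<kappa>\<bar>) * C"
 define M where "M = 2 * M0 + 1"
 have M0: "M0 >= 0" using C(1) by (simp add: M0_def)
 have main: "norm (anti (K (pt N (wpt N q c h)))) <= M / r * h powr (1 - expo)"
  if z: "wall_zero q c" and ch: "wpt N q c h \<in> chamber N" and h: "0 < h" "h <= pi / 2"
   and r: "0 < r" "r <= 2" "2 * sin h <= r / 2"
   and far: "\<And>i j. (i, j) \<in> pairs N ==> (i, j) \<notin> last_pairs N ==>
    r <= cmod (pt N (wpt N q c h) i - pt N (wpt N q c h) j)" for q c h r
 proof -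
  define d where "d = (\<lambda>i. if i = N - 1 then - 1 else if i = N then 1 else 0 :: real)"
  define p where "p = (\<lambda>s. wpt N q c s)"
  have p_line: "p s = (\<lambda>i. wpt N q c 0 i + s * d i)" for s
   by (auto simp: p_def wpt_def d_def)
  define X where "X = (\<lambda>s. K (pt N (p s)))"
  define Y where "Y = (\<lambda>s. refl (N - 1) N ** X s ** refl (N - 1) N)"
  have pch: "p s \<in> chamber N" if s: "0 < s" "s <= h" for s
   unfolding chamber_def
  proof (intro CollectI conjI ballI)
   fix i assume i: "i \<in> {1..<N}"
   then have *: "wpt N q c h i < wpt N q c h (i + 1)" using ch by (auto simp: chamber_def)
   show "p s i < p s (i + 1)"
    using * s i N3 by (auto simp: p_def wpt_def split: if_splits)
  next
   have "wpt N q c h N < wpt N q c h 1 + 2 * pi" using ch by (auto simp: chamber_def)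
   then show "p s N < p s 1 + 2 * pi" using s N3 by (auto simp: p_def wpt_def split: if_splits)
  qed
  have move: "cmod (cis (p h i) - cis (p s i)) <= 2 * sin ((h - s) / 2)" if s: "0 < s" "s <= h" for s i
  proof -
   have "\<bar>sin ((p h i - p s i) / 2)\<bar> <= sin ((h - s) / 2)"
   proof -
    have s0: "sin ((h - s) / 2) >= 0" using s h by (intro sin_ge_zero) auto
    have "(p h i - p s i) / 2 \<in> {(h - s) / 2, - ((h - s) / 2), 0}"
     by (auto simp: p_def wpt_def field_simps)
    then have "sin ((p h i - p s i) / 2) \<in> {sin ((h - s) / 2), - sin ((h - s) / 2), 0}"
     using sin_minus[of "(h - s) / 2"] by (metis insert_iff empty_iff sin_zero)
    then show ?thesis using s0 by auto
   qed
   then show ?thesis by (simp add: chord_eq)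
  qed
  have move_pair: "cmod (cis (p s i) - cis (p s j)) >= r / 2"
   if s: "0 < s" "s <= h" and ij: "(i, j) \<in> pairs N" "(i, j) \<notin> last_pairs N" for s i j
  proof -
   have r1: "r <= cmod (cis (p h i) - cis (p h j))"
    using far[OF ij] ij(1) by (simp add: p_def pt_def pairs_def)
   have half: "2 * sin ((h - s) / 2) <= 2 * sin h"
    using s h by (intro mult_left_mono sin_monotone_2pi_le) auto
   have "i \<notin> {N - 1, N} \<or> j \<notin> {N - 1, N}" using ij by (auto simp: pairs_def)
   then have "p s i = p h i \<or> p s j = p h j" by (auto simp: p_def wpt_def)
   moreover have "cmod (cis (p h i) - cis (p h j)) <= cmod (cis (p h i) - cis (p s i)) +
     cmod (cis (p s i) - cis (p s j)) + cmod (cis (p h j) - cis (p s j))"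
    using norm_triangle_ineq[of "cis (p h i) - cis (p s i)" "cis (p s i) - cis (p s j)"]
     norm_triangle_ineq[of "cis (p h i) - cis (p s j)" "cis (p s j) - cis (p h j)"]
    by (simp add: norm_minus_commute)
   moreover have "cmod (cis (p h i) - cis (p s i)) <= r / 2" "cmod (cis (p h j) - cis (p s j)) <= r / 2"
    using move[OF s, of i] move[OF s, of j] half r(3) by linarith+
   ultimately show ?thesis using r1 by auto
  qed
  have sin_pair: "r / 4 <= \<bar>sin ((p s i - p s j) / 2)\<bar>"
   if s: "0 < s" "s <= h" and ij: "(i, j) \<in> pairs N" "(i, j) \<notin> last_pairs N" for s i j
   using move_pair[OF s ij] by (simp add: chord_eq)
  have normX: "norm (X s) <= C * s powr (- expo)" if s: "0 < s" "s <= h" for s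
   unfolding X_def
  proof (rule C(2)[OF chamber_torus_reg[OF pch[OF s]] s(1)], clarify)
   fix i j assume ij: "(i, j) \<in> pairs N"
   have eq: "pt N (p s) i - pt N (p s) j = cis (p s i) - cis (p s j)"
    using ij by (simp add: pairs_def pt_def)
   have ss: "s / 2 <= sin s" using s h by (intro sin_ge_half) auto
   show "s <= cmod (pt N (p s) i - pt N (p s) j)"
   proof (cases "(i, j) \<in> last_pairs N")
    case True
    then have "\<bar>sin ((p s i - p s j) / 2)\<bar> = \<bar>sin s\<bar>" using N3 by (auto simp: p_def wpt_def)
    then show ?thesis unfolding eq chord_eq using ss by linarith
   next
    case False
    have "sin s <= sin h" using s h by (intro sin_monotone_2pi_le) auto
    then show ?thesis unfolding eq using move_pair[OF s ij False] ss r(3) by linarith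
   qed
  qed
  have Xder: "(X has_vector_derivative gen d (p s) (X s)) (at s)" if s: "0 < s" "s <= h" for s
   unfolding X_def using K_line[of "wpt N q c 0" s d UNIV] pch[OF s] by (simp add: p_line[symmetric])
  have der_bound: "norm (gen d (p s) (X s) - gen (d \<circ> sw) (p s \<circ> sw) (Y s)) <= M0 / r * s powr (- expo)"
   if s: "0 < s" "s <= h" for s
  proof -
   define T where "T = (\<lambda>(i, j). brk (\<kappa> * (d i + d j) / 4)
    (\<kappa> * (d i - d j) / 4 * cot ((p s i - p s j) / 2)) (refl i j) (X s))"
   define T' where "T' = (\<lambda>(i, j). brk (\<kappa> * ((d \<circ> sw) i + (d \<circ> sw) j) / 4)
    (\<kappa> * ((d \<circ> sw) i - (d \<circ> sw) j) / 4 * cot (((p s \<circ> sw) i - (p s \<circ> sw) j) / 2)) (refl i j) (Y s))"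
   have normY: "norm (Y s) = norm (X s)" by (simp add: Y_def norm_conj_refl del: One_nat_def)
   have coeff: "2 * (\<bar>\<kappa> * (a + b) / 4\<bar> + \<bar>\<kappa> * (a - b) / 4 * k\<bar>) * n <= 6 * \<bar>\<kappa>\<bar> / r * n"
    if "\<bar>a\<bar> <= 1" "\<bar>b\<bar> <= 1" "\<bar>k\<bar> <= 4 / r" "n >= 0" for a b k n :: real
   proof -
    have 1: "\<bar>\<kappa> * (a + b) / 4\<bar> <= \<bar>\<kappa>\<bar> / 2"
     using mult_left_mono[of "\<bar>a + b\<bar>" 2 "\<bar>\<kappa>\<bar>"] that by (auto simp: abs_mult)
    have "\<bar>\<kappa> * (a - b) / 4\<bar> <= \<bar>\<kappa>\<bar> / 2"
     using mult_left_mono[of "\<bar>a - b\<bar>" 2 "\<bar>\<kappa>\<bar>"] that by (auto simp: abs_mult)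
    then have 2: "\<bar>\<kappa> * (a - b) / 4 * k\<bar> <= \<bar>\<kappa>\<bar> / 2 * (4 / r)"
     unfolding abs_mult[of _ k] using that r by (intro mult_mono) auto
    have 3: "\<bar>\<kappa>\<bar> / 2 <= \<bar>\<kappa>\<bar> / r" using r by (intro divide_left_mono) auto
    have "2 * (\<bar>\<kappa> * (a + b) / 4\<bar> + \<bar>\<kappa> * (a - b) / 4 * k\<bar>) <= 2 * (\<bar>\<kappa>\<bar> / r + \<bar>\<kappa>\<bar> / 2 * (4 / r))"
     using order_trans[OF 1 3] 2 by (intro mult_left_mono add_mono) auto
    also have "\<dots> = 6 * \<bar>\<kappa>\<bar> / r" by (simp add: field_simps)
    finally show ?thesis using that by (intro mult_right_mono) auto
   qed
   have d1: "\<bar>d i\<bar> <= 1" for i by (simp add: d_def)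
   have "norm (T x - T' x) <= 12 * \<bar>\<kappa>\<bar> / r * norm (X s)" if x: "x \<in> pairs N" for x
   proof -
    obtain i j where ij: "x = (i, j)" "(i, j) \<in> pairs N" using x by (cases x) auto
    show ?thesis
    proof (cases "(i, j) \<in> last_pairs N")
     case True
     \<comment> \<open>both the direction and the angle change sign under the swap, and the symmetric bracket
      of the last reflection is invariant under conjugation by it\<close>
     define e where "e = \<kappa> * (d i - d j) / 4 * cot ((p s i - p s j) / 2)"
     define \<sigma> where "\<sigma> = refl (N - 1) N"
     have ss: "\<sigma> ** \<sigma> = mat 1" unfolding \<sigma>_def by (rule refl_refl[OF last_pair])
     have sij: "sw i = j" "sw j = i" using True by (auto simp: Transposition.transpose_def)
     have d0: "d i + d j = 0" "d j + d i = 0" using True N3 by (auto simp: d_def)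
     have "cot ((p s j - p s i) / 2) = - cot ((p s i - p s j) / 2)"
      using cot_minus[of "(p s i - p s j) / 2"] by (simp add: minus_divide_left)
     then have e': "\<kappa> * (d j - d i) / 4 * cot ((p s j - p s i) / 2) = e"
      by (simp add: e_def algebra_simps)
     have r\<sigma>: "refl i j = \<sigma>" using True by (auto simp: \<sigma>_def transpose_commute)
     have "T x = brk 0 e \<sigma> (X s)" "T' x = brk 0 e \<sigma> (Y s)"
      unfolding T_def T'_def ij(1) prod.case o_apply sij e' e_def[symmetric] d0 r\<sigma> by simp_all
     moreover have "Y s ** \<sigma> + \<sigma> ** Y s = X s ** \<sigma> + \<sigma> ** X s"
     proof -
      have "Y s ** \<sigma> = \<sigma> ** X s ** (\<sigma> ** \<sigma>)" "\<sigma> ** Y s = (\<sigma> ** \<sigma>) ** X s ** \<sigma>"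
       by (simp_all only: Y_def \<sigma>_def matrix_mul_assoc)
      then show ?thesis by (simp add: ss)
     qed
     ultimately have "T x = T' x" by (simp add: brk_def mscale_simps)
     then show ?thesis using r by simp
    next
     case False
     have ij': "(sw i, sw j) \<in> pairs N"
      using ij(2) permutes_in_image[OF sw_permutes] inj_eq[OF permutes_inj[OF sw_permutes]]
      by (simp add: pairs_def del: atLeastAtMost_iff)
     have not_last: "(sw i, sw j) \<notin> last_pairs N"
      using False N3 by (auto simp: Transposition.transpose_def split: if_splits)
     have r4: "r / 4 > 0" using r by simp
     have "norm (T x) <= 6 * \<bar>\<kappa>\<bar> / r * norm (X s)"
      unfolding T_def ij(1) prod.case
      using norm_brk_le[OF refl_unitary[OF ij(2)]] coeff[OF d1 d1 _ norm_ge_zero]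
       abs_cot_le_inverse_sin[OF r4 sin_pair[OF s ij(2) False]] by (fastforce intro: order_trans)
     moreover have "norm (T' x) <= 6 * \<bar>\<kappa>\<bar> / r * norm (Y s)"
      unfolding T'_def ij(1) prod.case o_apply
      using norm_brk_le[OF refl_unitary[OF ij(2)]] coeff[OF d1 d1 _ norm_ge_zero]
       abs_cot_le_inverse_sin[OF r4 sin_pair[OF s ij' not_last]] by (fastforce intro: order_trans)
     moreover have "norm (T x - T' x) <= norm (T x) + norm (T' x)" by (rule norm_triangle_ineq4)
     ultimately show ?thesis unfolding normY by simp
    qed
   qed
   then have "norm (\<Sum>x\<in>pairs N. T x - T' x) <= (\<Sum>x\<in>pairs N. 12 * \<bar>\<kappa>\<bar> / r * norm (X s))"
    by (intro sum_norm_le) auto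
   also have "\<dots> = real (card (pairs N)) * (12 * \<bar>\<kappa>\<bar>) / r * norm (X s)" by simp
   also have "\<dots> <= real (card (pairs N)) * (12 * \<bar>\<kappa>\<bar>) / r * (C * s powr (- expo))"
    using r normX[OF s] by (intro mult_left_mono) auto
   also have "\<dots> = M0 / r * s powr (- expo)" by (simp add: M0_def)
   finally show ?thesis by (simp add: gen_def T_def T'_def sum_subtractf split_def)
  qed
  define \<Phi> where "\<Phi> = (\<lambda>s. M0 / r * (s powr (1 - expo) / (1 - expo)))"
  have \<Phi>0: "\<Phi> s >= 0" for s using M0 r small by (simp add: \<Phi>_def)
  have incr: "norm (anti (X h)) <= norm (anti (X \<delta>)) + \<Phi> h" if \<delta>: "0 < \<delta>" "\<delta> < h" for \<delta>
  proof -
   have "norm (anti (X h) - anti (X \<delta>)) <= \<Phi> h - \<Phi> \<delta>"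
   proof (rule differentiable_bound_general[OF \<delta>(2)])
    have der: "((\<lambda>s. anti (X s)) has_vector_derivative
      gen d (p s) (X s) - gen (d \<circ> sw) (p s \<circ> sw) (Y s)) (at s)" if "\<delta> <= s" "s <= h" for s
     unfolding Y_def using that \<delta> by (intro anti_derivative Xder) auto
    show "continuous_on {\<delta>..h} (\<lambda>s. anti (X s))"
     by (intro continuous_at_imp_continuous_on ballI)
      (use der in \<open>auto intro: has_vector_derivative_continuous\<close>)
    show "continuous_on {\<delta>..h} \<Phi>"
     unfolding \<Phi>_def using \<delta> small by (intro continuous_intros) auto
    show "((\<lambda>s. anti (X s)) has_vector_derivative
      gen d (p s) (X s) - gen (d \<circ> sw) (p s \<circ> sw) (Y s)) (at s)" if "\<delta> < s" "s < h" for s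
     using der that by simp
    show "(\<Phi> has_vector_derivative M0 / r * s powr (- expo)) (at s)" if "\<delta> < s" "s < h" for s
    proof -
     have "((\<lambda>s. s powr (1 - expo)) has_real_derivative (1 - expo) * s powr (1 - expo - 1)) (at s)"
      using \<delta> that by (intro has_real_derivative_powr) auto
     then have "(\<Phi> has_real_derivative M0 / r * ((1 - expo) * s powr (1 - expo - 1) / (1 - expo))) (at s)"
      unfolding \<Phi>_def by (intro DERIV_cmult DERIV_cdivide)
     then show ?thesis using small by (simp add: has_real_derivative_iff_has_vector_derivative)
    qed
    show "norm (gen d (p s) (X s) - gen (d \<circ> sw) (p s \<circ> sw) (Y s)) <= M0 / r * s powr (- expo)"
     if "\<delta> < s" "s < h" for s using der_bound[of s] \<delta> that by simp
   qed
   then show ?thesis using \<Phi>0[of \<delta>] norm_triangle_ineq2[of "anti (X h)" "anti (X \<delta>)"] by linarith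
  qed
  have "norm (anti (X h)) <= norm (0 :: complex^'t^'t) + \<Phi> h"
  proof (rule tendsto_lowerbound)
   show "((\<lambda>s. norm (anti (X s)) + \<Phi> h) \<longlongrightarrow> norm (0 :: complex^'t^'t) + \<Phi> h) (at_right 0)"
    using z unfolding wall_zero_def X_def p_def by (intro tendsto_intros)
   show "\<forall>\<^sub>F s in at_right 0. norm (anti (X h)) <= norm (anti (X s)) + \<Phi> h"
    unfolding eventually_at_right_field using h incr by (intro exI[of _ h]) auto
  qed simp
  also have "norm (0 :: complex^'t^'t) + \<Phi> h = M0 / (1 - expo) / r * h powr (1 - expo)"
   by (simp add: \<Phi>_def)
  also have "\<dots> <= M / r * h powr (1 - expo)"
  proof -
   have "M0 / (1 - expo) <= M0 / (1 / 2)" using small M0 by (intro divide_left_mono) auto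
   then have "M0 / (1 - expo) <= M" by (simp add: M_def)
   then show ?thesis using r by (intro mult_right_mono divide_right_mono) auto
  qed
  finally show ?thesis by (simp add: X_def p_def)
 qed
 show ?thesis
 proof (intro exI[of _ M] conjI allI impI)
  show "M > 0" using M0 by (simp add: M_def)
 qed (use main in blast)
qed

end

section \<open>The reflection defect of the form\<close>

lemma permutes_pairs:
 assumes "w permutes {1..N}"
 shows "(w i, w j) \<in> pairs N \<longleftrightarrow> (i, j) \<in> pairs N"
 using permutes_in_image[OF assms] inj_eq[OF permutes_inj[OF assms]]
 by (simp add: pairs_def del: atLeastAtMost_iff)

lemma sorted_less:
 fixes y :: "nat => real"
 assumes "\<forall>i\<in>{1..<N}. y i < y (i + 1)" "1 <= i" "i < j" "j <= N"
 shows "y i < y j"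
 using assms(3,4)
proof (induction j)
 case (Suc j)
 have "y j < y (j + 1)" if "1 <= j" using assms(1) Suc.prems that by auto
 then show ?case using Suc assms(2) by (cases "i = j") (auto simp: less_Suc_eq)
qed simp

text \<open>If the distance of two coordinates is the smallest one, they are neighbours on the circle, so
 a permutation moves them to the last two positions of a point of the chamber.\<close>

lemma closest_pair_last:
 assumes N: "N >= 3" and x: "x \<in> torus_reg N" and ij: "(i, j) \<in> pairs N" and Im: "0 <= Im (x j / x i)"
  and far: "\<And>k. k \<in> {1..N} - {i, j} ==> cmod (x i - x j) < cmod (x k - x i)"
 shows "\<exists>w q c h. w permutes {1..N} \<and> w (N - 1) = i \<and> w N = j \<and> x \<circ> w = pt N (wpt N q c h) \<and>
  wpt N q c h \<in> chamber N \<and> 0 < h \<and> h <= pi / 2 \<and> 2 * sin h = cmod (x i - x j)"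
proof -
 have norm1: "cmod (x k) = 1" if "k \<in> {1..N}" for k
  using x that by (auto simp: torus_reg_def torus_def)
 have inj: "inj_on x {1..N}" using x by (simp add: torus_reg_def)
 have i: "i \<in> {1..N}" and j: "j \<in> {1..N}" and "i ~= j" using ij by (auto simp: pairs_def)
 define a where "a = Arg2pi (x i)"
 define \<psi> where "\<psi> = (\<lambda>k. Arg2pi (x k / x i))"
 have xi: "x i = cis a"
  using Arg2pi_eq[of "x i"] norm1[OF i] by (simp add: a_def cis_conv_exp)
 have xk: "x k = cis (a + \<psi> k)" if "k \<in> {1..N}" for k
 proof -
  have "x k / x i = cis (\<psi> k)"
   using Arg2pi_eq[of "x k / x i"] norm1[OF i] norm1[OF that]
   by (simp add: \<psi>_def cis_conv_exp norm_divide)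
  then have "x k = cis (\<psi> k) * x i" using norm1[OF i] by (metis nonzero_divide_eq_eq norm_zero zero_neq_one)
  also have "\<dots> = cis (a + \<psi> k)" unfolding xi by (simp add: cis_mult add.commute)
  finally show ?thesis .
 qed
 have \<psi>_pos: "0 < \<psi> k" "\<psi> k < 2 * pi" if "k \<in> {1..N}" "k ~= i" for k
 proof -
  have "x k ~= x i" using that(2) by (simp add: inj_on_eq_iff[OF inj that(1) i])
  then have "\<psi> k ~= 0" unfolding xk[OF that(1)] xi by (metis add.right_neutral)
  then show "0 < \<psi> k" using Arg2pi_ge_0[of "x k / x i"] by (simp add: \<psi>_def)
  show "\<psi> k < 2 * pi" by (simp add: \<psi>_def Arg2pi_lt_2pi)
 qed
 have \<psi>j: "0 < \<psi> j" "\<psi> j <= pi"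
  using \<psi>_pos[OF j] \<open>i ~= j\<close> Im by (auto simp: \<psi>_def Arg2pi_le_pi)
 have chord: "cmod (x k - x i) = 2 * sin (\<psi> k / 2)" if "k \<in> {1..N}" "k ~= i" for k
 proof -
  have "sin (\<psi> k / 2) > 0" using \<psi>_pos[OF that] by (intro sin_gt_zero) auto
  then show ?thesis unfolding xi using xk[OF that(1)] chord_eq[of "a + \<psi> k" a] by simp
 qed
 have later: "\<psi> j < \<psi> k" if k: "k \<in> {1..N}" "k ~= i" "k ~= j" for k
 proof (rule ccontr)
  assume "\<not> \<psi> j < \<psi> k"
  then have "sin (\<psi> k / 2) <= sin (\<psi> j / 2)"
   using \<psi>j \<psi>_pos[OF k(1,2)] by (intro sin_monotone_2pi_le) auto
  then have "cmod (x k - x i) <= cmod (x j - x i)" using chord[OF k(1,2)] chord[OF j] \<open>i ~= j\<close> by simp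
  then show False using far[of k] k by (simp add: norm_minus_commute)
 qed
 define y where "y = (\<lambda>k. if k = i then a else if k = j then a + \<psi> j else a + \<psi> k - 2 * pi)"
 have xy: "x k = cis (y k)" if "k \<in> {1..N}" for k
 proof -
  have "cis (a + \<psi> k - 2 * pi) = cis (a + \<psi> k)" by (simp flip: cis_divide)
  then show ?thesis using xi xk[OF that] by (auto simp: y_def)
 qed
 have "inj_on y {1..N}"
  by (rule inj_onI) (use xy inj in \<open>metis inj_on_eq_iff\<close>)
 from ex_sorting[OF this] obtain w where w: "w permutes {1..N}"
  and inc: "\<forall>k\<in>{1..<N}. y (w k) < y (w (k + 1))" by blast
 have low: "y k < a" if "k \<in> {1..N}" "k ~= i" "k ~= j" for k
  using \<psi>_pos[OF that(1,2)] that by (simp add: y_def)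
 have less: "y (w k) < y (w l)" if "1 <= k" "k < l" "l <= N" for k l
  using sorted_less[of N "\<lambda>k. y (w k)"] inc that by auto
 have inN: "w k \<in> {1..N} \<longleftrightarrow> k \<in> {1..N}" for k using permutes_in_image[OF w] .
 obtain k where k: "k \<in> {1..N}" "w k = j" using j w by (metis permutes_image imageE)
 obtain l where l: "l \<in> {1..N}" "w l = i" using i w by (metis permutes_image imageE)
 have kN: "k = N"
 proof (rule ccontr)
  assume "k ~= N"
  then have "y j < y (w N)" using less[of k N] k by auto
  moreover have "y (w N) <= y j" using low[of "w N"] inN[of N] N \<psi>j(1)
   by (cases "w N = i \<or> w N = j") (auto simp: y_def)
  ultimately show False by simp
 qed
 have lN: "l = N - 1"
 proof (rule ccontr)
  assume "l ~= N - 1"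
  moreover have "l ~= N" using kN k l \<open>i ~= j\<close> by auto
  ultimately have "l < N - 1" using l by auto
  then have "y i < y (w (N - 1))" using less[of l "N - 1"] l by auto
  moreover have "w (N - 1) ~= j" using k kN N inj_eq[OF permutes_inj[OF w], of "N - 1" N] by auto
  moreover have "w (N - 1) \<in> {1..N}" using inN[of "N - 1"] N by auto
  ultimately show False using low[of "w (N - 1)"] by (cases "w (N - 1) = i") (auto simp: y_def)
 qed
 define th where "th = y \<circ> w"
 define h c where "h = \<psi> j / 2" and "c = a + h"
 have ends: "th (N - 1) = a" "th N = a + \<psi> j" using k l kN lN \<open>i ~= j\<close> by (auto simp: th_def y_def)
 have wpt: "wpt N th c h = th" using ends N by (auto simp: wpt_def c_def h_def fun_eq_iff)
 have "x = pt N y" using x xy by (intro torus_eq_pt) (auto simp: torus_reg_def)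
 then have "x \<circ> w = pt N th" using pt_comp_permutes[OF w] by (simp add: th_def)
 moreover have "th \<in> chamber N"
 proof -
  have w1: "w 1 \<in> {1..N}" "w 1 ~= i" "w 1 ~= j"
   using inN[of 1] N k l kN lN inj_eq[OF permutes_inj[OF w]] by auto
  have "th N < th 1 + 2 * pi" using later[OF w1] ends w1 by (simp add: th_def y_def)
  then show ?thesis using inc by (auto simp: chamber_def th_def)
 qed
 moreover have "2 * sin h = cmod (x i - x j)"
  using chord[OF j] \<open>i ~= j\<close> by (simp add: h_def norm_minus_commute)
 moreover have "0 < h" "h <= pi / 2" using \<psi>j by (simp_all add: h_def)
 ultimately show ?thesis
  using w k l kN lN
  by - (rule exI[of _ w], rule exI[of _ th], rule exI[of _ c], rule exI[of _ h], auto simp: wpt)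
qed

locale torus_form_wall = torus_form N \<kappa> \<tau> K
 for N :: nat and \<kappa> :: real and \<tau> :: "(nat => nat) => complex^'t^'t" and K +
 fixes q0 :: "nat => real" and c0 :: real
 assumes expo_small: "expo < 1 / 2"
  and base_wall: "wall N q0 c0" and base_zero: "wall_zero q0 c0"
begin

lemma wall_zero_all: "wall N q c ==> wall_zero q c"
 using wall_step[OF _ base_wall _ base_zero] expo_small by auto

lemma wall_of_chamber:
 assumes "wpt N q c h \<in> chamber N" "0 < h"
 shows "wall N q c"
proof -
 have step: "wpt N q c h i < wpt N q c h (i + 1)" if "i \<in> {1..<N}" for i
  using assms(1) that by (auto simp: chamber_def)
 have "q i < q (i + 1)" if "i \<in> {1..<N - 2}" for i
 proof -
  have "i ~= N - 1" "i ~= N" "i + 1 ~= N - 1" "i + 1 ~= N" "i < N" using that by auto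
  then show ?thesis using step[of i] that by (simp add: wpt_def)
 qed
 moreover have "q (N - 2) < c"
 proof -
  have "N - 2 \<in> {1..<N}" "N - 2 ~= N - 1" "N - 2 ~= N" "N - 2 + 1 = N - 1" using N3 by auto
  then show ?thesis using step[of "N - 2"] assms(2) by (simp add: wpt_def)
 qed
 moreover have "wpt N q c h N < wpt N q c h 1 + 2 * pi" using assms(1) by (auto simp: chamber_def)
 then have "c < q 1 + 2 * pi" using N3 assms(2) by (auto simp: wpt_def split: if_splits)
 ultimately show ?thesis by (simp add: wall_def)
qed

text \<open>The decisive estimate. Away from the wall it follows from the growth of \<open>K\<close>. It is stated with
 half powers because the exponent of the smallest other distance has to stay below one.\<close>

lemma reflection_defect:
 "\<exists>M>0. \<forall>x\<in>torus_reg N. \<forall>(i, j)\<in>pairs N. \<forall>r>0.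
  (\<forall>(k, l)\<in>pairs N - {(i, j), (j, i)}. r <= cmod (x k - x l)) \<longrightarrow>
  norm (K x - refl i j ** K x ** refl i j) <= M * cmod (x i - x j) powr (1 / 2) * r powr (- 1 / 2 - expo)"
proof -
 obtain C where C: "C > 0" "\<And>x \<delta>. x \<in> torus_reg N ==> \<delta> > 0 ==>
   (\<forall>(i, j)\<in>pairs N. \<delta> <= cmod (x i - x j)) ==> norm (K x) <= C * \<delta> powr (- expo)"
  using K_bound by blast
 obtain M1 where M1: "M1 > 0" "\<And>q c h r. wall_zero q c ==> wpt N q c h \<in> chamber N ==> 0 < h ==>
   h <= pi / 2 ==> 0 < r ==> r <= 2 ==> 2 * sin h <= r / 2 ==>
   (\<forall>(i, j)\<in>pairs N - last_pairs N. r <= cmod (pt N (wpt N q c h) i - pt N (wpt N q c h) j)) ==>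
   norm (anti (K (pt N (wpt N q c h)))) <= M1 / r * h powr (1 - expo)"
  using near_wall_bound[OF expo_small] by blast
 define M where "M = 8 * C + M1"
 have e0: "expo >= 0" by simp
 have defect_swap: "refl i j = refl j i" for i j by (simp add: transpose_commute)
 have close: "norm (K x - refl i j ** K x ** refl i j) <= M1 * cmod (x i - x j) powr (1 / 2) * r powr (- 1 / 2 - expo)"
  if x: "x \<in> torus_reg N" and ij: "(i, j) \<in> pairs N" and r: "0 < r" "r <= 2"
   and far: "\<And>k l. (k, l) \<in> pairs N - {(i, j), (j, i)} ==> r <= cmod (x k - x l)"
   and s: "cmod (x i - x j) <= r / 2" and Im: "0 <= Im (x j / x i)" for x i j r
 proof -
  have "cmod (x i - x j) < cmod (x k - x i)" if "k \<in> {1..N} - {i, j}" for k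
   using far[of k i] that ij s r by (auto simp: pairs_def)
  from closest_pair_last[OF N3 x ij Im this] obtain w q c h where
   w: "w permutes {1..N}" "w (N - 1) = i" "w N = j" and xw: "x \<circ> w = pt N (wpt N q c h)"
   and ch: "wpt N q c h \<in> chamber N" and h: "0 < h" "h <= pi / 2" "2 * sin h = cmod (x i - x j)" by blast
  have sh: "h <= cmod (x i - x j)" using sin_ge_half[of h] h by simp
  have w_pairs: "(w a, w b) \<in> {(i, j), (j, i)} \<longleftrightarrow> (a, b) \<in> last_pairs N" for a b
  proof -
   have "w a = i \<longleftrightarrow> a = N - 1" "w a = j \<longleftrightarrow> a = N" for a
    unfolding w(2,3)[symmetric] by (rule inj_eq[OF permutes_inj[OF w(1)]])+
   then show ?thesis by blast
  qed
  have "norm (anti (K (pt N (wpt N q c h)))) <= M1 / r * h powr (1 - expo)"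
  proof (rule M1(2)[OF wall_zero_all[OF wall_of_chamber[OF ch h(1)]] ch h(1,2) r])
   show "2 * sin h <= r / 2" using h(3) s by simp
   show "\<forall>(a, b)\<in>pairs N - last_pairs N. r <= cmod (pt N (wpt N q c h) a - pt N (wpt N q c h) b)"
   proof (rule ballI)
    fix p assume "p \<in> pairs N - last_pairs N"
    then obtain a b where p: "p = (a, b)" and ab: "(a, b) \<in> pairs N" "(a, b) \<notin> last_pairs N"
     by (cases p) auto
    from ab have "r <= cmod (x (w a) - x (w b))"
     using far[of "w a" "w b"] permutes_pairs[OF w(1), of a b] w_pairs[of a b] by blast
    then show "case p of (a, b) => r <= cmod (pt N (wpt N q c h) a - pt N (wpt N q c h) b)"
     by (simp add: p flip: xw)
   qed
  qed
  also have "\<dots> <= M1 / r * cmod (x i - x j) powr (1 - expo)"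
   using sh h(1) M1(1) r expo_small by (intro mult_left_mono powr_mono2) auto
  also have "cmod (x i - x j) powr (1 - expo) =
    cmod (x i - x j) powr (1 / 2) * cmod (x i - x j) powr (1 / 2 - expo)"
   by (simp flip: powr_add)
  also have "M1 / r * (cmod (x i - x j) powr (1 / 2) * cmod (x i - x j) powr (1 / 2 - expo)) \<le>
    M1 / r * (cmod (x i - x j) powr (1 / 2) * r powr (1 / 2 - expo))"
   using s r expo_small M1(1) by (intro mult_left_mono powr_mono2) auto
  also have "M1 / r * (cmod (x i - x j) powr (1 / 2) * r powr (1 / 2 - expo)) =
    M1 * cmod (x i - x j) powr (1 / 2) * r powr (- 1 / 2 - expo)"
  proof -
   have "r powr (1 / 2 - expo) = r * r powr (- 1 / 2 - expo)"
    using r powr_add[of r 1 "- 1 / 2 - expo"] by simp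
   then show ?thesis using r by simp
  qed
  finally have bound: "norm (anti (K (x \<circ> w))) <= M1 * cmod (x i - x j) powr (1 / 2) * r powr (- 1 / 2 - expo)"
   by (simp only: xw)
  have "anti (K (x \<circ> w)) = adj (\<tau> w) ** (K x - refl i j ** K x ** refl i j) ** \<tau> w"
  proof -
   define \<sigma> where "\<sigma> = refl (N - 1) N"
   have "\<tau> w ** \<sigma> ** adj (\<tau> w) = refl i j"
    unfolding \<sigma>_def refl_conj[OF w(1) last_pair] w(2,3) ..
   then have \<sigma>: "\<sigma> = adj (\<tau> w) ** refl i j ** \<tau> w" by (rule conj_cancel[OF w(1)])
   have m: "adj (\<tau> w) ** A ** \<tau> w ** (adj (\<tau> w) ** B ** \<tau> w) = adj (\<tau> w) ** (A ** B) ** \<tau> w" for A B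
   proof -
    have "adj (\<tau> w) ** A ** \<tau> w ** (adj (\<tau> w) ** B ** \<tau> w) =
      adj (\<tau> w) ** A ** (\<tau> w ** adj (\<tau> w)) ** B ** \<tau> w" by (simp only: matrix_mul_assoc)
    then show ?thesis by (simp add: \<tau>_unitary'[OF w(1)] matrix_mul_assoc)
   qed
   show ?thesis
    unfolding anti_def \<sigma>_def[symmetric] K_equivariant[OF x w(1)] unfolding \<sigma> m
    by (simp add: mm.diff_left mm.diff_right)
  qed
  then show ?thesis using bound norm_\<tau>_conj[OF w(1)] by simp
 qed
 show ?thesis
 proof (intro exI[of _ M] conjI ballI, goal_cases)
  case 1
  then show ?case using C(1) M1(1) by (simp add: M_def)
 next
  case (2 x p)
  then obtain i j where p: "p = (i, j)" and ij: "(i, j) \<in> pairs N" and x: "x \<in> torus_reg N" by (cases p) auto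
  show ?case unfolding p prod.case
  proof (intro allI impI)
   fix r :: real assume r: "0 < r" and
    far: "\<forall>(k, l)\<in>pairs N - {(i, j), (j, i)}. r <= cmod (x k - x l)"
   have norm1: "cmod (x k) = 1" if "k \<in> {1..N}" for k
    using x that by (auto simp: torus_reg_def torus_def)
   have s0: "cmod (x i - x j) > 0"
   proof -
    have "inj_on x {1..N}" using x by (simp add: torus_reg_def)
    moreover have "i \<in> {1..N}" "j \<in> {1..N}" "i ~= j" using ij by (auto simp: pairs_def)
    ultimately show ?thesis by (simp add: inj_on_eq_iff del: atLeastAtMost_iff)
   qed
   have r2: "r <= 2"
   proof -
    have "\<exists>k\<in>{1..N}. k ~= i \<and> k ~= j"
    proof (rule ccontr)
     assume "\<not> ?thesis"
     then have "{1..N} \<subseteq> {i, j}" by auto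
     then have "card {1..N} <= card {i, j}" by (intro card_mono) auto
     then show False using N3 card_insert_le_m1[of 2 "{j}" i] by simp
    qed
    then obtain k where k: "k \<in> {1..N}" "k ~= i" "k ~= j" by blast
    then have "r <= cmod (x k - x i)" using far ij by (auto simp: pairs_def)
    also have "\<dots> <= cmod (x k) + cmod (x i)" by (rule norm_triangle_ineq4)
    also have "\<dots> = 2" using norm1 k ij by (simp add: pairs_def)
    finally show ?thesis .
   qed
   show "norm (K x - refl i j ** K x ** refl i j) <= M * cmod (x i - x j) powr (1 / 2) * r powr (- 1 / 2 - expo)"
   proof (cases "cmod (x i - x j) <= r / 2")
    case True
    have "norm (K x - refl i j ** K x ** refl i j) \<le>
      M1 * cmod (x i - x j) powr (1 / 2) * r powr (- 1 / 2 - expo)"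
    proof (cases "0 <= Im (x j / x i)")
     case Im: True
     show ?thesis by (rule close[OF x ij r r2 _ True Im]) (use far in auto)
    next
     case False
     have ji: "(j, i) \<in> pairs N" using ij by (auto simp: pairs_def)
     have "x i / x j = cnj (x j / x i)"
     proof -
      have "cmod (x i) = 1" "cmod (x j) = 1" using norm1 ij by (simp_all add: pairs_def)
      then show ?thesis by (simp add: divide_conv_cnj mult.commute)
     qed
     then have "0 <= Im (x i / x j)" using False by (simp del: complex_cnj_divide)
     from close[OF x ji r r2 _ _ this] show ?thesis
      using far True by (auto simp: norm_minus_commute[of "x j"] defect_swap[of j i] insert_commute)
    qed
    also have "\<dots> <= M * cmod (x i - x j) powr (1 / 2) * r powr (- 1 / 2 - expo)"
     using C(1) by (intro mult_right_mono) (auto simp: M_def)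
    finally show ?thesis .
   next
    case False
    then have big: "r / 2 < cmod (x i - x j)" by (simp only: not_le)
    have r_half: "(r / 2) powr (- expo) <= 2 * r powr (- expo)"
    proof -
     have "(r / 2) powr (- expo) = 2 powr expo * r powr (- expo)"
      using r by (simp add: powr_divide powr_minus_divide)
     also have "\<dots> <= 2 powr 1 * r powr (- expo)"
      using expo_small by (intro mult_right_mono powr_mono) auto
     finally show ?thesis by simp
    qed
    have "norm (K x) <= C * (r / 2) powr (- expo)"
    proof (rule C(2)[OF x], goal_cases)
     case 2
     show ?case
     proof clarify
      fix k l assume kl: "(k, l) \<in> pairs N"
      show "r / 2 <= cmod (x k - x l)"
      proof (cases "(k, l) \<in> {(i, j), (j, i)}")
       case True
       then show ?thesis using big by (auto simp: norm_minus_commute)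
      next
       case False
       then have "r <= cmod (x k - x l)" using far kl by blast
       then show ?thesis using r by simp
      qed
     qed
    qed (use r in simp)
    also have "\<dots> <= C * (2 * r powr (- expo))" using C(1) r_half by (intro mult_left_mono) auto
    finally have K: "norm (K x) <= 2 * C * r powr (- expo)" by simp
    have "1 / 2 <= (1 / 2 :: real) powr (1 / 2)"
     using powr_mono'[of "1 / 2" 1 "1 / 2 :: real"] by simp
    then have "1 / 2 * r powr (1 / 2) <= (r / 2) powr (1 / 2)"
     using r by (simp add: powr_divide mult_right_mono divide_simps)
    also have "\<dots> <= cmod (x i - x j) powr (1 / 2)" using big r by (intro powr_mono2) auto
    finally have half: "r powr (1 / 2) <= 2 * cmod (x i - x j) powr (1 / 2)" by simp
    have "norm (refl i j ** K x ** refl i j) = norm (K x)"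
     using norm_\<tau>_conj[OF transpose_permutes[OF ij], of "K x"] by (simp add: refl_hermitian[OF ij])
    then have "norm (K x - refl i j ** K x ** refl i j) <= 2 * norm (K x)"
     using norm_triangle_ineq4[of "K x" "refl i j ** K x ** refl i j"] by simp
    also have "\<dots> <= 4 * C * r powr (- expo)" using K by simp
    also have "r powr (- expo) = r powr (1 / 2) * r powr (- 1 / 2 - expo)"
     by (simp flip: powr_add)
    also have "4 * C * (r powr (1 / 2) * r powr (- 1 / 2 - expo)) \<le>
      4 * C * ((2 * cmod (x i - x j) powr (1 / 2)) * r powr (- 1 / 2 - expo))"
     using C(1) half by (intro mult_left_mono mult_right_mono) auto
    also have "\<dots> = 8 * C * cmod (x i - x j) powr (1 / 2) * r powr (- 1 / 2 - expo)" by simp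
    also have "\<dots> <= M * cmod (x i - x j) powr (1 / 2) * r powr (- 1 / 2 - expo)"
     using M1(1) by (intro mult_right_mono) (auto simp: M_def)
    finally show ?thesis .
   qed
  qed
 qed
qed

end

section \<open>The solution near the collision of the last two coordinates\<close>

lemma has_vector_derivative_matrix:
 fixes F :: "real => complex^'t^'t"
 assumes "\<And>a b. ((\<lambda>r. F r $ a $ b) has_vector_derivative F' $ a $ b) (at r)"
 shows "(F has_vector_derivative F') (at r)"
 unfolding has_vector_derivative_def has_derivative_at_within
proof (intro conjI bounded_linear_scaleR_left vec_tendstoI)
 fix a b
 have "((\<lambda>y. (F y $ a $ b - F r $ a $ b - (y - r) *\<^sub>R F' $ a $ b) /\<^sub>R norm (y - r)) \<longlongrightarrow> 0) (at r)"
  using assms[of a b] unfolding has_vector_derivative_def has_derivative_at_within by blast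
 then show "((\<lambda>y. ((F y - F r - (y - r) *\<^sub>R F') /\<^sub>R norm (y - r)) $ a $ b) \<longlongrightarrow> 0 $ a $ b) (at r)"
  by simp
qed

lemma has_vector_derivative_cis: "(cis has_vector_derivative \<i> * cis t) (at t within A)"
proof -
 have e: "exp (t *\<^sub>R \<i>) = cis t" for t
  by (simp add: cis_conv_exp scaleR_conv_of_real mult.commute)
 show ?thesis
  using has_vector_derivative_at_within[OF exp_scaleR_has_vector_derivative_left[of "\<i>" t], of A]
  unfolding e .
qed

lemma cmod_exp_real: "cmod (exp (of_real r * w)) = cmod (exp w) powr r"
 by (simp add: norm_exp_eq_Re powr_def mult.commute)

lemma powr_le_abs:
 fixes x e :: real
 assumes "0 < x" "x <= 1"
 shows "x powr e <= x powr (- \<bar>e\<bar>)"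
 using assms by (intro powr_mono') auto

lemma powr_le_two:
 fixes x e :: real
 assumes "1 <= x" "x <= 2"
 shows "x powr e <= 2 powr \<bar>e\<bar>"
proof -
 have "x powr e <= x powr \<bar>e\<bar>" using assms by (intro powr_mono) auto
 also have "\<dots> <= 2 powr \<bar>e\<bar>" using assms by (intro powr_mono2) auto
 finally show ?thesis .
qed

lemma one_minus_cos_le: "1 - cos s <= (s :: real)\<^sup>2"
proof -
 have "\<bar>sin (s / 2)\<bar>\<^sup>2 <= \<bar>s / 2\<bar>\<^sup>2" by (intro power_mono abs_sin_x_le_abs_x) auto
 then have 1: "4 * (sin (s / 2))\<^sup>2 <= s\<^sup>2" by (simp add: power_divide)
 have 2: "1 - cos s = 2 * (sin (s / 2))\<^sup>2" using cos_double_sin[of "s / 2"] by simp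
 have 3: "(sin (s / 2))\<^sup>2 >= 0" by simp
 show ?thesis using 1 3 unfolding 2 by linarith
qed

lemma linear_growth:
 fixes X X' :: "real => 'a::real_inner"
 assumes der: "\<And>t. t \<in> {0..1} ==> (X has_vector_derivative X' t) (at t)"
  and bound: "\<And>t. t \<in> {0..1} ==> norm (X' t) <= c * norm (X t)" and c: "0 <= c" "c <= c1"
 shows "norm (X 1) <= sqrt (exp (2 * c1 + 1)) * norm (X 0)"
  and "norm (X 1 - X 0) <= c * (sqrt (exp (2 * c1 + 1)) * norm (X 0))"
proof -
 define A where "A = sqrt (exp (2 * c1 + 1))"
 have A: "A >= 0" by (simp add: A_def)
 have der': "(X has_vector_derivative X' t) (at t within {0..1})" if "t \<in> {0..1}" for t
  using der[OF that] by (rule has_vector_derivative_at_within)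
 have growth: "norm (X t) <= A * norm (X 0)" if t: "t \<in> {0..1}" for t
 proof -
  have "(norm (X t))\<^sup>2 <= exp (2 * c + 1) * ((norm (X 0))\<^sup>2 + 0\<^sup>2)"
   by (rule gronwall[OF der']) (use bound c t in auto)
  also have "\<dots> <= exp (2 * c1 + 1) * ((norm (X 0))\<^sup>2 + 0\<^sup>2)"
   using c by (intro mult_right_mono) auto
  finally have "(norm (X t))\<^sup>2 <= (A * norm (X 0))\<^sup>2" by (simp add: A_def power_mult_distrib)
  then show ?thesis by (rule power2_le_imp_le) (use A in auto)
 qed
 then show "norm (X 1) <= sqrt (exp (2 * c1 + 1)) * norm (X 0)" by (simp add: A_def)
 show "norm (X 1 - X 0) <= c * (sqrt (exp (2 * c1 + 1)) * norm (X 0))"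
  unfolding A_def[symmetric]
 proof (rule norm_increment_le[OF der'])
  show "norm (X' t) <= c * (A * norm (X 0))" if "t \<in> {0..1}" for t
   using bound[OF that] mult_left_mono[OF growth[OF that] c(1)] by linarith
 qed auto
qed

lemma power_series_head:
 fixes a :: "nat => complex^'t^'t"
 assumes sum1: "summable (\<lambda>n. mscale (z1 ^ n) (a n))" and "z1 ~= 0"
 obtains B where "B > 0" "\<And>z. cmod z <= cmod z1 / 2 ==> summable (\<lambda>n. mscale (z ^ n) (a n)) ==>
  norm ((\<Sum>n. mscale (z ^ n) (a n)) - a 0) <= B * cmod z"
proof -
 have "Bseq (\<lambda>n. mscale (z1 ^ n) (a n))"
  using summable_LIMSEQ_zero[OF sum1] convergent_def convergent_imp_Bseq by blast
 then obtain b where b: "b > 0" "\<And>n. norm (mscale (z1 ^ n) (a n)) <= b" by (auto elim: BseqE)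
 have z1: "cmod z1 > 0" using assms(2) by simp
 show ?thesis
 proof (rule that[of "2 * b / cmod z1"])
  show "2 * b / cmod z1 > 0" using b(1) z1 by simp
  fix z assume z: "cmod z <= cmod z1 / 2" and sum: "summable (\<lambda>n. mscale (z ^ n) (a n))"
  define q where "q = cmod z / cmod z1"
  have q: "0 <= q" "q <= 1 / 2" using z z1 by (auto simp: q_def field_simps)
  have tail: "norm (mscale (z ^ Suc n) (a (Suc n))) <= b * q * (1 / 2) ^ n" for n
  proof -
   have "norm (mscale (z ^ Suc n) (a (Suc n))) = q ^ Suc n * norm (mscale (z1 ^ Suc n) (a (Suc n)))"
    using z1 by (simp add: norm_mscale norm_power norm_mult q_def power_divide field_simps)
   also have "\<dots> <= q ^ Suc n * b" using q by (intro mult_left_mono b(2)) auto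
   also have "q ^ Suc n <= q * (1 / 2) ^ n" unfolding power_Suc using q by (intro mult_left_mono power_mono) auto
   finally show ?thesis using b(1) by (simp add: mult_ac mult_right_mono)
  qed
  have "norm (\<Sum>n. mscale (z ^ Suc n) (a (Suc n))) <= (\<Sum>n. b * q * (1 / 2) ^ n)"
   by (intro norm_suminf_le tail summable_mult summable_geometric) simp
  also have "\<dots> = b * q * (1 / (1 - 1 / 2))"
   by (intro sums_unique[symmetric] sums_mult geometric_sums) simp
  also have "\<dots> = 2 * b / cmod z1 * cmod z" by (simp add: q_def)
  also have "(\<Sum>n. mscale (z ^ Suc n) (a (Suc n))) = (\<Sum>n. mscale (z ^ n) (a n)) - a 0"
   using suminf_split_head[OF sum] by (simp add: mscale_simps)
  finally show "norm ((\<Sum>n. mscale (z ^ n) (a n)) - a 0) <= 2 * b / cmod z1 * cmod z" .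
 qed
qed

lemma rho_mult: "rho N p Y a b ** rho N p Y c d = rho N p Y (a * c) (b * d)"
proof -
 have "(rho N p Y a b ** rho N p Y c d) $ s $ t = rho N p Y (a * c) (b * d) $ s $ t" for s t
 proof -
  have e: "rho N p Y a b $ s $ k * rho N p Y c d $ k $ t =
    (if k = s then rho N p Y a b $ s $ s * rho N p Y c d $ s $ t else 0)" for k
   by (simp add: rho_def)
  have "(rho N p Y a b ** rho N p Y c d) $ s $ t =
    (\<Sum>k\<in>UNIV. rho N p Y a b $ s $ k * rho N p Y c d $ k $ t)"
   by (simp add: matrix_matrix_mult_def)
  also have "\<dots> = (\<Sum>k\<in>UNIV. if k = s then rho N p Y a b $ s $ s * rho N p Y c d $ s $ t else 0)"
   by (rule sum.cong[OF refl e])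
  also have "\<dots> = rho N p Y a b $ s $ s * rho N p Y c d $ s $ t" by simp
  also have "\<dots> = rho N p Y (a * c) (b * d) $ s $ t" by (simp add: rho_def)
  finally show ?thesis .
 qed
 then show ?thesis by (simp add: vec_eq_iff)
qed

lemma rho_one: "rho N p Y 1 1 = mat 1"
 by (simp add: rho_def mat_def vec_eq_iff)

lemma adj_rho: "adj (rho N p Y a b) = rho N p Y (cnj a) (cnj b)"
 by (simp add: rho_def adj_def vec_eq_iff)

lemma norm_rho_le:
 "norm (rho N p Y a b) <= (cmod a + cmod b) * (norm (rho N p Y 1 0) + norm (rho N p Y 0 1))"
proof -
 have "rho N p Y a b = mscale a (rho N p Y 1 0) + mscale b (rho N p Y 0 1)"
  by (simp add: rho_def mscale_def vec_eq_iff)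
 then have "norm (rho N p Y a b) <= cmod a * norm (rho N p Y 1 0) + cmod b * norm (rho N p Y 0 1)"
  by (metis norm_mscale norm_triangle_ineq)
 also have "\<dots> <= cmod a * (norm (rho N p Y 1 0) + norm (rho N p Y 0 1)) +
   cmod b * (norm (rho N p Y 1 0) + norm (rho N p Y 0 1))"
  by (intro add_mono mult_left_mono) auto
 finally show ?thesis by (simp add: distrib_right)
qed

locale expansion = torus_rep N \<kappa> \<tau> for N :: nat and \<kappa> :: real and \<tau> :: "(nat => nat) => complex^'t^'t" +
 fixes p :: "nat list" and Y :: "'t => nat \<times> nat => nat"
  and L1 :: "(nat => complex) => complex^'t^'t" and D :: "(nat => complex) set"
  and \<alpha> :: "nat => (nat => complex) => complex^'t^'t" and lp lz :: "(nat => complex) \<times> complex => complex"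
 assumes D_open: "openin (product_topology (\<lambda>_. euclidean) {1..N - 1}) D"
  and D_base: "t \<in> {cos (pi / real N)..1} ==> base_point N t \<in> D"
  and \<alpha>_base: "\<alpha> 0 (base_point N 1) = mat 1"
  and exp_lp: "(y, z) \<in> expansion_domain N D ==>
   exp (lp (y, z)) = ((y (N - 1))\<^sup>2 - z\<^sup>2) * (\<Prod>j = 1..N - 2. y j)"
  and exp_lz: "(y, z) \<in> expansion_domain N D ==> exp (lz (y, z)) = z"
  and \<alpha>_summable: "(y, z) \<in> expansion_domain N D ==> summable (\<lambda>n. mscale (z ^ n) (\<alpha> n y))"
  and L1_eq: "(y, z) \<in> expansion_domain N D ==> L1 (split_point N y z) =
   mscale (exp (- of_real (gamma N p * \<kappa>) * lp (y, z)))
    (rho N p Y (exp (- of_real \<kappa> * lz (y, z))) (exp (of_real \<kappa> * lz (y, z)))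
     ** (\<Sum>n. mscale (z ^ n) (\<alpha> n y)))"
  and L1_partial: "(y, z) \<in> expansion_domain N D ==> i \<in> {1..N} ==>
   ((\<lambda>s. L1 ((split_point N y z)(i := s)) $ a $ b) has_field_derivative
    (L1 (split_point N y z) ** system_coeff N \<kappa> (gamma N p) \<tau> i (split_point N y z)) $ a $ b)
    (at (split_point N y z i))"
  and refl_rho: "refl (N - 1) N = rho N p Y (- 1) 1"
begin

abbreviation wdir :: complex where "wdir \<equiv> cis (- 3 * pi / real N)"
abbreviation base_y :: "nat => complex" where "base_y \<equiv> base_point N 1"
abbreviation base_path :: "real => nat => real" where
 "base_path s \<equiv> wpt N (regular_angles N) (pi * (2 * real N - 3) / real N) s"
abbreviation base_domain :: "(complex \<times> complex) set" where
 "base_domain \<equiv> {(u, z). (base_y(N - 1 := u), z) \<in> expansion_domain N D}"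

lemma L1_chain:
 assumes dom: "(y, z) \<in> expansion_domain N D" and i: "i \<in> {1..N}"
  and \<phi>: "\<phi> r = split_point N y z i" "(\<phi> has_vector_derivative \<phi>') (at r)"
 shows "((\<lambda>r. L1 ((split_point N y z)(i := \<phi> r))) has_vector_derivative
  mscale \<phi>' (L1 (split_point N y z) ** system_coeff N \<kappa> (gamma N p) \<tau> i (split_point N y z))) (at r)"
proof (rule has_vector_derivative_matrix)
 fix a b
 have "((\<lambda>s. L1 ((split_point N y z)(i := s)) $ a $ b) \<circ> \<phi> has_vector_derivative
   \<phi>' * (L1 (split_point N y z) ** system_coeff N \<kappa> (gamma N p) \<tau> i (split_point N y z)) $ a $ b) (at r)"
  using L1_partial[OF dom i, of a b] unfolding \<phi>(1)[symmetric]
  by (rule field_vector_diff_chain_at[OF \<phi>(2)])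
 then show "((\<lambda>r. L1 ((split_point N y z)(i := \<phi> r)) $ a $ b) has_vector_derivative
   mscale \<phi>' (L1 (split_point N y z) ** system_coeff N \<kappa> (gamma N p) \<tau> i (split_point N y z)) $ a $ b) (at r)"
  by (simp add: o_def mscale_def)
qed

lemma base_point_upd: "base_point N t = base_y(N - 1 := of_real t * wdir)"
 using N3 by (auto simp: base_point_def fun_eq_iff)

lemma omega_power: "omega N ^ (j - 1) = cis (regular_angles N j)"
 using Complex.DeMoivre[of "2 * pi / real N" "j - 1"] by (simp add: omega_def regular_angles_def mult_ac)

lemma base_y_eq: "j \<in> {1..N - 2} ==> base_point N t j = cis (regular_angles N j)"
 using omega_power[of j] by (auto simp: base_point_def)

text \<open>Near the base path, points of the torus are of the form \<open>x(u, z)\<close>.\<close>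

lemma pt_split:
 assumes "\<And>j. j \<in> {1..N - 2} ==> et j = regular_angles N j"
 shows "pt N et = split_point N (base_y(N - 1 := (cis (et (N - 1)) + cis (et N)) / 2))
  ((cis (et N) - cis (et (N - 1))) / 2)"
proof
 fix i
 consider "i \<notin> {1..N}" | "i = N - 1" | "i = N" | "i \<in> {1..N - 2}" using N3 by force
 then show "pt N et i = split_point N (base_y(N - 1 := (cis (et (N - 1)) + cis (et N)) / 2))
  ((cis (et N) - cis (et (N - 1))) / 2) i"
 proof cases
  case 4
  then have "i ~= N - 1" "i ~= N" "i \<in> {1..N}" by auto
  then show ?thesis using assms[OF 4] base_y_eq[OF 4, of 1] by (simp add: pt_def split_point_def)
 qed (use N3 in \<open>auto simp: pt_def split_point_def field_simps\<close>)
qed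

lemma cis_base_center: "cis (pi * (2 * real N - 3) / real N) = wdir"
proof -
 have "pi * (2 * real N - 3) / real N = 2 * pi + (- 3 * pi / real N)"
  using N3 by (simp add: field_simps)
 then have "cis (pi * (2 * real N - 3) / real N) = cis (2 * pi) * wdir" by (simp only: cis_mult)
 then show ?thesis by simp
qed

lemma cis_base_path:
 "cis (base_path s (N - 1)) = wdir * (of_real (cos s) - \<i> * of_real (sin s))"
 "cis (base_path s N) = wdir * (of_real (cos s) + \<i> * of_real (sin s))"
proof -
 have s: "cis s = of_real (cos s) + \<i> * of_real (sin s)" "cis (- s) = of_real (cos s) - \<i> * of_real (sin s)"
  by (simp_all add: complex_eq_iff)
 have "base_path s (N - 1) = pi * (2 * real N - 3) / real N + (- s)"
  "base_path s N = pi * (2 * real N - 3) / real N + s"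
  using N3 by (simp_all add: wpt_def)
 then have "cis (base_path s (N - 1)) = wdir * cis (- s)" "cis (base_path s N) = wdir * cis s"
  by (simp_all only: cis_mult[symmetric] cis_base_center)
 then show "cis (base_path s (N - 1)) = wdir * (of_real (cos s) - \<i> * of_real (sin s))"
  "cis (base_path s N) = wdir * (of_real (cos s) + \<i> * of_real (sin s))"
  by (simp_all only: s)
qed

lemma base_path_regular: "j \<in> {1..N - 2} ==> base_path s j = regular_angles N j"
 by (auto simp: wpt_def)

lemma base_path_split:
 "pt N (base_path s) = split_point N (base_point N (cos s)) (wdir * (\<i> * of_real (sin s)))"
proof -
 have 1: "(wdir * (of_real (cos s) - \<i> * of_real (sin s)) + wdir * (of_real (cos s) + \<i> * of_real (sin s))) / 2
   = of_real (cos s) * wdir"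
  "(wdir * (of_real (cos s) + \<i> * of_real (sin s)) - wdir * (of_real (cos s) - \<i> * of_real (sin s))) / 2
   = wdir * (\<i> * of_real (sin s))" by (simp_all add: algebra_simps)
 show ?thesis
  by (subst pt_split[OF base_path_regular]) (simp_all only: cis_base_path base_point_upd[of "cos s"] 1)
qed

lemma Im_divide_pos_iff: "0 < Im (z / u) \<longleftrightarrow> 0 < Im (z * cnj u)"
proof (cases "u = 0")
 case False
 have "z / u = z * cnj u / of_real ((cmod u)\<^sup>2)" by (rule complex_div_cnj)
 then have "Im (z / u) = Im (z * cnj u) / (cmod u)\<^sup>2" by (simp only: Im_divide_of_real)
 then show ?thesis using False by (simp add: zero_less_divide_iff)
qed simp

lemma open_base_domain: "open base_domain"
proof -
 have "continuous_map euclidean (product_topology (\<lambda>_. euclidean) {1..N - 1}) (\<lambda>u::complex. base_y(N - 1 := u))"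
  using N3 by (auto simp: continuous_map_componentwise extensional_def base_point_def)
 then have "open {u. base_y(N - 1 := u) \<in> D}"
  using openin_continuous_map_preimage[OF _ D_open] by fastforce
 then have 1: "open ({u. base_y(N - 1 := u) \<in> D} \<times> (UNIV :: complex set))" by (intro open_Times) auto
 have 2: "open (\<Inter>j\<in>{1..N - 2}. {q :: complex \<times> complex. norm (snd q) < norm (base_y j - fst q)})"
  by (intro open_INT ballI open_Collect_less continuous_intros) auto
 have 3: "open {q :: complex \<times> complex. 0 < Im (snd q * cnj (fst q))}"
  by (intro open_Collect_less continuous_intros)
 have "base_domain = ({u. base_y(N - 1 := u) \<in> D} \<times> UNIV) \<inter>
   (\<Inter>j\<in>{1..N - 2}. {q. norm (snd q) < norm (base_y j - fst q)}) \<inter>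
   {q. 0 < Im (snd q * cnj (fst q))}"
 proof (intro set_eqI, clarify)
  fix u z :: complex
  have "(base_y(N - 1 := u)) j = base_y j" if "j \<in> {1..N - 2}" for j using that by auto
  then show "(u, z) \<in> base_domain \<longleftrightarrow> (u, z) \<in> ({u. base_y(N - 1 := u) \<in> D} \<times> UNIV) \<inter>
   (\<Inter>j\<in>{1..N - 2}. {q. norm (snd q) < norm (base_y j - fst q)}) \<inter>
   {q. 0 < Im (snd q * cnj (fst q))}"
   by (auto simp: expansion_domain_def Im_divide_pos_iff)
 qed
 then show ?thesis using 1 2 3 by (simp only: open_Int)
qed

lemma cmod_diff_sq: "(cmod (cis b - of_real t * cis a))\<^sup>2 = 1 - 2 * t * cos (b - a) + t\<^sup>2"
proof -
 have "(cmod (cis b - of_real t * cis a))\<^sup>2 = (cos b - t * cos a)\<^sup>2 + (sin b - t * sin a)\<^sup>2"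
  by (simp add: cmod_power2)
 also have "\<dots> = ((cos b)\<^sup>2 + (sin b)\<^sup>2) - 2 * t * (cos b * cos a + sin b * sin a) + t\<^sup>2 * ((cos a)\<^sup>2 + (sin a)\<^sup>2)"
  by algebra
 finally show ?thesis by (simp add: cos_diff)
qed

lemma cos_base_less:
 assumes "j \<in> {1..N - 2}" "s \<in> {0..pi / real N}"
 shows "cos (regular_angles N j - (- 3 * pi / real N)) < cos s"
proof -
 define \<delta> where "\<delta> = regular_angles N j - (- 3 * pi / real N)"
 have Npos: "real N > 0" using N3 by simp
 have "real (j - 1) = real j - 1" using assms(1) by (simp add: of_nat_diff)
 then have \<delta>: "\<delta> = pi * (2 * real j + 1) / real N"
  using Npos by (simp only: \<delta>_def regular_angles_def) (simp add: divide_simps, simp add: algebra_simps)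
 have "real j >= 1" "real j <= real N - 2" using assms(1) N3 by (auto simp: of_nat_diff)
 then have "pi * 1 < pi * (2 * real j + 1)" "pi * (2 * real j + 1) < pi * (2 * real N - 1)"
  by (intro mult_strict_left_mono; simp)+
 then have lo: "pi / real N < \<delta>" and hi: "\<delta> < 2 * pi - pi / real N"
 proof -
  have "pi * 1 / real N < \<delta>"
   unfolding \<delta> using \<open>pi * 1 < _\<close> Npos by (rule divide_strict_right_mono)
  then show "pi / real N < \<delta>" by simp
  have "\<delta> < pi * (2 * real N - 1) / real N"
   unfolding \<delta> using \<open>_ < pi * (2 * real N - 1)\<close> Npos by (rule divide_strict_right_mono)
  also have "\<dots> = 2 * pi - pi / real N" using Npos by (simp add: field_simps)
  finally show "\<delta> < 2 * pi - pi / real N" .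
 qed
 have s: "0 <= s" "s <= pi / real N" using assms(2) by auto
 show ?thesis
 proof (cases "\<delta> <= pi")
  case True
  then show ?thesis unfolding \<delta>_def[symmetric] using lo s by (intro cos_monotone_0_pi) auto
 next
  case False
  have "cos (2 * pi - \<delta>) < cos s" using False hi s by (intro cos_monotone_0_pi) auto
  then show ?thesis unfolding \<delta>_def[symmetric] by simp
 qed
qed

lemma pi_over_N: "0 < pi / real N" "pi / real N <= pi / 3"
proof -
 show "0 < pi / real N" using N3 by simp
 show "pi / real N <= pi / 3" using N3 by (intro divide_left_mono) auto
qed

lemma base_path_domain:
 assumes s: "0 < s" "s <= pi / real N"
 shows "(base_point N (cos s), wdir * (\<i> * of_real (sin s))) \<in> expansion_domain N D"
 unfolding expansion_domain_def
proof (intro CollectI case_prodI conjI ballI)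
 have s2: "s < pi / 2" "s < pi" "pi / real N <= pi" using s pi_over_N pi_gt_zero by linarith+
 have cs: "cos s > 0" using s s2 by (intro cos_gt_zero) auto
 have ss: "sin s > 0" using s s2 by (intro sin_gt_zero) auto
 show "base_point N (cos s) \<in> D"
 proof (rule D_base)
  have "cos (pi / real N) <= cos s" using s s2(3) by (intro cos_monotone_0_pi_le) auto
  then show "cos s \<in> {cos (pi / real N)..1}" by simp
 qed
 have bN: "base_point N (cos s) (N - 1) = of_real (cos s) * wdir"
  unfolding base_point_upd[of "cos s"] by simp
 show "0 < Im (wdir * (\<i> * of_real (sin s)) / base_point N (cos s) (N - 1))"
 proof -
  have "wdir * (\<i> * of_real (sin s)) / (of_real (cos s) * wdir) = \<i> * of_real (sin s / cos s)"
   by simp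
  then show ?thesis unfolding bN using cs ss by simp
 qed
 fix j assume j: "j \<in> {1..N - 2}"
 have "cos (regular_angles N j - (- 3 * pi / real N)) < cos s" using cos_base_less[OF j] s by simp
 then have "2 * cos s * cos (regular_angles N j - (- 3 * pi / real N)) < 2 * cos s * cos s"
  using cs by simp
 then have "(sin s)\<^sup>2 < 1 - 2 * cos s * cos (regular_angles N j - (- 3 * pi / real N)) + (cos s)\<^sup>2"
  using sin_cos_squared_add[of s] by (simp add: power2_eq_square)
 also have "\<dots> = (cmod (base_point N (cos s) j - base_point N (cos s) (N - 1)))\<^sup>2"
  unfolding bN base_y_eq[OF j] cmod_diff_sq ..
 finally have "sin s < cmod (base_point N (cos s) j - base_point N (cos s) (N - 1))"
  by (rule power2_less_imp_less) simp
 then show "cmod (wdir * (\<i> * of_real (sin s))) < cmod (base_point N (cos s) j - base_point N (cos s) (N - 1))"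
  using ss by (simp add: norm_mult)
qed

lemma base_path_chamber:
 assumes s: "0 < s" "s <= pi / real N"
 shows "base_path s \<in> chamber N"
proof -
 have gap: "wgap N (regular_angles N) (pi * (2 * real N - 3) / real N) (2 * pi / real N)"
  unfolding wgap_def using N3 by (auto simp: regular_angles_def of_nat_diff field_simps)
 show ?thesis
  by (rule wgap_chamber[OF N3 gap]) (use s N3 in auto)
qed

lemma base_path_end: "pt N (base_path (pi / real N)) = x0 N"
proof -
 have "base_path (pi / real N) i = regular_angles N i" if "i \<in> {1..N}" for i
  using that N3 by (auto simp: wpt_def regular_angles_def of_nat_diff field_simps)
 then show ?thesis unfolding x0_eq by (auto simp: pt_def restrict_def fun_eq_iff)
qed

text \<open>Any quadratic form in \<open>L\<^sub>1\<close> solves the same equation on the torus as \<open>K\<close> does.\<close>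

lemma L1_form_solves:
 assumes s: "0 < s" "s <= pi / real N"
 shows "solves_at {N - 1, N} (base_path s) (\<lambda>et. adj (L1 (pt N et)) ** H ** L1 (pt N et))"
proof -
 define f where "f = (\<lambda>(a, b). ((cis a + cis b) / 2, (cis b - cis a) / 2))"
 have "continuous_on UNIV f" unfolding f_def split_def by (intro continuous_intros) auto
 then have "open (f -` base_domain)" using open_base_domain open_vimage by blast
 moreover have "(base_path s (N - 1), base_path s N) \<in> f -` base_domain"
 proof -
  have "f (base_path s (N - 1), base_path s N) = (of_real (cos s) * wdir, wdir * (\<i> * of_real (sin s)))"
   unfolding f_def prod.case cis_base_path by (simp add: field_simps)
  then show ?thesis using base_path_domain[OF s] unfolding base_point_upd[of "cos s"] by simp
 qed
 ultimately have "\<exists>e>0. \<forall>q. dist q (base_path s (N - 1), base_path s N) < e \<longrightarrow> q \<in> f -` base_domain"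
  unfolding open_dist by (rule bspec)
 then obtain e where e: "e > 0" "\<And>q. dist q (base_path s (N - 1), base_path s N) < e ==> f q \<in> base_domain"
  by (metis vimageD)
 obtain \<delta>1 where \<delta>1: "\<delta>1 > 0" "\<And>et. (\<forall>i\<in>{1..N}. \<bar>et i - base_path s i\<bar> < \<delta>1) ==> et \<in> chamber N"
  using chamber_box[OF base_path_chamber[OF s]] N3 by auto
 define \<delta> where "\<delta> = min \<delta>1 (e / 2)"
 show ?thesis unfolding solves_at_def
 proof (intro exI[of _ \<delta>] conjI ballI)
  show "\<delta> > 0" using e(1) \<delta>1(1) by (simp add: \<delta>_def)
  fix et i assume et: "et \<in> coord_box {N - 1, N} (base_path s) \<delta>" and i: "i \<in> {N - 1, N}"
  have i': "i \<in> {1..N}" using i N3 by auto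
  have ch: "et \<in> chamber N"
  proof (rule \<delta>1(2), rule ballI)
   fix k
   show "\<bar>et k - base_path s k\<bar> < \<delta>1"
    using et \<delta>1(1) by (cases "k \<in> {N - 1, N}") (auto simp: coord_box_def \<delta>_def)
  qed
  have eta_reg: "et j = regular_angles N j" if "j \<in> {1..N - 2}" for j
  proof -
   have "j \<notin> {N - 1, N}" using that by auto
   then show ?thesis using et base_path_regular[OF that, of s] by (simp add: coord_box_def)
  qed
  define y where "y = base_y(N - 1 := (cis (et (N - 1)) + cis (et N)) / 2)"
  define z where "z = (cis (et N) - cis (et (N - 1))) / 2"
  have x: "pt N et = split_point N y z" unfolding y_def z_def by (rule pt_split[OF eta_reg])
  have "f (et (N - 1), et N) \<in> base_domain"
  proof (rule e(2))
   have "dist (et (N - 1), et N) (base_path s (N - 1), base_path s N) \<le>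
     dist (et (N - 1)) (base_path s (N - 1)) + dist (et N) (base_path s N)"
    unfolding dist_Pair_Pair by (rule sqrt_sum_squares_le_sum) auto
   also have "\<dots> < e / 2 + e / 2"
    using et by (intro add_strict_mono) (auto simp: coord_box_def \<delta>_def dist_real_def)
   finally show "dist (et (N - 1), et N) (base_path s (N - 1), base_path s N) < e" by simp
  qed
  then have dom: "(y, z) \<in> expansion_domain N D" by (simp add: f_def y_def z_def)
  have upd: "pt N (et(i := r)) = (pt N et)(i := cis r)" for r using i' by (auto simp: pt_def fun_eq_iff)
  have "(cis has_vector_derivative \<i> * cis (et i)) (at (et i))"
   by (rule has_vector_derivative_cis)
  moreover have "cis (et i) = split_point N y z i" using i' by (simp add: pt_def flip: x)
  ultimately have "((\<lambda>r. L1 ((split_point N y z)(i := cis r))) has_vector_derivative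
   mscale (\<i> * cis (et i)) (L1 (split_point N y z) ** system_coeff N \<kappa> (gamma N p) \<tau> i (split_point N y z))) (at (et i))"
   by (intro L1_chain[OF dom i'])
  then have "((\<lambda>r. L1 (pt N (et(i := r)))) has_vector_derivative mscale (\<i> * pt N et i)
    (L1 (pt N (et(i := et i))) ** system_coeff N \<kappa> (gamma N p) \<tau> i (pt N et))) (at (et i))"
   using i' by (simp only: upd fun_upd_triv flip: x) (simp add: pt_def)
  from quadratic_partial[OF i' chamber_regular[OF ch] this]
  show "((\<lambda>r. adj (L1 (pt N (et(i := r)))) ** H ** L1 (pt N (et(i := r)))) has_vector_derivative
    gen (unit_vec i) et (adj (L1 (pt N et)) ** H ** L1 (pt N et))) (at (et i))" by simp
 qed
qed

lemma base_path_unique: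
 assumes F: "\<And>s. 0 < s ==> s <= pi / real N ==> solves_at {N - 1, N} (base_path s) F"
  and G: "\<And>s. 0 < s ==> s <= pi / real N ==> solves_at {N - 1, N} (base_path s) G"
  and eq: "F (base_path (pi / real N)) = G (base_path (pi / real N))"
  and s: "0 < s" "s <= pi / real N"
 shows "F (base_path s) = G (base_path s)"
proof -
 define e where "e = s - pi / real N"
 define d where "d = (\<lambda>i. if i = N - 1 then - e else if i = N then e else 0)"
 have line: "(\<lambda>i. base_path (pi / real N) i + t * d i) = base_path (pi / real N + t * e)" for t
  by (auto simp: wpt_def d_def fun_eq_iff)
 have range: "0 < pi / real N + t * e \<and> pi / real N + t * e <= pi / real N" if "t \<in> {0..1}" for t
 proof -
  have "t * (pi / real N - s) <= 1 * (pi / real N - s)" using that s by (intro mult_right_mono) auto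
  moreover have "0 <= t * (pi / real N - s)" using that s by simp
  ultimately show ?thesis using s by (simp add: e_def algebra_simps)
 qed
 have S: "{N - 1, N} \<subseteq> {1..N}" using N3 by auto
 have reg: "regular N (\<lambda>i. base_path (pi / real N) i + t * d i)" if "t \<in> {0..1}" for t
  unfolding line using range[OF that] by (intro chamber_regular base_path_chamber) auto
 have d0: "d k = 0" if "k \<notin> {N - 1, N}" for k using that by (auto simp: d_def)
 have "F (\<lambda>i. base_path (pi / real N) i + 1 * d i) = G (\<lambda>i. base_path (pi / real N) i + 1 * d i)"
 proof (rule line_unique[OF reg])
  fix t :: real assume t: "t \<in> {0..1}"
  show "((\<lambda>t. F (\<lambda>i. base_path (pi / real N) i + t * d i)) has_vector_derivative
    gen d (\<lambda>i. base_path (pi / real N) i + t * d i) (F (\<lambda>i. base_path (pi / real N) i + t * d i)))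
    (at t within {0..1})"
   by (rule solves_at_line[OF S d0 reg[OF t]]) (use F range[OF t] in \<open>auto simp: line\<close>)
  show "((\<lambda>t. G (\<lambda>i. base_path (pi / real N) i + t * d i)) has_vector_derivative
    gen d (\<lambda>i. base_path (pi / real N) i + t * d i) (G (\<lambda>i. base_path (pi / real N) i + t * d i)))
    (at t within {0..1})"
   by (rule solves_at_line[OF S d0 reg[OF t]]) (use G range[OF t] in \<open>auto simp: line\<close>)
 qed (use eq in auto)
 then show ?thesis unfolding line by (simp add: e_def)
qed

end

context expansion
begin

text \<open>For \<open>a = b = cos s\<close> this is a point of the base path. For \<open>a = b = 1\<close> it is \<open>x(u, z)\<close> with \<open>u\<close> independent
 of \<open>s\<close>, where the coefficients of the expansion are constant. Changing \<open>a\<close> and \<open>b\<close> one after the other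
 leads from one to the other.\<close>

definition cross :: "real => real => real => nat => complex" where
 "cross a b s = (\<lambda>i\<in>{1..N}. if i = N - 1 then wdir * (of_real a - \<i> * of_real (sin s))
   else if i = N then wdir * (of_real b + \<i> * of_real (sin s)) else cis (regular_angles N i))"

lemma cross_last:
 "cross a b s (N - 1) = wdir * (of_real a - \<i> * of_real (sin s))"
 "cross a b s N = wdir * (of_real b + \<i> * of_real (sin s))"
 using N3 by (auto simp: cross_def)

definition gap0 :: real where
 "gap0 = Min ((\<lambda>j. cmod (cis (regular_angles N j) - wdir)) ` {1..N - 2})"

lemma gap0: "gap0 > 0" "j \<in> {1..N - 2} ==> gap0 <= cmod (cis (regular_angles N j) - wdir)"
proof -
 have pos: "cmod (cis (regular_angles N j) - wdir) > 0" if "j \<in> {1..N - 2}" for j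
 proof -
  have "cos (regular_angles N j - (- 3 * pi / real N)) < 1"
   using cos_base_less[OF that, of 0] pi_over_N by simp
  then have "(cmod (cis (regular_angles N j) - of_real 1 * wdir))\<^sup>2 > 0"
   unfolding cmod_diff_sq by simp
  then show ?thesis by simp
 qed
 have fin: "finite ((\<lambda>j. cmod (cis (regular_angles N j) - wdir)) ` {1..N - 2})"
  "(\<lambda>j. cmod (cis (regular_angles N j) - wdir)) ` {1..N - 2} ~= {}" using N3 by auto
 show "gap0 > 0" unfolding gap0_def using fin pos by (auto simp: Min_gr_iff)
 show "j \<in> {1..N - 2} ==> gap0 <= cmod (cis (regular_angles N j) - wdir)"
  unfolding gap0_def using fin by (intro Min_le) auto
qed

lemma cross_split:
 "cross a b s = split_point N (base_point N ((a + b) / 2)) (wdir * (of_real ((b - a) / 2) + \<i> * of_real (sin s)))"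
proof
 fix i
 consider "i \<notin> {1..N}" | "i = N - 1" | "i = N" | "i \<in> {1..N - 2}" using N3 by force
 then show "cross a b s i = split_point N (base_point N ((a + b) / 2))
   (wdir * (of_real ((b - a) / 2) + \<i> * of_real (sin s))) i"
 proof cases
  case 4
  then have "i ~= N - 1" "i ~= N" "i \<in> {1..N}" by auto
  then show ?thesis using base_y_eq[OF 4] by (simp add: cross_def split_point_def)
 qed (use N3 in \<open>auto simp: cross_def split_point_def base_point_def field_simps\<close>)
qed

lemma cross_base_path: "cross (cos s) (cos s) s = pt N (base_path s)"
 unfolding cross_split base_path_split by simp

text \<open>The last two coordinates of \<open>cross a b s\<close> then stay away from all the others.\<close>

definition small :: "real => bool" where
 "small s \<longleftrightarrow> 0 < s \<and> s <= pi / real N \<and> 4 * s <= gap0 \<and> s <= 1 / 2"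

lemma small_trig:
 assumes "small s"
 shows "0 < cos s" "1 / 2 <= cos s" "cos s <= 1" "1 - cos s <= s\<^sup>2" "1 - cos s <= s / 2"
  "0 < sin s" "sin s <= s" "s / 2 <= sin s"
proof -
 have s: "0 < s" "s <= pi / real N" "s <= 1 / 2" using assms by (auto simp: small_def)
 have pi3: "s < pi / 2" "s < pi" using s pi_gt3 by linarith+
 show c: "1 - cos s <= s\<^sup>2" by (rule one_minus_cos_le)
 have "s\<^sup>2 <= s * (1 / 2)" unfolding power2_eq_square using s by (intro mult_left_mono) auto
 then show c2: "1 - cos s <= s / 2" using c by simp
 show "1 / 2 <= cos s" using c2 s by linarith
 then show "0 < cos s" by linarith
 show "cos s <= 1" by simp
 show "0 < sin s" using s pi3 by (intro sin_gt_zero) auto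
 show "sin s <= s" using s by (intro sin_x_le_x) auto
 show "s / 2 <= sin s" using s pi3 by (intro sin_ge_half) auto
qed

lemma cross_domain:
 assumes s: "small s" and a: "a \<in> {cos s..1}" and b: "b \<in> {cos s..1}"
 shows "(base_point N ((a + b) / 2), wdir * (of_real ((b - a) / 2) + \<i> * of_real (sin s))) \<in> expansion_domain N D"
 unfolding expansion_domain_def
proof (intro CollectI case_prodI conjI ballI)
 note t = small_trig[OF s]
 have s': "0 < s" "s <= pi / real N" "4 * s <= gap0" using s by (auto simp: small_def)
 define c where "c = (a + b) / 2"
 have c: "cos s <= c" "c <= 1" using a b by (auto simp: c_def)
 have c0: "c > 0" using c(1) t(1) by linarith
 have "pi / real N <= pi" using pi_over_N pi_gt_zero by linarith
 then have "cos (pi / real N) <= cos s" using s' by (intro cos_monotone_0_pi_le) auto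
 then show "base_point N ((a + b) / 2) \<in> D" using c by (intro D_base) (auto simp: c_def)
 have u: "base_point N ((a + b) / 2) (N - 1) = of_real c * wdir"
  unfolding c_def[symmetric] base_point_upd[of c] by simp
 have "wdir * (of_real ((b - a) / 2) + \<i> * of_real (sin s)) / (of_real c * wdir) =
   (of_real ((b - a) / 2) + \<i> * of_real (sin s)) / of_real c" by simp
 then have "Im (wdir * (of_real ((b - a) / 2) + \<i> * of_real (sin s)) / (of_real c * wdir)) = sin s / c"
  by (simp only: Im_divide_of_real) simp
 then show "0 < Im (wdir * (of_real ((b - a) / 2) + \<i> * of_real (sin s)) / base_point N ((a + b) / 2) (N - 1))"
  unfolding u using c0 t(6) by simp
 fix j assume j: "j \<in> {1..N - 2}"
 have "cmod (wdir * (of_real ((b - a) / 2) + \<i> * of_real (sin s))) \<le>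
   cmod (of_real ((b - a) / 2)) + cmod (\<i> * of_real (sin s))"
  unfolding norm_mult[of wdir] by (simp only: norm_cis mult_1) (rule norm_triangle_ineq)
 also have "\<dots> = \<bar>(b - a) / 2\<bar> + sin s"
  using t(6) by (simp only: norm_mult norm_of_real norm_ii mult_1 abs_of_pos)
 also have "\<bar>(b - a) / 2\<bar> <= s" using a b t(5) s' by auto
 finally have z: "cmod (wdir * (of_real ((b - a) / 2) + \<i> * of_real (sin s))) <= 2 * s" using t(7) by simp
 have "cmod (cis (regular_angles N j) - wdir) \<le>
   cmod (cis (regular_angles N j) - of_real c * wdir) + cmod (of_real c * wdir - wdir)"
  using norm_triangle_ineq[of "cis (regular_angles N j) - of_real c * wdir" "of_real c * wdir - wdir"] by simp
 also have "cmod (of_real c * wdir - wdir) = 1 - c"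
 proof -
  have "of_real c * wdir - wdir = of_real (c - 1) * wdir" by (simp add: algebra_simps)
  then show ?thesis using c by (simp only: norm_mult norm_cis norm_of_real) simp
 qed
 finally have "gap0 <= cmod (cis (regular_angles N j) - of_real c * wdir) + s"
  using gap0(2)[OF j] c t(5) s' by linarith
 then have "2 * s < cmod (cis (regular_angles N j) - of_real c * wdir)" using s' by linarith
 then show "cmod (wdir * (of_real ((b - a) / 2) + \<i> * of_real (sin s))) <
   cmod (base_point N ((a + b) / 2) j - base_point N ((a + b) / 2) (N - 1))"
  unfolding u base_y_eq[OF j] using z by linarith
qed

abbreviation coeff :: "nat => (nat => complex) => complex^'t^'t" where
 "coeff \<equiv> system_coeff N \<kappa> (gamma N p) \<tau>"

definition coeff_const :: real where
 "coeff_const = \<bar>\<kappa>\<bar> * (real N + \<bar>gamma N p\<bar>) * norm (mat 1 :: complex^'t^'t)"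

lemma coeff_const_nonneg: "coeff_const >= 0"
 by (simp add: coeff_const_def)

lemma cross_coeff_le:
 assumes s: "small s" and a: "a \<in> {cos s..1}" and b: "b \<in> {cos s..1}" and i: "i \<in> {N - 1, N}"
 shows "norm (coeff i (cross a b s)) <= coeff_const / s"
proof -
 note t = small_trig[OF s]
 have s': "0 < s" "4 * s <= gap0" "s <= 1 / 2" using s by (auto simp: small_def)
 define x where "x = cross a b s"
 have i': "i \<in> {1..N}" using i N3 by auto
 have xN1: "x (N - 1) = wdir * (of_real a - \<i> * of_real (sin s))"
  and xN: "x N = wdir * (of_real b + \<i> * of_real (sin s))"
  and xj: "j \<in> {1..N - 2} ==> x j = cis (regular_angles N j)" for j
  using N3 by (auto simp: x_def cross_def)
 have near: "cmod (x i - wdir) <= 2 * s"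
 proof -
  have bound: "cmod (wdir * w - wdir) <= \<bar>Re w - 1\<bar> + \<bar>Im w\<bar>" for w
  proof -
   have "wdir * w - wdir = wdir * (w - 1)" by (simp add: algebra_simps)
   then have "cmod (wdir * w - wdir) = cmod (w - 1)" by (simp only: norm_mult norm_cis mult_1)
   then show ?thesis using cmod_le[of "w - 1"] by simp
  qed
  have "cmod (x (N - 1) - wdir) <= 2 * s"
   using bound[of "of_real a - \<i> * of_real (sin s)"] a t(5,6,7) s' unfolding xN1 by auto
  moreover have "cmod (x N - wdir) <= 2 * s"
   using bound[of "of_real b + \<i> * of_real (sin s)"] b t(5,6,7) s' unfolding xN by auto
  ultimately show ?thesis using i by auto
 qed
 have dist: "s <= cmod (x i - x j)" if j: "j \<in> {1..N} - {i}" for j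
 proof (cases "j \<in> {1..N - 2}")
  case True
  have "cmod (cis (regular_angles N j) - wdir) <= cmod (x i - x j) + cmod (x i - wdir)"
   using norm_triangle_ineq[of "x j - x i" "x i - wdir"] by (simp add: xj[OF True] norm_minus_commute)
  then show ?thesis using gap0(2)[OF True] near s' by linarith
 next
  case False
  then have "(i = N - 1 \<and> j = N) \<or> (i = N \<and> j = N - 1)" using i j N3 by force
  moreover have "s <= cmod (x N - x (N - 1))"
  proof -
   have "x N - x (N - 1) = wdir * (of_real (b - a) + \<i> * of_real (2 * sin s))"
    unfolding xN xN1 by (simp add: algebra_simps)
   then have "cmod (x N - x (N - 1)) = cmod (of_real (b - a) + \<i> * of_real (2 * sin s))"
    by (simp only: norm_mult norm_cis mult_1)
   moreover have "\<bar>Im (of_real (b - a) + \<i> * of_real (2 * sin s))\<bar> <= \<dots>" by (rule abs_Im_le_cmod)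
   ultimately show ?thesis using t(6,8) by simp
  qed
  ultimately show ?thesis by (auto simp: norm_minus_commute)
 qed
 have xi: "s <= cmod (x i)"
 proof -
  have re: "cmod (wdir * w) >= \<bar>Re w\<bar>" for w
   by (simp only: norm_mult norm_cis mult_1 abs_Re_le_cmod)
  have "1 / 2 <= cmod (x (N - 1))"
   using re[of "of_real a - \<i> * of_real (sin s)"] a t(2) unfolding xN1 by auto
  moreover have "1 / 2 <= cmod (x N)"
   using re[of "of_real b + \<i> * of_real (sin s)"] b t(2) unfolding xN by auto
  ultimately have "1 / 2 <= cmod (x i)" using i by auto
  then show ?thesis using s' by linarith
 qed
 have normt: "norm (refl i j) = norm (mat 1 :: complex^'t^'t)" if "j \<in> {1..N} - {i}" for j
 proof -
  have "(i, j) \<in> pairs N" using i' that by (auto simp: pairs_def)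
  then have "norm (refl i j ** mat 1) = norm (mat 1 :: complex^'t^'t)"
   by (intro norm_unitary_left refl_unitary)
  then show ?thesis by simp
 qed
 have "norm (coeff i x) <= \<bar>\<kappa>\<bar> * (norm (\<Sum>j\<in>{1..N} - {i}. mscale (1 / (x i - x j)) (refl i j))
   + norm (mscale (of_real (gamma N p) / x i) (mat 1 :: complex^'t^'t)))"
  unfolding system_coeff_def norm_mscale[of "of_real \<kappa>"] norm_of_real
  by (intro mult_left_mono norm_triangle_ineq4) auto
 also have "\<dots> <= \<bar>\<kappa>\<bar> * (real N * (1 / s * norm (mat 1 :: complex^'t^'t)) + \<bar>gamma N p\<bar> / s * norm (mat 1 :: complex^'t^'t))"
 proof (intro mult_left_mono add_mono)
  have "norm (\<Sum>j\<in>{1..N} - {i}. mscale (1 / (x i - x j)) (refl i j)) \<le>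
    (\<Sum>j\<in>{1..N} - {i}. 1 / s * norm (mat 1 :: complex^'t^'t))"
  proof (rule sum_norm_le)
   fix j assume j: "j \<in> {1..N} - {i}"
   have "norm (mscale (1 / (x i - x j)) (refl i j)) = 1 / cmod (x i - x j) * norm (mat 1 :: complex^'t^'t)"
    by (simp add: norm_mscale norm_divide normt[OF j])
   also have "\<dots> <= 1 / s * norm (mat 1 :: complex^'t^'t)"
    using dist[OF j] s' by (intro mult_right_mono frac_le) auto
   finally show "norm (mscale (1 / (x i - x j)) (refl i j)) <= 1 / s * norm (mat 1 :: complex^'t^'t)" .
  qed
  also have "\<dots> = real (N - 1) * (1 / s * norm (mat 1 :: complex^'t^'t))" using i' by simp
  also have "\<dots> <= real N * (1 / s * norm (mat 1 :: complex^'t^'t))"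
   using s' by (intro mult_right_mono) auto
  finally show "norm (\<Sum>j\<in>{1..N} - {i}. mscale (1 / (x i - x j)) (refl i j)) \<le>
    real N * (1 / s * norm (mat 1 :: complex^'t^'t))" .
  show "norm (mscale (of_real (gamma N p) / x i) (mat 1 :: complex^'t^'t)) \<le>
    \<bar>gamma N p\<bar> / s * norm (mat 1 :: complex^'t^'t)"
   unfolding norm_mscale norm_divide norm_of_real using xi s' by (intro mult_right_mono frac_le) auto
 qed simp
 also have "\<dots> = coeff_const / s" by (simp add: coeff_const_def add_divide_distrib algebra_simps)
 finally show ?thesis by (simp add: x_def)
qed

text \<open>Passing from the torus to the straight line \<open>u = const\<close> costs a factor \<open>1 + O(s)\<close>: each of the
 last two coordinates moves by \<open>O(s\<^sup>2)\<close>, and the coefficients of the system are \<open>O(1 / s)\<close> there.\<close>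

lemma L1_cross_compare:
 "\<exists>A\<ge>0. \<forall>s. small s \<longrightarrow>
  norm (L1 (pt N (base_path s)) - L1 (cross 1 1 s)) <= A * s * norm (L1 (cross 1 1 s))"
proof -
 define B where "B = sqrt (exp (2 * coeff_const + 1))"
 have B: "B >= 1"
  unfolding B_def using coeff_const_nonneg by simp
 have move: "norm (X 1) <= B * norm (X 0)" "norm (X 1 - X 0) <= coeff_const * s * (B * norm (X 0))"
  if s: "small s" and i: "i \<in> {N - 1, N}"
   and ab: "\<And>r. r \<in> {0..1} ==> a r \<in> {cos s..1} \<and> b r \<in> {cos s..1}"
   and upd: "\<And>r r'. (cross (a r) (b r) s)(i := cross (a r') (b r') s i) = cross (a r') (b r') s"
   and \<phi>: "\<And>r. ((\<lambda>r. cross (a r) (b r) s i) has_vector_derivative (of_real (cos s - 1) * wdir)) (at r)"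
   and X: "X = (\<lambda>r. L1 (cross (a r) (b r) s))"
  for s i a b and X :: "real => complex^'t^'t"
 proof -
  have s': "0 < s" "s <= 1 / 2" using s by (auto simp: small_def)
  have i': "i \<in> {1..N}" using i N3 by auto
  have der: "(X has_vector_derivative mscale (of_real (cos s - 1) * wdir) (X r ** coeff i (cross (a r) (b r) s))) (at r)"
   if r: "r \<in> {0..1}" for r
  proof -
   have ab': "a r \<in> {cos s..1}" "b r \<in> {cos s..1}" using ab[OF r] by auto
   from L1_chain[OF cross_domain[OF s ab'] i', of "\<lambda>r. cross (a r) (b r) s i" r, folded cross_split, OF _ \<phi>[of r]]
   show ?thesis unfolding upd X by simp
  qed
  have bound: "norm (mscale (of_real (cos s - 1) * wdir) (X r ** coeff i (cross (a r) (b r) s))) \<le>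
    coeff_const * s * norm (X r)" if r: "r \<in> {0..1}" for r
  proof -
   have ab': "a r \<in> {cos s..1}" "b r \<in> {cos s..1}" using ab[OF r] by auto
   have "norm (mscale (of_real (cos s - 1) * wdir) (X r ** coeff i (cross (a r) (b r) s))) =
     \<bar>cos s - 1\<bar> * norm (X r ** coeff i (cross (a r) (b r) s))"
    unfolding norm_mscale by (simp only: norm_mult norm_cis norm_of_real mult_1_right)
   also have "\<dots> <= s\<^sup>2 * (norm (X r) * (coeff_const / s))"
   proof (rule mult_mono)
    show "\<bar>cos s - 1\<bar> <= s\<^sup>2" using small_trig(3,4)[OF s] by simp
    have "norm (X r ** coeff i (cross (a r) (b r) s)) <= norm (X r) * norm (coeff i (cross (a r) (b r) s))"
     by (rule norm_matrix_mult_le)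
    also have "\<dots> <= norm (X r) * (coeff_const / s)"
     by (intro mult_left_mono cross_coeff_le[OF s ab' i]) auto
    finally show "norm (X r ** coeff i (cross (a r) (b r) s)) <= norm (X r) * (coeff_const / s)" .
   qed auto
   also have "\<dots> = coeff_const * s * norm (X r)" using s' by (simp add: power2_eq_square)
   finally show ?thesis .
  qed
  have c1: "coeff_const * s <= coeff_const"
   using s' coeff_const_nonneg mult_left_mono[of s 1 coeff_const] by simp
  have c0: "0 <= coeff_const * s" using s' coeff_const_nonneg by simp
  show "norm (X 1) <= B * norm (X 0)" "norm (X 1 - X 0) <= coeff_const * s * (B * norm (X 0))"
   unfolding B_def using linear_growth[OF der bound c0 c1] by auto
 qed
 have "norm (L1 (pt N (base_path s)) - L1 (cross 1 1 s)) <= (2 * coeff_const * B * B) * s * norm (L1 (cross 1 1 s))"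
  if s: "small s" for s
 proof -
  have s': "0 < s" using s by (auto simp: small_def)
  define c where "c = (\<lambda>r. 1 - r * (1 - cos s))"
  have c: "c r \<in> {cos s..1}" if "r \<in> {0..1}" for r
  proof -
   have "r * (1 - cos s) <= 1 * (1 - cos s)" using that by (intro mult_right_mono) auto
   moreover have "0 <= r * (1 - cos s)" using that by simp
   ultimately show ?thesis by (simp add: c_def)
  qed
  have dc: "((\<lambda>r. wdir * (of_real (c r) + k)) has_vector_derivative of_real (cos s - 1) * wdir) (at r)" for r k
   unfolding c_def by (auto intro!: derivative_eq_intros simp: algebra_simps has_vector_derivative_def scaleR_conv_of_real)
  have c1: "c 1 = cos s" "c 0 = 1" by (simp_all add: c_def)
  have one: "1 \<in> {cos s..1}" "cos s \<in> {cos s..1}" by simp_all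
  define X where "X = (\<lambda>r. L1 (cross 1 (c r) s))"
  define X2 where "X2 = (\<lambda>r. L1 (cross (c r) (cos s) s))"
  have m1: "norm (X 1) <= B * norm (X 0)" "norm (X 1 - X 0) <= coeff_const * s * (B * norm (X 0))"
  proof -
   have u: "(cross 1 (c r) s)(N := cross 1 (c r') s N) = cross 1 (c r') s" for r r'
    using N3 by (auto simp: cross_def fun_eq_iff)
   have d: "((\<lambda>r. cross 1 (c r) s N) has_vector_derivative of_real (cos s - 1) * wdir) (at r)" for r
    using dc[of "\<i> * of_real (sin s)" r] by (simp only: cross_last)
   have r: "1 \<in> {cos s..1} \<and> c r \<in> {cos s..1}" if "r \<in> {0..1}" for r using c[OF that] by simp
   show "norm (X 1) <= B * norm (X 0)" "norm (X 1 - X 0) <= coeff_const * s * (B * norm (X 0))"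
    using move[OF s, of N "\<lambda>_. 1" c X, OF _ r u d X_def] by simp_all
  qed
  have m2: "norm (X2 1 - X2 0) <= coeff_const * s * (B * norm (X2 0))"
  proof (rule move(2)[OF s, of "N - 1" c "\<lambda>_. cos s" X2])
   show "(cross (c r) (cos s) s)(N - 1 := cross (c r') (cos s) s (N - 1)) = cross (c r') (cos s) s" for r r'
    using N3 by (auto simp: cross_def fun_eq_iff)
   show "((\<lambda>r. cross (c r) (cos s) s (N - 1)) has_vector_derivative of_real (cos s - 1) * wdir) (at r)" for r
    using dc[of "- (\<i> * of_real (sin s))" r] by (simp only: cross_last add_uminus_conv_diff)
  qed (use c in \<open>auto simp: X2_def\<close>)
  have e: "X2 0 = X 1" "X 0 = L1 (cross 1 1 s)" "X2 1 = L1 (pt N (base_path s))"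
   by (simp_all add: X_def X2_def c1 cross_base_path)
  have k: "0 <= coeff_const * s" using s' coeff_const_nonneg by simp
  have "norm (X2 1 - X 0) <= norm (X2 1 - X2 0) + norm (X 1 - X 0)"
   using norm_triangle_ineq[of "X2 1 - X2 0" "X 1 - X 0"] by (simp add: e(1))
  also have "norm (X2 1 - X2 0) <= coeff_const * s * (B * (B * norm (X 0)))"
   using m2 m1(1) mult_left_mono[of "B * norm (X 1)" "B * (B * norm (X 0))" "coeff_const * s"] k B
   by (simp add: e(1) mult_left_mono order_trans)
  also have "norm (X 1 - X 0) <= coeff_const * s * (B * (B * norm (X 0)))"
  proof -
   have "1 * (B * norm (X 0)) <= B * (B * norm (X 0))" using B by (intro mult_right_mono) auto
   then have "B * norm (X 0) <= B * (B * norm (X 0))" by simp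
   then have "coeff_const * s * (B * norm (X 0)) <= coeff_const * s * (B * (B * norm (X 0)))"
    using k by (rule mult_left_mono)
   then show ?thesis using m1(2) by linarith
  qed
  finally show ?thesis by (simp add: e mult_ac)
 qed
 moreover have "2 * coeff_const * B * B >= 0" using B coeff_const_nonneg by simp
 ultimately show ?thesis by blast
qed

text \<open>On the line \<open>u = const\<close> the expansion starts with \<open>\<alpha>\<^sub>0 = 1\<close>, so the leading term is a scalar multiple
 of \<open>rho\<close>, which is explicitly invertible and commutes with the last reflection.\<close>

lemma L1_asymptotic:
 "\<exists>C>0. \<exists>s0>0. s0 <= pi / real N \<and> (\<forall>s. 0 < s \<and> s < s0 \<longrightarrow> (\<exists>P P'. P ** P' = mat 1 \<and>
  P ** refl (N - 1) N = refl (N - 1) N ** P \<and> adj P ** refl (N - 1) N = refl (N - 1) N ** adj P \<and>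
  norm P <= C * s powr (- \<bar>\<kappa>\<bar>) \<and> norm P' <= C * s powr (- \<bar>\<kappa>\<bar>) \<and>
  norm (L1 (pt N (base_path s)) - P) <= C * s powr (1 - \<bar>\<kappa>\<bar>)))"
proof -
 obtain A where A: "A >= 0" "\<And>s. small s ==>
   norm (L1 (pt N (base_path s)) - L1 (cross 1 1 s)) <= A * s * norm (L1 (cross 1 1 s))"
  using L1_cross_compare by blast
 define s1 where "s1 = min (pi / real N) (min (gap0 / 4) (1 / 2))"
 have s1: "s1 > 0" "s1 <= pi / real N" using gap0 pi_over_N by (auto simp: s1_def)
 have small: "small s" if "0 < s" "s <= s1" for s using that by (auto simp: small_def s1_def)
 define zz where "zz = (\<lambda>s. wdir * (\<i> * of_real (sin s)))"
 have dom: "(base_y, zz s) \<in> expansion_domain N D" if "0 < s" "s <= s1" for s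
  using cross_domain[OF small[OF that], of 1 1] by (simp add: zz_def)
 have cross1: "cross 1 1 s = split_point N base_y (zz s)" for s by (simp add: cross_split zz_def)
 have cz: "cmod (zz s) = sin s" if "0 < s" "s <= s1" for s
  using small_trig(6)[OF small[OF that]] by (simp add: zz_def norm_mult)
 define ser where "ser = (\<lambda>z. \<Sum>n. mscale (z ^ n) (\<alpha> n base_y))"
 have zz1: "zz s1 ~= 0" using cz[of s1] small_trig(6)[OF small[of s1]] s1 by auto
 obtain B where B: "B > 0" "\<And>z. cmod z <= cmod (zz s1) / 2 ==> summable (\<lambda>n. mscale (z ^ n) (\<alpha> n base_y)) ==>
   norm (ser z - \<alpha> 0 base_y) <= B * cmod z"
  using power_series_head[OF \<alpha>_summable[OF dom[of s1]] zz1] s1 unfolding ser_def by blast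
 define s0 where "s0 = min s1 (sin s1 / 2)"
 have s0: "s0 > 0" "s0 <= s1" using s1 small_trig(6)[OF small[of s1]] by (auto simp: s0_def)
 define R where "R = norm (rho N p Y 1 0) + norm (rho N p Y 0 1)"
 define C0 where "C0 = 2 powr \<bar>gamma N p * \<kappa>\<bar> * (2 * 2 powr \<bar>\<kappa>\<bar>) * R"
 define C1 where "C1 = C0 * B"
 define C where "C = C0 + C1 + A * (C0 + C1) + 1"
 have R0: "R >= 0" by (simp add: R_def)
 have C0: "C0 >= 0" "C1 >= 0" using R0 B(1) by (simp_all add: C0_def C1_def)
 have main: "\<exists>P P'. P ** P' = mat 1 \<and>
   P ** refl (N - 1) N = refl (N - 1) N ** P \<and> adj P ** refl (N - 1) N = refl (N - 1) N ** adj P \<and>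
   norm P <= C * s powr (- \<bar>\<kappa>\<bar>) \<and> norm P' <= C * s powr (- \<bar>\<kappa>\<bar>) \<and>
   norm (L1 (pt N (base_path s)) - P) <= C * s powr (1 - \<bar>\<kappa>\<bar>)" if s: "0 < s" "s < s0" for s
 proof -
  have ss: "0 < s" "s <= s1" using s s0 by auto
  note t = small_trig[OF small[OF ss]]
  have s12: "s <= 1 / 2" using small[OF ss] by (simp add: small_def)
  define z where "z = zz s"
  define c where "c = exp (- of_real (gamma N p * \<kappa>) * lp (base_y, z))"
  define a b where "a = exp (- of_real \<kappa> * lz (base_y, z))" and "b = exp (of_real \<kappa> * lz (base_y, z))"
  define P P' where "P = mscale c (rho N p Y a b)" and "P' = mscale (1 / c) (rho N p Y (1 / a) (1 / b))"
  have nz: "c ~= 0" "a ~= 0" "b ~= 0" by (simp_all add: c_def a_def b_def)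
  have PP': "P ** P' = mat 1"
   using nz by (simp add: P_def P'_def mscale_simps rho_mult rho_one)
  have comm: "P ** refl (N - 1) N = refl (N - 1) N ** P" "adj P ** refl (N - 1) N = refl (N - 1) N ** adj P"
   unfolding refl_rho P_def by (simp_all add: adj_simps mscale_simps rho_mult adj_rho mult.commute)
  have cmz: "cmod (exp (lz (base_y, z))) = sin s" using exp_lz[OF dom[OF ss]] cz[OF ss] by (simp add: z_def)
  have pow: "x powr e <= 2 powr \<bar>\<kappa>\<bar> * s powr (- \<bar>\<kappa>\<bar>)" if "x = sin s" "\<bar>e\<bar> = \<bar>\<kappa>\<bar>" for x e
  proof -
   have "x powr e <= (sin s) powr (- \<bar>\<kappa>\<bar>)" using powr_le_abs[of "sin s" e] t that by simp
   also have "\<dots> <= (s / 2) powr (- \<bar>\<kappa>\<bar>)" using t s by (intro powr_mono2') auto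
   also have "\<dots> = 2 powr \<bar>\<kappa>\<bar> * s powr (- \<bar>\<kappa>\<bar>)" using s by (simp add: powr_divide powr_minus_divide)
   finally show ?thesis .
  qed
  have ab: "cmod a = sin s powr (- \<kappa>)" "cmod b = sin s powr \<kappa>"
   using cmod_exp_real[of "- \<kappa>" "lz (base_y, z)"] cmod_exp_real[of \<kappa> "lz (base_y, z)"]
   unfolding a_def b_def cmz by (simp_all only: of_real_minus)
  have ab_le: "cmod a + cmod b <= 2 * 2 powr \<bar>\<kappa>\<bar> * s powr (- \<bar>\<kappa>\<bar>)"
   using pow[OF refl, of "- \<kappa>"] pow[OF refl, of \<kappa>] by (simp add: ab)
  have ab_inv: "cmod (1 / a) + cmod (1 / b) <= 2 * 2 powr \<bar>\<kappa>\<bar> * s powr (- \<bar>\<kappa>\<bar>)"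
  proof -
   have "cmod (1 / a) = sin s powr \<kappa>" "cmod (1 / b) = sin s powr (- \<kappa>)"
    by (simp_all add: norm_divide ab powr_minus_divide)
   then show ?thesis using pow[OF refl, of "- \<kappa>"] pow[OF refl, of \<kappa>] by simp
  qed
  have clp: "cmod (exp (lp (base_y, z))) = 1 + (sin s)\<^sup>2"
  proof -
   have y1: "cmod (base_y j) = 1" if "j \<in> {1..N - 2}" for j by (simp add: base_y_eq[OF that])
   have "N - 1 \<in> {1..N - 1}" using N3 by auto
   then have "base_y (N - 1) = wdir" by (simp add: base_point_def)
   then have "(base_y (N - 1))\<^sup>2 - z\<^sup>2 = wdir\<^sup>2 * of_real (1 + (sin s)\<^sup>2)"
    unfolding z_def zz_def by (simp add: power_mult_distrib algebra_simps)
   moreover have "cmod (\<Prod>j = 1..N - 2. base_y j) = 1"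
    unfolding prod_norm[symmetric] by (rule prod.neutral) (use y1 in auto)
   ultimately show ?thesis
    using exp_lp[OF dom[OF ss]] unfolding z_def[symmetric]
    by (simp only: norm_mult norm_power norm_cis norm_of_real) simp
  qed
  have cbase: "1 <= 1 + (sin s)\<^sup>2" "1 + (sin s)\<^sup>2 <= 2" using sin_cos_squared_add[of s] zero_le_power2[of "cos s"] zero_le_power2[of "sin s"] by linarith+
  have c_le: "cmod c <= 2 powr \<bar>gamma N p * \<kappa>\<bar>" "cmod (1 / c) <= 2 powr \<bar>gamma N p * \<kappa>\<bar>"
  proof -
   have c: "cmod c = (1 + (sin s)\<^sup>2) powr (- (gamma N p * \<kappa>))"
    using cmod_exp_real[of "- (gamma N p * \<kappa>)" "lp (base_y, z)"]
    unfolding c_def clp by (simp only: of_real_minus)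
   then show "cmod c <= 2 powr \<bar>gamma N p * \<kappa>\<bar>"
    using powr_le_two[OF cbase, of "- (gamma N p * \<kappa>)"] by (simp only: abs_minus_cancel)
   have "cmod (1 / c) = (1 + (sin s)\<^sup>2) powr (gamma N p * \<kappa>)"
    unfolding norm_divide c powr_minus_divide by simp
   then show "cmod (1 / c) <= 2 powr \<bar>gamma N p * \<kappa>\<bar>"
    using powr_le_two[OF cbase, of "gamma N p * \<kappa>"] by simp
  qed
  have scaled: "norm (mscale k (rho N p Y u v)) <= C0 * s powr (- \<bar>\<kappa>\<bar>)"
   if "cmod k <= 2 powr \<bar>gamma N p * \<kappa>\<bar>" "cmod u + cmod v <= 2 * 2 powr \<bar>\<kappa>\<bar> * s powr (- \<bar>\<kappa>\<bar>)" for k u v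
  proof -
   have "norm (rho N p Y u v) <= (2 * 2 powr \<bar>\<kappa>\<bar> * s powr (- \<bar>\<kappa>\<bar>)) * R"
    using norm_rho_le[of N p Y u v] mult_right_mono[OF that(2) R0] by (simp add: R_def)
   then have "cmod k * norm (rho N p Y u v) \<le>
     2 powr \<bar>gamma N p * \<kappa>\<bar> * ((2 * 2 powr \<bar>\<kappa>\<bar> * s powr (- \<bar>\<kappa>\<bar>)) * R)"
    using that(1) by (intro mult_mono) auto
   then show ?thesis by (simp add: norm_mscale C0_def mult_ac)
  qed
  have P: "norm P <= C0 * s powr (- \<bar>\<kappa>\<bar>)" "norm P' <= C0 * s powr (- \<bar>\<kappa>\<bar>)"
   unfolding P_def P'_def by (intro scaled c_le ab_le ab_inv)+
  have "norm (ser z - mat 1) <= B * s"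
  proof -
   have "cmod z <= cmod (zz s1) / 2"
    using cz[OF ss] cz[of s1] s1 s t(7) by (simp add: z_def s0_def)
   then have "norm (ser z - \<alpha> 0 base_y) <= B * cmod z"
    unfolding z_def by (intro B(2) \<alpha>_summable dom ss)
   also have "\<dots> <= B * s" using B(1) cz[OF ss] t(7) by (simp add: z_def)
   finally show ?thesis by (simp add: \<alpha>_base)
  qed
  moreover have L1c: "L1 (cross 1 1 s) = P ** ser z"
   using L1_eq[OF dom[OF ss]] unfolding cross1 z_def[symmetric]
   by (simp add: P_def c_def a_def b_def ser_def mscale_simps)
  then have "L1 (cross 1 1 s) - P = P ** (ser z - mat 1)" by (simp add: mm.diff_right)
  then have "norm (L1 (cross 1 1 s) - P) <= norm P * norm (ser z - mat 1)"
   by (simp only: norm_matrix_mult_le)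
  ultimately have "norm (L1 (cross 1 1 s) - P) <= (C0 * s powr (- \<bar>\<kappa>\<bar>)) * (B * s)"
   using P(1) mult_mono[of "norm P" "C0 * s powr (- \<bar>\<kappa>\<bar>)" "norm (ser z - mat 1)" "B * s"] C0 by simp
  also have "\<dots> = C1 * s powr (1 - \<bar>\<kappa>\<bar>)"
   using s powr_add[of s 1 "- \<bar>\<kappa>\<bar>"] by (simp add: C1_def mult_ac)
  finally have E: "norm (L1 (cross 1 1 s) - P) <= C1 * s powr (1 - \<bar>\<kappa>\<bar>)" .
  have mono: "s powr (1 - \<bar>\<kappa>\<bar>) <= s powr (- \<bar>\<kappa>\<bar>)" using s s12 by (intro powr_mono') auto
  have "norm (L1 (cross 1 1 s)) <= norm (L1 (cross 1 1 s) - P) + norm P"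
   using norm_triangle_ineq[of "L1 (cross 1 1 s) - P" P] by simp
  also have "\<dots> <= (C0 + C1) * s powr (- \<bar>\<kappa>\<bar>)"
   using E P(1) mult_left_mono[OF mono C0(2)] by (simp add: distrib_right)
  finally have Lc: "norm (L1 (cross 1 1 s)) <= (C0 + C1) * s powr (- \<bar>\<kappa>\<bar>)" .
  have "norm (L1 (pt N (base_path s)) - L1 (cross 1 1 s)) <= A * s * ((C0 + C1) * s powr (- \<bar>\<kappa>\<bar>))"
   using A(2)[OF small[OF ss]] mult_left_mono[OF Lc, of "A * s"] A(1) s by simp
  also have "\<dots> = A * (C0 + C1) * s powr (1 - \<bar>\<kappa>\<bar>)"
   using s powr_add[of s 1 "- \<bar>\<kappa>\<bar>"] by (simp add: mult_ac)
  finally have "norm (L1 (pt N (base_path s)) - L1 (cross 1 1 s)) + norm (L1 (cross 1 1 s) - P) \<le>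
    (C1 + A * (C0 + C1)) * s powr (1 - \<bar>\<kappa>\<bar>)" using E by (simp add: distrib_right)
  also have "\<dots> <= C * s powr (1 - \<bar>\<kappa>\<bar>)" using C0 by (intro mult_right_mono) (auto simp: C_def)
  finally have "norm (L1 (pt N (base_path s)) - P) <= C * s powr (1 - \<bar>\<kappa>\<bar>)"
   using norm_triangle_ineq[of "L1 (pt N (base_path s)) - L1 (cross 1 1 s)" "L1 (cross 1 1 s) - P"] by simp
  moreover have "C0 * s powr (- \<bar>\<kappa>\<bar>) <= C * s powr (- \<bar>\<kappa>\<bar>)"
   using C0 A(1) by (intro mult_right_mono) (auto simp: C_def)
  ultimately show ?thesis using PP' comm P by (intro exI[of _ P] exI[of _ P'] conjI) auto
 qed
 have "C > 0" using C0 A(1) by (simp add: C_def add_nonneg_pos)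
 then show ?thesis using main s0 s1 by (intro exI[of _ C] exI[of _ s0] conjI) auto
qed

lemma tendsto_small_power:
 assumes "\<bar>\<kappa>\<bar> < 1 / 2"
 shows "((\<lambda>s. c * s powr (1 - 2 * \<bar>\<kappa>\<bar>)) \<longlongrightarrow> 0) (at_right 0)"
proof -
 have "((\<lambda>s. s powr (1 - 2 * \<bar>\<kappa>\<bar>)) \<longlongrightarrow> 0 powr (1 - 2 * \<bar>\<kappa>\<bar>)) (at_right 0)"
  using assms by (intro tendsto_powr2 tendsto_const tendsto_ident_at)
   (auto simp: eventually_at_right_field intro!: exI[of _ 1])
 then show ?thesis using tendsto_mult_right_zero by fastforce
qed

lemma solves_at_subset: "S' \<subseteq> S ==> solves_at S th F ==> solves_at S' th F"
proof -
 assume S': "S' \<subseteq> S" and sol: "solves_at S th F"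
 obtain \<delta> where \<delta>: "\<delta> > 0" "\<forall>et\<in>coord_box S th \<delta>. \<forall>i\<in>S.
   ((\<lambda>r. F (et(i := r))) has_vector_derivative gen (unit_vec i) et (F et)) (at (et i))"
  using sol unfolding solves_at_def by blast
 have "coord_box S' th \<delta> \<subseteq> coord_box S th \<delta>"
  using S' \<delta>(1) by (fastforce simp: coord_box_def)
 then show ?thesis unfolding solves_at_def using \<delta> S' by blast
qed

text \<open>The differential equation transports the kernel of \<open>L\<^sub>1\<^sup>*\<close> along the path, and near the wall
 \<open>L\<^sub>1\<close> is too close to an invertible matrix to have a kernel.\<close>

lemma L1_kernel:
 fixes V :: "complex^'t^'t"
 assumes \<kappa>: "\<bar>\<kappa>\<bar> < 1 / 2" and V: "adj (L1 (x0 N)) ** V = 0"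
 shows "V = 0"
proof -
 have zero: "adj (L1 (pt N (base_path s))) ** V = 0" if s: "0 < s" "s <= pi / real N" for s
 proof -
  define F where "F = (\<lambda>et. adj (L1 (pt N et)) ** (V ** adj V) ** L1 (pt N et))"
  have F: "F et = (adj (L1 (pt N et)) ** V) ** adj (adj (L1 (pt N et)) ** V)" for et
   by (simp add: F_def adj_simps matrix_mul_assoc)
  have "F (base_path s) = 0"
  proof (rule base_path_unique[where G = "\<lambda>_. 0", OF _ _ _ s])
   show "solves_at {N - 1, N} (base_path s) F" if "0 < s" "s <= pi / real N" for s
    unfolding F_def by (rule L1_form_solves[OF that])
   have "gen d th (0 :: complex^'t^'t) = 0" for d th using gen_linear(3)[of d th 0 0] by simp
   then show "solves_at {N - 1, N} (base_path s) (\<lambda>_. 0)" for s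
    unfolding solves_at_def by (intro exI[of _ 1]) auto
   show "F (base_path (pi / real N)) = 0" unfolding F base_path_end V by simp
  qed
  define A where "A = adj (L1 (pt N (base_path s))) ** V"
  have "A ** adj A = 0" using \<open>F (base_path s) = 0\<close> by (simp add: F A_def)
  then have "inner (adj A) (adj A) = 0" by (simp add: inner_matrix_eq adj_simps trace_def)
  then have "adj (adj A) = 0" by (simp add: adj_simps)
  then show ?thesis by (simp add: adj_simps A_def)
 qed
 obtain C s0 where C: "C > 0" "s0 > 0" "s0 <= pi / real N" and asym: "\<And>s. 0 < s ==> s < s0 ==>
   \<exists>P P'. P ** P' = mat 1 \<and> P ** refl (N - 1) N = refl (N - 1) N ** P \<and>
   adj P ** refl (N - 1) N = refl (N - 1) N ** adj P \<and>
   norm P <= C * s powr (- \<bar>\<kappa>\<bar>) \<and> norm P' <= C * s powr (- \<bar>\<kappa>\<bar>) \<and>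
   norm (L1 (pt N (base_path s)) - P) <= C * s powr (1 - \<bar>\<kappa>\<bar>)"
  using L1_asymptotic by blast
 have "\<forall>\<^sub>F s in at_right 0. C * C * s powr (1 - 2 * \<bar>\<kappa>\<bar>) < 1"
  using order_tendstoD(2)[OF tendsto_small_power[OF \<kappa>, of "C * C"], of 1] by simp
 then obtain b where b: "b > 0" "\<And>s. 0 < s ==> s < b ==> C * C * s powr (1 - 2 * \<bar>\<kappa>\<bar>) < 1"
  unfolding eventually_at_right_field by blast
 define s where "s = min b s0 / 2"
 have s: "0 < s" "s < b" "s < s0" using b(1) C(2) by (auto simp: s_def)
 obtain P P' where P: "P ** P' = mat 1" "norm P' <= C * s powr (- \<bar>\<kappa>\<bar>)"
   "norm (L1 (pt N (base_path s)) - P) <= C * s powr (1 - \<bar>\<kappa>\<bar>)"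
  using asym[OF s(1,3)] by blast
 define E where "E = L1 (pt N (base_path s)) - P"
 have "adj P ** V = - (adj E ** V)"
  using zero[of s] s C(3) by (simp add: E_def adj_simps mm.diff_left)
 moreover have "adj P' ** adj P = mat 1" using P(1) by (metis adj_simps(5,9))
 ultimately have V_eq: "V = - (adj P' ** (adj E ** V))"
  by (metis matrix_mul_assoc matrix_mul_lid mm.minus_right)
 have "norm (adj P' ** (adj E ** V)) <= norm P' * (norm E * norm V)"
  using norm_matrix_mult_le[of "adj P'" "adj E ** V"] norm_matrix_mult_le[of "adj E" V]
  by (smt (verit) mult_left_mono norm_adj norm_ge_zero)
 also have "\<dots> <= (C * s powr (- \<bar>\<kappa>\<bar>)) * ((C * s powr (1 - \<bar>\<kappa>\<bar>)) * norm V)"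
  using P(2,3) by (intro mult_mono mult_right_mono) (auto simp: E_def intro: order_trans[OF norm_ge_zero])
 also have "\<dots> = C * C * s powr (1 - 2 * \<bar>\<kappa>\<bar>) * norm V"
 proof -
  have "s powr (- \<bar>\<kappa>\<bar>) * s powr (1 - \<bar>\<kappa>\<bar>) = s powr (1 - 2 * \<bar>\<kappa>\<bar>)"
   using powr_add[of s "- \<bar>\<kappa>\<bar>" "1 - \<bar>\<kappa>\<bar>"] by simp
  then show ?thesis by (simp add: mult_ac)
 qed
 finally have "norm V <= C * C * s powr (1 - 2 * \<bar>\<kappa>\<bar>) * norm V"
  using arg_cong[OF V_eq, of norm] by simp
 then have "norm V * (1 - C * C * s powr (1 - 2 * \<bar>\<kappa>\<bar>)) <= 0" by (simp add: algebra_simps)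
 then show ?thesis using b(2)[OF s(1,2)] by (simp add: mult_le_0_iff)
qed

text \<open>If the middle matrix commutes with the last reflection, so does the leading term of the form near
 the base wall, because \<open>rho\<close> is a linear combination of the identity and that reflection.\<close>

lemma base_wall_zero:
 assumes \<kappa>: "\<bar>\<kappa>\<bar> < 1 / 2" and form: "torus_form N \<kappa> \<tau> K"
  and K0: "K (x0 N) = adj (L1 (x0 N)) ** H ** L1 (x0 N)"
  and comm: "H ** refl (N - 1) N = refl (N - 1) N ** H"
 shows "torus_form.wall_zero N \<tau> K (regular_angles N) (pi * (2 * real N - 3) / real N)"
proof -
 interpret tf: torus_form N \<kappa> \<tau> K by (rule form)
 define \<sigma> where "\<sigma> = refl (N - 1) N"
 have \<sigma>\<sigma>: "\<sigma> ** \<sigma> = mat 1" unfolding \<sigma>_def by (rule refl_refl[OF tf.last_pair])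
 have K_eq: "K (pt N (base_path s)) = adj (L1 (pt N (base_path s))) ** H ** L1 (pt N (base_path s))"
  if s: "0 < s" "s <= pi / real N" for s
 proof (rule base_path_unique[where F = "\<lambda>th. K (pt N th)", OF _ _ _ s])
  show "solves_at {N - 1, N} (base_path s) (\<lambda>th. K (pt N th))" if "0 < s" "s <= pi / real N" for s
   using N3 by (intro solves_at_subset[OF _ tf.K_solves[OF base_path_chamber[OF that]]])  auto
  show "solves_at {N - 1, N} (base_path s) (\<lambda>et. adj (L1 (pt N et)) ** H ** L1 (pt N et))"
   if "0 < s" "s <= pi / real N" for s by (rule L1_form_solves[OF that])
 qed (simp add: base_path_end K0)
 obtain C s0 where C: "C > 0" "s0 > 0" "s0 <= pi / real N" and asym: "\<And>s. 0 < s ==> s < s0 ==>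
   \<exists>P P'. P ** P' = mat 1 \<and> P ** refl (N - 1) N = refl (N - 1) N ** P \<and>
   adj P ** refl (N - 1) N = refl (N - 1) N ** adj P \<and>
   norm P <= C * s powr (- \<bar>\<kappa>\<bar>) \<and> norm P' <= C * s powr (- \<bar>\<kappa>\<bar>) \<and>
   norm (L1 (pt N (base_path s)) - P) <= C * s powr (1 - \<bar>\<kappa>\<bar>)"
  using L1_asymptotic by blast
 have bound: "norm (tf.anti (K (pt N (base_path s)))) <= 6 * C * C * norm H * s powr (1 - 2 * \<bar>\<kappa>\<bar>)"
  if s: "0 < s" "s < min s0 1" for s
 proof -
  obtain P P' where P: "P ** \<sigma> = \<sigma> ** P" "adj P ** \<sigma> = \<sigma> ** adj P" "norm P <= C * s powr (- \<bar>\<kappa>\<bar>)"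
    "norm (L1 (pt N (base_path s)) - P) <= C * s powr (1 - \<bar>\<kappa>\<bar>)"
   using asym[of s] s unfolding \<sigma>_def by auto
  define E where "E = L1 (pt N (base_path s)) - P"
  have L: "L1 (pt N (base_path s)) = P + E" by (simp add: E_def)
  have E: "norm E <= C * s powr (1 - \<bar>\<kappa>\<bar>)" using P(4) by (simp add: E_def)
  have "s powr (1 - \<bar>\<kappa>\<bar>) <= s powr (- \<bar>\<kappa>\<bar>)" using s by (intro powr_mono') auto
  then have E': "norm E <= C * s powr (- \<bar>\<kappa>\<bar>)" using E C(1) by (meson mult_left_mono less_imp_le order_trans)
  have split: "K (pt N (base_path s)) = adj P ** H ** P + (adj E ** H ** P + adj (P + E) ** H ** E)"
   unfolding K_eq[OF s(1) less_imp_le[OF less_le_trans[OF _ C(3)]], OF less_le_trans[OF s(2) min.cobounded1]] L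
   by (simp add: adj_simps mm.add_left mm.add_right algebra_simps)
  have "\<sigma> ** (adj P ** H ** P) ** \<sigma> = adj P ** H ** P"
  proof -
   have "\<sigma> ** (adj P ** H ** P) ** \<sigma> = (\<sigma> ** adj P) ** H ** (P ** \<sigma>)" by (simp only: matrix_mul_assoc)
   also have "\<dots> = adj P ** (\<sigma> ** H) ** \<sigma> ** P" unfolding P(1) P(2)[symmetric] by (simp only: matrix_mul_assoc)
   also have "\<sigma> ** H = H ** \<sigma>" using comm by (simp add: \<sigma>_def)
   also have "adj P ** (H ** \<sigma>) ** \<sigma> ** P = adj P ** H ** (\<sigma> ** \<sigma>) ** P" by (simp only: matrix_mul_assoc)
   finally show ?thesis by (simp add: \<sigma>\<sigma>)
  qed
  then have "tf.anti (adj P ** H ** P) = 0" unfolding tf.anti_def \<sigma>_def[symmetric] by simp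
  then have "tf.anti (K (pt N (base_path s))) = tf.anti (adj E ** H ** P + adj (P + E) ** H ** E)"
   unfolding split by (simp add: linear_add[OF bounded_linear.linear[OF tf.bounded_linear_anti]])
  then have "norm (tf.anti (K (pt N (base_path s)))) <= 2 * norm (adj E ** H ** P + adj (P + E) ** H ** E)"
   using tf.norm_anti_le by simp
  also have "norm (adj E ** H ** P + adj (P + E) ** H ** E) \<le>
    norm E * norm H * norm P + norm (P + E) * norm H * norm E"
   using norm_matrix_mult3_le[of "adj E" H P] norm_matrix_mult3_le[of "adj (P + E)" H E]
   by (intro norm_triangle_le) (simp add: norm_adj)
  also have "norm (P + E) * norm H * norm E <= (norm P + norm E) * norm H * norm E"
   by (intro mult_right_mono norm_triangle_ineq) auto
  also have "norm E * norm H * norm P + (norm P + norm E) * norm H * norm E =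
    norm H * (norm E * (2 * norm P + norm E))" by (simp add: algebra_simps)
  also have "\<dots> <= norm H * ((C * s powr (1 - \<bar>\<kappa>\<bar>)) * (3 * (C * s powr (- \<bar>\<kappa>\<bar>))))"
   using E E' P(3) C(1) by (intro mult_left_mono mult_mono) auto
  also have "(C * s powr (1 - \<bar>\<kappa>\<bar>)) * (3 * (C * s powr (- \<bar>\<kappa>\<bar>))) = 3 * C * C * s powr (1 - 2 * \<bar>\<kappa>\<bar>)"
   using powr_add[of s "1 - \<bar>\<kappa>\<bar>" "- \<bar>\<kappa>\<bar>"] by simp
  finally show ?thesis by (simp add: mult_ac)
 qed
 show ?thesis unfolding tf.wall_zero_def
 proof (rule Lim_null_comparison[OF _ tendsto_small_power[OF \<kappa>]])
  show "\<forall>\<^sub>F s in at_right 0. norm (tf.anti (K (pt N (base_path s)))) \<le>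
    6 * C * C * norm H * s powr (1 - 2 * \<bar>\<kappa>\<bar>)"
   unfolding eventually_at_right_field using bound C(2) by (intro exI[of _ "min s0 1"]) auto
 qed
qed

lemma base_wall: "wall N (regular_angles N) (pi * (2 * real N - 3) / real N)"
proof -
 show ?thesis unfolding wall_def regular_angles_def
  using N3 by (auto simp: of_nat_diff field_simps)
qed

end

section \<open>Integration over the torus\<close>

lemma cis_measurable: "cis \<in> measurable (uniform_measure lborel {0..<2 * pi}) (restrict_space borel (sphere 0 1))"
proof (rule measurable_restrict_space2)
 have "isCont cis t" for t :: real
  using has_vector_derivative_continuous[OF has_vector_derivative_cis[of t UNIV]] .
 then have "cis \<in> borel_measurable borel"
  by (intro borel_measurable_continuous_onI continuous_at_imp_continuous_on) auto
 then show "cis \<in> borel_measurable (uniform_measure lborel {0..<2 * pi})"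
  by (simp add: measurable_cong_sets[OF sets_uniform_measure refl])
qed auto

lemma sets_circle: "sets circle_measure = sets (restrict_space borel (sphere 0 1))"
 by (simp add: circle_measure_def)

lemma space_circle: "space circle_measure = sphere 0 1"
 by (simp add: circle_measure_def space_restrict_space)

interpretation circle: prob_space circle_measure
 unfolding circle_measure_def
 by (rule prob_space.prob_space_distr[OF prob_space_uniform_measure cis_measurable]) auto

interpretation prod: product_sigma_finite "\<lambda>_::nat. circle_measure"
 by unfold_locales

lemma borel_measurable_circle: "f \<in> borel_measurable borel ==> f \<in> borel_measurable circle_measure"
 by (simp add: measurable_cong_sets[OF sets_circle refl] measurable_restrict_space1)

lemma nn_integral_circle:
 assumes "h \<in> borel_measurable circle_measure"
 shows "(\<integral>\<^sup>+ z. h z \<partial>circle_measure) =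
  (\<integral>\<^sup>+ t. h (cis t) * indicator {0..<2 * pi} t \<partial>lborel) / ennreal (2 * pi)"
proof -
 have h: "h \<in> borel_measurable (restrict_space borel (sphere 0 1))"
  using assms by (simp add: measurable_cong_sets[OF sets_circle refl])
 have "(\<integral>\<^sup>+ z. h z \<partial>circle_measure) = (\<integral>\<^sup>+ t. h (cis t) \<partial>uniform_measure lborel {0..<2 * pi})"
  unfolding circle_measure_def by (rule nn_integral_distr[OF cis_measurable]) (simp add: h)
 also have "\<dots> = (\<integral>\<^sup>+ t. h (cis t) * indicator {0..<2 * pi} t \<partial>lborel) / emeasure lborel {0..<2 * pi}"
 proof (rule nn_integral_uniform_measure)
  show "(\<lambda>t. h (cis t)) \<in> borel_measurable lborel"
   using measurable_compose[OF cis_measurable h]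
   by (simp add: measurable_cong_sets[OF sets_uniform_measure refl])
 qed auto
 finally show ?thesis by simp
qed

lemma circle_integral:
 fixes h :: "complex => complex"
 assumes "h \<in> borel_measurable circle_measure"
 shows "integral\<^sup>L circle_measure h = (LBINT t:{0..<2 * pi}. h (cis t)) /\<^sub>R (2 * pi)"
proof -
 have h: "h \<in> borel_measurable (restrict_space borel (sphere 0 1))"
  using assms by (simp add: measurable_cong_sets[OF sets_circle refl])
 have hm: "(\<lambda>t. h (cis t)) \<in> borel_measurable lborel"
   using measurable_compose[OF cis_measurable h]
   by (simp add: measurable_cong_sets[OF sets_uniform_measure refl])
 have unif: "uniform_measure lborel {0..<2 * pi} =
   density lborel (\<lambda>t. ennreal (indicator {0..<2 * pi} t / (2 * pi)))"
  unfolding uniform_measure_def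
  by (intro density_cong) (auto simp: indicator_def divide_ennreal[symmetric] split: split_indicator)
 have "integral\<^sup>L circle_measure h = integral\<^sup>L (uniform_measure lborel {0..<2 * pi}) (\<lambda>t. h (cis t))"
  unfolding circle_measure_def by (rule integral_distr[OF cis_measurable h])
 also have "\<dots> = integral\<^sup>L lborel (\<lambda>t. (indicator {0..<2 * pi} t / (2 * pi)) *\<^sub>R h (cis t))"
  unfolding unif by (intro integral_density hm) auto
 also have "\<dots> = (LBINT t:{0..<2 * pi}. h (cis t)) /\<^sub>R (2 * pi)"
 proof -
  have "(indicator {0..<2 * pi} t / (2 * pi)) *\<^sub>R h (cis t) =
    inverse (2 * pi) *\<^sub>R (indicator {0..<2 * pi} t *\<^sub>R h (cis t))" for t
   by (simp only: scaleR_scaleR divide_inverse mult.commute)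
  then show ?thesis
   unfolding set_lebesgue_integral_def by (simp only: integral_scaleR_right)
 qed
 finally show ?thesis .
qed

text \<open>In terms of the angle this is the fundamental theorem of calculus on \<open>{0..2 * pi}\<close>.\<close>

lemma circle_integral_derivative:
 fixes h :: "complex => complex" and \<Phi> :: "real => complex"
 assumes meas: "h \<in> borel_measurable circle_measure" and bounded: "\<And>z. cmod z = 1 ==> cmod (h z) <= B"
  and "finite S" and der: "\<And>t. t \<in> {0<..<2 * pi} - S ==> (\<Phi> has_vector_derivative h (cis t)) (at t)"
  and cont: "continuous_on {0..2 * pi} \<Phi>" and per: "\<Phi> (2 * pi) = \<Phi> 0"
 shows "integral\<^sup>L circle_measure h = 0"
proof -
 have h: "h \<in> borel_measurable (restrict_space borel (sphere 0 1))"
  using meas by (simp add: measurable_cong_sets[OF sets_circle refl])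
 have hm: "(\<lambda>t. h (cis t)) \<in> borel_measurable lborel"
   using measurable_compose[OF cis_measurable h]
   by (simp add: measurable_cong_sets[OF sets_uniform_measure refl])
 have int: "set_integrable lborel {0..2 * pi} (\<lambda>t. h (cis t))"
 proof (rule set_integrable_bound[of _ _ "\<lambda>_. B"])
  show "set_integrable lborel {0..2 * pi} (\<lambda>_. B)"
   unfolding set_integrable_def by (simp add: integrable_mult_left)
  show "set_borel_measurable lborel {0..2 * pi} (\<lambda>t. h (cis t))"
   unfolding set_borel_measurable_def using hm by measurable
 qed (use bounded in \<open>auto intro!: AE_I2 order_trans[OF _ abs_ge_self]\<close>)
 have "((\<lambda>t. h (cis t)) has_integral (\<Phi> (2 * pi) - \<Phi> 0)) {0..2 * pi}"
  by (rule fundamental_theorem_of_calculus_interior_strong[OF \<open>finite S\<close> _ der cont]) auto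
 then have "integral {0..2 * pi} (\<lambda>t. h (cis t)) = 0" using per by (simp add: integral_unique)
 then have "(LBINT t:{0..2 * pi}. h (cis t)) = 0"
  using set_borel_integral_eq_integral(2)[OF int] by simp
 moreover have "(LBINT t:{0..<2 * pi}. h (cis t)) = (LBINT t:{0..2 * pi}. h (cis t))"
  unfolding set_lebesgue_integral_def
  by (rule integral_cong_AE) 
   (use hm AE_lborel_singleton[of "2 * pi"] in \<open>auto simp: indicator_def elim!: eventually_mono\<close>)
 ultimately show ?thesis using circle_integral[OF meas] by simp
qed

lemma chord_ge:
 fixes t a :: real
 assumes "t \<in> {0..<2 * pi}" "a \<in> {0..<2 * pi}"
 shows "\<exists>b\<in>{a, a - 2 * pi, a + 2 * pi}. \<bar>t - b\<bar> / 2 <= cmod (cis t - cis a) \<and> \<bar>t - b\<bar> <= 4 * pi"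
proof -
 define x where "x = \<bar>t - a\<bar>"
 have x: "0 <= x" "x < 2 * pi" using assms by (auto simp: x_def)
 have "\<bar>sin ((t - a) / 2)\<bar> = sin (x / 2)"
 proof -
  have "sin (x / 2) >= 0" using x by (intro sin_ge_zero) auto
  moreover have "(t - a) / 2 = x / 2 \<or> (t - a) / 2 = - (x / 2)" by (auto simp: x_def abs_if)
  ultimately show ?thesis by (elim disjE) (simp_all only: sin_minus abs_minus_cancel abs_of_nonneg)
 qed
 then have chord: "cmod (cis t - cis a) = 2 * sin (x / 2)" by (simp add: chord_eq)
 show ?thesis
 proof (cases "x <= pi")
  case True
  then have "x / 2 / 2 <= sin (x / 2)" using x by (intro sin_ge_half) auto
  then show ?thesis using x unfolding chord by (intro bexI[of _ a]) (auto simp: x_def[symmetric])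
 next
  case False
  then have "(pi - x / 2) / 2 <= sin (pi - x / 2)" using x by (intro sin_ge_half) auto
  then have *: "2 * pi - x <= 4 * sin (x / 2)" by simp
  show ?thesis
  proof (cases "a <= t")
   case True
   then have "\<bar>t - (a + 2 * pi)\<bar> = 2 * pi - x" using x by (simp add: x_def)
   then show ?thesis using * x pi_gt_zero unfolding chord by (intro bexI[of _ "a + 2 * pi"]) auto
  next
   case False
   then have "\<bar>t - (a - 2 * pi)\<bar> = 2 * pi - x" using x by (simp add: x_def)
   then show ?thesis using * x pi_gt_zero unfolding chord by (intro bexI[of _ "a - 2 * pi"]) auto
  qed
 qed
qed

text \<open>The chord is bounded below by a multiple of the distance of the angles modulo \<open>2 \<pi>\<close>, which is the
 distance to one of three translates of the angle of \<open>w\<close>.\<close>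

lemma circle_power_bound:
 assumes e: "0 <= e" "e < 1"
 shows "\<exists>C. \<forall>w. cmod w = 1 \<longrightarrow> (\<integral>\<^sup>+ z. ennreal (cmod (z - w) powr (- e)) \<partial>circle_measure) <= ennreal C"
proof -
 define f where "f = (\<lambda>s::real. if s \<in> {0..4 * pi} then s powr (- e) else 0)"
 define I where "I = (4 * pi) powr (- e + 1) / (- e + 1)"
 have fm: "f \<in> borel_measurable borel" unfolding f_def by measurable
 have "(f has_integral I) UNIV"
  unfolding f_def has_integral_restrict_UNIV I_def using e by (intro has_integral_powr_from_0) auto
 then have fI: "(\<integral>\<^sup>+ s. ennreal (f s) \<partial>lborel) = ennreal I"
  by (intro nn_integral_has_integral_lborel fm) (auto simp: f_def)
 have I0: "I >= 0" using e by (simp add: I_def)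
 have shift1: "(\<integral>\<^sup>+ t. ennreal (f (t - b)) \<partial>lborel) = ennreal I" for b
  using nn_integral_real_affine[of "\<lambda>s. ennreal (f s)" 1 "- b"] fm fI by (simp add: algebra_simps)
 have shift2: "(\<integral>\<^sup>+ t. ennreal (f (b - t)) \<partial>lborel) = ennreal I" for b
  using nn_integral_real_affine[of "\<lambda>s. ennreal (f s)" "- 1" b] fm fI by simp
 define g where "g = (\<lambda>b t. ennreal (f (t - b)) + ennreal (f (b - t)))"
 have gm: "g b \<in> borel_measurable lborel" for b unfolding g_def using fm by measurable
 have gI: "(\<integral>\<^sup>+ t. g b t \<partial>lborel) = ennreal (2 * I)" for b
  unfolding g_def using fm I0
  by (subst nn_integral_add) (auto simp: shift1 shift2 simp flip: ennreal_plus)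
 show ?thesis
 proof (intro exI[of _ "2 * (6 * I) / (2 * pi)"] allI impI)
  fix w :: complex assume "cmod w = 1"
  define a where "a = Arg2pi w"
  have w: "w = cis a" using Arg2pi_eq[of w] \<open>cmod w = 1\<close> by (simp add: a_def cis_conv_exp)
  have a: "a \<in> {0..<2 * pi}" by (simp add: a_def Arg2pi_ge_0 Arg2pi_lt_2pi)
  have point: "ennreal (cmod (cis t - w) powr (- e)) * indicator {0..<2 * pi} t \<le>
    2 * (g a t + g (a - 2 * pi) t + g (a + 2 * pi) t)" for t
  proof (cases "t \<in> {0..<2 * pi} \<and> cmod (cis t - w) ~= 0")
   case True
   then obtain b where b: "b \<in> {a, a - 2 * pi, a + 2 * pi}" "\<bar>t - b\<bar> / 2 <= cmod (cis t - cis a)" "\<bar>t - b\<bar> <= 4 * pi"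
    using chord_ge[OF _ a] by blast
   have "cmod (cis t - w) powr (- e) <= 2 * (f (t - b) + f (b - t))"
   proof (cases "t = b")
    case True
    have "cis b = cis a" using b(1) by (auto simp: cis_mult[symmetric] simp flip: cis_divide)
    then show ?thesis using \<open>t \<in> _ \<and> _\<close> w True by simp
   next
    case False
    have "cmod (cis t - w) powr (- e) <= (\<bar>t - b\<bar> / 2) powr (- e)"
     using b(2) False e w by (intro powr_mono2') auto
    also have "\<dots> = 2 powr e * \<bar>t - b\<bar> powr (- e)" by (simp add: powr_divide powr_minus_divide)
    also have "\<dots> <= 2 powr 1 * \<bar>t - b\<bar> powr (- e)" using e by (intro mult_right_mono powr_mono) auto
    also have "\<bar>t - b\<bar> powr (- e) <= f (t - b) + f (b - t)"
     using b(3) False by (cases "b <= t") (auto simp: f_def)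
    finally show ?thesis by simp
   qed
   then have "ennreal (cmod (cis t - w) powr (- e)) <= ennreal (2 * (f (t - b) + f (b - t)))"
    by (rule ennreal_leI)
   also have "\<dots> = 2 * g b t"
   proof -
    have "g b t = ennreal (f (t - b) + f (b - t))"
     unfolding g_def by (rule ennreal_plus[symmetric]) (auto simp: f_def)
    then show ?thesis using ennreal_mult'[of 2 "f (t - b) + f (b - t)"] by simp
   qed
   also have "\<dots> <= 2 * (g a t + g (a - 2 * pi) t + g (a + 2 * pi) t)"
    using b(1) by (intro mult_left_mono) (auto intro: add_increasing add_increasing2)
   finally show ?thesis using True by simp
  next
   case False
   then have "ennreal (cmod (cis t - w) powr (- e)) * indicator {0..<2 * pi} t = 0" by auto
   then show ?thesis by (simp only:) simp
  qed
  have meas: "(\<lambda>z. ennreal (cmod (z - w) powr (- e))) \<in> borel_measurable circle_measure"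
   by (rule borel_measurable_circle) measurable
  have "(\<integral>\<^sup>+ t. ennreal (cmod (cis t - w) powr (- e)) * indicator {0..<2 * pi} t \<partial>lborel) \<le>
    (\<integral>\<^sup>+ t. 2 * (g a t + g (a - 2 * pi) t + g (a + 2 * pi) t) \<partial>lborel)"
   by (intro nn_integral_mono point)
  also have "\<dots> = 2 * (ennreal (2 * I) + ennreal (2 * I) + ennreal (2 * I))"
   using gm by (simp add: nn_integral_cmult nn_integral_add gI)
  also have "ennreal (2 * I) + ennreal (2 * I) + ennreal (2 * I) = ennreal (6 * I)"
   using I0 by (simp flip: ennreal_plus)
  also have "2 * ennreal (6 * I) = ennreal (2 * (6 * I))"
   using ennreal_mult'[of 2 "6 * I"] by simp
  finally have "(\<integral>\<^sup>+ t. ennreal (cmod (cis t - w) powr (- e)) * indicator {0..<2 * pi} t \<partial>lborel) / ennreal (2 * pi)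
    <= ennreal (2 * (6 * I)) / ennreal (2 * pi)" by (rule divide_right_mono_ennreal)
  also have "\<dots> = ennreal (2 * (6 * I) / (2 * pi))" using I0 by (intro divide_ennreal) auto
  finally show "(\<integral>\<^sup>+ z. ennreal (cmod (z - w) powr (- e)) \<partial>circle_measure) <= ennreal (2 * (6 * I) / (2 * pi))"
   unfolding nn_integral_circle[OF meas] .
 qed
qed

lemma circle_null: "emeasure circle_measure {w} = 0" if "cmod w = 1"
proof -
 have m: "indicator {w} \<in> borel_measurable circle_measure" by (rule borel_measurable_circle) measurable
 have set: "{w} \<in> sets circle_measure"
  using that by (simp add: sets_circle sets_restrict_space_iff)
 have "emeasure circle_measure {w} = (\<integral>\<^sup>+ z. indicator {w} z \<partial>circle_measure)" using set by simp
 also have "\<dots> = (\<integral>\<^sup>+ t. indicator {w} (cis t) * indicator {0..<2 * pi} t \<partial>lborel) / ennreal (2 * pi)"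
  by (rule nn_integral_circle[OF m])
 also have "(\<integral>\<^sup>+ t. indicator {w} (cis t) * indicator {0..<2 * pi} t \<partial>lborel) = (\<integral>\<^sup>+ (t::real). 0 \<partial>lborel)"
 proof (rule nn_integral_cong_AE)
  have "t = Arg2pi w" if "cis t = w" "t \<in> {0..<2 * pi}" for t
   using that Arg2pi_unique[of 1 t w] by (simp add: cis_conv_exp)
  then show "AE t in lborel. indicator {w} (cis t) * indicator {0..<2 * pi} t = (0 :: ennreal)"
   using AE_lborel_singleton[of "Arg2pi w"] by (auto simp: indicator_def elim!: eventually_mono)
 qed
 finally show ?thesis by simp
qed

abbreviation torus_measure :: "nat => (nat => complex) measure" where
 "torus_measure N \<equiv> Pi\<^sub>M {1..N} (\<lambda>_. circle_measure)"

lemma space_torus: "space (Pi\<^sub>M J (\<lambda>_. circle_measure)) = J \<rightarrow>\<^sub>E sphere 0 1"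
 by (simp add: space_PiM space_circle)

lemma space_torus_measure: "space (torus_measure N) = torus N"
 by (simp add: space_torus torus_def)

lemma prob_space_torus: "prob_space (Pi\<^sub>M J (\<lambda>_::nat. circle_measure))"
 by (intro prob_space_PiM circle.prob_space_axioms)

lemma coordinate_measurable: "i \<in> J ==> (\<lambda>x. x i) \<in> borel_measurable (Pi\<^sub>M J (\<lambda>_. circle_measure))"
 by (rule measurable_compose[OF measurable_component_singleton[of i] borel_measurable_circle]) auto

lemma ident_measurable: "(\<lambda>x. x) \<in> borel_measurable (torus_measure N)"
proof (rule measurable_coordinatewise_then_product)
 fix i
 show "(\<lambda>x. x i) \<in> borel_measurable (torus_measure N)"
 proof (cases "i \<in> {1..N}")
  case True
  then show ?thesis by (rule coordinate_measurable)
 next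
  case False
  have "(\<lambda>x. x i) \<in> borel_measurable (torus_measure N) \<longleftrightarrow>
    (\<lambda>x. undefined :: complex) \<in> borel_measurable (torus_measure N)"
   by (rule measurable_cong) (use False in \<open>auto simp: space_torus PiE_iff extensional_def\<close>)
  then show ?thesis by simp
 qed
qed

lemma torus_closed: "closed (torus N)"
proof -
 define A where "A i = (\<lambda>x :: nat => complex. x i) -` (if i \<in> {1..N} then sphere 0 1 else {undefined})" for i
 have "torus N = (\<Inter>i. A i)"
 proof (rule set_eqI, rule iffI)
  fix x assume x: "x \<in> torus N"
  have "x i \<in> (if i \<in> {1..N} then sphere 0 1 else {undefined})" for i
  proof (cases "i \<in> {1..N}")
   case True
   show ?thesis unfolding if_P[OF True] using x unfolding torus_def by (rule PiE_mem[OF _ True])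
  next
   case False
   show ?thesis unfolding if_not_P[OF False] singleton_iff
    using x unfolding torus_def by (rule PiE_arb[OF _ False])
  qed
  then show "x \<in> (\<Inter>i. A i)" by (simp only: A_def INT_iff vimage_eq) blast
 next
  fix x assume x: "x \<in> (\<Inter>i. A i)"
  then have *: "x i \<in> (if i \<in> {1..N} then sphere 0 1 else {undefined})" for i
   by (simp only: A_def INT_iff vimage_eq) blast
  show "x \<in> torus N" unfolding torus_def
  proof (rule PiE_I)
   fix i assume i: "i \<in> {1..N}"
   show "x i \<in> sphere 0 1" using *[of i] unfolding if_P[OF i] .
  next
   fix i assume i: "i \<notin> {1..N}"
   show "x i = undefined" using *[of i] unfolding if_not_P[OF i] singleton_iff .
  qed
 qed
 moreover have "closed (A i)" for i unfolding A_def by (rule closed_vimage) auto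
 ultimately show ?thesis by (simp add: closed_INT)
qed

lemma torus_reg_eq: "torus_reg N = torus N \<inter> {x. \<forall>(i, j)\<in>pairs N. x i ~= x j}"
proof -
 have "inj_on x {1..N} \<longleftrightarrow> (\<forall>(i, j)\<in>pairs N. x i ~= x j)" for x :: "nat => complex"
  unfolding inj_on_def pairs_def by blast
 then show ?thesis unfolding torus_reg_def by blast
qed

lemma torus_reg_borel: "torus_reg N \<in> sets borel"
proof -
 have "open {x :: nat => complex. \<forall>(i, j)\<in>pairs N. x i ~= x j}"
 proof -
  have "{x :: nat => complex. \<forall>(i, j)\<in>pairs N. x i ~= x j} = (\<Inter>p\<in>pairs N. {x. x (fst p) ~= x (snd p)})"
   by fastforce
  also have "open \<dots>"
   by (intro open_INT ballI open_Collect_neq continuous_on_product_coordinates) simp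
  finally show ?thesis .
 qed
 then show ?thesis unfolding torus_reg_eq using torus_closed by auto
qed

lemma measurable_torus_reg:
 fixes f :: "(nat => complex) => 'b::{real_normed_vector, second_countable_topology}"
 assumes "continuous_on (torus_reg N) f"
 shows "(\<lambda>x. if x \<in> torus_reg N then f x else 0) \<in> borel_measurable (torus_measure N)"
proof -
 have "(\<lambda>x. indicator (torus_reg N) x *\<^sub>R f x) \<in> borel_measurable borel"
  by (rule borel_measurable_continuous_on_indicator[OF torus_reg_borel assms])
 then have "(\<lambda>x. indicator (torus_reg N) x *\<^sub>R f x) \<in> borel_measurable (torus_measure N)"
  by (rule measurable_compose[OF ident_measurable])
 moreover have "(\<lambda>x. indicator (torus_reg N) x *\<^sub>R f x) = (\<lambda>x. if x \<in> torus_reg N then f x else 0)"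
  by (auto simp: fun_eq_iff)
 ultimately show ?thesis by simp
qed

lemma nn_integral_torus_insert:
 fixes J :: "nat set"
 assumes "finite J" "i \<in> J" "f \<in> borel_measurable (Pi\<^sub>M J (\<lambda>_. circle_measure))"
 shows "(\<integral>\<^sup>+ x. f x \<partial>Pi\<^sub>M J (\<lambda>_. circle_measure)) =
  (\<integral>\<^sup>+ x. (\<integral>\<^sup>+ z. f (x(i := z)) \<partial>circle_measure) \<partial>Pi\<^sub>M (J - {i}) (\<lambda>_. circle_measure))"
proof -
 have "insert i (J - {i}) = J" using assms(2) by auto
 then show ?thesis using prod.product_nn_integral_insert[of "J - {i}" i f] assms by simp
qed

lemma pair_power_nn_integral:
 fixes J :: "nat set"
 assumes e: "0 <= e" "e < 1" and J: "finite J" "i \<in> J" "j \<in> J" "i ~= j"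
 shows "(\<integral>\<^sup>+ x. ennreal (cmod (x i - x j) powr (- e)) \<partial>Pi\<^sub>M J (\<lambda>_. circle_measure)) < \<infinity>"
proof -
 obtain C where C: "\<And>w. cmod w = 1 ==> (\<integral>\<^sup>+ z. ennreal (cmod (z - w) powr (- e)) \<partial>circle_measure) <= ennreal C"
  using circle_power_bound[OF e] by blast
 interpret P: prob_space "Pi\<^sub>M (J - {i}) (\<lambda>_. circle_measure)" by (rule prob_space_torus)
 note [measurable] = coordinate_measurable[OF J(2)] coordinate_measurable[OF J(3)]
 have "(\<integral>\<^sup>+ x. ennreal (cmod (x i - x j) powr (- e)) \<partial>Pi\<^sub>M J (\<lambda>_. circle_measure)) =
  (\<integral>\<^sup>+ x. (\<integral>\<^sup>+ z. ennreal (cmod ((x(i := z)) i - (x(i := z)) j) powr (- e)) \<partial>circle_measure)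
   \<partial>Pi\<^sub>M (J - {i}) (\<lambda>_. circle_measure))"
  by (rule nn_integral_torus_insert[OF J(1,2)]) measurable
 also have "\<dots> <= (\<integral>\<^sup>+ x. ennreal C \<partial>Pi\<^sub>M (J - {i}) (\<lambda>_. circle_measure))"
  using J by (intro nn_integral_mono) (auto simp: space_torus PiE_iff intro!: C)
 also have "\<dots> = ennreal C" by (simp add: P.emeasure_space_1)
 also have "\<dots> < \<infinity>" by simp
 finally show ?thesis .
qed

text \<open>Two different pairs of coordinates differ in a coordinate, which is integrated out first.\<close>

lemma two_pairs_integrable:
 assumes e: "0 <= e1" "e1 < 1" "0 <= e2" "e2 < 1"
  and ij: "(i, j) \<in> pairs N" and kl: "(k, l) \<in> pairs N - {(i, j), (j, i)}"
 shows "integrable (torus_measure N) (\<lambda>x. cmod (x i - x j) powr (- e1) * cmod (x k - x l) powr (- e2))"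
proof -
 have main: "integrable (torus_measure N) (\<lambda>x. cmod (x i - x j) powr (- e1) * cmod (x k - x l) powr (- e2))"
  if kl: "(k, l) \<in> pairs N" and k: "k ~= i" "k ~= j" for k l
 proof -
  obtain C where C: "\<And>w. cmod w = 1 ==> (\<integral>\<^sup>+ z. ennreal (cmod (z - w) powr (- e2)) \<partial>circle_measure) <= ennreal C"
   using circle_power_bound[OF e(3,4)] by blast
  have mem: "i \<in> {1..N}" "j \<in> {1..N}" "k \<in> {1..N}" "l \<in> {1..N}" "i ~= j" "k ~= l"
   using ij kl by (auto simp: pairs_def)
  note [measurable] = coordinate_measurable[OF mem(1)] coordinate_measurable[OF mem(2)]
   coordinate_measurable[OF mem(3)] coordinate_measurable[OF mem(4)]
  let ?R = "Pi\<^sub>M ({1..N} - {k}) (\<lambda>_. circle_measure)"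
  have mem': "i \<in> {1..N} - {k}" "j \<in> {1..N} - {k}" using mem k by auto
  note [measurable] = coordinate_measurable[OF mem'(1)] coordinate_measurable[OF mem'(2)]
  show ?thesis
  proof (rule integrableI_bounded)
   have "(\<integral>\<^sup>+ x. ennreal (norm (cmod (x i - x j) powr (- e1) * cmod (x k - x l) powr (- e2))) \<partial>torus_measure N) =
     (\<integral>\<^sup>+ x. (\<integral>\<^sup>+ z. ennreal (norm (cmod ((x(k := z)) i - (x(k := z)) j) powr (- e1) *
      cmod ((x(k := z)) k - (x(k := z)) l) powr (- e2))) \<partial>circle_measure) \<partial>?R)"
    by (rule nn_integral_torus_insert[OF _ mem(3)]) (simp, measurable)
   also have "\<dots> <= (\<integral>\<^sup>+ x. ennreal (cmod (x i - x j) powr (- e1)) * ennreal C \<partial>?R)"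
   proof (intro nn_integral_mono)
    fix x assume x: "x \<in> space ?R"
    have meas: "(\<lambda>z. ennreal (cmod (z - x l) powr (- e2))) \<in> borel_measurable circle_measure"
     by (rule borel_measurable_circle) measurable
    have "(\<integral>\<^sup>+ z. ennreal (norm (cmod ((x(k := z)) i - (x(k := z)) j) powr (- e1) *
      cmod ((x(k := z)) k - (x(k := z)) l) powr (- e2))) \<partial>circle_measure) =
      (\<integral>\<^sup>+ z. ennreal (cmod (x i - x j) powr (- e1)) * ennreal (cmod (z - x l) powr (- e2)) \<partial>circle_measure)"
     using k mem by (intro nn_integral_cong) (auto simp: ennreal_mult' abs_mult)
    also have "\<dots> = ennreal (cmod (x i - x j) powr (- e1)) * (\<integral>\<^sup>+ z. ennreal (cmod (z - x l) powr (- e2)) \<partial>circle_measure)"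
     by (rule nn_integral_cmult[OF meas])
    also have "\<dots> <= ennreal (cmod (x i - x j) powr (- e1)) * ennreal C"
     using x mem by (intro mult_left_mono C) (auto simp: space_torus PiE_iff)
    finally show "(\<integral>\<^sup>+ z. ennreal (norm (cmod ((x(k := z)) i - (x(k := z)) j) powr (- e1) *
      cmod ((x(k := z)) k - (x(k := z)) l) powr (- e2))) \<partial>circle_measure) \<le>
      ennreal (cmod (x i - x j) powr (- e1)) * ennreal C" .
   qed
   also have "\<dots> = (\<integral>\<^sup>+ x. ennreal (cmod (x i - x j) powr (- e1)) \<partial>?R) * ennreal C"
    by (rule nn_integral_multc) measurable
   also have "\<dots> < \<infinity>"
    using pair_power_nn_integral[OF e(1,2) _ mem' mem(5)] by (simp add: ennreal_mult_less_top)
   finally show "(\<integral>\<^sup>+ x. ennreal (norm (cmod (x i - x j) powr (- e1) * cmod (x k - x l) powr (- e2))) \<partial>torus_measure N) < \<infinity>" .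
  qed measurable
 qed
 show ?thesis
 proof (cases "k ~= i \<and> k ~= j")
  case True
  then show ?thesis using main kl by auto
 next
  case False
  then have l: "l ~= i" "l ~= j" using kl by (auto simp: pairs_def)
  have "(l, k) \<in> pairs N" using kl by (auto simp: pairs_def)
  from main[OF this l] show ?thesis by (simp add: norm_minus_commute[of "_ l"])
 qed
qed

lemma pair_integrable:
 assumes e: "0 <= e" "e < 1" and ij: "(i, j) \<in> pairs N"
 shows "integrable (torus_measure N) (\<lambda>x. cmod (x i - x j) powr (- e))"
proof -
 have mem: "i \<in> {1..N}" "j \<in> {1..N}" "i ~= j" using ij by (auto simp: pairs_def)
 note [measurable] = coordinate_measurable[OF mem(1)] coordinate_measurable[OF mem(2)]
 show ?thesis
 proof (rule integrableI_bounded)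
  show "(\<integral>\<^sup>+ x. ennreal (norm (cmod (x i - x j) powr (- e))) \<partial>torus_measure N) < \<infinity>"
   using pair_power_nn_integral[OF e _ mem] by simp
 qed measurable
qed

lemma AE_torus_reg: "AE x in torus_measure N. x \<in> torus_reg N"
proof -
 have "AE x in torus_measure N. x i ~= x j" if ij: "(i, j) \<in> pairs N" for i j
 proof -
  have mem: "i \<in> {1..N}" "j \<in> {1..N}" "i ~= j" using ij by (auto simp: pairs_def)
  note [measurable] = coordinate_measurable[OF mem(1)] coordinate_measurable[OF mem(2)]
  define A where "A = {x \<in> space (torus_measure N). x i = x j}"
  have A: "A \<in> sets (torus_measure N)" unfolding A_def by measurable
  have "emeasure (torus_measure N) A = (\<integral>\<^sup>+ x. indicator {0} (x i - x j) \<partial>torus_measure N)"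
   unfolding nn_integral_indicator[OF A, symmetric]
   by (intro nn_integral_cong) (auto simp: A_def indicator_def)
  also have "\<dots> = (\<integral>\<^sup>+ x. (\<integral>\<^sup>+ z. indicator {0} ((x(i := z)) i - (x(i := z)) j) \<partial>circle_measure)
    \<partial>Pi\<^sub>M ({1..N} - {i}) (\<lambda>_. circle_measure))"
   by (rule nn_integral_torus_insert[OF _ mem(1)]) (simp, measurable)
  also have "\<dots> = (\<integral>\<^sup>+ x. 0 \<partial>Pi\<^sub>M ({1..N} - {i}) (\<lambda>_. circle_measure))"
  proof (rule nn_integral_cong)
   fix x assume x: "x \<in> space (Pi\<^sub>M ({1..N} - {i}) (\<lambda>_. circle_measure))"
   then have w: "cmod (x j) = 1" using mem by (auto simp: space_torus PiE_iff)
   then have set: "{x j} \<in> sets circle_measure" by (simp add: sets_circle sets_restrict_space_iff)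
   have "(\<integral>\<^sup>+ z. indicator {0} ((x(i := z)) i - (x(i := z)) j) \<partial>circle_measure) =
     (\<integral>\<^sup>+ z. indicator {x j} z \<partial>circle_measure)"
    using mem by (intro nn_integral_cong) (auto simp: indicator_def)
   then show "(\<integral>\<^sup>+ z. indicator {0} ((x(i := z)) i - (x(i := z)) j) \<partial>circle_measure) = 0"
    using circle_null[OF w] set by simp
  qed
  finally have "emeasure (torus_measure N) A = 0" by simp
  then show ?thesis using A by (intro AE_I[of _ _ A]) (auto simp: A_def)
 qed
 then have "AE x in torus_measure N. \<forall>p\<in>pairs N. x (fst p) ~= x (snd p)"
  by (intro AE_finite_allI) auto
 moreover have "AE x in torus_measure N. x \<in> torus N"
  using AE_space[of "torus_measure N"] by (simp only: space_torus_measure)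
 ultimately show ?thesis
 proof eventually_elim
  fix x assume "\<forall>p\<in>pairs N. x (fst p) ~= x (snd p)" "x \<in> torus N"
  then show "x \<in> torus_reg N" unfolding torus_reg_eq by (force simp del: split_paired_All)
 qed
qed

lemma torus_swap:
 fixes f :: "(nat => complex) => 'b::{banach, second_countable_topology}"
 assumes w: "w permutes {1..N}" and f: "f \<in> borel_measurable (torus_measure N)"
 shows "integral\<^sup>L (torus_measure N) (\<lambda>x. f (x \<circ> w)) = integral\<^sup>L (torus_measure N) f"
proof -
 let ?T = "\<lambda>x. \<lambda>n\<in>{1..N}. x (w n)"
 have T: "?T \<in> measurable (torus_measure N) (torus_measure N)"
  by (rule measurable_restrict) (use permutes_in_image[OF w] in \<open>auto intro!: measurable_component_singleton simp del: atLeastAtMost_iff\<close>)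
 have d: "distr (torus_measure N) (torus_measure N) ?T = torus_measure N"
  using distr_PiM_reindex[of "{1..N}" "\<lambda>_. circle_measure" w "{1..N}"] circle.prob_space_axioms
   permutes_inj_on[OF w] permutes_in_image[OF w] by (auto simp del: atLeastAtMost_iff)
 have "integral\<^sup>L (torus_measure N) f = integral\<^sup>L (torus_measure N) (\<lambda>x. f (?T x))"
  by (subst d[symmetric]) (rule integral_distr[OF T f])
 also have "\<dots> = integral\<^sup>L (torus_measure N) (\<lambda>x. f (x \<circ> w))"
 proof (rule Bochner_Integration.integral_cong[OF refl])
  fix x assume "x \<in> space (torus_measure N)"
  then have "x \<in> torus N" unfolding space_torus_measure .
  then have "x \<circ> w \<in> extensional {1..N}"
   using torus_comp[of x N w] w unfolding torus_def PiE_def by blast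
  then have "x \<circ> w = ?T x"
   by (intro ext) (simp add: restrict_def extensional_def)
  then show "f (?T x) = f (x \<circ> w)" by simp
 qed
 finally show ?thesis by simp
qed

lemma torus_fiber_zero:
 fixes f :: "(nat => complex) => complex"
 assumes i: "i \<in> {1..N}" and f: "integrable (torus_measure N) f"
  and zero: "\<And>x. x \<in> ({1..N} - {i}) \<rightarrow>\<^sub>E sphere 0 1 ==> integral\<^sup>L circle_measure (\<lambda>z. f (x(i := z))) = 0"
 shows "integral\<^sup>L (torus_measure N) f = 0"
proof -
 have ins: "insert i ({1..N} - {i}) = {1..N}" using i by auto
 have "integral\<^sup>L (torus_measure N) f =
   (LINT x|Pi\<^sub>M ({1..N} - {i}) (\<lambda>_. circle_measure). LINT z|circle_measure. f (x(i := z)))"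
  using prod.product_integral_insert[of "{1..N} - {i}" i f, unfolded ins] f by blast
 also have "\<dots> = (LINT x|Pi\<^sub>M ({1..N} - {i}) (\<lambda>_. circle_measure). 0)"
  by (intro Bochner_Integration.integral_cong refl zero) (simp add: space_torus)
 finally show ?thesis by simp
qed

section \<open>Integrals of derivatives over the torus\<close>

text \<open>The cotangent of half the angle between \<open>z\<close> and \<open>w\<close>, expressed by the points to avoid a choice of
 angles on the torus.\<close>

definition ctg :: "complex => complex => real" where
 "ctg z w = 2 * Im (z * cnj w) / (cmod (z - w))\<^sup>2"

lemma ctg_swap: "ctg w z = - ctg z w"
proof -
 have "Im (w * cnj z) = - Im (z * cnj w)" by simp
 then show ?thesis unfolding ctg_def by (simp only: norm_minus_commute mult_minus_right minus_divide_left)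
qed

lemma ctg_cis: "ctg (cis a) (cis b) = cot ((a - b) / 2)"
proof -
 define u where "u = (a - b) / 2"
 have "a - b = 2 * u" by (simp add: u_def)
 then have "Im (cis a * cnj (cis b)) = sin (2 * u)"
  by (simp flip: sin_diff)
 moreover have "(cmod (cis a - cis b))\<^sup>2 = 4 * (sin u)\<^sup>2"
  unfolding chord_eq u_def[symmetric] by (simp add: power_mult_distrib)
 ultimately have "ctg (cis a) (cis b) = cot u"
  by (cases "sin u = 0") (simp_all add: ctg_def sin_double cot_def power2_eq_square)
 then show ?thesis by (simp add: u_def)
qed

lemma abs_ctg_le:
 assumes "cmod z = 1" "cmod w = 1"
 shows "\<bar>ctg z w\<bar> * cmod (z - w) <= 2"
proof (cases "z = w")
 case False
 have "Im (z * cnj w) = Im ((z - w) * cnj w)" by (simp add: algebra_simps)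
 also have "\<bar>\<dots>\<bar> <= cmod ((z - w) * cnj w)" by (rule abs_Im_le_cmod)
 finally have *: "\<bar>Im (z * cnj w)\<bar> <= cmod (z - w)" using assms by (simp add: norm_mult)
 have "\<bar>ctg z w\<bar> = 2 * \<bar>Im (z * cnj w)\<bar> / (cmod (z - w))\<^sup>2"
  unfolding ctg_def abs_divide abs_mult by simp
 then have "\<bar>ctg z w\<bar> * cmod (z - w) = 2 * \<bar>Im (z * cnj w)\<bar> / cmod (z - w)"
  using False by (simp only: power2_eq_square) simp
 also have "\<dots> <= 2" using * False by (simp add: pos_divide_le_eq)
 finally show ?thesis .
qed (simp add: ctg_def)

text \<open>Squared chords reproduce themselves under differentiation, with the cotangent as factor.\<close>

lemma chord_derivative:
 assumes "cmod z = 1" "cmod w = 1"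
 shows "((\<lambda>t. (cmod (z * cis t - w))\<^sup>2) has_real_derivative ctg z w * (cmod (z - w))\<^sup>2) (at 0)"
  and "((\<lambda>t. (cmod (w - z * cis t))\<^sup>2) has_real_derivative ctg z w * (cmod (w - z))\<^sup>2) (at 0)"
proof -
 have expand: "(cmod (u - w))\<^sup>2 = 2 - 2 * Re (u * cnj w)" if "cmod u = 1" for u
 proof -
  have "(cmod (u - w))\<^sup>2 = (cmod u)\<^sup>2 + (cmod w)\<^sup>2 - 2 * Re (u * cnj w)"
   unfolding cmod_power2 by (simp add: algebra_simps power2_eq_square)
  then show ?thesis using that assms by simp
 qed
 have "((\<lambda>t. 2 - 2 * Re (z * cis t * cnj w)) has_real_derivative 2 * Im (z * cnj w)) (at 0)"
  by (auto intro!: derivative_eq_intros simp: algebra_simps)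
 moreover have "(\<lambda>t. (cmod (z * cis t - w))\<^sup>2) = (\<lambda>t. 2 - 2 * Re (z * cis t * cnj w))"
  by (intro ext expand) (simp add: norm_mult assms)
 moreover have "ctg z w * (cmod (z - w))\<^sup>2 = 2 * Im (z * cnj w)"
  by (cases "z = w") (simp_all add: ctg_def mult.commute[of z "cnj z"] complex_eq_iff)
 ultimately show 1: "((\<lambda>t. (cmod (z * cis t - w))\<^sup>2) has_real_derivative ctg z w * (cmod (z - w))\<^sup>2) (at 0)"
  by simp
 then show "((\<lambda>t. (cmod (w - z * cis t))\<^sup>2) has_real_derivative ctg z w * (cmod (w - z))\<^sup>2) (at 0)"
  by (simp add: norm_minus_commute[of w])
qed

lemma prod_log_derivative:
 fixes h :: "'a => real => real"
 assumes "finite A" "\<And>a. a \<in> A ==> (h a has_real_derivative c a * h a s) (at s)"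
 shows "((\<lambda>t. \<Prod>a\<in>A. h a t) has_real_derivative (\<Sum>a\<in>A. c a) * (\<Prod>a\<in>A. h a s)) (at s)"
 using assms
proof (induction A rule: finite_induct)
 case (insert a A)
 have "((\<lambda>t. h a t * (\<Prod>a\<in>A. h a t)) has_real_derivative
   c a * h a s * (\<Prod>a\<in>A. h a s) + (\<Sum>a\<in>A. c a) * (\<Prod>a\<in>A. h a s) * h a s) (at s)"
  by (intro DERIV_mult insert) auto
 then show ?case using insert(1,2) by (simp add: algebra_simps)
qed simp

definition discr :: "nat => (nat => complex) => real" where
 "discr N x = (\<Prod>(a, b)\<in>pairs N. (cmod (x a - x b))\<^sup>2)"

lemma discr_nonneg: "0 <= discr N x"
 unfolding discr_def by (intro prod_nonneg) auto

lemma discr_zero_iff: "x \<in> torus N ==> discr N x = 0 \<longleftrightarrow> x \<notin> torus_reg N"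
proof -
 assume "x \<in> torus N"
 moreover have "discr N x = 0 \<longleftrightarrow> (\<exists>(a, b)\<in>pairs N. x a = x b)"
  unfolding discr_def prod_zero_iff[OF finite_pairs] by (simp add: case_prod_beta)
 ultimately show ?thesis unfolding torus_reg_eq by blast
qed

lemma discr_pos: "x \<in> torus_reg N ==> 0 < discr N x"
 using discr_zero_iff[of x N] discr_nonneg[of N x] by (auto simp: torus_reg_def)

lemma discr_comp:
 assumes w: "w permutes {1..N}"
 shows "discr N (x \<circ> w) = discr N x"
proof -
 have "bij_betw (\<lambda>p. (w (fst p), w (snd p))) (pairs N) (pairs N)"
 proof (rule bij_betw_byWitness[where f' = "\<lambda>p. (inv w (fst p), inv w (snd p))"])
  show "\<forall>p\<in>pairs N. (inv w (fst (w (fst p), w (snd p))), inv w (snd (w (fst p), w (snd p)))) = p"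
   using permutes_inverses[OF w] by simp
  show "\<forall>p\<in>pairs N. (w (fst (inv w (fst p), inv w (snd p))), w (snd (inv w (fst p), inv w (snd p)))) = p"
   using permutes_inverses[OF w] by simp
  show "(\<lambda>p. (w (fst p), w (snd p))) ` pairs N \<subseteq> pairs N"
   using permutes_pairs[OF w] by auto
  show "(\<lambda>p. (inv w (fst p), inv w (snd p))) ` pairs N \<subseteq> pairs N"
   using permutes_pairs[OF permutes_inv[OF w]] by auto
 qed
 from prod.reindex_bij_betw[OF this, of "\<lambda>p. (cmod (x (fst p) - x (snd p)))\<^sup>2"]
 show ?thesis by (simp add: discr_def case_prod_beta)
qed

lemma coordinate_continuous: "continuous_on A (\<lambda>x :: nat => complex. x i)"
 by (rule continuous_on_subset[OF continuous_on_product_coordinates]) simp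

lemma discr_continuous: "continuous_on A (discr N)"
 unfolding discr_def case_prod_beta
 by (intro continuous_intros coordinate_continuous)

text \<open>The discriminant dominates any two chords, and twice the same one as well.\<close>

lemma discr_le:
 assumes x: "x \<in> torus N" and ab: "(a, b) \<in> pairs N" and kl: "(k, l) \<in> pairs N"
 shows "discr N x <= 4 ^ card (pairs N) * (cmod (x a - x b) * cmod (x k - x l))"
proof -
 have le2: "cmod (x (fst p) - x (snd p)) <= 2" if "p \<in> pairs N" for p
 proof -
  have "cmod (x (fst p)) = 1" "cmod (x (snd p)) = 1"
   using that x by (auto simp: torus_def PiE_iff pairs_def)
  then show ?thesis using norm_triangle_ineq4[of "x (fst p)" "x (snd p)"] by simp
 qed
 define W where "W = (\<Prod>p\<in>pairs N. cmod (x (fst p) - x (snd p)))"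
 have W0: "0 <= W" unfolding W_def by (intro prod_nonneg) auto
 have W_le: "W <= 2 ^ card (pairs N) * cmod (x (fst q) - x (snd q))" if q: "q \<in> pairs N" for q
 proof -
  have "W = cmod (x (fst q) - x (snd q)) * (\<Prod>p\<in>pairs N - {q}. cmod (x (fst p) - x (snd p)))"
   unfolding W_def using q by (simp add: prod.remove)
  also have "(\<Prod>p\<in>pairs N - {q}. cmod (x (fst p) - x (snd p))) <= (\<Prod>p\<in>pairs N - {q}. 2)"
   by (intro prod_mono) (use le2 in auto)
  also have "(\<Prod>p\<in>pairs N - {q}. 2 :: real) = 2 ^ card (pairs N - {q})" by simp
  also have "\<dots> <= 2 ^ card (pairs N)" by (intro power_increasing card_mono) auto
  finally have "W <= cmod (x (fst q) - x (snd q)) * 2 ^ card (pairs N)"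
   by (simp add: mult_left_mono)
  then show ?thesis by (simp only: mult.commute)
 qed
 have "discr N x = W * W" by (simp add: discr_def W_def case_prod_beta power2_eq_square prod.distrib)
 also have "\<dots> <= (2 ^ card (pairs N) * cmod (x a - x b)) * (2 ^ card (pairs N) * cmod (x k - x l))"
  using W_le[OF ab] W_le[OF kl] W0 by (intro mult_mono) auto
 also have "\<dots> = 4 ^ card (pairs N) * (cmod (x a - x b) * cmod (x k - x l))"
  by (simp add: power_mult_distrib[symmetric] algebra_simps)
 finally show ?thesis .
qed

lemma torus_rotate: "x \<in> torus N ==> i \<in> {1..N} ==> cmod z = 1 ==> x(i := z) \<in> torus N"
 by (auto simp: torus_def PiE_iff extensional_def)

lemma torus_norm: "x \<in> torus N ==> i \<in> {1..N} ==> cmod (x i) = 1"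
 by (auto simp: torus_def PiE_iff)

lemma torus_reg_torus: "x \<in> torus_reg N ==> x \<in> torus N"
 by (simp add: torus_reg_def)

lemma discr_derivative:
 assumes x: "x \<in> torus N" and i: "i \<in> {1..N}"
 shows "((\<lambda>t. discr N (x(i := x i * cis t))) has_real_derivative
  2 * (\<Sum>j\<in>{1..N} - {i}. ctg (x i) (x j)) * discr N x) (at 0)"
proof -
 define c where "c = (\<lambda>(a, b). if a = i then ctg (x i) (x b) else if b = i then ctg (x i) (x a) else 0)"
 have der: "((\<lambda>t. (cmod ((x(i := x i * cis t)) (fst p) - (x(i := x i * cis t)) (snd p)))\<^sup>2)
   has_real_derivative c p * (cmod ((x(i := x i * cis 0)) (fst p) - (x(i := x i * cis 0)) (snd p)))\<^sup>2) (at 0)"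
  if p: "p \<in> pairs N" for p
 proof -
  obtain a b where ab: "p = (a, b)" by (cases p)
  then have m: "a \<in> {1..N}" "b \<in> {1..N}" "a ~= b" using p by (auto simp: pairs_def)
  note ch = chord_derivative[OF torus_norm[OF x i] torus_norm[OF x m(1)]]
   chord_derivative[OF torus_norm[OF x i] torus_norm[OF x m(2)]]
  consider "a = i" | "a ~= i" "b = i" | "a ~= i" "b ~= i" by blast
  then show ?thesis
   by cases (use ch m(3) in \<open>simp_all add: ab c_def\<close>)
 qed
 have "((\<lambda>t. discr N (x(i := x i * cis t))) has_real_derivative
   (\<Sum>p\<in>pairs N. c p) * discr N (x(i := x i * cis 0))) (at 0)"
  unfolding discr_def case_prod_beta by (rule prod_log_derivative[OF finite_pairs der])
 also have "x(i := x i * cis 0) = x" by simp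
 also have "(\<Sum>p\<in>pairs N. c p) = (\<Sum>a\<in>{1..N}. \<Sum>b\<in>{1..N} - {a}. c (a, b))"
 proof -
  have "pairs N = (SIGMA a:{1..N}. {1..N} - {a})" by (auto simp: pairs_def)
  then show ?thesis by (simp add: sum.Sigma del: One_nat_def)
 qed
 also have "\<dots> = (\<Sum>b\<in>{1..N} - {i}. c (i, b)) + (\<Sum>a\<in>{1..N} - {i}. \<Sum>b\<in>{1..N} - {a}. c (a, b))"
  using i by (simp add: sum.remove del: One_nat_def atLeastAtMost_iff)
 also have "(\<Sum>b\<in>{1..N} - {i}. c (i, b)) = (\<Sum>j\<in>{1..N} - {i}. ctg (x i) (x j))"
  by (simp add: c_def)
 also have "(\<Sum>a\<in>{1..N} - {i}. \<Sum>b\<in>{1..N} - {a}. c (a, b)) = (\<Sum>j\<in>{1..N} - {i}. ctg (x i) (x j))"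
 proof (rule sum.cong[OF refl])
  fix a assume a: "a \<in> {1..N} - {i}"
  have "(\<Sum>b\<in>{1..N} - {a}. c (a, b)) = (\<Sum>b\<in>{1..N} - {a}. if b = i then ctg (x i) (x a) else 0)"
   using a by (intro sum.cong) (auto simp: c_def)
  also have "\<dots> = ctg (x i) (x a)" using a i by (auto simp: sum.delta')
  finally show "(\<Sum>b\<in>{1..N} - {a}. c (a, b)) = ctg (x i) (x a)" .
 qed
 finally show ?thesis by (simp add: fun_upd_def algebra_simps)
qed

lemma ctg_continuous:
 assumes "(i, j) \<in> pairs N"
 shows "continuous_on (torus_reg N) (\<lambda>x. ctg (x i) (x j))"
 unfolding ctg_def
 by (intro continuous_intros coordinate_continuous)
  (use assms in \<open>auto simp: torus_reg_eq\<close>)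

lemma comp_continuous: "continuous_on A (\<lambda>x :: nat => complex. x \<circ> w)"
 by (rule continuous_on_coordinatewise_then_product) (simp add: coordinate_continuous)

lemma continuous_comp_torus_reg:
 assumes "continuous_on (torus_reg N) f" "w permutes {1..N}"
 shows "continuous_on (torus_reg N) (\<lambda>x. f (x \<circ> w))"
 by (rule continuous_on_compose2[OF assms(1) comp_continuous]) (use torus_reg_comp assms(2) in auto)

lemma antisymmetric_integral:
 fixes T :: "(nat => complex) => complex"
 assumes w: "w permutes {1..N}" and T: "T \<in> borel_measurable (torus_measure N)"
  and anti: "\<And>x. x \<in> torus N ==> T (x \<circ> w) = - T x"
 shows "integral\<^sup>L (torus_measure N) T = 0"
proof -
 have "integral\<^sup>L (torus_measure N) T = integral\<^sup>L (torus_measure N) (\<lambda>x. T (x \<circ> w))"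
  by (rule torus_swap[OF w T, symmetric])
 also have "\<dots> = integral\<^sup>L (torus_measure N) (\<lambda>x. - T x)"
  by (intro Bochner_Integration.integral_cong refl anti) (simp only: space_torus_measure)
 finally show ?thesis by simp
qed

lemma has_vector_derivative_shift:
 assumes "((\<lambda>s. F (t + s)) has_vector_derivative d) (at 0)"
 shows "(F has_vector_derivative d) (at t)"
proof -
 have "((\<lambda>u. u - t) has_vector_derivative 1) (at t)" by (auto intro!: derivative_eq_intros)
 from vector_diff_chain_at[OF this, of "\<lambda>s. F (t + s)" d] assms
 show ?thesis by (simp add: o_def)
qed

lemma derivative_zero_squeeze:
 fixes F :: "real => 'b::real_normed_vector"
 assumes g: "(g has_real_derivative 0) (at s)" "g s = 0" and le: "\<And>t. norm (F t) <= C * g t" and "\<And>t. 0 <= g t"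
 shows "(F has_vector_derivative 0) (at s)"
proof -
 have "F s = 0" using le[of s] g by simp
 have "((\<lambda>y. norm (g y - g s - (y - s) * 0) / norm (y - s)) \<longlongrightarrow> 0) (at s)"
  using g(1) unfolding has_field_derivative_def has_derivative_iff_norm by (simp add: mult.commute)
 then have "((\<lambda>y. C * (\<bar>g y\<bar> / \<bar>y - s\<bar>)) \<longlongrightarrow> C * 0) (at s)"
  using g(2) by (intro tendsto_mult_left) simp
 then have lim: "((\<lambda>y. C * (\<bar>g y\<bar> / \<bar>y - s\<bar>)) \<longlongrightarrow> 0) (at s)" by simp
 have "((\<lambda>y. norm (F y) / norm (y - s)) \<longlongrightarrow> 0) (at s)"
 proof (rule Lim_null_comparison[OF _ lim], rule always_eventually, rule allI)
  fix y
  have "norm (F y) <= C * \<bar>g y\<bar>" using le[of y] assms(4)[of y] by simp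
  from divide_right_mono[OF this, of "\<bar>y - s\<bar>"]
  show "norm (norm (F y) / norm (y - s)) <= C * (\<bar>g y\<bar> / \<bar>y - s\<bar>)" by simp
 qed
 then show ?thesis
  unfolding has_vector_derivative_def has_derivative_iff_norm using \<open>F s = 0\<close> by simp
qed

text \<open>A cutoff that vanishes on the walls and tends to 1 elsewhere as \<open>\<epsilon>\<close> tends to 0.\<close>

definition cutoff :: "nat => real => (nat => complex) => real" where
 "cutoff N \<epsilon> x = (discr N x)\<^sup>2 / ((discr N x)\<^sup>2 + \<epsilon>)"

text \<open>What differentiation of the cutoff leaves besides the cotangents. It stays below 1 for all \<open>\<epsilon>\<close> and tends
 to 0 with \<open>\<epsilon>\<close>, so it does not spoil a majorant.\<close>

definition cutoff_slope :: "nat => real => (nat => complex) => real" where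
 "cutoff_slope N \<epsilon> x = 4 * \<epsilon> * (discr N x)\<^sup>2 / ((discr N x)\<^sup>2 + \<epsilon>)\<^sup>2"

lemma cutoff_derivative:
 assumes x: "x \<in> torus N" and i: "i \<in> {1..N}" and e: "\<epsilon> > 0"
 shows "((\<lambda>t. cutoff N \<epsilon> (x(i := x i * cis t))) has_real_derivative
  (\<Sum>j\<in>{1..N} - {i}. ctg (x i) (x j)) * cutoff_slope N \<epsilon> x) (at 0)"
proof -
 define Q where "Q t = discr N (x(i := x i * cis t))" for t
 define c where "c = (\<Sum>j\<in>{1..N} - {i}. ctg (x i) (x j))"
 have Q0: "Q 0 = discr N x" by (simp add: Q_def)
 have [derivative_intros]: "(Q has_real_derivative 2 * c * Q 0) (at 0)"
  using discr_derivative[OF x i] unfolding Q_def[symmetric] Q0 c_def .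
 have pos: "(Q 0)\<^sup>2 + \<epsilon> > 0" using e by (simp add: add_nonneg_pos)
 have "((\<lambda>t. (Q t)\<^sup>2 / ((Q t)\<^sup>2 + \<epsilon>)) has_real_derivative
   c * (4 * \<epsilon> * (Q 0)\<^sup>2 / ((Q 0)\<^sup>2 + \<epsilon>)\<^sup>2)) (at 0)"
  using pos by (auto intro!: derivative_eq_intros simp: power2_eq_square algebra_simps)
 then show ?thesis unfolding Q0 c_def unfolding cutoff_def cutoff_slope_def Q_def .
qed

lemma cutoff_bounds:
 assumes "\<epsilon> > 0"
 shows "0 <= cutoff N \<epsilon> x" "cutoff N \<epsilon> x <= 1" "cutoff N \<epsilon> x <= 4 / \<epsilon> * (discr N x)\<^sup>2"
  "0 <= cutoff_slope N \<epsilon> x" "cutoff_slope N \<epsilon> x <= 1" "cutoff_slope N \<epsilon> x <= 4 / \<epsilon> * (discr N x)\<^sup>2"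
proof -
 define V where "V = (discr N x)\<^sup>2"
 have V: "0 <= V" by (simp add: V_def)
 have pos: "V + \<epsilon> > 0" using V assms by simp
 show "0 <= cutoff N \<epsilon> x" "cutoff N \<epsilon> x <= 1" "0 <= cutoff_slope N \<epsilon> x"
  using V assms pos unfolding cutoff_def cutoff_slope_def V_def[symmetric] by (simp_all add: divide_le_eq)
 have "V / (V + \<epsilon>) <= V / \<epsilon>" using V assms by (intro divide_left_mono) auto
 also have "\<dots> <= 4 * V / \<epsilon>" using V assms by (intro divide_right_mono) auto
 finally show "cutoff N \<epsilon> x <= 4 / \<epsilon> * (discr N x)\<^sup>2"
  unfolding cutoff_def V_def[symmetric] by simp
 have "0 <= (V - \<epsilon>)\<^sup>2" by simp
 then have "4 * \<epsilon> * V <= (V + \<epsilon>)\<^sup>2" by (simp add: power2_eq_square algebra_simps)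
 then show "cutoff_slope N \<epsilon> x <= 1"
  using pos unfolding cutoff_slope_def V_def[symmetric] by (simp add: divide_le_eq)
 have "4 * \<epsilon> * V / (V + \<epsilon>)\<^sup>2 <= 4 * \<epsilon> * V / \<epsilon>\<^sup>2"
  using V assms by (intro divide_left_mono power_mono) auto
 also have "\<dots> = 4 / \<epsilon> * V" using assms by (simp add: power2_eq_square)
 finally show "cutoff_slope N \<epsilon> x <= 4 / \<epsilon> * (discr N x)\<^sup>2"
  unfolding cutoff_slope_def V_def[symmetric] .
qed

lemma cutoff_continuous:
 assumes "\<epsilon> > 0"
 shows "continuous_on A (cutoff N \<epsilon>)" "continuous_on A (cutoff_slope N \<epsilon>)"
proof -
 have "(discr N x)\<^sup>2 + \<epsilon> ~= 0" for x using assms zero_le_power2[of "discr N x"] by linarith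
 then show "continuous_on A (cutoff N \<epsilon>)" "continuous_on A (cutoff_slope N \<epsilon>)"
  unfolding cutoff_def cutoff_slope_def by (auto intro!: continuous_intros discr_continuous)
qed

lemma discr_bounded: "x \<in> torus N ==> discr N x <= 4 ^ card (pairs N)"
proof -
 assume x: "x \<in> torus N"
 have "discr N x <= (\<Prod>p\<in>pairs N. 4)"
  unfolding discr_def case_prod_beta
 proof (rule prod_mono, rule conjI)
  fix p assume p: "p \<in> pairs N"
  then have "cmod (x (fst p)) = 1" "cmod (x (snd p)) = 1"
   using torus_norm[OF x] by (auto simp: pairs_def)
  then have "cmod (x (fst p) - x (snd p)) <= 2"
   using norm_triangle_ineq4[of "x (fst p)" "x (snd p)"] by simp
  then have "(cmod (x (fst p) - x (snd p)))\<^sup>2 <= 2\<^sup>2" by (intro power_mono) auto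
  then show "(cmod (x (fst p) - x (snd p)))\<^sup>2 <= 4" by simp
 qed simp
 then show ?thesis by simp
qed

text \<open>The weight is quadratic in the discriminant: one factor compensates the growth of \<open>h\<close>, the other one
 makes the product small near the walls.\<close>

lemma damped_bounded:
 fixes h :: "(nat => complex) => complex"
 assumes k: "continuous_on (torus_reg N) k" "\<And>x. 0 <= k x" "\<And>x. k x <= A * (discr N x)\<^sup>2" and A: "0 <= A"
  and h: "continuous_on (torus_reg N) h" "\<And>x. x \<in> torus_reg N ==> discr N x * cmod (h x) <= B"
 shows "(\<lambda>x. of_real (k x) * h x) \<in> borel_measurable (torus_measure N)" (is ?measurable)
  and "x \<in> torus N ==> cmod (of_real (k x) * h x) <= A * \<bar>B\<bar> * discr N x"
  and "x \<in> torus N ==> cmod (of_real (k x) * h x) <= A * \<bar>B\<bar> * 4 ^ card (pairs N)"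
  and "integrable (torus_measure N) (\<lambda>x. of_real (k x) * h x)"
proof -
 have zero: "k x = 0" if "x \<in> torus N" "x \<notin> torus_reg N" for x
  using k(2,3)[of x] discr_zero_iff[of x N] that by simp
 have "(\<lambda>x. if x \<in> torus_reg N then of_real (k x) * h x else 0) \<in> borel_measurable (torus_measure N)"
  by (intro measurable_torus_reg continuous_intros k(1) h(1))
 also have "?this \<longleftrightarrow> ?measurable"
  by (rule measurable_cong, unfold space_torus_measure) (simp add: zero)
 finally show meas: ?measurable .
 show le: "cmod (of_real (k x) * h x) <= A * \<bar>B\<bar> * discr N x" if x: "x \<in> torus N" for x
 proof (cases "x \<in> torus_reg N")
  case True
  have "cmod (of_real (k x) * h x) = k x * cmod (h x)" using k(2)[of x] by (simp add: norm_mult)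
  also have "\<dots> <= A * (discr N x)\<^sup>2 * cmod (h x)" by (intro mult_right_mono k) simp
  also have "\<dots> = A * discr N x * (discr N x * cmod (h x))" by (simp add: power2_eq_square)
  also have "\<dots> <= A * discr N x * \<bar>B\<bar>"
   using h(2)[OF True] A discr_nonneg[of N x] by (intro mult_left_mono) auto
  finally show ?thesis by (simp add: algebra_simps)
 next
  case False
  then show ?thesis using zero[OF x] A discr_nonneg[of N x] by simp
 qed
 show le': "cmod (of_real (k x) * h x) <= A * \<bar>B\<bar> * 4 ^ card (pairs N)" if x: "x \<in> torus N" for x
  using order_trans[OF le[OF x] mult_left_mono[OF discr_bounded[OF x], of "A * \<bar>B\<bar>"]] A by simp
 interpret T: prob_space "torus_measure N" by (rule prob_space_torus)
 show "integrable (torus_measure N) (\<lambda>x. of_real (k x) * h x)"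
  by (rule T.integrable_const_bound[OF AE_I2 meas]) (use le' in \<open>simp only: space_torus_measure\<close>)
qed

text \<open>The damped function is differentiable along each circle in the \<open>i\<close>-th coordinate, also where the circle
 meets the walls; hence its derivative integrates to zero on each circle.\<close>

lemma cutoff_fiber_integral:
 fixes \<Phi> D :: "(nat => complex) => complex"
 assumes i: "i \<in> {1..N}" and e: "\<epsilon> > 0"
  and cont: "continuous_on (torus_reg N) \<Phi>" "continuous_on (torus_reg N) D"
  and der: "\<And>x. x \<in> torus_reg N ==> ((\<lambda>t. \<Phi> (x(i := x i * cis t))) has_vector_derivative D x) (at 0)"
  and B: "\<And>x. x \<in> torus_reg N ==> discr N x * cmod (\<Phi> x) <= B"
   "\<And>x. x \<in> torus_reg N ==> discr N x * cmod (D x) <= B"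
   "\<And>x j. x \<in> torus_reg N ==> j \<in> {1..N} - {i} ==> discr N x * cmod (of_real (ctg (x i) (x j)) * \<Phi> x) <= B"
 shows "has_bochner_integral (torus_measure N) (\<lambda>x. of_real (cutoff N \<epsilon> x) * D x +
  (\<Sum>j\<in>{1..N} - {i}. of_real (cutoff_slope N \<epsilon> x) * (of_real (ctg (x i) (x j)) * \<Phi> x))) 0"
proof -
 define J where "J = {1..N} - {i}"
 have pair: "(i, j) \<in> pairs N" if "j \<in> J" for j using that i by (auto simp: J_def pairs_def)
 note cb = cutoff_bounds[OF e] and cc = cutoff_continuous[OF e]
 have A: "0 <= 4 / \<epsilon>" using e by simp
 note damp = damped_bounded[OF cc(1) cb(1,3) A] damped_bounded[OF cc(2) cb(4,6) A]
 have contj: "continuous_on (torus_reg N) (\<lambda>x. of_real (ctg (x i) (x j)) * \<Phi> x)" if "j \<in> J" for j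
  by (intro continuous_intros ctg_continuous pair that cont)
 define H where "H x = of_real (cutoff N \<epsilon> x) * D x +
  (\<Sum>j\<in>J. of_real (cutoff_slope N \<epsilon> x) * (of_real (ctg (x i) (x j)) * \<Phi> x))" for x
 define \<Psi> where "\<Psi> x = of_real (cutoff N \<epsilon> x) * \<Phi> x" for x
 define M where "M = 4 / \<epsilon> * \<bar>B\<bar> * 4 ^ card (pairs N)"
 have meas: "H \<in> borel_measurable (torus_measure N)"
  unfolding H_def
  by (intro borel_measurable_add borel_measurable_sum damp(1)[OF cont(2) B(2)] damp(5)[OF contj B(3)])
   (auto simp: J_def)
 have int: "integrable (torus_measure N) H"
  unfolding H_def
  by (intro Bochner_Integration.integrable_add Bochner_Integration.integrable_sum
    damp(4)[OF cont(2) B(2)] damp(8)[OF contj B(3)])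
   (auto simp: J_def)
 have bound: "cmod (H x) <= M + real (card J) * M" if x: "x \<in> torus N" for x
 proof -
  have "cmod (H x) <= M + (\<Sum>j\<in>J. M)"
   unfolding H_def M_def
  proof (intro norm_triangle_le add_mono order_trans[OF norm_sum] sum_mono)
   show "cmod (of_real (cutoff N \<epsilon> x) * D x) <= 4 / \<epsilon> * \<bar>B\<bar> * 4 ^ card (pairs N)"
    by (rule damp(3)[OF cont(2) B(2) x])
   fix j assume j: "j \<in> J"
   show "cmod (of_real (cutoff_slope N \<epsilon> x) * (of_real (ctg (x i) (x j)) * \<Phi> x)) <= 4 / \<epsilon> * \<bar>B\<bar> * 4 ^ card (pairs N)"
    by (rule damp(7)[OF contj[OF j] B(3) x]) (use j in \<open>auto simp: J_def\<close>)
  qed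
  then show ?thesis by simp
 qed
 have \<Psi>_bound: "cmod (\<Psi> x) <= 4 / \<epsilon> * \<bar>B\<bar> * discr N x" if "x \<in> torus N" for x
  unfolding \<Psi>_def by (rule damp(2)[OF cont(1) B(1) that])
 have deriv: "((\<lambda>t. \<Psi> (x(i := x i * cis t))) has_vector_derivative H x) (at 0)" if x: "x \<in> torus N" for x
 proof (cases "x \<in> torus_reg N")
  case True
  have c: "((\<lambda>t. complex_of_real (cutoff N \<epsilon> (x(i := x i * cis t)))) has_vector_derivative
    of_real ((\<Sum>j\<in>J. ctg (x i) (x j)) * cutoff_slope N \<epsilon> x)) (at 0)"
   using cutoff_derivative[OF x i e]
   unfolding J_def[symmetric] has_real_derivative_iff_has_vector_derivative
   by (rule bounded_linear.has_vector_derivative[OF bounded_linear_of_real])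
  have "((\<lambda>t. \<Psi> (x(i := x i * cis t))) has_vector_derivative
    of_real (cutoff N \<epsilon> (x(i := x i * cis 0))) * D x +
    of_real ((\<Sum>j\<in>J. ctg (x i) (x j)) * cutoff_slope N \<epsilon> x) * \<Phi> (x(i := x i * cis 0))) (at 0)"
   unfolding \<Psi>_def by (rule has_vector_derivative_mult[OF c der[OF True]])
  also have "of_real (cutoff N \<epsilon> (x(i := x i * cis 0))) * D x +
    of_real ((\<Sum>j\<in>J. ctg (x i) (x j)) * cutoff_slope N \<epsilon> x) * \<Phi> (x(i := x i * cis 0)) = H x"
   by (simp add: H_def sum_distrib_left sum_distrib_right algebra_simps)
  finally show ?thesis .
 next
  case False
  then have d0: "discr N x = 0" using discr_zero_iff[OF x] by simp
  then have "H x = 0" by (simp add: H_def cutoff_def cutoff_slope_def)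
  moreover have "((\<lambda>t. \<Psi> (x(i := x i * cis t))) has_vector_derivative 0) (at 0)"
  proof (rule derivative_zero_squeeze)
   show "((\<lambda>t. discr N (x(i := x i * cis t))) has_real_derivative 0) (at 0)"
    using discr_derivative[OF x i] d0 by simp
   show "discr N (x(i := x i * cis 0)) = 0" using d0 by simp
   show "norm (\<Psi> (x(i := x i * cis t))) <= 4 / \<epsilon> * \<bar>B\<bar> * discr N (x(i := x i * cis t))" for t
    by (intro \<Psi>_bound torus_rotate x i) (simp add: norm_mult torus_norm[OF x i])
  qed (rule discr_nonneg)
  ultimately show ?thesis by simp
 qed
 have "integral\<^sup>L (torus_measure N) H = 0"
 proof (rule torus_fiber_zero[OF i int])
  fix x :: "nat => complex" assume x: "x \<in> ({1..N} - {i}) \<rightarrow>\<^sub>E sphere 0 1"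
  have on_torus: "x(i := z) \<in> torus N" if "cmod z = 1" for z
   using x i that by (auto simp: torus_def PiE_iff extensional_def)
  have d: "((\<lambda>t. \<Psi> (x(i := cis t))) has_vector_derivative H (x(i := cis t))) (at t)" for t
  proof (rule has_vector_derivative_shift)
   show "((\<lambda>s. \<Psi> (x(i := cis (t + s)))) has_vector_derivative H (x(i := cis t))) (at 0)"
    using deriv[OF on_torus[of "cis t"]] by (simp add: cis_mult)
  qed
  show "integral\<^sup>L circle_measure (\<lambda>z. H (x(i := z))) = 0"
  proof (rule circle_integral_derivative[where S = "{}" and \<Phi> = "\<lambda>t. \<Psi> (x(i := cis t))" and B = "M + real (card J) * M"])
   have "(\<lambda>z. x(i := z)) \<in> measurable circle_measure (torus_measure N)"
   proof (rule measurable_fun_upd[where J = "{1..N} - {i}"])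
    show "{1..N} = {1..N} - {i} \<union> {i}" using i by blast
    show "(\<lambda>z. x) \<in> measurable circle_measure (Pi\<^sub>M ({1..N} - {i}) (\<lambda>_. circle_measure))"
     by (rule measurable_const) (simp only: space_torus x)
   qed (rule measurable_ident_sets[OF refl])
   then show "(\<lambda>z. H (x(i := z))) \<in> borel_measurable circle_measure"
    by (rule measurable_compose[OF _ meas])
   show "cmod (H (x(i := z))) <= M + real (card J) * M" if "cmod z = 1" for z
    by (rule bound[OF on_torus[OF that]])
   show "((\<lambda>t. \<Psi> (x(i := cis t))) has_vector_derivative H (x(i := cis t))) (at t)" for t by (rule d)
   show "continuous_on {0..2 * pi} (\<lambda>t. \<Psi> (x(i := cis t)))"
    by (intro continuous_at_imp_continuous_on ballI has_vector_derivative_continuous[OF d])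
  qed simp_all
 qed
 then show ?thesis using int unfolding H_def J_def by (simp add: has_bochner_integral_iff)
qed

text \<open>The cutoff costs a term with the slope times \<open>ctg (x i) (x j) * \<Phi> x\<close>, too singular for a limit. But the
 cotangent is odd under the exchange of \<open>x i\<close> and \<open>x j\<close>, so the even part of \<open>\<Phi>\<close> does not contribute;
 for the odd part there is a majorant, and the slope tends to zero.\<close>

theorem torus_integral_by_parts:
 fixes \<Phi> D :: "(nat => complex) => complex" and S :: "nat => (nat => complex) => complex"
 assumes i: "i \<in> {1..N}"
  and cont: "continuous_on (torus_reg N) \<Phi>" "continuous_on (torus_reg N) D"
   "\<And>j. j \<in> {1..N} - {i} ==> continuous_on (torus_reg N) (S j)"
  and der: "\<And>x. x \<in> torus_reg N ==> ((\<lambda>t. \<Phi> (x(i := x i * cis t))) has_vector_derivative D x) (at 0)"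
  and anti: "\<And>x j. x \<in> torus_reg N ==> j \<in> {1..N} - {i} ==> S j (x \<circ> Transposition.transpose i j) = - S j x"
  and B: "\<And>x. x \<in> torus_reg N ==> discr N x * cmod (\<Phi> x) <= B"
   "\<And>x. x \<in> torus_reg N ==> discr N x * cmod (D x) <= B"
   "\<And>x j. x \<in> torus_reg N ==> j \<in> {1..N} - {i} ==> discr N x * cmod (of_real (ctg (x i) (x j)) * \<Phi> x) <= B"
   "\<And>x j. x \<in> torus_reg N ==> j \<in> {1..N} - {i} ==> discr N x * cmod (S j x) <= B"
  and G: "integrable (torus_measure N) G"
   "\<And>x. x \<in> torus_reg N ==> cmod (\<i> * D x + (\<Sum>j\<in>{1..N} - {i}. S j x)) <= G x"
   "\<And>x j. x \<in> torus_reg N ==> j \<in> {1..N} - {i} ==>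
    \<bar>ctg (x i) (x j)\<bar> * cmod (\<Phi> x - \<Phi> (x \<circ> Transposition.transpose i j)) <= G x"
 shows "has_bochner_integral (torus_measure N)
  (\<lambda>x. if x \<in> torus_reg N then \<i> * D x + (\<Sum>j\<in>{1..N} - {i}. S j x) else 0) 0"
proof -
 define J where "J = {1..N} - {i}"
 define sw where "sw j = Transposition.transpose i j" for j
 have pair: "(i, j) \<in> pairs N" if "j \<in> J" for j using that i by (auto simp: J_def pairs_def)
 have sw: "sw j permutes {1..N}" if "j \<in> J" for j
  using that i unfolding sw_def J_def by (intro permutes_swap_id) auto
 have sw_sw: "x \<circ> sw j \<circ> sw j = x" for x :: "nat => complex" and j by (simp add: sw_def comp_assoc)
 have sw_reg: "x \<circ> sw j \<in> torus_reg N" if "x \<in> torus_reg N" "j \<in> J" for x j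
  by (rule torus_reg_comp[OF that(1) sw[OF that(2)]])
 have ctg_sw: "ctg ((x \<circ> sw j) i) ((x \<circ> sw j) j) = - ctg (x i) (x j)" for x :: "nat => complex" and j
  by (simp only: sw_def o_apply transpose_apply_first transpose_apply_second) (rule ctg_swap)
 note J_cont = cont(3)[folded J_def] and J_anti = anti[folded J_def sw_def] and J_B = B(3,4)[folded J_def]
  and J_G = G(2,3)[folded J_def sw_def]
 have cut_sw: "cutoff N \<epsilon> (x \<circ> sw j) = cutoff N \<epsilon> x" "cutoff_slope N \<epsilon> (x \<circ> sw j) = cutoff_slope N \<epsilon> x"
  if "j \<in> J" for \<epsilon> x j
  unfolding cutoff_def cutoff_slope_def discr_comp[OF sw[OF that]] by simp_all
 define F where "F x = \<i> * D x + (\<Sum>j\<in>J. S j x)" for x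
 define T where "T \<epsilon> j x = 2 * (of_real (cutoff N \<epsilon> x) * S j x) -
  \<i> * (of_real (cutoff_slope N \<epsilon> x) * (of_real (ctg (x i) (x j)) * (\<Phi> x + \<Phi> (x \<circ> sw j))))" for \<epsilon> j x
 define H where "H \<epsilon> x = of_real (cutoff N \<epsilon> x) * D x +
  (\<Sum>j\<in>J. of_real (cutoff_slope N \<epsilon> x) * (of_real (ctg (x i) (x j)) * \<Phi> x))" for \<epsilon> x
 define E where "E \<epsilon> x = 2 * of_real (cutoff N \<epsilon> x) * F x + \<i> * (\<Sum>j\<in>J.
  of_real (cutoff_slope N \<epsilon> x) * (of_real (ctg (x i) (x j)) * (\<Phi> x - \<Phi> (x \<circ> sw j))))" for \<epsilon> x
 have E_eq: "E \<epsilon> x = 2 * \<i> * H \<epsilon> x + (\<Sum>j\<in>J. T \<epsilon> j x)" for \<epsilon> x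
  unfolding E_def H_def F_def T_def
  by (simp add: sum_subtractf sum.distrib sum_distrib_left algebra_simps)
 have E_int: "has_bochner_integral (torus_measure N) (E \<epsilon>) 0" if e: "\<epsilon> > 0" for \<epsilon>
 proof -
  note cb = cutoff_bounds[OF e] and cc = cutoff_continuous[OF e]
  have A: "0 <= 4 / \<epsilon>" using e by simp
  note damp = damped_bounded[OF cc(1) cb(1,3) A] damped_bounded[OF cc(2) cb(4,6) A]
  have H: "has_bochner_integral (torus_measure N) (H \<epsilon>) 0"
   unfolding H_def J_def by (rule cutoff_fiber_integral[OF i e cont(1,2) der B(1-3)])
  have T: "has_bochner_integral (torus_measure N) (T \<epsilon> j) 0" if j: "j \<in> J" for j
  proof -
   have c: "continuous_on (torus_reg N) (\<lambda>x. of_real (ctg (x i) (x j)) * (\<Phi> x + \<Phi> (x \<circ> sw j)))"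
    by (intro continuous_intros ctg_continuous pair j cont continuous_comp_torus_reg sw)
   have b: "discr N x * cmod (of_real (ctg (x i) (x j)) * (\<Phi> x + \<Phi> (x \<circ> sw j))) <= B + B"
    if x: "x \<in> torus_reg N" for x
   proof -
    have "cmod (of_real (ctg (x i) (x j)) * (\<Phi> x + \<Phi> (x \<circ> sw j))) \<le>
      cmod (of_real (ctg (x i) (x j)) * \<Phi> x) + cmod (of_real (ctg (x i) (x j)) * \<Phi> (x \<circ> sw j))"
     unfolding distrib_left by (rule norm_triangle_ineq)
    from mult_left_mono[OF this discr_nonneg[of N x]]
    have "discr N x * cmod (of_real (ctg (x i) (x j)) * (\<Phi> x + \<Phi> (x \<circ> sw j))) \<le>
      discr N x * cmod (of_real (ctg (x i) (x j)) * \<Phi> x) +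
      discr N x * cmod (of_real (ctg (x i) (x j)) * \<Phi> (x \<circ> sw j))"
     unfolding distrib_left .
    moreover have "discr N x * cmod (of_real (ctg (x i) (x j)) * \<Phi> (x \<circ> sw j)) <= B"
     using J_B(1)[OF sw_reg[OF x j] j] unfolding ctg_sw discr_comp[OF sw[OF j]] by (simp add: norm_mult)
    ultimately show ?thesis using J_B(1)[OF x j] by linarith
   qed
   have m: "T \<epsilon> j \<in> borel_measurable (torus_measure N)"
    unfolding T_def
    by (intro borel_measurable_diff borel_measurable_times borel_measurable_const
      damp(1)[OF J_cont[OF j] J_B(2)[OF _ j]] damp(5)[OF c b])
   have int: "integrable (torus_measure N) (T \<epsilon> j)"
    unfolding T_def
    by (intro Bochner_Integration.integrable_diff integrable_mult_right
      damp(4)[OF J_cont[OF j] J_B(2)[OF _ j]] damp(8)[OF c b])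
   have "integral\<^sup>L (torus_measure N) (T \<epsilon> j) = 0"
   proof (rule antisymmetric_integral[OF sw[OF j] m])
    fix x assume x: "x \<in> torus N"
    show "T \<epsilon> j (x \<circ> sw j) = - T \<epsilon> j x"
    proof (cases "x \<in> torus_reg N")
     case True
     show ?thesis unfolding T_def cut_sw[OF j] ctg_sw sw_sw J_anti[OF True j]
      by (simp add: algebra_simps)
    next
     case False
     then have "discr N x = 0" using discr_zero_iff[OF x] by simp
     then have "cutoff N \<epsilon> x = 0" "cutoff_slope N \<epsilon> x = 0" by (simp_all add: cutoff_def cutoff_slope_def)
     then show ?thesis unfolding T_def cut_sw[OF j] by simp
    qed
   qed
   then show ?thesis using int by (simp only: has_bochner_integral_iff)
  qed
  have "has_bochner_integral (torus_measure N) (\<lambda>x. 2 * \<i> * H \<epsilon> x + (\<Sum>j\<in>J. T \<epsilon> j x)) (2 * \<i> * 0 + (\<Sum>j\<in>J. 0))"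
   by (intro has_bochner_integral_add has_bochner_integral_sum has_bochner_integral_mult_right H T)
  then show ?thesis unfolding E_eq by simp
 qed
 define \<epsilon> where "\<epsilon> n = inverse (real (Suc n))" for n
 have \<epsilon>: "\<epsilon> n > 0" for n by (simp add: \<epsilon>_def)
 have \<epsilon>_lim: "\<epsilon> \<longlonglongrightarrow> 0" unfolding \<epsilon>_def by (rule LIMSEQ_inverse_real_of_nat)
 let ?f = "\<lambda>x. if x \<in> torus_reg N then 2 * F x else 0"
 have F_cont: "continuous_on (torus_reg N) F"
  unfolding F_def by (intro continuous_intros cont J_cont)
 have mf: "?f \<in> borel_measurable (torus_measure N)"
  by (intro measurable_torus_reg continuous_intros F_cont)
 have mE: "E (\<epsilon> n) \<in> borel_measurable (torus_measure N)" for n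
  using E_int[OF \<epsilon>[of n]] by (rule borel_measurable_has_bochner_integral)
 have lim: "AE x in torus_measure N. (\<lambda>n. E (\<epsilon> n) x) \<longlonglongrightarrow> ?f x"
  using AE_torus_reg[of N]
 proof eventually_elim
  fix x assume x: "x \<in> torus_reg N"
  define V where "V = (discr N x)\<^sup>2"
  have V: "V > 0" using discr_pos[OF x] by (simp add: V_def)
  have "(\<lambda>n. V / (V + \<epsilon> n)) \<longlonglongrightarrow> V / (V + 0)"
   using V by (intro tendsto_intros \<epsilon>_lim) auto
  then have c: "(\<lambda>n. cutoff N (\<epsilon> n) x) \<longlonglongrightarrow> 1" using V by (simp add: cutoff_def V_def)
  have "(\<lambda>n. 4 * \<epsilon> n * V / (V + \<epsilon> n)\<^sup>2) \<longlonglongrightarrow> 4 * 0 * V / (V + 0)\<^sup>2"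
   using V by (intro tendsto_intros \<epsilon>_lim) auto
  then have s: "(\<lambda>n. cutoff_slope N (\<epsilon> n) x) \<longlonglongrightarrow> 0" by (simp add: cutoff_slope_def V_def)
  have "(\<lambda>n. E (\<epsilon> n) x) \<longlonglongrightarrow> 2 * of_real 1 * F x + \<i> * (\<Sum>j\<in>J.
    of_real 0 * (of_real (ctg (x i) (x j)) * (\<Phi> x - \<Phi> (x \<circ> sw j))))"
   unfolding E_def by (intro tendsto_intros c s)
  then show "(\<lambda>n. E (\<epsilon> n) x) \<longlonglongrightarrow> ?f x" using x by simp
 qed
 have bound: "AE x in torus_measure N. norm (E (\<epsilon> n) x) <= (2 + real (card J)) * G x" for n
  using AE_torus_reg[of N]
 proof eventually_elim
  fix x assume x: "x \<in> torus_reg N"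
  note cb = cutoff_bounds[OF \<epsilon>[of n], of N x]
  have G0: "0 <= G x" using J_G(1)[OF x] norm_ge_zero order_trans by blast
  have 1: "cmod (2 * of_real (cutoff N (\<epsilon> n) x) * F x) <= 2 * G x"
  proof -
   have "cmod (2 * of_real (cutoff N (\<epsilon> n) x) * F x) = 2 * (cutoff N (\<epsilon> n) x * cmod (F x))"
    using cb by (simp add: norm_mult)
   also have "\<dots> <= 2 * (1 * G x)"
    using cb G0 J_G(1)[OF x] unfolding F_def by (intro mult_left_mono mult_mono) auto
   finally show ?thesis by simp
  qed
  have 2: "cmod (of_real (cutoff_slope N (\<epsilon> n) x) * (of_real (ctg (x i) (x j)) * (\<Phi> x - \<Phi> (x \<circ> sw j)))) <= G x"
   if j: "j \<in> J" for j
  proof -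
   have "cmod (of_real (cutoff_slope N (\<epsilon> n) x) * (of_real (ctg (x i) (x j)) * (\<Phi> x - \<Phi> (x \<circ> sw j)))) =
     cutoff_slope N (\<epsilon> n) x * (\<bar>ctg (x i) (x j)\<bar> * cmod (\<Phi> x - \<Phi> (x \<circ> sw j)))"
    using cb by (simp add: norm_mult)
   also have "\<dots> <= 1 * G x"
    using cb G0 J_G(2)[OF x j] by (intro mult_mono) auto
   finally show ?thesis by simp
  qed
  have "cmod (E (\<epsilon> n) x) <= 2 * G x + (\<Sum>j\<in>J. G x)"
   unfolding E_def
   by (intro norm_triangle_le add_mono 1) (simp only: norm_mult norm_ii mult_1, intro order_trans[OF norm_sum] sum_mono 2)
  then show "norm (E (\<epsilon> n) x) <= (2 + real (card J)) * G x" by (simp add: algebra_simps)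
 qed
 have wint: "integrable (torus_measure N) (\<lambda>x. (2 + real (card J)) * G x)" using G(1) by simp
 have fint: "integrable (torus_measure N) ?f"
  by (rule integrable_dominated_convergence[OF mf mE wint lim bound])
 have "(\<lambda>n. integral\<^sup>L (torus_measure N) (E (\<epsilon> n))) \<longlonglongrightarrow> integral\<^sup>L (torus_measure N) ?f"
  by (rule integral_dominated_convergence[OF mf mE wint lim bound])
 moreover have "integral\<^sup>L (torus_measure N) (E (\<epsilon> n)) = 0" for n
  by (rule has_bochner_integral_integral_eq[OF E_int[OF \<epsilon>]])
 ultimately have "integral\<^sup>L (torus_measure N) ?f = 0" by (simp add: LIMSEQ_const_iff)
 then have "has_bochner_integral (torus_measure N) ?f 0" using fint by (simp only: has_bochner_integral_iff)
 from has_bochner_integral_mult_right[OF this, of "1 / 2"]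
 have "has_bochner_integral (torus_measure N) (\<lambda>x. 1 / 2 * ?f x) 0" by simp
 moreover have "(\<lambda>x. 1 / 2 * ?f x) = (\<lambda>x. if x \<in> torus_reg N then F x else 0)" by (simp add: fun_eq_iff)
 ultimately show ?thesis unfolding F_def J_def by simp
qed

section \<open>Continuously differentiable functions on the torus\<close>

lemma herm_linear:
 "herm (u + v) w = herm u w + herm v w" "herm w (u + v) = herm w u + herm w v"
 "herm (u - v) w = herm u w - herm v w" "herm w (u - v) = herm w u - herm w v"
 "herm (c *s u) w = cnj c * herm u w" "herm w (c *s u) = c * herm w u"
 "herm (r *\<^sub>R u) w = r *\<^sub>R herm u w" "herm w (r *\<^sub>R u) = r *\<^sub>R herm w u"
 by (simp_all add: herm_def algebra_simps sum.distrib sum_subtractf sum_distrib_left scaleR_sum_right)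

lemma herm_adj: "herm (A *v u) w = herm u (adj A *v w)"
proof -
 have "herm (A *v u) w = (\<Sum>a\<in>UNIV. \<Sum>b\<in>UNIV. cnj (A $ a $ b) * cnj (u $ b) * w $ a)"
  by (simp add: herm_def matrix_vector_mult_def sum_distrib_right)
 also have "\<dots> = (\<Sum>b\<in>UNIV. \<Sum>a\<in>UNIV. cnj (A $ a $ b) * cnj (u $ b) * w $ a)"
  by (rule sum.swap)
 also have "\<dots> = herm u (adj A *v w)"
  by (simp add: herm_def matrix_vector_mult_def adj_def sum_distrib_left mult_ac)
 finally show ?thesis .
qed

lemma mscale_vector: "mscale c A *v v = c *s (A *v v)"
 by (simp add: mscale_def matrix_vector_mult_def vec_eq_iff sum_distrib_left mult.assoc)

lemma matrix_vector_smult: "(A :: complex^'t^'t) *v (c *s v) = c *s (A *v v)"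
 by (simp add: matrix_vector_mult_def vec_eq_iff sum_distrib_left mult_ac)

interpretation herm: bounded_bilinear "herm :: complex^'t => complex^'t => complex"
proof -
 have "bilinear (herm :: complex^'t => complex^'t => complex)"
  unfolding bilinear_def by (auto intro!: linearI simp: herm_linear)
 then show "bounded_bilinear (herm :: complex^'t => complex^'t => complex)"
  by (simp add: bilinear_conv_bounded_bilinear)
qed

interpretation mv: bounded_bilinear "(*v) :: complex^'t^'t => complex^'t => complex^'t"
proof -
 have "bilinear ((*v) :: complex^'t^'t => complex^'t => complex^'t)"
  unfolding bilinear_def
  by (auto intro!: linearI simp: matrix_vector_mult_def vec_eq_iff algebra_simps sum.distrib scaleR_sum_right)
 then show "bounded_bilinear ((*v) :: complex^'t^'t => complex^'t => complex^'t)"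
  by (simp add: bilinear_conv_bounded_bilinear)
qed

lemma herm_mult_bound:
 obtains C where "C > 0" "\<And>(u :: complex^'t) (A :: complex^'t^'t) v. cmod (herm u (A *v v)) <= C * (norm u * norm A * norm v)"
proof -
 obtain C1 where C1: "C1 > 0" "\<And>(u :: complex^'t) v. norm (herm u v) <= norm u * norm v * C1"
  using herm.pos_bounded by blast
 obtain C2 where C2: "C2 > 0" "\<And>(A :: complex^'t^'t) v. norm (A *v v) <= norm A * norm v * C2"
  using mv.pos_bounded by blast
 have "cmod (herm u (A *v v)) <= C1 * C2 * (norm u * norm A * norm v)" for u :: "complex^'t" and A :: "complex^'t^'t" and v
 proof -
  have "cmod (herm u (A *v v)) <= norm u * norm (A *v v) * C1" by (rule C1)
  also have "\<dots> <= norm u * (norm A * norm v * C2) * C1"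
   using C1(1) C2 by (intro mult_right_mono mult_left_mono) auto
  finally show ?thesis by (simp add: mult_ac)
 qed
 then show ?thesis using that[of "C1 * C2"] C1(1) C2(1) by simp
qed

lemma torus_compact: "compact (torus N)"
proof -
 define A where "A i = (if i \<in> {1..N} then sphere (0 :: complex) 1 else {undefined})" for i :: nat
 have "torus N = Pi\<^sub>E UNIV A"
 proof (rule set_eqI, rule iffI)
  fix x assume x: "x \<in> torus N"
  show "x \<in> Pi\<^sub>E UNIV A"
  proof (rule PiE_I)
   fix i :: nat
   show "x i \<in> A i"
   proof (cases "i \<in> {1..N}")
    case True
    show ?thesis unfolding A_def if_P[OF True] using x unfolding torus_def by (rule PiE_mem[OF _ True])
   next
    case False
    show ?thesis unfolding A_def if_not_P[OF False] singleton_iff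
     using x unfolding torus_def by (rule PiE_arb[OF _ False])
   qed
  qed simp
 next
  fix x assume x: "x \<in> Pi\<^sub>E UNIV A"
  then have *: "x i \<in> A i" for i by (rule PiE_mem) simp
  show "x \<in> torus N" unfolding torus_def
  proof (rule PiE_I)
   fix i assume i: "i \<in> {1..N}"
   show "x i \<in> sphere 0 1" using *[of i] unfolding A_def if_P[OF i] .
  next
   fix i assume i: "i \<notin> {1..N}"
   show "x i = undefined" using *[of i] unfolding A_def if_not_P[OF i] singleton_iff .
  qed
 qed
 moreover have "compactin (product_topology (\<lambda>i::nat. euclidean) UNIV) (Pi\<^sub>E UNIV A)"
  unfolding compactin_PiE by (auto simp: A_def)
 ultimately show ?thesis by (simp add: euclidean_product_topology)
qed

lemma torus_bounded:
 assumes "continuous_on (torus N) (h :: (nat => complex) => 'b::real_normed_vector)"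
 shows "\<exists>B\<ge>0. \<forall>x\<in>torus N. norm (h x) <= B"
proof -
 have "bounded (h ` torus N)" by (intro compact_imp_bounded compact_continuous_image assms torus_compact)
 then obtain B where "\<forall>x\<in>torus N. norm (h x) <= B" unfolding bounded_iff by auto
 then show ?thesis by (intro exI[of _ "\<bar>B\<bar>"]) force
qed

lemma C1_derivative:
 assumes f: "C1_torus N f" and i: "i \<in> {1..N}" and x: "x \<in> torus N"
 shows "((\<lambda>t. f (x(i := x i * cis t))) has_vector_derivative \<i> *s euler_deriv i f (x(i := x i * cis t))) (at t)"
proof -
 have base: "((\<lambda>t. f (y(i := y i * cis t))) has_vector_derivative \<i> *s euler_deriv i f y) (at 0)"
  if y: "y \<in> torus N" for y
 proof -
  have d: "(\<lambda>t::real. f (y(i := y i * cis t))) differentiable (at 0)"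
   using f i y by (simp add: C1_torus_def)
  have "\<i> *s euler_deriv i f y = vector_derivative (\<lambda>t::real. f (y(i := y i * cis t))) (at 0)"
   by (simp add: euler_deriv_def vec_eq_iff)
  then show ?thesis using d by (simp add: vector_derivative_works)
 qed
 show ?thesis
 proof (rule has_vector_derivative_shift)
  have "x(i := x i * cis t) \<in> torus N"
   by (rule torus_rotate[OF x i]) (simp add: norm_mult torus_norm[OF x i])
  from base[OF this]
  show "((\<lambda>s. f (x(i := x i * cis (t + s)))) has_vector_derivative \<i> *s euler_deriv i f (x(i := x i * cis t))) (at 0)"
   by (simp add: cis_mult mult.assoc)
 qed
qed

lemma C1_bounded:
 assumes f: "C1_torus N f"
 shows "\<exists>B\<ge>0. \<forall>x\<in>torus N. norm (f x) <= B \<and> (\<forall>i\<in>{1..N}. norm (euler_deriv i f x) <= B)"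
proof -
 obtain B0 where B0: "B0 >= 0" "\<forall>x\<in>torus N. norm (f x) <= B0"
  using torus_bounded[of N f] f by (auto simp: C1_torus_def)
 have "\<forall>i\<in>{1..N}. \<exists>B. B >= 0 \<and> (\<forall>x\<in>torus N. norm (euler_deriv i f x) <= B)"
  using torus_bounded f unfolding C1_torus_def by blast
 from bchoice[OF this] obtain b where
  b: "\<forall>i\<in>{1..N}. b i >= 0 \<and> (\<forall>x\<in>torus N. norm (euler_deriv i f x) <= b i)" by blast
 have le: "b i <= (\<Sum>i\<in>{1..N}. b i)" if "i \<in> {1..N}" for i
  by (rule member_le_sum[OF that]) (use b in auto)
 have s0: "0 <= (\<Sum>i\<in>{1..N}. b i)" using b by (intro sum_nonneg) auto
 show ?thesis
 proof (intro exI[of _ "B0 + (\<Sum>i\<in>{1..N}. b i)"] conjI ballI)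
  show "0 <= B0 + (\<Sum>i\<in>{1..N}. b i)" using B0 s0 by simp
  fix x assume x: "x \<in> torus N"
  show "norm (f x) <= B0 + (\<Sum>i\<in>{1..N}. b i)" using B0(2)[rule_format, OF x] s0 by linarith
  fix i assume i: "i \<in> {1..N}"
  have "norm (euler_deriv i f x) <= b i" using b i x by blast
  then show "norm (euler_deriv i f x) <= B0 + (\<Sum>i\<in>{1..N}. b i)" using le[OF i] B0(1) by linarith
 qed
qed

lemma short_arc:
 assumes "cmod z = 1" "cmod w = 1"
 obtains t where "w = z * cis t" "z = w * cis (- t)" "\<bar>t\<bar> <= 2 * cmod (z - w)"
proof -
 have nz: "z ~= 0" "w ~= 0" using assms by auto
 define t where "t = Arg (w / z)"
 have c: "cis t = w / z"
  using nz assms cis_Arg[of "w / z"] by (simp add: t_def sgn_eq norm_divide)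
 have w: "w = z * cis t" using c nz by simp
 have z: "z = w * cis (- t)" unfolding w by (simp add: mult.assoc cis_mult)
 have pi: "\<bar>t\<bar> <= pi" unfolding t_def using Arg_bounded[of "w / z"] by linarith
 have "cmod (z - w) = cmod (z * (cis 0 - cis t))" unfolding w by (simp add: algebra_simps)
 also have "\<dots> = 2 * \<bar>sin (- t / 2)\<bar>" using assms by (simp add: norm_mult chord_eq[of 0 t] del: cis_zero)
 also have "\<bar>sin (- t / 2)\<bar> = sin (\<bar>t\<bar> / 2)"
 proof -
  have "0 <= sin (\<bar>t\<bar> / 2)" using pi by (intro sin_ge_zero) auto
  then show ?thesis by (cases "t >= 0") auto
 qed
 finally have "cmod (z - w) = 2 * sin (\<bar>t\<bar> / 2)" .
 moreover have "\<bar>t\<bar> / 2 / 2 <= sin (\<bar>t\<bar> / 2)" using pi by (intro sin_ge_half) auto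
 ultimately have "\<bar>t\<bar> <= 2 * cmod (z - w)" by simp
 then show ?thesis using that w z by blast
qed

text \<open>The exchange of two coordinates consists of two moves along the arc between them.\<close>

lemma C1_lipschitz:
 assumes f: "C1_torus N f"
 shows "\<exists>C\<ge>0. \<forall>x\<in>torus N. \<forall>(i, j)\<in>pairs N.
  norm (f x - f (x \<circ> Transposition.transpose i j)) <= C * cmod (x i - x j)"
proof -
 obtain B where B: "B >= 0" "\<And>x i. x \<in> torus N ==> i \<in> {1..N} ==> norm (euler_deriv i f x) <= B"
  using C1_bounded[OF f] by blast
 have norm_i: "norm (\<i> *s v) = norm v" for v :: "complex^'a"
  by (simp add: norm_vec_def norm_mult)
 have move: "norm (f (x(i := x i * cis t)) - f x) <= \<bar>t\<bar> * B" if x: "x \<in> torus N" and i: "i \<in> {1..N}" for x i t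
 proof -
  have "norm ((\<lambda>s. f (x(i := x i * cis (s * t)))) 1 - (\<lambda>s. f (x(i := x i * cis (s * t)))) 0) <= \<bar>t\<bar> * B"
  proof (rule norm_increment_le)
   fix s :: real
   have "((\<lambda>s. s * t) has_vector_derivative t) (at s)" by (auto intro!: derivative_eq_intros)
   from vector_diff_chain_at[OF this C1_derivative[OF f i x]]
   show "((\<lambda>s. f (x(i := x i * cis (s * t)))) has_vector_derivative
     t *\<^sub>R (\<i> *s euler_deriv i f (x(i := x i * cis (s * t))))) (at s within {0..1})"
    by (simp add: o_def has_vector_derivative_at_within)
   have "x(i := x i * cis (s * t)) \<in> torus N"
    by (rule torus_rotate[OF x i]) (simp add: norm_mult torus_norm[OF x i])
   from B(2)[OF this i]
   show "norm (t *\<^sub>R (\<i> *s euler_deriv i f (x(i := x i * cis (s * t))))) <= \<bar>t\<bar> * B"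
    by (simp add: norm_i mult_left_mono)
  qed
  then show ?thesis by simp
 qed
 show ?thesis
 proof (intro exI[of _ "4 * B"] conjI ballI)
  show "0 <= 4 * B" using B by simp
  fix x p assume x: "x \<in> torus N" and p: "p \<in> pairs N"
  obtain i j where ij: "p = (i, j)" by (cases p)
  have m: "i \<in> {1..N}" "j \<in> {1..N}" "i ~= j" using p ij by (auto simp: pairs_def)
  obtain t where t: "x j = x i * cis t" "x i = x j * cis (- t)" "\<bar>t\<bar> <= 2 * cmod (x i - x j)"
   using short_arc[OF torus_norm[OF x m(1)] torus_norm[OF x m(2)]] by blast
  define y where "y = x(i := x i * cis t)"
  have y: "y \<in> torus N" unfolding y_def
   by (rule torus_rotate[OF x m(1)]) (simp add: norm_mult torus_norm[OF x m(1)])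
  have yj: "y j = x j" using m by (simp add: y_def)
  have "x \<circ> Transposition.transpose i j = y(j := y j * cis (- t))"
   unfolding yj t(2)[symmetric]
   by (rule ext) (use t(1) in \<open>simp add: y_def transpose_def\<close>)
  moreover have "norm (f y - f x) <= \<bar>t\<bar> * B" unfolding y_def by (rule move[OF x m(1)])
  moreover have "norm (f (y(j := y j * cis (- t))) - f y) <= \<bar>t\<bar> * B" using move[OF y m(2), of "- t"] by simp
  ultimately have "norm (f (x \<circ> Transposition.transpose i j) - f x) <= 2 * (\<bar>t\<bar> * B)"
   using norm_triangle_ineq[of "f (x \<circ> Transposition.transpose i j) - f y" "f y - f x"] by simp
  also have "\<bar>t\<bar> * B <= (2 * cmod (x i - x j)) * B" using t(3) B(1) by (rule mult_right_mono)
  finally show "case p of (i, j) => norm (f x - f (x \<circ> Transposition.transpose i j)) <= 4 * B * cmod (x i - x j)"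
   unfolding ij by (simp add: norm_minus_commute mult_ac)
 qed
qed

section \<open>Regularity of the form\<close>

context torus_form
begin

lemma K_continuous_chamber:
 assumes th: "th \<in> chamber N"
 shows "continuous (at (pt N th) within torus N) K"
proof -
 obtain \<delta> C where \<delta>: "\<delta> > 0" "C >= 0" and le: "\<And>et. et \<in> coord_box {1..N} th \<delta> ==>
   norm (K (pt N et) - K (pt N th)) <= C * (\<Sum>i\<in>{1..N}. \<bar>et i - th i\<bar>)"
  using solves_at_bounds[OF subset_refl chamber_regular[OF th] K_solves[OF th]] by blast
 define F where "F = at (pt N th) within torus N"
 define \<alpha> where "\<alpha> y i = Arg (y i * cis (- th i))" for y :: "nat => complex" and i
 define et where "et y i = (if i \<in> {1..N} then th i + \<alpha> y i else th i)" for y i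
 have \<alpha>: "((\<lambda>y. \<alpha> y i) \<longlongrightarrow> 0) F" if i: "i \<in> {1..N}" for i
 proof -
  have "((\<lambda>y. y i) \<longlongrightarrow> pt N th i) F"
   unfolding F_def using coordinate_continuous[of UNIV i]
   by (metis UNIV_I continuous_on_def tendsto_within_subset subset_UNIV)
  then have "((\<lambda>y. y i * cis (- th i)) \<longlongrightarrow> pt N th i * cis (- th i)) F" by (intro tendsto_intros)
  moreover have "pt N th i * cis (- th i) = 1" using i by (simp add: pt_def cis_mult)
  ultimately have "((\<lambda>y. y i * cis (- th i)) \<longlongrightarrow> 1) F" by simp
  from isCont_tendsto_compose[OF continuous_at_Arg this]
  show ?thesis unfolding \<alpha>_def by (simp add: complex_nonpos_Reals_iff)
 qed
 have "((\<lambda>y. \<Sum>i\<in>{1..N}. \<bar>\<alpha> y i\<bar>) \<longlongrightarrow> (\<Sum>i\<in>{1..N}. \<bar>0\<bar>)) F"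
  by (intro tendsto_sum tendsto_rabs \<alpha>)
 then have "((\<lambda>y. C * (\<Sum>i\<in>{1..N}. \<bar>\<alpha> y i\<bar>)) \<longlongrightarrow> C * 0) F" by (intro tendsto_mult_left) simp
 then have lim: "((\<lambda>y. C * (\<Sum>i\<in>{1..N}. \<bar>\<alpha> y i\<bar>)) \<longlongrightarrow> 0) F" by simp
 have "eventually (\<lambda>y. \<forall>i\<in>{1..N}. \<bar>\<alpha> y i\<bar> < \<delta>) F"
 proof (intro eventually_ball_finite ballI)
  fix i assume "i \<in> {1..N}"
  from tendstoD[OF \<alpha>[OF this] \<delta>(1)] show "eventually (\<lambda>y. \<bar>\<alpha> y i\<bar> < \<delta>) F" by (simp add: dist_real_def)
 qed simp
 moreover have "eventually (\<lambda>y. y \<in> torus N) F" unfolding F_def by (simp add: eventually_at_filter)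
 ultimately have "eventually (\<lambda>y. norm (K y - K (pt N th)) <= C * (\<Sum>i\<in>{1..N}. \<bar>\<alpha> y i\<bar>)) F"
 proof eventually_elim
  fix y assume small: "\<forall>i\<in>{1..N}. \<bar>\<alpha> y i\<bar> < \<delta>" and y: "y \<in> torus N"
  have "y i = cis (et y i)" if i: "i \<in> {1..N}" for i
  proof -
   have "cmod (y i * cis (- th i)) = 1" using torus_norm[OF y i] by (simp add: norm_mult)
   then have "cis (\<alpha> y i) = y i * cis (- th i)"
    unfolding \<alpha>_def by (subst cis_Arg) (auto simp: sgn_eq)
   then have "cis (th i) * cis (\<alpha> y i) = y i * (cis (th i) * cis (- th i))" by simp
   then have "cis (th i + \<alpha> y i) = y i" by (simp only: cis_mult) simp
   then show ?thesis using i by (simp add: et_def)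
  qed
  then have "y = pt N (et y)" by (rule torus_eq_pt[OF y])
  moreover have "et y \<in> coord_box {1..N} th \<delta>" using small by (auto simp: coord_box_def et_def)
  moreover have "(\<Sum>i\<in>{1..N}. \<bar>et y i - th i\<bar>) = (\<Sum>i\<in>{1..N}. \<bar>\<alpha> y i\<bar>)"
   by (intro sum.cong) (auto simp: et_def)
  ultimately show "norm (K y - K (pt N th)) <= C * (\<Sum>i\<in>{1..N}. \<bar>\<alpha> y i\<bar>)"
   using le[of "et y"] by simp
 qed
 from Lim_null_comparison[OF this lim] show ?thesis
  unfolding continuous_within F_def by (rule LIM_zero_cancel)
qed

lemma K_comp_inverse:
 assumes "x \<in> torus_reg N" "w permutes {1..N}"
 shows "K x = \<tau> w ** K (x \<circ> w) ** adj (\<tau> w)"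
proof -
 have "\<tau> w ** (adj (\<tau> w) ** K x ** \<tau> w) ** adj (\<tau> w) = (\<tau> w ** adj (\<tau> w)) ** K x ** (\<tau> w ** adj (\<tau> w))"
  by (simp only: matrix_mul_assoc)
 then show ?thesis using K_equivariant[OF assms] \<tau>_unitary'[OF assms(2)] by simp
qed

lemma K_continuous: "continuous_on (torus_reg N) K"
 unfolding continuous_on_eq_continuous_within
proof
 fix x assume x: "x \<in> torus_reg N"
 obtain w th where w: "w permutes {1..N}" and th: "th \<in> chamber N" "x \<circ> w = pt N th"
  using torus_reg_sorted[OF x] N3 by auto
 have "continuous (at x within torus_reg N) (\<lambda>y. y \<circ> w)"
  using comp_continuous[of "torus_reg N" w] x by (simp add: continuous_on_eq_continuous_within)
 moreover have "continuous (at (x \<circ> w) within (\<lambda>y. y \<circ> w) ` torus_reg N) K"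
  unfolding th(2) by (rule continuous_within_subset[OF K_continuous_chamber[OF th(1)]])
   (use torus_reg_comp w torus_reg_torus in blast)
 ultimately have "continuous (at x within torus_reg N) (\<lambda>y. K (y \<circ> w))"
  by (rule continuous_within_compose2)
 then have "((\<lambda>y. \<tau> w ** K (y \<circ> w) ** adj (\<tau> w)) \<longlongrightarrow> \<tau> w ** K (x \<circ> w) ** adj (\<tau> w)) (at x within torus_reg N)"
  unfolding continuous_within by (intro mm.tendsto tendsto_const)
 moreover have "eventually (\<lambda>y. \<tau> w ** K (y \<circ> w) ** adj (\<tau> w) = K y) (at x within torus_reg N)"
  by (simp add: eventually_at_filter K_comp_inverse[OF _ w, symmetric])
 ultimately have "(K \<longlongrightarrow> \<tau> w ** K (x \<circ> w) ** adj (\<tau> w)) (at x within torus_reg N)"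
  by (rule Lim_transform_eventually)
 then show "continuous (at x within torus_reg N) K"
  unfolding continuous_within K_comp_inverse[OF x w, symmetric] .
qed

definition dK :: "nat => (nat => complex) => complex^'t^'t" where
 "dK i x = (\<Sum>j\<in>{1..N} - {i}. brk (\<kappa> / 2) (\<kappa> / 2 * ctg (x i) (x j)) (refl i j) (K x))"

lemma K_derivative_chamber:
 assumes th: "th \<in> chamber N" and i: "i \<in> {1..N}"
 shows "((\<lambda>t. K ((pt N th)(i := pt N th i * cis t))) has_vector_derivative dK i (pt N th)) (at 0)"
proof -
 have "((\<lambda>t. th i + t) has_vector_derivative 1) (at 0)" by (auto intro!: derivative_eq_intros)
 from vector_diff_chain_at[OF this, of "\<lambda>r. K (pt N (th(i := r)))"] K_partial[OF th i]
 have "((\<lambda>t. K (pt N (th(i := th i + t)))) has_vector_derivative gen (unit_vec i) th (K (pt N th))) (at 0)"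
  by (simp add: o_def)
 moreover have "pt N (th(i := th i + t)) = (pt N th)(i := pt N th i * cis t)" for t
  by (rule ext) (use i in \<open>simp add: pt_def cis_mult\<close>)
 moreover have "gen (unit_vec i) th (K (pt N th)) = dK i (pt N th)"
  unfolding gen_unit[OF i] dK_def by (intro sum.cong refl) (use i in \<open>simp add: pt_def ctg_cis\<close>)
 ultimately show ?thesis by simp
qed

text \<open>Equivariance transports the equation from the chamber to the other components.\<close>

lemma K_derivative:
 assumes x: "x \<in> torus_reg N" and i: "i \<in> {1..N}"
 shows "((\<lambda>t. K (x(i := x i * cis t))) has_vector_derivative dK i x) (at 0)"
proof -
 obtain w th where w: "w permutes {1..N}" and th: "th \<in> chamber N" "x \<circ> w = pt N th"
  using torus_reg_sorted[OF x] N3 by auto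
 define k where "k = inv w i"
 have wk: "w k = i" using permutes_inverses(1)[OF w] by (simp add: k_def)
 have k: "k \<in> {1..N}" using permutes_in_image[OF permutes_inv[OF w], of i] i by (simp add: k_def)
 have inj: "w l = i \<longleftrightarrow> l = k" for l using wk permutes_inj[OF w] by (auto dest: injD)
 have comp: "x(i := z) \<circ> w = (x \<circ> w)(k := z)" for z
  by (rule ext) (simp add: inj)
 have "((\<lambda>t. K (x(i := x i * cis t) \<circ> w)) has_vector_derivative dK k (x \<circ> w)) (at 0)"
  using K_derivative_chamber[OF th(1) k] unfolding th(2)[symmetric] comp by (simp add: wk)
 then have "((\<lambda>t. \<tau> w ** K (x(i := x i * cis t) \<circ> w)) has_vector_derivative \<tau> w ** dK k (x \<circ> w)) (at 0)"
  by (rule bounded_linear.has_vector_derivative[OF mm.bounded_linear_right])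
 then have der: "((\<lambda>t. \<tau> w ** K (x(i := x i * cis t) \<circ> w) ** adj (\<tau> w)) has_vector_derivative
   \<tau> w ** dK k (x \<circ> w) ** adj (\<tau> w)) (at 0)"
  by (rule bounded_linear.has_vector_derivative[OF mm.bounded_linear_left])
 have "\<tau> w ** dK k (x \<circ> w) ** adj (\<tau> w) =
   (\<Sum>j\<in>{1..N} - {k}. brk (\<kappa> / 2) (\<kappa> / 2 * ctg (x i) (x (w j))) (refl i (w j)) (K x))"
  unfolding dK_def mm.sum_left mm.sum_right
 proof (rule sum.cong[OF refl])
  fix j assume j: "j \<in> {1..N} - {k}"
  then have kj: "(k, j) \<in> pairs N" using k by (auto simp: pairs_def)
  show "\<tau> w ** brk (\<kappa> / 2) (\<kappa> / 2 * ctg ((x \<circ> w) k) ((x \<circ> w) j)) (refl k j) (K (x \<circ> w)) ** adj (\<tau> w) =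
    brk (\<kappa> / 2) (\<kappa> / 2 * ctg (x i) (x (w j))) (refl i (w j)) (K x)"
   unfolding brk_conj[OF \<tau>_unitary[OF w]] refl_conj[OF w kj] K_comp_inverse[OF x w, symmetric]
   by (simp add: wk)
 qed
 also have "\<dots> = dK i x"
  unfolding dK_def
 proof (rule sum.reindex_bij_betw)
  have "bij_betw w ({1..N} - {k}) ({1..N} - {w k})"
   using permutes_imp_bij[OF w] k i wk by (intro bij_betw_DiffI) (auto simp: bij_betw_def)
  then show "bij_betw w ({1..N} - {k}) ({1..N} - {i})" by (simp only: wk)
 qed
 finally have eq: "\<tau> w ** dK k (x \<circ> w) ** adj (\<tau> w) = dK i x" .
 have "isCont (\<lambda>t. discr N (x(i := x i * cis t))) 0"
  by (rule DERIV_isCont[OF discr_derivative[OF torus_reg_torus[OF x] i]])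
 then have "((\<lambda>t. discr N (x(i := x i * cis t))) \<longlongrightarrow> discr N x) (at 0)" by (simp add: isCont_def)
 from order_tendstoD(1)[OF this discr_pos[OF x]]
 have "eventually (\<lambda>t. 0 < discr N (x(i := x i * cis t))) (at 0)" .
 then have "eventually (\<lambda>t. \<tau> w ** K (x(i := x i * cis t) \<circ> w) ** adj (\<tau> w) = K (x(i := x i * cis t))) (at 0)"
 proof eventually_elim
  fix t assume pos: "0 < discr N (x(i := x i * cis t))"
  have "x(i := x i * cis t) \<in> torus N"
   using torus_reg_torus[OF x] i by (intro torus_rotate) (simp_all add: norm_mult torus_norm)
  then have "x(i := x i * cis t) \<in> torus_reg N" using discr_zero_iff pos by fastforce
  then show "\<tau> w ** K (x(i := x i * cis t) \<circ> w) ** adj (\<tau> w) = K (x(i := x i * cis t))"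
   using K_comp_inverse[OF _ w] by metis
 qed
 then obtain d where d: "d > 0" "\<And>t. t ~= 0 ==> dist t 0 < d ==>
   \<tau> w ** K (x(i := x i * cis t) \<circ> w) ** adj (\<tau> w) = K (x(i := x i * cis t))"
  unfolding eventually_at by auto
 show ?thesis
 proof (rule has_vector_derivative_transform_within[OF der[unfolded eq] d(1)])
  fix t :: real assume t: "dist t 0 < d"
  show "\<tau> w ** K (x(i := x i * cis t) \<circ> w) ** adj (\<tau> w) = K (x(i := x i * cis t))"
  proof (cases "t = 0")
   case True
   then show ?thesis using K_comp_inverse[OF x w] by simp
  qed (use d(2) t in blast)
 qed simp
qed

end

section \<open>Symmetry of the Dunkl operators\<close>

text \<open>The coefficient of a reflection in the Dunkl operators. Its real part is one half, its imaginary part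
 half the negative cotangent, which is why it appears in the equation of \<open>K\<close>.\<close>

definition dcoef :: "complex => complex => complex" where
 "dcoef z w = z / (z - w)"

lemma dcoef_ctg:
 assumes "cmod z = 1" "cmod w = 1" "z ~= w"
 shows "\<i> * dcoef z w = of_real (ctg z w / 2) + \<i> / 2"
  and "\<i> * cnj (dcoef z w) = - of_real (ctg z w / 2) + \<i> / 2"
proof -
 have "z ~= 0" "w ~= 0" using assms by auto
 then have "z = cis (Arg z)" "w = cis (Arg w)"
  using assms cis_Arg[of z] cis_Arg[of w] by (simp_all add: sgn_eq)
 then obtain a b where ab: "z = cis a" "w = cis b" by blast
 have "sin ((a - b) / 2) ~= 0" using assms(3) chord_eq[of a b] by (auto simp: ab)
 from cis_quotient[OF this]
 show *: "\<i> * dcoef z w = of_real (ctg z w / 2) + \<i> / 2" by (simp add: dcoef_def ab ctg_cis)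
 then have "cnj (\<i> * dcoef z w) = cnj (of_real (ctg z w / 2) + \<i> / 2)" by simp
 then show "\<i> * cnj (dcoef z w) = - of_real (ctg z w / 2) + \<i> / 2"
  by (simp add: complex_eq_iff)
qed

lemma dcoef_swap:
 assumes "cmod z = 1" "cmod w = 1" "z ~= w"
 shows "dcoef w z = cnj (dcoef z w)"
proof -
 have "\<i> * dcoef w z = \<i> * cnj (dcoef z w)"
  unfolding dcoef_ctg(1)[OF assms(2,1) assms(3)[symmetric]] dcoef_ctg(2)[OF assms] ctg_swap[of w z] by simp
 then show ?thesis by simp
qed

lemma brk_dcoef:
 assumes "cmod z = 1" "cmod w = 1" "z ~= w"
 shows "brk (\<kappa> / 2) (\<kappa> / 2 * ctg z w) t X =
  mscale (of_real \<kappa>) (mscale (\<i> * dcoef z w) (X ** t) - mscale (\<i> * cnj (dcoef z w)) (t ** X))"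
 unfolding dcoef_ctg[OF assms] brk_def mscale_of_real[symmetric]
 by (simp add: mscale_def vec_eq_iff algebra_simps add_divide_distrib)

context torus_form_wall
begin

lemma expo_nonneg: "0 <= expo" by simp

text \<open>The smallest of the chords is one of the summands.\<close>

lemma K_pair_bound:
 "\<exists>C\<ge>0. \<forall>x\<in>torus_reg N. norm (K x) <= C * (\<Sum>p\<in>pairs N. cmod (x (fst p) - x (snd p)) powr (- expo))"
proof -
 obtain C where C: "C > 0" "\<And>x \<delta>. x \<in> torus_reg N ==> \<delta> > 0 ==>
   (\<forall>(i, j)\<in>pairs N. \<delta> <= cmod (x i - x j)) ==> norm (K x) <= C * \<delta> powr (- expo)"
  using K_bound by blast
 have "norm (K x) <= C * (\<Sum>p\<in>pairs N. cmod (x (fst p) - x (snd p)) powr (- expo))" if x: "x \<in> torus_reg N" for x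
 proof -
  define D where "D = (\<lambda>p. cmod (x (fst p) - x (snd p))) ` pairs N"
  have "(1, 2) \<in> pairs N" using N3 by (simp add: pairs_def)
  then have D: "finite D" "D ~= {}" by (auto simp: D_def)
  from Min_in[OF this] obtain q where q: "q \<in> pairs N" "Min D = cmod (x (fst q) - x (snd q))"
   by (auto simp: D_def)
  have "x (fst q) ~= x (snd q)" using x q(1) unfolding torus_reg_eq by (auto simp: case_prod_beta)
  then have "Min D > 0" using q by simp
  moreover have "\<forall>(i, j)\<in>pairs N. Min D <= cmod (x i - x j)"
   using Min_le[OF D(1)] unfolding D_def by fastforce
  ultimately have "norm (K x) <= C * Min D powr (- expo)" using C(2)[OF x] by blast
  also have "Min D powr (- expo) <= (\<Sum>p\<in>pairs N. cmod (x (fst p) - x (snd p)) powr (- expo))"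
   unfolding q(2) by (rule member_le_sum[OF q(1)]) auto
  finally show ?thesis using C(1) by (simp add: mult_left_mono)
 qed
 then show ?thesis using C(1) by (intro exI[of _ C]) auto
qed

lemma chord_le_2: "x \<in> torus N ==> p \<in> pairs N ==> cmod (x (fst p) - x (snd p)) <= 2"
proof -
 assume "x \<in> torus N" "p \<in> pairs N"
 then have "cmod (x (fst p)) = 1" "cmod (x (snd p)) = 1" using torus_norm by (auto simp: pairs_def)
 then show ?thesis using norm_triangle_ineq4[of "x (fst p)" "x (snd p)"] by simp
qed

text \<open>Besides the given chord, the discriminant contains each chord of the previous bound as a further
 factor, and the exponent is less than 1.\<close>

lemma K_discr_bound:
 "\<exists>B\<ge>0. \<forall>x\<in>torus_reg N. \<forall>(i, j)\<in>pairs N. discr N x * norm (K x) <= B * cmod (x i - x j)"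
proof -
 obtain C where C: "C >= 0" "\<And>x. x \<in> torus_reg N ==>
   norm (K x) <= C * (\<Sum>p\<in>pairs N. cmod (x (fst p) - x (snd p)) powr (- expo))"
  using K_pair_bound by blast
 define c where "c = (4 :: real) ^ card (pairs N)"
 have "discr N x * norm (K x) <= (C * c * (2 * real (card (pairs N)))) * cmod (x i - x j)"
  if x: "x \<in> torus_reg N" and ij: "(i, j) \<in> pairs N" for x i j
 proof -
  have term_le: "discr N x * cmod (x (fst p) - x (snd p)) powr (- expo) <= c * cmod (x i - x j) * 2"
   if p: "p \<in> pairs N" for p
  proof -
   define d where "d = cmod (x (fst p) - x (snd p))"
   have "x (fst p) ~= x (snd p)" using x p unfolding torus_reg_eq by (auto simp: case_prod_beta)
   then have d: "0 < d" "d <= 2" using chord_le_2[OF torus_reg_torus[OF x] p] by (simp_all add: d_def)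
   have "discr N x * d powr (- expo) <= (c * (cmod (x i - x j) * d)) * d powr (- expo)"
    using discr_le[OF torus_reg_torus[OF x] ij, of "fst p" "snd p"] p
    unfolding c_def d_def by (intro mult_right_mono) auto
   also have "\<dots> = c * cmod (x i - x j) * (d powr 1 * d powr (- expo))" using d by simp
   also have "d powr 1 * d powr (- expo) = d powr (1 - expo)" unfolding powr_add[symmetric] by simp
   also have "d powr (1 - expo) <= 2 powr (1 - expo)" using d expo_small by (intro powr_mono2) auto
   also have "(2 :: real) powr (1 - expo) <= 2 powr 1" using expo_nonneg by (intro powr_mono) auto
   finally show ?thesis by (simp add: d_def c_def mult_left_mono)
  qed
  have "discr N x * norm (K x) <= discr N x * (C * (\<Sum>p\<in>pairs N. cmod (x (fst p) - x (snd p)) powr (- expo)))"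
   by (intro mult_left_mono C x discr_nonneg)
  also have "\<dots> = C * (\<Sum>p\<in>pairs N. discr N x * cmod (x (fst p) - x (snd p)) powr (- expo))"
   by (simp add: sum_distrib_left mult_ac)
  also have "\<dots> <= C * (\<Sum>p\<in>pairs N. c * cmod (x i - x j) * 2)"
   by (intro mult_left_mono sum_mono term_le C(1))
  finally show ?thesis by (simp add: mult_ac)
 qed
 then show ?thesis using C(1) by (intro exI[of _ "C * c * (2 * real (card (pairs N)))"]) (auto simp: c_def)
qed

lemma defect_pair_bound:
 "\<exists>M\<ge>0. \<forall>x\<in>torus_reg N. \<forall>(i, j)\<in>pairs N. norm (K x - refl i j ** K x ** refl i j) \<le>
   M * cmod (x i - x j) powr (1 / 2) *
   (\<Sum>p\<in>pairs N - {(i, j), (j, i)}. cmod (x (fst p) - x (snd p)) powr (- 1 / 2 - expo))"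
proof -
 obtain M where M: "M > 0" "\<And>x i j r. x \<in> torus_reg N ==> (i, j) \<in> pairs N ==> r > 0 ==>
   (\<forall>(k, l)\<in>pairs N - {(i, j), (j, i)}. r <= cmod (x k - x l)) ==>
   norm (K x - refl i j ** K x ** refl i j) <= M * cmod (x i - x j) powr (1 / 2) * r powr (- 1 / 2 - expo)"
  using reflection_defect by blast
 have "norm (K x - refl i j ** K x ** refl i j) <= M * cmod (x i - x j) powr (1 / 2) *
   (\<Sum>p\<in>pairs N - {(i, j), (j, i)}. cmod (x (fst p) - x (snd p)) powr (- 1 / 2 - expo))"
  if x: "x \<in> torus_reg N" and ij: "(i, j) \<in> pairs N" for x i j
 proof -
  define P where "P = pairs N - {(i, j), (j, i)}"
  define D where "D = (\<lambda>p. cmod (x (fst p) - x (snd p))) ` P"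
  have "P ~= {}"
  proof -
   have "card {1..N} > card {i, j}" using N3 by (simp add: card_insert_if)
   then have "\<not> {1..N} \<subseteq> {i, j}" using card_mono[of "{i, j}" "{1..N}"] by auto
   then obtain k where "k \<in> {1..N}" "k ~= i" "k ~= j" by blast
   then have "(i, k) \<in> P" using ij by (auto simp: P_def pairs_def)
   then show ?thesis by blast
  qed
  moreover have P: "finite P" by (simp add: P_def)
  ultimately have D: "finite D" "D ~= {}" by (auto simp: D_def)
  from Min_in[OF this] obtain q where q: "q \<in> P" "Min D = cmod (x (fst q) - x (snd q))"
   by (auto simp: D_def)
  have "x (fst q) ~= x (snd q)" using x q(1) unfolding torus_reg_eq P_def by (auto simp: case_prod_beta)
  then have "Min D > 0" using q by simp
  moreover have "\<forall>(k, l)\<in>P. Min D <= cmod (x k - x l)"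
   using Min_le[OF D(1)] unfolding D_def by fastforce
  ultimately have "norm (K x - refl i j ** K x ** refl i j) \<le>
    M * cmod (x i - x j) powr (1 / 2) * Min D powr (- 1 / 2 - expo)" using M(2)[OF x ij] unfolding P_def by blast
  also have "Min D powr (- 1 / 2 - expo) <= (\<Sum>p\<in>P. cmod (x (fst p) - x (snd p)) powr (- 1 / 2 - expo))"
   unfolding q(2) by (rule member_le_sum[OF q(1)]) (use P in auto)
  finally show ?thesis using M(1) by (simp add: P_def mult_left_mono)
 qed
 then show ?thesis using M(1) by (intro exI[of _ M]) auto
qed

lemma dK_continuous:
 assumes i: "i \<in> {1..N}"
 shows "continuous_on (torus_reg N) (dK i)"
proof -
 have eq: "mscale c A = mat c ** A" for c and A :: "complex^'t^'t" by (rule mscale_eq)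
 have "continuous_on (torus_reg N) (\<lambda>x. brk (\<kappa> / 2) (\<kappa> / 2 * ctg (x i) (x j)) (refl i j) (K x))"
  if "j \<in> {1..N} - {i}" for j
  unfolding brk_def eq
  by (intro continuous_intros mm.continuous_on ctg_continuous K_continuous)
   (use that i in \<open>auto simp: pairs_def\<close>)
 then show ?thesis unfolding dK_def by (intro continuous_on_sum)
qed

lemma norm_dK_le: "norm (dK i x) <= (\<Sum>j\<in>{1..N} - {i}. \<bar>\<kappa>\<bar> * (1 + \<bar>ctg (x i) (x j)\<bar>) * norm (K x))"
 if i: "i \<in> {1..N}"
 unfolding dK_def
proof (rule order_trans[OF norm_sum], rule sum_mono)
 fix j assume "j \<in> {1..N} - {i}"
 then have p: "(i, j) \<in> pairs N" using i by (auto simp: pairs_def)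
 have "norm (brk (\<kappa> / 2) (\<kappa> / 2 * ctg (x i) (x j)) (refl i j) (K x)) \<le>
   2 * (\<bar>\<kappa> / 2\<bar> + \<bar>\<kappa> / 2 * ctg (x i) (x j)\<bar>) * norm (K x)"
  by (rule norm_brk_le[OF refl_unitary[OF p]])
 also have "2 * (\<bar>\<kappa> / 2\<bar> + \<bar>\<kappa> / 2 * ctg (x i) (x j)\<bar>) = \<bar>\<kappa>\<bar> * (1 + \<bar>ctg (x i) (x j)\<bar>)"
  by (simp add: abs_mult algebra_simps)
 finally show "norm (brk (\<kappa> / 2) (\<kappa> / 2 * ctg (x i) (x j)) (refl i j) (K x)) \<le>
   \<bar>\<kappa>\<bar> * (1 + \<bar>ctg (x i) (x j)\<bar>) * norm (K x)" .
qed

lemma norm_refl_mult: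
 assumes "(i, j) \<in> pairs N"
 shows "norm (refl i j ** X) = norm X" "norm (X ** refl i j) = norm X"
 using norm_unitary_left[OF refl_unitary(1)[OF assms]] norm_unitary_right[OF refl_unitary(2)[OF assms]] by auto

text \<open>The derivative of \<open>K\<close> produces the reflection terms of both Dunkl operators that act on \<open>f x\<close> and \<open>g x\<close>
 themselves. The terms \<open>S j\<close> with an exchanged argument remain, and equivariance makes them
 antisymmetric.\<close>

theorem dunkl_form_integral:
 assumes f: "C1_torus N f" and g: "C1_torus N g" and i: "i \<in> {1..N}"
 shows "has_bochner_integral (torus_measure N) (\<lambda>x. if x \<in> torus_reg N then
  herm (dunkl N \<kappa> \<tau> i f x) (K x *v g x) - herm (f x) (K x *v dunkl N \<kappa> \<tau> i g x) else 0) 0"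
proof -
 define J where "J = {1..N} - {i}"
 define sw where "sw j = Transposition.transpose i j" for j
 define ef where "ef = euler_deriv i f"
 define eg where "eg = euler_deriv i g"
 define c where "c x j = dcoef (x i) (x j)" for x :: "nat => complex" and j
 define \<Phi> where "\<Phi> x = herm (f x) (K x *v g x)" for x
 define D where "D x = herm (\<i> *s ef x) (K x *v g x) + (herm (f x) (dK i x *v g x) + herm (f x) (K x *v (\<i> *s eg x)))" for x
 define S where "S j x = of_real \<kappa> * (c x j * herm (f x) ((K x ** refl i j) *v g (x \<circ> sw j))
  - cnj (c x j) * herm (f (x \<circ> sw j)) ((refl i j ** K x) *v g x))" for j x
 have pair: "(i, j) \<in> pairs N" if "j \<in> J" for j using that i by (auto simp: J_def pairs_def)
 have swp: "sw j permutes {1..N}" if "j \<in> J" for j unfolding sw_def by (rule transpose_permutes[OF pair[OF that]])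
 have sw_sw: "x \<circ> sw j \<circ> sw j = x" for x :: "nat => complex" and j by (simp add: sw_def comp_assoc)
 have sw_reg: "x \<circ> sw j \<in> torus_reg N" if "x \<in> torus_reg N" "j \<in> J" for x j
  by (rule torus_reg_comp[OF that(1) swp[OF that(2)]])
 have sw_i: "(x \<circ> sw j) i = x j" "(x \<circ> sw j) j = x i" for x :: "nat => complex" and j by (simp_all add: sw_def)
 have unit: "cmod (x i) = 1" "cmod (x j) = 1" "x i ~= x j" if "x \<in> torus_reg N" "j \<in> J" for x j
  using that torus_norm[OF torus_reg_torus[OF that(1)]] i pair[OF that(2)]
  unfolding torus_reg_eq by (auto simp: J_def)
 have dist: "0 < cmod (x i - x j)" if "x \<in> torus_reg N" "j \<in> J" for x j using unit(3)[OF that] by simp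
 have c_norm: "cmod (c x j) * cmod (x i - x j) = 1" if "x \<in> torus_reg N" "j \<in> J" for x j
  using unit[OF that] by (simp add: c_def dcoef_def norm_divide)
 have c_sw: "c (x \<circ> sw j) j = cnj (c x j)" if "x \<in> torus_reg N" "j \<in> J" for x j
  unfolding c_def sw_i by (rule dcoef_swap[OF unit[OF that]])
 have ctg_le: "\<bar>ctg (x i) (x j)\<bar> * cmod (x i - x j) <= 2" if "x \<in> torus_reg N" "j \<in> J" for x j
  by (rule abs_ctg_le[OF unit(1,2)[OF that]])
 have K_sw: "K (x \<circ> sw j) = refl i j ** K x ** refl i j" if "x \<in> torus_reg N" "j \<in> J" for x j
  using K_equivariant[OF that(1) swp[OF that(2)]] refl_hermitian[OF pair[OF that(2)]] by (simp add: sw_def)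
 have refl2: "refl i j ** refl i j = mat 1" if "j \<in> J" for j by (rule refl_refl[OF pair[OF that]])
 have cont_reg: "continuous_on (torus_reg N) h" if "continuous_on (torus N) h" for h :: "(nat => complex) => complex^'t"
  by (rule continuous_on_subset[OF that]) (auto simp: torus_reg_def)
 have cf: "continuous_on (torus_reg N) f" "continuous_on (torus_reg N) g"
  "continuous_on (torus_reg N) ef" "continuous_on (torus_reg N) eg"
  using f g i by (auto simp: C1_torus_def ef_def eg_def intro!: cont_reg)
 have smult_cont: "continuous_on A (\<lambda>x. \<i> *s h x)" if "continuous_on A h" for A and h :: "(nat => complex) => complex^'t"
 proof -
  have "\<i> *s v = mat \<i> *v v" for v :: "complex^'t"
   using mscale_vector[of \<i> "mat 1" v] by (simp add: mscale_eq)
  then show ?thesis using mv.continuous_on[OF continuous_on_const that] by simp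
 qed
 have \<Phi>_cont: "continuous_on (torus_reg N) \<Phi>"
  unfolding \<Phi>_def by (intro herm.continuous_on mv.continuous_on cf K_continuous)
 have D_cont: "continuous_on (torus_reg N) D"
  unfolding D_def
  by (intro continuous_on_add herm.continuous_on mv.continuous_on cf K_continuous smult_cont dK_continuous i)
 have S_cont: "continuous_on (torus_reg N) (S j)" if j: "j \<in> {1..N} - {i}" for j
 proof -
  have j: "j \<in> J" using j by (simp add: J_def)
  have c: "continuous_on (torus_reg N) (\<lambda>x. c x j)"
   unfolding c_def dcoef_def by (intro continuous_intros coordinate_continuous) (use unit(3) j in auto)
  show ?thesis unfolding S_def
   by (intro continuous_intros c herm.continuous_on mv.continuous_on mm.continuous_on K_continuous cf
     continuous_comp_torus_reg[OF cf(1) swp[OF j]] continuous_comp_torus_reg[OF cf(2) swp[OF j]])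
 qed
 have der: "((\<lambda>t. \<Phi> (x(i := x i * cis t))) has_vector_derivative D x) (at 0)" if x: "x \<in> torus_reg N" for x
 proof -
  have x': "x(i := x i * cis 0) = x" by simp
  have df: "((\<lambda>t. f (x(i := x i * cis t))) has_vector_derivative \<i> *s ef x) (at 0)"
   using C1_derivative[OF f i torus_reg_torus[OF x], of 0] unfolding x' ef_def .
  have dg: "((\<lambda>t. g (x(i := x i * cis t))) has_vector_derivative \<i> *s eg x) (at 0)"
   using C1_derivative[OF g i torus_reg_torus[OF x], of 0] unfolding x' eg_def .
  have "((\<lambda>t. K (x(i := x i * cis t)) *v g (x(i := x i * cis t))) has_vector_derivative
    K x *v (\<i> *s eg x) + dK i x *v g x) (at 0)"
   using mv.has_vector_derivative[OF K_derivative[OF x i] dg] unfolding x' .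
  from herm.has_vector_derivative[OF df this]
  show ?thesis unfolding \<Phi>_def D_def x' by (simp add: herm_linear add.commute)
 qed
 have anti: "S j (x \<circ> Transposition.transpose i j) = - S j x"
  if x: "x \<in> torus_reg N" and j: "j \<in> {1..N} - {i}" for x j
 proof -
  have j: "j \<in> J" using j by (simp add: J_def)
  have 1: "refl i j ** K x ** refl i j ** refl i j = refl i j ** K x"
   using refl2[OF j] by (simp add: matrix_mul_assoc[symmetric])
  have 2: "refl i j ** (refl i j ** K x ** refl i j) = K x ** refl i j"
   using refl2[OF j] by (simp add: matrix_mul_assoc)
  have "S j (x \<circ> sw j) = - S j x"
   unfolding S_def c_sw[OF x j] K_sw[OF x j] sw_sw 1 2 by (simp add: algebra_simps)
  then show ?thesis by (simp add: sw_def)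
 qed
 have integrand: "\<i> * D x + (\<Sum>j\<in>J. S j x) =
   herm (ef x) (K x *v g x) - herm (f x) (K x *v eg x) +
   of_real \<kappa> * (\<Sum>j\<in>J. cnj (c x j) * herm (f x - f (x \<circ> sw j)) ((refl i j ** K x) *v g x)
    - c x j * herm (f x) ((K x ** refl i j) *v (g x - g (x \<circ> sw j))))" if x: "x \<in> torus_reg N" for x
 proof -
  have "dK i x = (\<Sum>j\<in>J. mscale (of_real \<kappa>) (mscale (\<i> * c x j) (K x ** refl i j) - mscale (\<i> * cnj (c x j)) (refl i j ** K x)))"
   unfolding dK_def J_def[symmetric] c_def by (intro sum.cong refl brk_dcoef unit[OF x])
  then have "herm (f x) (dK i x *v g x) = (\<Sum>j\<in>J. of_real \<kappa> * (\<i> * c x j * herm (f x) ((K x ** refl i j) *v g x)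
    - \<i> * cnj (c x j) * herm (f x) ((refl i j ** K x) *v g x)))"
   by (simp add: mv.sum_left herm.sum_right mscale_vector herm_linear mv.diff_left right_diff_distrib mult.assoc)
  then have "\<i> * herm (f x) (dK i x *v g x) + (\<Sum>j\<in>J. S j x) = (\<Sum>j\<in>J. \<i> * (of_real \<kappa> * (\<i> * c x j * herm (f x) ((K x ** refl i j) *v g x)
    - \<i> * cnj (c x j) * herm (f x) ((refl i j ** K x) *v g x))) + S j x)"
   by (simp only: sum.distrib sum_distrib_left)
  moreover have "\<i> * D x = herm (ef x) (K x *v g x) - herm (f x) (K x *v eg x) + \<i> * herm (f x) (dK i x *v g x)"
   by (simp add: D_def herm_linear matrix_vector_smult algebra_simps)
  ultimately have "\<i> * D x + (\<Sum>j\<in>J. S j x) = herm (ef x) (K x *v g x) - herm (f x) (K x *v eg x) +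
    (\<Sum>j\<in>J. \<i> * (of_real \<kappa> * (\<i> * c x j * herm (f x) ((K x ** refl i j) *v g x)
    - \<i> * cnj (c x j) * herm (f x) ((refl i j ** K x) *v g x))) + S j x)"
   by (simp only: add.assoc)
  also have "(\<Sum>j\<in>J. \<i> * (of_real \<kappa> * (\<i> * c x j * herm (f x) ((K x ** refl i j) *v g x)
    - \<i> * cnj (c x j) * herm (f x) ((refl i j ** K x) *v g x))) + S j x) =
    of_real \<kappa> * (\<Sum>j\<in>J. cnj (c x j) * herm (f x - f (x \<circ> sw j)) ((refl i j ** K x) *v g x)
    - c x j * herm (f x) ((K x ** refl i j) *v (g x - g (x \<circ> sw j))))"
   unfolding sum_distrib_left
  proof (rule sum.cong[OF refl])
   fix j
   have ii: "\<i> * (\<i> * z) = - z" for z :: complex by (simp flip: mult.assoc)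
   show "\<i> * (of_real \<kappa> * (\<i> * c x j * herm (f x) ((K x ** refl i j) *v g x)
    - \<i> * cnj (c x j) * herm (f x) ((refl i j ** K x) *v g x))) + S j x =
    of_real \<kappa> * (cnj (c x j) * herm (f x - f (x \<circ> sw j)) ((refl i j ** K x) *v g x)
    - c x j * herm (f x) ((K x ** refl i j) *v (g x - g (x \<circ> sw j))))"
    by (simp add: S_def herm_linear mv.diff_right algebra_simps ii)
  qed
  finally show ?thesis .
 qed
 have dunkl_eq: "herm (dunkl N \<kappa> \<tau> i f x) (K x *v g x) - herm (f x) (K x *v dunkl N \<kappa> \<tau> i g x) =
   \<i> * D x + (\<Sum>j\<in>J. S j x)" if x: "x \<in> torus_reg N" for x
 proof -
  have reg: "\<forall>j\<in>{1..N} - {i}. x i ~= x j" using unit(3)[OF x] by (simp only: J_def) blast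
  have d: "dunkl N \<kappa> \<tau> i h x = euler_deriv i h x +
    of_real \<kappa> *s (\<Sum>j\<in>J. c x j *s (refl i j *v (h x - h (x \<circ> sw j))))" for h :: "(nat => complex) => complex^'t"
   unfolding dunkl_def if_P[OF reg] dunkl_formula_def J_def c_def dcoef_def sw_def by (rule refl)
  have "herm (dunkl N \<kappa> \<tau> i f x) (K x *v g x) = herm (ef x) (K x *v g x) +
    of_real \<kappa> * (\<Sum>j\<in>J. cnj (c x j) * herm (refl i j *v (f x - f (x \<circ> sw j))) (K x *v g x))"
   unfolding d by (simp add: ef_def herm_linear herm.sum_left)
  also have "(\<Sum>j\<in>J. cnj (c x j) * herm (refl i j *v (f x - f (x \<circ> sw j))) (K x *v g x)) =
    (\<Sum>j\<in>J. cnj (c x j) * herm (f x - f (x \<circ> sw j)) ((refl i j ** K x) *v g x))"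
   by (intro sum.cong refl) (simp add: herm_adj refl_hermitian[OF pair] matrix_vector_mul_assoc)
  finally have 1: "herm (dunkl N \<kappa> \<tau> i f x) (K x *v g x) = herm (ef x) (K x *v g x) +
    of_real \<kappa> * (\<Sum>j\<in>J. cnj (c x j) * herm (f x - f (x \<circ> sw j)) ((refl i j ** K x) *v g x))" .
  have 2: "herm (f x) (K x *v dunkl N \<kappa> \<tau> i g x) = herm (f x) (K x *v eg x) +
    of_real \<kappa> * (\<Sum>j\<in>J. c x j * herm (f x) ((K x ** refl i j) *v (g x - g (x \<circ> sw j))))"
   unfolding d
   by (simp add: eg_def herm_linear herm.sum_right mv.add_right mv.sum_right matrix_vector_smult
     matrix_vector_mul_assoc del: matrix_vector_mul_assoc[symmetric])
  show ?thesis unfolding 1 2 integrand[OF x] by (simp add: sum_subtractf algebra_simps)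
 qed
 \<comment> \<open>\<open>M\<close> bounds \<open>f\<close>, \<open>g\<close>, their derivatives and their Lipschitz constants, so a pairing with a matrix is at
  most \<open>Q\<close> times the norm of the matrix\<close>
 obtain C0 where C0: "C0 > 0" "\<And>(u :: complex^'t) (A :: complex^'t^'t) v. cmod (herm u (A *v v)) <= C0 * (norm u * norm A * norm v)"
  using herm_mult_bound by blast
 obtain M1 where M1: "M1 >= 0" "\<And>x. x \<in> torus N ==> norm (f x) <= M1 \<and> (\<forall>i\<in>{1..N}. norm (euler_deriv i f x) <= M1)"
  using C1_bounded[OF f] by blast
 obtain M2 where M2: "M2 >= 0" "\<And>x. x \<in> torus N ==> norm (g x) <= M2 \<and> (\<forall>i\<in>{1..N}. norm (euler_deriv i g x) <= M2)"
  using C1_bounded[OF g] by blast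
 obtain L1 where L1: "L1 >= 0" "\<And>x i j. x \<in> torus N ==> (i, j) \<in> pairs N ==>
   norm (f x - f (x \<circ> Transposition.transpose i j)) <= L1 * cmod (x i - x j)"
  using C1_lipschitz[OF f] by blast
 obtain L2 where L2: "L2 >= 0" "\<And>x i j. x \<in> torus N ==> (i, j) \<in> pairs N ==>
   norm (g x - g (x \<circ> Transposition.transpose i j)) <= L2 * cmod (x i - x j)"
  using C1_lipschitz[OF g] by blast
 define M where "M = M1 + M2 + L1 + L2"
 have M0: "M >= 0" using M1 M2 L1 L2 by (simp add: M_def)
 have nf: "norm (f x) <= M" "norm (g x) <= M" "norm (ef x) <= M" "norm (eg x) <= M" if "x \<in> torus N" for x
  using M1(1) M1(2)[OF that] M2(1) M2(2)[OF that] L1(1) L2(1) i unfolding M_def ef_def eg_def by force+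
 have lip: "norm (f x - f (x \<circ> sw j)) <= M * cmod (x i - x j)" "norm (g x - g (x \<circ> sw j)) <= M * cmod (x i - x j)"
  if x: "x \<in> torus N" and j: "j \<in> J" for x j
 proof -
  have "norm (f x - f (x \<circ> sw j)) <= L1 * cmod (x i - x j)" "norm (g x - g (x \<circ> sw j)) <= L2 * cmod (x i - x j)"
   unfolding sw_def using L1(2)[OF x pair[OF j]] L2(2)[OF x pair[OF j]] by auto
  moreover have "L1 * cmod (x i - x j) <= M * cmod (x i - x j)" "L2 * cmod (x i - x j) <= M * cmod (x i - x j)"
   using M1(1) M2(1) L1(1) L2(1) by (intro mult_right_mono; simp add: M_def)+
  ultimately show "norm (f x - f (x \<circ> sw j)) <= M * cmod (x i - x j)" "norm (g x - g (x \<circ> sw j)) <= M * cmod (x i - x j)"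
   by linarith+
 qed
 have tri: "cmod (herm u (A *v v)) <= C0 * (a * norm A * b)"
  if "norm u <= a" "norm v <= b" for u v :: "complex^'t" and A :: "complex^'t^'t" and a b
 proof -
  have "0 <= a" using that(1) norm_ge_zero order_trans by blast
  then have "norm u * norm A * norm v <= a * norm A * b" using that by (intro mult_mono) auto
  then show ?thesis using C0(2)[of u A v] C0(1) by (meson mult_left_mono less_imp_le order_trans)
 qed
 define Q where "Q = C0 * M * M"
 have Q0: "Q >= 0" using C0(1) M0 by (simp add: Q_def)
 have triM: "cmod (herm u (A *v v)) <= Q * norm A" if "norm u <= M" "norm v <= M"
  for u v :: "complex^'t" and A :: "complex^'t^'t"
  using tri[OF that, of A] by (simp add: Q_def mult_ac)
 have nsmul: "norm (\<i> *s v) = norm v" for v :: "complex^'t" by (simp add: norm_vec_def norm_mult)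
 obtain B where B: "B >= 0" "\<And>x i j. x \<in> torus_reg N ==> (i, j) \<in> pairs N ==> discr N x * norm (K x) <= B * cmod (x i - x j)"
  using K_discr_bound by blast
 have Bc: "discr N x * (a * norm (K x)) <= B * k"
  if x: "x \<in> torus_reg N" and j: "j \<in> J" and a: "0 <= a" "a * cmod (x i - x j) <= k" for x j a k
 proof -
  have "discr N x * (a * norm (K x)) = a * (discr N x * norm (K x))" by simp
  also have "\<dots> <= a * (B * cmod (x i - x j))" by (intro mult_left_mono B(2)[OF x pair[OF j]] a)
  also have "\<dots> = B * (a * cmod (x i - x j))" by simp
  also have "\<dots> <= B * k" by (intro mult_left_mono a B)
  finally show ?thesis .
 qed
 have J: "\<exists>j. j \<in> J"
 proof -
  have "(if i = 1 then 2 else 1) \<in> J" using N3 by (auto simp: J_def)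
  then show ?thesis by blast
 qed
 have dK_B: "discr N x * norm (K x) <= B * 2" if x: "x \<in> torus_reg N" for x
 proof -
  obtain j where j: "j \<in> J" using J by blast
  from Bc[OF x j, of 1 2] show ?thesis using chord_le_2[OF torus_reg_torus[OF x] pair[OF j]] by simp
 qed
 have dctg_B: "discr N x * (\<bar>ctg (x i) (x j)\<bar> * norm (K x)) <= B * 2" if "x \<in> torus_reg N" "j \<in> J" for x j
  by (rule Bc[OF that]) (use ctg_le[OF that] in auto)
 have dc_B: "discr N x * (cmod (c x j) * norm (K x)) <= B * 1" if "x \<in> torus_reg N" "j \<in> J" for x j
  by (rule Bc[OF that]) (use c_norm[OF that] in auto)
 have ddK_B: "discr N x * norm (dK i x) <= real (card J) * (\<bar>\<kappa>\<bar> * (B * 4))" if x: "x \<in> torus_reg N" for x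
 proof -
  have "discr N x * norm (dK i x) <= discr N x * (\<Sum>j\<in>J. \<bar>\<kappa>\<bar> * (1 + \<bar>ctg (x i) (x j)\<bar>) * norm (K x))"
   unfolding J_def by (intro mult_left_mono norm_dK_le i discr_nonneg)
  also have "\<dots> = (\<Sum>j\<in>J. \<bar>\<kappa>\<bar> * (discr N x * norm (K x) + discr N x * (\<bar>ctg (x i) (x j)\<bar> * norm (K x))))"
   by (simp add: sum_distrib_left algebra_simps)
  also have "\<dots> <= (\<Sum>j\<in>J. \<bar>\<kappa>\<bar> * (B * 2 + B * 2))"
   by (intro sum_mono mult_left_mono add_mono dK_B dctg_B x) auto
  finally show ?thesis by simp
 qed
 define BB where "BB = Q * (B * 2) + Q * (B * 2) + Q * (real (card J) * (\<bar>\<kappa>\<bar> * (B * 4))) + \<bar>\<kappa>\<bar> * (Q * (B * 2))"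
 have BB: "Q * (B * 2) <= BB" "Q * (B * 2) + (Q * (real (card J) * (\<bar>\<kappa>\<bar> * (B * 4))) + Q * (B * 2)) <= BB" "\<bar>\<kappa>\<bar> * (Q * (B * 2)) <= BB"
  unfolding BB_def using Q0 B(1) by simp_all
 have scale: "discr N x * y <= Q * k" if "y <= Q * z" "discr N x * z <= k" for x y z k
 proof -
  have "discr N x * y <= discr N x * (Q * z)" by (rule mult_left_mono[OF that(1) discr_nonneg])
  also have "\<dots> = Q * (discr N x * z)" by simp
  also have "\<dots> <= Q * k" by (rule mult_left_mono[OF that(2) Q0])
  finally show ?thesis .
 qed
 have \<Phi>_le: "cmod (\<Phi> x) <= Q * norm (K x)" if x: "x \<in> torus N" for x
  unfolding \<Phi>_def by (rule triM[OF nf(1,2)[OF x]])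
 have B1: "discr N x * cmod (\<Phi> x) <= BB" if x: "x \<in> torus_reg N" for x
  using scale[OF \<Phi>_le[OF torus_reg_torus[OF x]] dK_B[OF x]] BB(1) by linarith
 have B3: "discr N x * cmod (of_real (ctg (x i) (x j)) * \<Phi> x) <= BB" if x: "x \<in> torus_reg N" and j: "j \<in> {1..N} - {i}" for x j
 proof -
  have j: "j \<in> J" using j by (simp add: J_def)
  have "cmod (of_real (ctg (x i) (x j)) * \<Phi> x) <= \<bar>ctg (x i) (x j)\<bar> * (Q * norm (K x))"
   by (simp add: norm_mult mult_left_mono \<Phi>_le torus_reg_torus[OF x])
  then have "cmod (of_real (ctg (x i) (x j)) * \<Phi> x) <= Q * (\<bar>ctg (x i) (x j)\<bar> * norm (K x))" by (simp add: mult_ac)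
  from scale[OF this dctg_B[OF x j]] BB(1) show ?thesis by linarith
 qed
 have B2: "discr N x * cmod (D x) <= BB" if x: "x \<in> torus_reg N" for x
 proof -
  note xt = torus_reg_torus[OF x]
  have a1: "cmod (herm (\<i> *s ef x) (K x *v g x)) <= Q * norm (K x)"
   by (rule triM) (simp_all add: nsmul nf xt)
  have a2: "cmod (herm (f x) (dK i x *v g x)) <= Q * norm (dK i x)" by (rule triM[OF nf(1,2)[OF xt]])
  have a3: "cmod (herm (f x) (K x *v (\<i> *s eg x))) <= Q * norm (K x)"
   by (rule triM) (simp_all add: nsmul nf xt)
  have "cmod (D x) <= cmod (herm (\<i> *s ef x) (K x *v g x)) + (cmod (herm (f x) (dK i x *v g x)) + cmod (herm (f x) (K x *v (\<i> *s eg x))))"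
   unfolding D_def by (intro norm_triangle_le add_left_mono norm_triangle_ineq)
  from mult_left_mono[OF this discr_nonneg[of N x]]
  have "discr N x * cmod (D x) <= discr N x * cmod (herm (\<i> *s ef x) (K x *v g x)) +
    (discr N x * cmod (herm (f x) (dK i x *v g x)) + discr N x * cmod (herm (f x) (K x *v (\<i> *s eg x))))"
   by (simp only: distrib_left)
  then show ?thesis using scale[OF a1 dK_B[OF x]] scale[OF a2 ddK_B[OF x]] scale[OF a3 dK_B[OF x]] BB(2) by linarith
 qed
 have B4: "discr N x * cmod (S j x) <= BB" if x: "x \<in> torus_reg N" and j: "j \<in> {1..N} - {i}" for x j
 proof -
  have j: "j \<in> J" using j by (simp add: J_def)
  note xt = torus_reg_torus[OF x] and yt = torus_reg_torus[OF sw_reg[OF x j]]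
  have a: "cmod (herm (f x) ((K x ** refl i j) *v g (x \<circ> sw j))) <= Q * norm (K x)"
   using triM[OF nf(1)[OF xt] nf(2)[OF yt], of "K x ** refl i j"] by (simp add: norm_refl_mult[OF pair[OF j]])
  have b: "cmod (herm (f (x \<circ> sw j)) ((refl i j ** K x) *v g x)) <= Q * norm (K x)"
   using triM[OF nf(1)[OF yt] nf(2)[OF xt], of "refl i j ** K x"] by (simp add: norm_refl_mult[OF pair[OF j]])
  have "cmod (S j x) <= \<bar>\<kappa>\<bar> * (cmod (c x j) * (Q * norm (K x)) + cmod (c x j) * (Q * norm (K x)))"
   unfolding S_def norm_mult norm_of_real
   by (intro mult_left_mono order_trans[OF norm_triangle_ineq4] add_mono)
    (simp_all add: norm_mult mult_left_mono a b)
  also have "\<dots> = 2 * \<bar>\<kappa>\<bar> * (Q * (cmod (c x j) * norm (K x)))" by simp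
  finally have "discr N x * cmod (S j x) <= discr N x * (2 * \<bar>\<kappa>\<bar> * (Q * (cmod (c x j) * norm (K x))))"
   by (rule mult_left_mono[OF _ discr_nonneg])
  also have "\<dots> = 2 * \<bar>\<kappa>\<bar> * (discr N x * (Q * (cmod (c x j) * norm (K x))))" by simp
  also have "\<dots> <= 2 * \<bar>\<kappa>\<bar> * (Q * (B * 1))"
   by (intro mult_left_mono scale[OF order_refl dc_B[OF x j]]) auto
  also have "\<dots> = \<bar>\<kappa>\<bar> * (Q * (B * 2))" by simp
  finally show ?thesis using BB(3) by linarith
 qed
 \<comment> \<open>the exponents \<open>expo\<close> and \<open>1 / 2 + expo\<close> are less than 1, which makes the majorant \<open>G\<close> integrable\<close>
 obtain CK where CK: "CK >= 0" "\<And>x. x \<in> torus_reg N ==>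
   norm (K x) <= CK * (\<Sum>p\<in>pairs N. cmod (x (fst p) - x (snd p)) powr (- expo))"
  using K_pair_bound by blast
 obtain CD where CD: "CD >= 0" "\<And>x i j. x \<in> torus_reg N ==> (i, j) \<in> pairs N ==>
   norm (K x - refl i j ** K x ** refl i j) <= CD * cmod (x i - x j) powr (1 / 2) *
   (\<Sum>p\<in>pairs N - {(i, j), (j, i)}. cmod (x (fst p) - x (snd p)) powr (- 1 / 2 - expo))"
  using defect_pair_bound by blast
 define G1 where "G1 x = (\<Sum>p\<in>pairs N. cmod (x (fst p) - x (snd p)) powr (- expo))" for x :: "nat => complex"
 define G2 where "G2 j x = (\<Sum>p\<in>pairs N - {(i, j), (j, i)}.
  cmod (x i - x j) powr (- (1 / 2)) * cmod (x (fst p) - x (snd p)) powr (- (1 / 2 + expo)))" for j and x :: "nat => complex"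
 define A1 where "A1 = Q * CK * (4 + 2 * \<bar>\<kappa>\<bar> * real (card J))"
 define A2 where "A2 = 2 * (Q * CD)"
 define G where "G x = A1 * G1 x + (\<Sum>j\<in>J. A2 * G2 j x)" for x
 have G1_0: "0 <= G1 x" for x unfolding G1_def by (intro sum_nonneg) auto
 have G2_0: "0 <= G2 j x" for j x unfolding G2_def by (intro sum_nonneg) auto
 have A0: "0 <= A1" "0 <= A2" using Q0 CK(1) CD(1) by (simp_all add: A1_def A2_def)
 have G1_int: "integrable (torus_measure N) G1"
  unfolding G1_def
  by (intro Bochner_Integration.integrable_sum pair_integrable) (use expo_nonneg expo_small in \<open>auto simp del: expo_nonneg\<close>)
 have G2_int: "integrable (torus_measure N) (G2 j)" if j: "j \<in> J" for j
  unfolding G2_def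
  by (intro Bochner_Integration.integrable_sum two_pairs_integrable[OF _ _ _ _ pair[OF j]])
   (use expo_nonneg expo_small in auto)
 have G_int: "integrable (torus_measure N) G"
  unfolding G_def by (intro Bochner_Integration.integrable_add Bochner_Integration.integrable_sum integrable_mult_right G1_int G2_int)
 have G_ge: "A1 * G1 x <= G x" "j \<in> J ==> A1 * G1 x + A2 * G2 j x <= G x" for j x
 proof -
  have nn: "0 <= A2 * G2 j x" for j using A0 G2_0 by simp
  then have "0 <= (\<Sum>j\<in>J. A2 * G2 j x)" by (intro sum_nonneg) auto
  then show "A1 * G1 x <= G x" by (simp add: G_def)
  show "A1 * G1 x + A2 * G2 j x <= G x" if j: "j \<in> J"
   unfolding G_def using member_le_sum[OF j, of "\<lambda>j. A2 * G2 j x"] nn by (simp add: J_def)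
 qed
 have K_G1: "norm (K x) <= CK * G1 x" if "x \<in> torus_reg N" for x unfolding G1_def by (rule CK(2)[OF that])
 have F_le: "cmod (\<i> * D x + (\<Sum>j\<in>{1..N} - {i}. S j x)) <= G x" if x: "x \<in> torus_reg N" for x
 proof -
  note xt = torus_reg_torus[OF x]
  have a1: "cmod (herm (ef x) (K x *v g x)) <= Q * norm (K x)" by (rule triM[OF nf(3,2)[OF xt]])
  have a2: "cmod (herm (f x) (K x *v eg x)) <= Q * norm (K x)" by (rule triM[OF nf(1,4)[OF xt]])
  have quot: "cmod (cnj (c x j) * herm (f x - f (x \<circ> sw j)) ((refl i j ** K x) *v g x)
    - c x j * herm (f x) ((K x ** refl i j) *v (g x - g (x \<circ> sw j)))) <= 2 * (Q * norm (K x))" if j: "j \<in> J" for j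
  proof -
   define d where "d = cmod (x i - x j)"
   have b1: "cmod (herm (f x - f (x \<circ> sw j)) ((refl i j ** K x) *v g x)) <= d * (Q * norm (K x))"
    using tri[OF lip(1)[OF xt j] nf(2)[OF xt], of "refl i j ** K x"]
    by (simp add: norm_refl_mult[OF pair[OF j]] Q_def d_def mult_ac)
   have b2: "cmod (herm (f x) ((K x ** refl i j) *v (g x - g (x \<circ> sw j)))) <= d * (Q * norm (K x))"
    using tri[OF nf(1)[OF xt] lip(2)[OF xt j], of "K x ** refl i j"]
    by (simp add: norm_refl_mult[OF pair[OF j]] Q_def d_def mult_ac)
   have "cmod (cnj (c x j) * herm (f x - f (x \<circ> sw j)) ((refl i j ** K x) *v g x)
    - c x j * herm (f x) ((K x ** refl i j) *v (g x - g (x \<circ> sw j)))) \<le>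
    cmod (c x j) * (d * (Q * norm (K x))) + cmod (c x j) * (d * (Q * norm (K x)))"
    by (intro order_trans[OF norm_triangle_ineq4] add_mono) (simp_all add: norm_mult mult_left_mono b1 b2)
   also have "\<dots> = 2 * ((cmod (c x j) * d) * (Q * norm (K x)))" by simp
   finally show ?thesis unfolding d_def c_norm[OF x j] by simp
  qed
  have "cmod (\<i> * D x + (\<Sum>j\<in>J. S j x)) <= (Q * norm (K x) + Q * norm (K x)) + \<bar>\<kappa>\<bar> * (\<Sum>j\<in>J. 2 * (Q * norm (K x)))"
   unfolding integrand[OF x]
  proof (intro order_trans[OF norm_triangle_ineq] add_mono)
   show "cmod (herm (ef x) (K x *v g x) - herm (f x) (K x *v eg x)) <= Q * norm (K x) + Q * norm (K x)"
    using norm_triangle_ineq4 a1 a2 add_mono order_trans by blast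
   show "cmod (of_real \<kappa> * (\<Sum>j\<in>J. cnj (c x j) * herm (f x - f (x \<circ> sw j)) ((refl i j ** K x) *v g x)
    - c x j * herm (f x) ((K x ** refl i j) *v (g x - g (x \<circ> sw j))))) <= \<bar>\<kappa>\<bar> * (\<Sum>j\<in>J. 2 * (Q * norm (K x)))"
    unfolding norm_mult norm_of_real by (intro mult_left_mono order_trans[OF norm_sum] sum_mono quot) auto
  qed
  also have "\<dots> = Q * (2 + 2 * \<bar>\<kappa>\<bar> * real (card J)) * norm (K x)" by (simp add: algebra_simps)
  also have "\<dots> <= Q * (4 + 2 * \<bar>\<kappa>\<bar> * real (card J)) * (CK * G1 x)"
   using Q0 by (intro mult_mono K_G1 x) (auto intro!: mult_left_mono)
  also have "\<dots> = A1 * G1 x" by (simp add: A1_def)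
  finally show ?thesis using G_ge(1)[of x] unfolding J_def by linarith
 qed
 have ctg_diff: "\<bar>ctg (x i) (x j)\<bar> * cmod (\<Phi> x - \<Phi> (x \<circ> Transposition.transpose i j)) <= G x"
  if x: "x \<in> torus_reg N" and j: "j \<in> {1..N} - {i}" for x j
 proof -
  have j: "j \<in> J" using j by (simp add: J_def)
  note xt = torus_reg_torus[OF x] and yt = torus_reg_torus[OF sw_reg[OF x j]]
  define d where "d = cmod (x i - x j)"
  define k where "k = \<bar>ctg (x i) (x j)\<bar>"
  define X where "X = refl i j ** K x ** refl i j"
  have d0: "0 < d" using dist[OF x j] by (simp add: d_def)
  have kd: "k * d <= 2" "0 <= k" using ctg_le[OF x j] by (simp_all add: d_def k_def)
  have X: "norm X = norm (K x)" by (simp add: X_def norm_refl_mult[OF pair[OF j]])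
  define \<Sigma> where "\<Sigma> = (\<Sum>p\<in>pairs N - {(i, j), (j, i)}. cmod (x (fst p) - x (snd p)) powr (- 1 / 2 - expo))"
  have \<Sigma>0: "0 <= \<Sigma>" unfolding \<Sigma>_def by (intro sum_nonneg) auto
  have "d powr (1 / 2) = d powr (1 + - (1 / 2))" by simp
  also have "\<dots> = d * d powr (- (1 / 2))" unfolding powr_add using d0 by simp
  finally have half: "d powr (1 / 2) = d * d powr (- (1 / 2))" .
  have "k * norm (K x - X) <= k * (CD * d powr (1 / 2) * \<Sigma>)"
   using CD(2)[OF x pair[OF j]] kd(2) unfolding X_def d_def \<Sigma>_def by (rule mult_left_mono)
  also have "\<dots> = (k * d) * (CD * d powr (- (1 / 2)) * \<Sigma>)" unfolding half by simp
  also have "\<dots> <= 2 * (CD * d powr (- (1 / 2)) * \<Sigma>)" using kd CD(1) \<Sigma>0 by (intro mult_right_mono) auto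
  also have "\<dots> = 2 * CD * G2 j x"
   unfolding G2_def \<Sigma>_def d_def by (simp add: sum_distrib_left mult_ac)
  finally have defect: "k * norm (K x - X) <= 2 * CD * G2 j x" .
  have "\<Phi> x - \<Phi> (x \<circ> sw j) = herm (f x - f (x \<circ> sw j)) (K x *v g x) +
    (herm (f (x \<circ> sw j)) ((K x - X) *v g x) + herm (f (x \<circ> sw j)) (X *v (g x - g (x \<circ> sw j))))"
   unfolding \<Phi>_def K_sw[OF x j] X_def[symmetric]
   by (simp add: herm_linear mv.diff_left mv.diff_right)
  also have "cmod \<dots> <= d * (Q * norm (K x)) + (Q * norm (K x - X) + d * (Q * norm (K x)))"
  proof (intro norm_triangle_le add_mono)
   show "cmod (herm (f x - f (x \<circ> sw j)) (K x *v g x)) <= d * (Q * norm (K x))"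
    using tri[OF lip(1)[OF xt j] nf(2)[OF xt], of "K x"] by (simp add: Q_def d_def mult_ac)
   show "cmod (herm (f (x \<circ> sw j)) ((K x - X) *v g x)) <= Q * norm (K x - X)"
    by (rule triM[OF nf(1)[OF yt] nf(2)[OF xt]])
   show "cmod (herm (f (x \<circ> sw j)) (X *v (g x - g (x \<circ> sw j)))) <= d * (Q * norm (K x))"
    using tri[OF nf(1)[OF yt] lip(2)[OF xt j], of X] by (simp add: Q_def d_def X mult_ac)
  qed
  finally have "k * cmod (\<Phi> x - \<Phi> (x \<circ> sw j)) <= k * (d * (Q * norm (K x)) + (Q * norm (K x - X) + d * (Q * norm (K x))))"
   by (rule mult_left_mono[OF _ kd(2)])
  also have "\<dots> = 2 * (Q * ((k * d) * norm (K x))) + Q * (k * norm (K x - X))" by (simp add: algebra_simps)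
  also have "\<dots> <= 2 * (Q * (2 * (CK * G1 x))) + Q * (2 * CD * G2 j x)"
  proof (rule add_mono)
   have "k * d * norm (K x) <= 2 * (CK * G1 x)"
    using kd d0 K_G1[OF x] by (intro mult_mono) auto
   then show "2 * (Q * (k * d * norm (K x))) <= 2 * (Q * (2 * (CK * G1 x)))"
    using Q0 by (intro mult_left_mono) auto
   show "Q * (k * norm (K x - X)) <= Q * (2 * CD * G2 j x)" by (rule mult_left_mono[OF defect Q0])
  qed
  also have "\<dots> <= A1 * G1 x + A2 * G2 j x"
  proof -
   have "4 * (Q * CK) * G1 x <= A1 * G1 x"
    unfolding A1_def using Q0 CK(1) G1_0[of x] by (intro mult_right_mono) (auto simp: algebra_simps)
   then show ?thesis unfolding A2_def by (simp add: mult_ac)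
  qed
  finally show ?thesis using G_ge(2)[OF j, of x] unfolding k_def sw_def by linarith
 qed
 have "has_bochner_integral (torus_measure N)
   (\<lambda>x. if x \<in> torus_reg N then \<i> * D x + (\<Sum>j\<in>{1..N} - {i}. S j x) else 0) 0"
  by (rule torus_integral_by_parts[OF i \<Phi>_cont D_cont S_cont der anti B1 B2 B3 B4 G_int F_le ctg_diff])
 moreover have "(\<lambda>x. if x \<in> torus_reg N then \<i> * D x + (\<Sum>j\<in>{1..N} - {i}. S j x) else 0) =
   (\<lambda>x. if x \<in> torus_reg N then
    herm (dunkl N \<kappa> \<tau> i f x) (K x *v g x) - herm (f x) (K x *v dunkl N \<kappa> \<tau> i g x) else 0)"
  unfolding J_def[symmetric] by (intro ext if_cong refl) (simp only: dunkl_eq)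
 ultimately show ?thesis by simp
qed

end

section \<open>The representation in the orthonormal basis\<close>

lemma norm0_sq_pos: "norm0_sq N p T > 0"
 unfolding norm0_sq_def
proof (rule prod_pos, safe)
 fix i j assume "content p i T <= content p j T - 2"
 then have "2 <= \<bar>real_of_int (content p i T - content p j T)\<bar>" by linarith
 then have "2\<^sup>2 <= \<bar>real_of_int (content p i T - content p j T)\<bar>\<^sup>2" by (intro power_mono) auto
 then have "4 <= (real_of_int (content p i T - content p j T))\<^sup>2" by simp
 then show "0 < 1 - 1 / (real_of_int (content p i T - content p j T))\<^sup>2"
  by (simp add: divide_less_eq)
qed

lemma orthonormal_entry:
 "orthonormal_matrix N p Y R w $ a $ b =
  complex_of_real (sqrt (norm0_sq N p (Y a)) * R w $ a $ b / sqrt (norm0_sq N p (Y b)))"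
 by (simp add: orthonormal_matrix_def)

lemma (in comm_monoid_add) sum_pairs_symmetric:
 assumes sym: "\<And>i j. h i j = h j i"
 shows "(\<Sum>(i, j)\<in>pairs N. h i j) = (\<Sum>i\<in>{1..N}. \<Sum>j\<in>{i<..N}. h i j) + (\<Sum>i\<in>{1..N}. \<Sum>j\<in>{i<..N}. h i j)"
proof -
 define U where "U = (SIGMA i:{1..N}. {i<..N})"
 have U: "finite U" by (simp add: U_def)
 have split: "pairs N = U \<union> prod.swap ` U" by (force simp: pairs_def U_def)
 have disj: "U \<inter> prod.swap ` U = {}" by (force simp: U_def)
 have "(\<Sum>(i, j)\<in>pairs N. h i j) = (\<Sum>(i, j)\<in>U. h i j) + (\<Sum>(i, j)\<in>prod.swap ` U. h i j)"
  unfolding split using U disj by (intro sum.union_disjoint) auto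
 also have "(\<Sum>(i, j)\<in>prod.swap ` U. h i j) = (\<Sum>(i, j)\<in>U. h i j)"
  by (subst sum.reindex) (auto simp: case_prod_beta sym)
 also have "(\<Sum>(i, j)\<in>U. h i j) = (\<Sum>i\<in>{1..N}. \<Sum>j\<in>{i<..N}. h i j)"
  unfolding U_def by (rule sum.Sigma[symmetric]) auto
 finally show ?thesis .
qed

context
 fixes N :: nat and p :: "nat list" and Y :: "'t::finite => nat \<times> nat => nat"
  and R :: "(nat => nat) => real^'t^'t" and \<tau> :: "(nat => nat) => complex^'t^'t"
 assumes N: "N >= 3" and young: "young_rep N p Y R" and \<tau>: "\<tau> = orthonormal_matrix N p Y R"
begin

abbreviation root_norm :: "'t => real" where "root_norm a \<equiv> sqrt (norm0_sq N p (Y a))"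

lemma root_norm_pos: "root_norm a > 0" by (simp add: norm0_sq_pos)

lemma \<tau>_entry: "\<tau> w $ a $ b = complex_of_real (root_norm a * R w $ a $ b / root_norm b)"
 unfolding \<tau> by (rule orthonormal_entry)

lemma column_axis: "(A *v axis b 1) $ a = A $ a $ b" for A :: "real^'t^'t"
 by (simp add: matrix_vector_mult_def axis_def if_distrib[where f = "\<lambda>x. _ * x"] cong: if_cong)

text \<open>The eigenvalue condition, entry by entry.\<close>

lemma reflection_sum_entry:
 assumes "i \<in> {1..N}"
 shows "(\<Sum>j\<in>{i<..N}. R (Transposition.transpose i j) $ a $ b) =
  (if a = b then real_of_int (content p i (Y b)) else 0)"
proof -
 have "((\<Sum>j\<in>{i<..N}. R (Transposition.transpose i j)) *v axis b 1) $ a =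
   (real_of_int (content p i (Y b)) *s axis b 1) $ a"
  using young assms unfolding young_rep_def by metis
 then show ?thesis unfolding column_axis by (auto simp: axis_def)
qed

text \<open>The reflections add up to the sum over \<open>i\<close> of \<open>\<Sum>\<^bsub>j>i\<^esub> (i, j)\<close>, which acts on each tableau by the sum of
 all its contents; this sum is the same for all tableaux.\<close>

lemma young_torus_rep: "torus_rep N \<tau>"
proof
 show "N >= 3" by (rule N)
 have id: "R id = mat 1" using young by (simp add: young_rep_def)
 show "\<tau> id = mat 1"
  using root_norm_pos by (simp add: vec_eq_iff \<tau>_entry id mat_def less_imp_neq[symmetric])
 fix v w :: "nat => nat"
 assume w: "w permutes {1..N}"
 show "\<tau> (v \<circ> w) = \<tau> v ** \<tau> w" if v: "v permutes {1..N}"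
 proof -
  have vw: "R (v \<circ> w) = R v ** R w" using young v w unfolding young_rep_def by blast
  have "(\<tau> v ** \<tau> w) $ a $ c = \<tau> (v \<circ> w) $ a $ c" for a c
  proof -
   have "(\<tau> v ** \<tau> w) $ a $ c = complex_of_real (\<Sum>b\<in>UNIV.
     (root_norm a * R v $ a $ b / root_norm b) * (root_norm b * R w $ b $ c / root_norm c))"
    by (simp only: matrix_matrix_mult_def vec_lambda_beta \<tau>_entry of_real_sum of_real_mult)
   also have "(\<Sum>b\<in>UNIV. (root_norm a * R v $ a $ b / root_norm b) * (root_norm b * R w $ b $ c / root_norm c)) =
     (\<Sum>b\<in>UNIV. root_norm a * (R v $ a $ b * R w $ b $ c) / root_norm c)"
    using root_norm_pos by (intro sum.cong refl) (simp add: less_imp_neq[symmetric])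
   also have "\<dots> = root_norm a * (R v ** R w) $ a $ c / root_norm c"
    by (simp add: matrix_matrix_mult_def sum_distrib_left sum_divide_distrib)
   finally show ?thesis by (simp add: \<tau>_entry vw)
  qed
  then show ?thesis by (simp add: vec_eq_iff)
 qed
 show "adj (\<tau> w) ** \<tau> w = mat 1"
 proof -
  have inv: "inner0 N p Y (R w *v axis b 1) (R w *v axis c 1) = inner0 N p Y (axis b 1) (axis c 1)" for b c
   using young w unfolding young_rep_def by blast
  have "(adj (\<tau> w) ** \<tau> w) $ b $ c = mat 1 $ b $ c" for b c
  proof -
   have "(adj (\<tau> w) ** \<tau> w) $ b $ c = complex_of_real (\<Sum>a\<in>UNIV.
     (root_norm a * R w $ a $ b / root_norm b) * (root_norm a * R w $ a $ c / root_norm c))"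
    unfolding matrix_matrix_mult_def adj_def by (simp add: \<tau>_entry)
   also have "(\<Sum>a\<in>UNIV. (root_norm a * R w $ a $ b / root_norm b) * (root_norm a * R w $ a $ c / root_norm c)) =
     (\<Sum>a\<in>UNIV. R w $ a $ b * R w $ a $ c * (root_norm a)\<^sup>2 / (root_norm b * root_norm c))"
    by (intro sum.cong refl) (simp add: power2_eq_square)
   also have "\<dots> = inner0 N p Y (R w *v axis b 1) (R w *v axis c 1) / (root_norm b * root_norm c)"
    by (simp only: inner0_def column_axis sum_divide_distrib real_sqrt_pow2[OF less_imp_le[OF norm0_sq_pos]])
   also have "inner0 N p Y (R w *v axis b 1) (R w *v axis c 1) = (if b = c then (root_norm b)\<^sup>2 else 0)"
   proof -
    have "inner0 N p Y (axis b 1) (axis c 1) =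
      (\<Sum>a\<in>UNIV. if a = b then (if b = c then norm0_sq N p (Y b) else 0) else 0)"
     unfolding inner0_def by (intro sum.cong refl) (auto simp: axis_def)
    then show ?thesis unfolding inv by (simp add: real_sqrt_pow2[OF less_imp_le[OF norm0_sq_pos]])
   qed
   also have "(if b = c then (root_norm b)\<^sup>2 else 0) / (root_norm b * root_norm c) = (if b = c then 1 else 0)"
   proof -
    have sq: "x\<^sup>2 / (x * x) = 1" if "x > 0" for x :: real using that by (simp add: power2_eq_square)
    show ?thesis
     by (cases "b = c"; simp only: sq[OF root_norm_pos] if_True if_False div_0 simp_thms)
   qed
   finally show ?thesis by (simp add: mat_def)
  qed
  then show ?thesis by (simp add: vec_eq_iff)
 qed
next
 define G where "G a b = (\<Sum>(i, j)\<in>pairs N. R (Transposition.transpose i j) $ a $ b)" for a b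
 have "G a b = (if a = b then 2 * (real N * gamma N p) else 0)" for a b
 proof -
  have Yb: "Y b \<in> rsyt N p" using young unfolding young_rep_def bij_betw_def by blast
  have "G a b = 2 * (\<Sum>i\<in>{1..N}. \<Sum>j\<in>{i<..N}. R (Transposition.transpose i j) $ a $ b)"
   unfolding G_def by (subst sum_pairs_symmetric) (simp_all add: transpose_commute)
  also have "\<dots> = 2 * (\<Sum>i\<in>{1..N}. if a = b then real_of_int (content p i (Y b)) else 0)"
   by (simp only: reflection_sum_entry cong: sum.cong)
  also have "\<dots> = (if a = b then 2 * (\<Sum>i = 1..N. real_of_int (content p i (Y b))) else 0)" by simp
  also have "(\<Sum>i = 1..N. real_of_int (content p i (Y b))) = real N * gamma N p"
   using gamma_eq[OF Yb] N by simp
  finally show ?thesis .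
 qed
 then have G: "root_norm a * G a b / root_norm b = (if a = b then 2 * (real N * gamma N p) else 0)" for a b
  using root_norm_pos[of b] by simp
 have "(\<Sum>(i, j)\<in>pairs N. \<tau> (Transposition.transpose i j)) $ a $ b =
   mat (complex_of_real (2 * (real N * gamma N p))) $ a $ b" for a b
 proof -
  have "(\<Sum>(i, j)\<in>pairs N. \<tau> (Transposition.transpose i j)) $ a $ b =
    (\<Sum>(i, j)\<in>pairs N. \<tau> (Transposition.transpose i j) $ a $ b)"
   by (simp add: case_prod_beta)
  also have "\<dots> = complex_of_real (root_norm a * G a b / root_norm b)"
   unfolding G_def by (simp add: \<tau>_entry case_prod_beta sum_distrib_left sum_divide_distrib)
  finally show ?thesis unfolding G by (simp add: mat_def)
 qed
 then show "\<exists>c. (\<Sum>(i, j)\<in>pairs N. \<tau> (Transposition.transpose i j)) = mat c"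
  by (intro exI[of _ "complex_of_real (2 * (real N * gamma N p))"]) (simp add: vec_eq_iff)
qed

text \<open>Only \<open>N\<close> is larger than \<open>N - 1\<close>, so the eigenvalue condition makes this reflection diagonal; being an
 involution, it has entries \<open>1\<close> and \<open>-1\<close>.\<close>

lemma last_reflection: "\<tau> (Transposition.transpose (N - 1) N) = rho N p Y (- 1) 1"
proof -
 interpret torus_rep N 0 \<tau> by (rule young_torus_rep)
 have pair: "(N - 1, N) \<in> pairs N" using N by (auto simp: pairs_def)
 have set: "{N - 1<..N} = {N}" using N by auto
 define k where "k b = content p (N - 1) (Y b)" for b
 have entry: "\<tau> (Transposition.transpose (N - 1) N) $ a $ b = (if a = b then complex_of_int (k b) else 0)" for a b
  using reflection_sum_entry[of "N - 1" a b] root_norm_pos[of b] pair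
  unfolding \<tau>_entry set by (auto simp: pairs_def k_def)
 have "k b = 1 \<or> k b = - 1" for b
 proof -
  have "(\<tau> (Transposition.transpose (N - 1) N) ** \<tau> (Transposition.transpose (N - 1) N)) $ b $ b = 1"
   unfolding refl_refl[OF pair] by (simp add: mat_def)
  then have "(\<Sum>c\<in>UNIV. if c = b then complex_of_int (k b) * complex_of_int (k b) else 0) = 1"
   unfolding matrix_matrix_mult_def entry by (simp add: if_distrib cong: if_cong)
  then have "complex_of_int (k b * k b) = 1" by simp
  then have "k b * k b = 1" by (simp only: of_int_eq_1_iff)
  then show ?thesis by (simp add: zmult_eq_1_iff)
 qed
 then have "(if a = b then complex_of_int (k b) else 0) = rho N p Y (- 1) 1 $ a $ b" for a b
  by (cases "k b = - 1") (auto simp: rho_def k_def)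
 then show ?thesis by (simp only: vec_eq_iff entry) simp
qed

end

lemma completion_integral_AE:
 fixes f g :: "'a => 'b::{banach, second_countable_topology}"
 assumes f: "has_bochner_integral M f x" and eq: "AE y in M. f y = g y"
 shows "has_bochner_integral (completion M) g x"
proof -
 have m: "f \<in> borel_measurable M" using f by (rule borel_measurable_has_bochner_integral)
 have fc: "has_bochner_integral (completion M) f x"
  using f by (simp add: has_bochner_integral_iff integrable_completion[OF m] integral_completion[OF m])
 have eqc: "AE y in completion M. f y = g y" using eq by (rule AE_completion)
 have mf: "f \<in> borel_measurable (completion M)" using m by (rule measurable_completion)
 have "g \<in> borel_measurable (completion M)"
 proof (rule measurableI)
  fix A :: "'b set" assume A: "A \<in> sets borel"
  show "g -` A \<inter> space (completion M) \<in> sets (completion M)"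
  proof (rule completion.in_sets_AE)
   show "AE y in completion M. y \<in> f -` A \<inter> space (completion M) \<longleftrightarrow> y \<in> g -` A \<inter> space (completion M)"
    using eqc by eventually_elim simp
   show "f -` A \<inter> space (completion M) \<in> sets (completion M)" by (rule measurable_sets[OF mf A])
  qed simp
 qed simp
 then show ?thesis using has_bochner_integral_cong_AE[OF mf _ eqc] fc by blast
qed

lemma matrix_inv_inverse:
 assumes "invertible A"
 shows "A ** matrix_inv A = mat 1" "matrix_inv A ** A = mat 1"
 using someI_ex[OF assms[unfolded invertible_def]] unfolding matrix_inv_def by auto

lemma inverse_of_kernel:
 fixes A :: "complex^'t^'t"
 assumes ker: "\<And>V :: complex^'t^'t. adj A ** V = 0 ==> V = 0"
 shows "adj A ** matrix_inv (adj A) = mat 1" "matrix_inv A ** A = mat 1"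
proof -
 have "v = 0" if v: "adj A *v v = 0" for v
 proof -
  define V :: "complex^'t^'t" where "V = (\<chi> a b. v $ a)"
  have "adj A ** V = (\<chi> a b. (adj A *v v) $ a)"
   by (simp add: V_def matrix_matrix_mult_def matrix_vector_mult_def vec_eq_iff)
  then have "adj A ** V = 0" by (simp add: v vec_eq_iff)
  then have "V = 0" by (rule ker)
  then show "v = 0" by (simp add: V_def vec_eq_iff)
 qed
 then obtain B where B: "B ** adj A = mat 1" using matrix_left_invertible_ker[of "adj A"] by blast
 then have B': "adj A ** B = mat 1" using matrix_left_right_inverse by blast
 have "invertible (adj A)" unfolding invertible_def using B B' by blast
 then show "adj A ** matrix_inv (adj A) = mat 1" by (rule matrix_inv_inverse)
 have "A ** adj B = mat 1" "adj B ** A = mat 1"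
  using arg_cong[OF B, of adj] arg_cong[OF B', of adj] by (simp_all add: adj_simps)
 then have "invertible A" unfolding invertible_def by blast
 then show "matrix_inv A ** A = mat 1" by (rule matrix_inv_inverse)
qed

text \<open>The normalization at \<open>x\<^sub>0\<close> turns the symmetry of \<open>K\<close> under the cycle into the hypothesis on \<open>H\<close>.\<close>

lemma form_of_solution:
 assumes rep: "torus_rep N \<tau>" and L: "is_L N \<kappa> \<gamma> \<tau> L" and comm: "\<tau> (w0 N) ** H = H ** \<tau> (w0 N)"
 shows "torus_form N \<kappa> \<tau> (\<lambda>x. adj (L x) ** H ** L x)"
proof -
 interpret torus_rep N \<kappa> \<tau> by (rule rep)
 show ?thesis
 proof
  fix th i assume th: "th \<in> chamber N" and i: "i \<in> {1..N}"
  have upd: "pt N (th(i := th i + t)) = (pt N th)(i := pt N th i * cis t)" for t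
   by (rule ext) (use i in \<open>simp add: pt_def cis_mult\<close>)
  have "pt N th \<in> C0 N" using th by (simp add: C0_eq)
  then have at_0: "((\<lambda>t. L ((pt N th)(i := pt N th i * cis t))) has_vector_derivative
    mscale (\<i> * pt N th i) (L (pt N th) ** system_coeff N \<kappa> \<gamma> \<tau> i (pt N th))) (at 0)"
   using L i unfolding is_L_def by blast
  have "((\<lambda>r. L (pt N (th(i := r)))) has_vector_derivative
    mscale (\<i> * pt N th i) (L (pt N th) ** system_coeff N \<kappa> \<gamma> \<tau> i (pt N th))) (at (th i))"
   by (rule has_vector_derivative_shift, unfold upd) (rule at_0)
  then show "((\<lambda>r. adj (L (pt N (th(i := r)))) ** H ** L (pt N (th(i := r)))) has_vector_derivative
    gen (unit_vec i) th (adj (L (pt N th)) ** H ** L (pt N th))) (at (th i))"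
   using quadratic_partial[OF i chamber_regular[OF th], where L = "\<lambda>r. L (pt N (th(i := r)))" and r = "th i"] by simp
 next
  have "L (x0 N) = mat 1" using L by (simp add: is_L_def)
  moreover have "\<tau> (w0 N) ** H ** adj (\<tau> (w0 N)) = H"
   using \<tau>_unitary'[OF w0_permutes] N3 unfolding comm by (simp flip: matrix_mul_assoc)
  ultimately show "\<tau> (w0 N) ** (adj (L (x0 N)) ** H ** L (x0 N)) ** adj (\<tau> (w0 N)) = adj (L (x0 N)) ** H ** L (x0 N)"
   by (simp add: adj_simps)
 next
  fix x w assume "x \<in> torus_reg N" "w permutes {1..N}" "w 1 = 1" "x \<circ> inv w \<in> C0 N"
  then have "L x = L (x \<circ> inv w) ** \<tau> w" using L unfolding is_L_def by blast
  then show "adj (L x) ** H ** L x = adj (\<tau> w) ** (adj (L (x \<circ> inv w)) ** H ** L (x \<circ> inv w)) ** \<tau> w"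
   by (simp add: adj_simps matrix_mul_assoc)
 qed
qed

lemma expansion_of_L1:
 assumes rep: "torus_rep N \<tau>" and L1: "is_L1 N \<kappa> p Y \<tau> L1"
  and rho: "\<tau> (Transposition.transpose (N - 1) N) = rho N p Y (- 1) 1"
 shows "\<exists>D \<alpha> lp lz. expansion N \<kappa> \<tau> p Y L1 D \<alpha> lp lz"
proof -
 interpret torus_rep N \<kappa> \<tau> by (rule rep)
 from L1 obtain D \<alpha> lp lz where
  D: "openin (product_topology (\<lambda>_. euclidean) {1..N - 1}) D"
   "\<forall>t\<in>{cos (pi / real N)..1}. base_point N t \<in> D" "\<alpha> 0 (base_point N 1) = mat 1"
  and e: "\<forall>(y, z)\<in>expansion_domain N D.
      exp (lp (y, z)) = ((y (N - 1))\<^sup>2 - z\<^sup>2) * (\<Prod>j = 1..N - 2. y j) \<and>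
      exp (lz (y, z)) = z \<and>
      summable (\<lambda>n. mscale (z ^ n) (\<alpha> n y)) \<and>
      L1 (split_point N y z) =
       mscale (exp (- of_real (gamma N p * \<kappa>) * lp (y, z)))
        (rho N p Y (exp (- of_real \<kappa> * lz (y, z))) (exp (of_real \<kappa> * lz (y, z)))
        ** (\<Sum>n. mscale (z ^ n) (\<alpha> n y)))"
  and d: "\<forall>(y, z)\<in>expansion_domain N D. let x = split_point N y z in
      \<forall>i\<in>{1..N}. \<forall>a b.
       ((\<lambda>s. L1 (x(i := s)) $ a $ b) has_field_derivative
        (L1 x ** system_coeff N \<kappa> (gamma N p) \<tau> i x) $ a $ b) (at (x i))"
  unfolding is_L1_def by blast
 have "expansion N \<kappa> \<tau> p Y L1 D \<alpha> lp lz"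
 proof
  show "openin (product_topology (\<lambda>_. euclidean) {1..N - 1}) D" "\<alpha> 0 (base_point N 1) = mat 1" by (fact D)+
  show "base_point N t \<in> D" if "t \<in> {cos (pi / real N)..1}" for t using D(2) that by blast
  show "\<tau> (Transposition.transpose (N - 1) N) = rho N p Y (- 1) 1" by (rule rho)
  fix y z assume yz: "(y, z) \<in> expansion_domain N D"
  note e' = e[rule_format, OF yz, unfolded prod.case] and d' = d[rule_format, OF yz, unfolded prod.case Let_def]
  show "exp (lp (y, z)) = ((y (N - 1))\<^sup>2 - z\<^sup>2) * (\<Prod>j = 1..N - 2. y j)" "exp (lz (y, z)) = z"
   "summable (\<lambda>n. mscale (z ^ n) (\<alpha> n y))"
   "L1 (split_point N y z) = mscale (exp (- of_real (gamma N p * \<kappa>) * lp (y, z)))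
    (rho N p Y (exp (- of_real \<kappa> * lz (y, z))) (exp (of_real \<kappa> * lz (y, z)))
     ** (\<Sum>n. mscale (z ^ n) (\<alpha> n y)))"
   using e' by blast+
  show "((\<lambda>s. L1 ((split_point N y z)(i := s)) $ a $ b) has_field_derivative
    (L1 (split_point N y z) ** system_coeff N \<kappa> (gamma N p) \<tau> i (split_point N y z)) $ a $ b)
    (at (split_point N y z i))" if "i \<in> {1..N}" for i a b
   using d' that by blast
 qed
 then show ?thesis by blast
qed

theorem theorem7p1:
  fixes N :: nat and p :: "nat list" and \<kappa> :: real
    and Y :: "'t::finite \<Rightarrow> nat \<times> nat \<Rightarrow> nat"
    and R :: "(nat \<Rightarrow> nat) \<Rightarrow> real^'t^'t"
    and \<tau> :: "(nat \<Rightarrow> nat) \<Rightarrow> complex^'t^'t"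
    and \<sigma> \<upsilon> H :: "complex^'t^'t"
    and L L1 :: "(nat \<Rightarrow> complex) \<Rightarrow> complex^'t^'t"
    and f g :: "(nat \<Rightarrow> complex) \<Rightarrow> complex^'t"
    and i :: nat
  assumes "N \<ge> 3"
    and "is_partition N p" and "p \<noteq> [N]" and "p \<noteq> replicate N 1"
    and "young_rep N p Y R"
    and "\<tau> = orthonormal_matrix N p Y R"
    and "\<sigma> = \<tau> (Transposition.transpose (N - 1) N)"
    and "\<upsilon> = \<tau> (w0 N)"
    and "is_L N \<kappa> (gamma N p) \<tau> L"
    and "is_L1 N \<kappa> p Y \<tau> L1"
    and "- (1 / (2 * ((real N)\<^sup>2 - real N + 2))) < \<kappa>"
    and "\<kappa> < 1 / (2 * ((real N)\<^sup>2 - real N + 2))"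
    and "adj H = H"
    and "\<upsilon> ** H = H ** \<upsilon>"
    and "(matrix_inv (adj (L1 (x0 N))) ** H ** matrix_inv (L1 (x0 N))) ** \<sigma>
       = \<sigma> ** (matrix_inv (adj (L1 (x0 N))) ** H ** matrix_inv (L1 (x0 N)))"
    and "C1_torus N f" and "C1_torus N g"
    and "i \<in> {1..N}"
  shows "has_bochner_integral (haar_torus N)
    (\<lambda>x. herm (dunkl N \<kappa> \<tau> i f x) ((adj (L x) ** H ** L x) *v g x)
       - herm (f x) ((adj (L x) ** H ** L x) *v dunkl N \<kappa> \<tau> i g x)) 0"
proof -
 have N: "N >= 3" by (rule assms(1))
 have rep: "torus_rep N \<tau>" by (rule young_torus_rep[OF N assms(5,6)])
 have rho: "\<tau> (Transposition.transpose (N - 1) N) = rho N p Y (- 1) 1"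
  by (rule last_reflection[OF N assms(5,6)])
 define K where "K x = adj (L x) ** H ** L x" for x
 have form: "torus_form N \<kappa> \<tau> K"
  unfolding K_def by (rule form_of_solution[OF rep assms(9)]) (use assms(8,14) in simp)
 define P where "P = real (N * (N - 1))"
 have P0: "0 <= P" unfolding P_def by (rule of_nat_0_le_iff)
 have "P = (real N)\<^sup>2 - real N"
  using N unfolding P_def by (simp add: of_nat_diff power2_eq_square algebra_simps)
 then have q: "2 * ((real N)\<^sup>2 - real N + 2) = 2 * (P + 2)" by simp
 have "\<bar>\<kappa>\<bar> < 1 / (2 * (P + 2))" using assms(11,12) unfolding q by (simp add: abs_less_iff)
 then have "\<bar>\<kappa>\<bar> * (2 * (P + 2)) < 1" using P0 by (simp add: less_divide_eq)
 then have sum: "\<bar>\<kappa>\<bar> * P + 2 * \<bar>\<kappa>\<bar> < 1 / 2" by (simp add: algebra_simps)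
 have "0 <= \<bar>\<kappa>\<bar> * P" using P0 by simp
 then have "\<bar>\<kappa>\<bar> * P < 1 / 2" and \<kappa>: "\<bar>\<kappa>\<bar> < 1 / 2" using sum by linarith+
 then have expo: "\<bar>\<kappa>\<bar> * real (N * (N - 1)) < 1 / 2" unfolding P_def by blast
 obtain D \<alpha> lp lz where "expansion N \<kappa> \<tau> p Y L1 D \<alpha> lp lz"
  using expansion_of_L1[OF rep assms(10) rho] by blast
 then interpret E: expansion N \<kappa> \<tau> p Y L1 D \<alpha> lp lz .
 define A where "A = L1 (x0 N)"
 define H' where "H' = matrix_inv (adj A) ** H ** matrix_inv A"
 have kernel: "V = 0" if "adj A ** V = 0" for V :: "complex^'t^'t"
  using E.L1_kernel[OF \<kappa>, of V] that unfolding A_def by blast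
 have inverse: "adj A ** matrix_inv (adj A) = mat 1" "matrix_inv A ** A = mat 1"
  using inverse_of_kernel[of A] kernel by blast+
 have "adj A ** H' ** A = (adj A ** matrix_inv (adj A)) ** H ** (matrix_inv A ** A)"
  unfolding H'_def by (simp only: matrix_mul_assoc)
 then have H: "adj A ** H' ** A = H" by (simp only: inverse matrix_mul_lid matrix_mul_rid)
 have "L (x0 N) = mat 1" using assms(9) by (simp add: is_L_def)
 then have K0: "K (x0 N) = adj (L1 (x0 N)) ** H' ** L1 (x0 N)"
  unfolding A_def[symmetric] H by (simp add: K_def adj_simps)
 have comm: "H' ** \<tau> (Transposition.transpose (N - 1) N) = \<tau> (Transposition.transpose (N - 1) N) ** H'"
  using assms(15) unfolding assms(7) H'_def A_def .
 have zero: "torus_form.wall_zero N \<tau> K (regular_angles N) (pi * (2 * real N - 3) / real N)"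
  by (rule E.base_wall_zero[OF \<kappa> form K0 comm])
 interpret T: torus_form_wall N \<kappa> \<tau> K "regular_angles N" "pi * (2 * real N - 3) / real N"
  by (intro torus_form_wall.intro torus_form_wall_axioms.intro form expo E.base_wall zero)
 have "AE x in torus_measure N. (if x \<in> torus_reg N then
   herm (dunkl N \<kappa> \<tau> i f x) (K x *v g x) - herm (f x) (K x *v dunkl N \<kappa> \<tau> i g x) else 0) =
   herm (dunkl N \<kappa> \<tau> i f x) (K x *v g x) - herm (f x) (K x *v dunkl N \<kappa> \<tau> i g x)"
  using AE_torus_reg by eventually_elim simp
 from completion_integral_AE[OF T.dunkl_form_integral[OF assms(16-18)] this]
 show ?thesis unfolding haar_torus_def K_def .
qed

end
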